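(* Assume condition (A1) or (A2). Let $\theta_n=(\tau_n,\ell_n)$ be a random mobile with $n$ edges as described below, and let $L_n$ be its label process. Then $$\Big(\frac{1}{\sqrt{2(1-\kappa)n}}\,L_n(tN^\circ_n)\Big)_{0\le t\le1}\xrightarrow{d}\big(\mathbf b(t)\big)_{0\le t\le1}$$ in $C([0,1])$ with the uniform topology, where $\mathbf b$ is a standard Brownian bridge on $[0,1]$ from $0$ to $0$.
   Context: Weights: $(w_i)_{i\ge0}$ nonnegative, $w_0=1$; $g(x)=\sum_iw_ix^i$ with radius of convergence $R$; $\kappa=\lim_{t\nearrow R}tg'(t)/g(t)$ if $R>0$, $\kappa=0$ if $R=0$. Condition (A1): $w_i=L(i)i^{-\beta}$ for $i\ge1$ with $\beta>2$, $L$ slowly varying, and $\kappa<1$ (then $\kappa=g'(1)/g(1)$). Condition (A2): $w_i=(i!)^\alpha$ for some $\alpha>0$ (then $\kappa=0$). Trees and labels: $\Gamma_n$ is the set of rooted planar (plane, ordered) trees with $n$ edges; vertices at even distance from the root (including the root) are white, at odd distance black; $\deg(v)$ is the number of neighbours. For black $u$ of degree $k$, $u_0$ is its parent, $u_1,\dots,u_{k-1}$ its children clockwise, $u_k=u_0$. An admissible labeling is $\ell:\{\text{white vertices}\}\to\mathbb Z$ with $\ell(\text{root})=0$ and $\ell(u_{j+1})\ge\ell(u_j)-1$ for all black $u$, $0\le j\le k-1$. A mobile is a pair $(\tau,\ell)$. The random mobile: $\tau_n$ has law $\tilde\nu_n(\tau)\propto\prod_{v\text{ black}}w_{\deg(v)}$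 on $\Gamma_n$, and given $\tau_n$, $\ell_n$ is uniform among admissible labelings. Label process: $N^\circ_n$ is the number of white vertices; $v_0,\dots,v_{N^\circ_n-1}$ are the white vertices in lexicographic (depth-first) order, $v_{N^\circ_n}=v_0$; $L_n(i)=\ell_n(v_i)$ for $i=0,\dots,N^\circ_n$, extended to $[0,N^\circ_n]$ by linear interpolation. *)

theory Defs
  imports "HOL-Probability.Probability" "HOL-Library.List_Lexorder"
begin

definition gen_fun :: "(nat \<Rightarrow> real) \<Rightarrow> real \<Rightarrow> real" where
  "gen_fun w t = (\<Sum>i. w i * t ^ i)"

definition kappa :: "(nat \<Rightarrow> real) \<Rightarrow> real" where
  "kappa w = (if conv_radius w > 0
     then Lim (filtercomap ereal (at_left (conv_radius w)))
              (\<lambda>t. t * deriv (gen_fun w) t / gen_fun w t)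
     else 0)"

definition slowly_varying :: "(real \<Rightarrow> real) \<Rightarrow> bool" where
  "slowly_varying L \<longleftrightarrow> L \<in> borel_measurable borel \<and> (\<forall>x>0. L x > 0) \<and>
     (\<forall>c>0. ((\<lambda>x. L (c * x) / L x) \<longlongrightarrow> 1) at_top)"

definition condA1 :: "(nat \<Rightarrow> real) \<Rightarrow> bool" where
  "condA1 w \<longleftrightarrow> (\<exists>\<beta> L. \<beta> > 2 \<and> slowly_varying L \<and>
      (\<forall>i\<ge>1. w i = L (real i) * real i powr (-\<beta>)) \<and> kappa w < 1)"

definition condA2 :: "(nat \<Rightarrow> real) \<Rightarrow> bool" where
  "condA2 w \<longleftrightarrow> (\<exists>\<alpha>>0. \<forall>i. w i = fact i powr \<alpha>)"

text \<open>A rooted plane tree is a finite set of words over nat containing the root [],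
  closed under taking parents and left siblings. The children of v are v@[0], ..., v@[c-1]
  in their planar (clockwise) order; depth of v is length v.\<close>
definition plane_tree :: "nat list set \<Rightarrow> bool" where
  "plane_tree T \<longleftrightarrow> finite T \<and> [] \<in> T \<and>
     (\<forall>v i. v @ [i] \<in> T \<longrightarrow> v \<in> T) \<and>
     (\<forall>v i j. v @ [i] \<in> T \<and> j < i \<longrightarrow> v @ [j] \<in> T)"

definition Gamma :: "nat \<Rightarrow> nat list set set" where
  "Gamma n = {T. plane_tree T \<and> card T = n + 1}"

definition num_children :: "nat list set \<Rightarrow> nat list \<Rightarrow> nat" where
  "num_children T v = card {i. v @ [i] \<in> T}"

definition deg :: "nat list set \<Rightarrow> nat list \<Rightarrow> nat" where
  "deg T v = num_children T v + (if v = [] then 0 else 1)"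

definition white :: "nat list set \<Rightarrow> nat list set" where
  "white T = {v \<in> T. even (length v)}"

definition black :: "nat list set \<Rightarrow> nat list set" where
  "black T = {v \<in> T. odd (length v)}"

definition tree_weight :: "(nat \<Rightarrow> real) \<Rightarrow> nat list set \<Rightarrow> real" where
  "tree_weight w T = (\<Prod>v\<in>black T. w (deg T v))"

definition nbr :: "nat list set \<Rightarrow> nat list \<Rightarrow> nat \<Rightarrow> nat list" where
  "nbr T u j = (if j = 0 \<or> j = deg T u then butlast u else u @ [j - 1])"

text \<open>Labelings are taken extensional (0 off the white vertices), so that the set of
  admissible labelings of a tree is a finite set of functions.\<close>
definition admissible :: "nat list set \<Rightarrow> (nat list \<Rightarrow> int) \<Rightarrow> bool" where
  "admissible T l \<longleftrightarrow> l [] = 0 \<and> (\<forall>v. v \<notin> white T \<longrightarrow> l v = 0) \<and>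
     (\<forall>u\<in>black T. \<forall>j<deg T u. l (nbr T u (Suc j)) \<ge> l (nbr T u j) - 1)"

definition labelings :: "nat list set \<Rightarrow> (nat list \<Rightarrow> int) set" where
  "labelings T = {l. admissible T l}"

text \<open>White vertices in lexicographic (depth-first) order.\<close>
definition white_list :: "nat list set \<Rightarrow> nat list list" where
  "white_list T = sorted_list_of_set (white T)"

definition label_seq :: "nat list set \<Rightarrow> (nat list \<Rightarrow> int) \<Rightarrow> nat \<Rightarrow> real" where
  "label_seq T l i = (if i < card (white T) then real_of_int (l (white_list T ! i))
                      else real_of_int (l []))"

definition label_proc :: "nat list set \<Rightarrow> (nat list \<Rightarrow> int) \<Rightarrow> real \<Rightarrow> real" where
  "label_proc T l s = (let k = nat \<lfloor>s\<rfloor> in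
      label_seq T l k + (s - real k) * (label_seq T l (Suc k) - label_seq T l k))"

definition scaled_proc :: "(nat \<Rightarrow> real) \<Rightarrow> nat \<Rightarrow> nat list set \<Rightarrow> (nat list \<Rightarrow> int) \<Rightarrow> real \<Rightarrow> real" where
  "scaled_proc w n T l t = label_proc T l (t * real (card (white T))) / sqrt (2 * (1 - kappa w) * real n)"

text \<open>tau_n has law proportional to tree_weight on Gamma n; given tau_n, l_n is uniform
  on the admissible labelings. E_n[F(theta)] written out as a finite sum.\<close>
definition mobile_expect :: "(nat \<Rightarrow> real) \<Rightarrow> nat \<Rightarrow> (nat list set \<Rightarrow> (nat list \<Rightarrow> int) \<Rightarrow> real) \<Rightarrow> real" where
  "mobile_expect w n F =
     (\<Sum>T\<in>Gamma n. tree_weight w T * ((\<Sum>l\<in>labelings T. F T l) / real (card (labelings T))))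
     / (\<Sum>T\<in>Gamma n. tree_weight w T)"

definition C01 :: "(real \<Rightarrow> real) set" where
  "C01 = {f. continuous_on {0..1} f}"

definition unif_dist :: "(real \<Rightarrow> real) \<Rightarrow> (real \<Rightarrow> real) \<Rightarrow> real" where
  "unif_dist f g = (SUP t\<in>{0..1}. \<bar>f t - g t\<bar>)"

definition bdd_cont_functional :: "((real \<Rightarrow> real) \<Rightarrow> real) \<Rightarrow> bool" where
  "bdd_cont_functional F \<longleftrightarrow> (\<exists>B. \<forall>f\<in>C01. \<bar>F f\<bar> \<le> B) \<and>
     (\<forall>f\<in>C01. \<forall>e>0. \<exists>d>0. \<forall>g\<in>C01. unif_dist f g < d \<longrightarrow> \<bar>F g - F f\<bar> < e)"

definition bb_cov :: "real \<Rightarrow> real \<Rightarrow> real" where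
  "bb_cov s t = min s t - s * t"

text \<open>Standard Brownian bridge on [0,1] from 0 to 0: a process with continuous paths on [0,1]
  which is a centred Gaussian process with covariance min s t - s t (every finite linear
  combination is centred normal with the corresponding variance; degenerate if variance 0).\<close>
definition brownian_bridge :: "'a measure \<Rightarrow> (real \<Rightarrow> 'a \<Rightarrow> real) \<Rightarrow> bool" where
  "brownian_bridge M b \<longleftrightarrow> prob_space M \<and>
     (\<forall>t\<in>{0..1}. b t \<in> borel_measurable M) \<and>
     (\<forall>\<omega>\<in>space M. continuous_on {0..1} (\<lambda>t. b t \<omega>)) \<and>
     (\<forall>ts cs :: real list. set ts \<subseteq> {0..1} \<longrightarrow> length cs = length ts \<longrightarrow>
        (let v = (\<Sum>i<length ts. \<Sum>j<length ts. cs!i * cs!j * bb_cov (ts!i) (ts!j));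
             Y = (\<lambda>\<omega>. \<Sum>i<length ts. cs!i * b (ts!i) \<omega>)
         in if v = 0 then (AE \<omega> in M. Y \<omega> = 0)
            else distributed M lborel Y (normal_density 0 (sqrt v))))"

end

theory Submission
 imports Defs "HOL-Real_Asymp.Real_Asymp"
begin

text \<open>Cutting a mobile at its black vertices turns the tree into a Lukasiewicz code, and the labels around a
black vertex of degree \<open>k\<close> into a uniform composition of \<open>k\<close> into \<open>k\<close> parts, that is, a bridge whose steps are
geometric variables minus one, independently over the black vertices. Under either condition one vertex has
degree \<open>k \<sim> (1 - \<kappa>) n\<close>, while the other degrees obey a law of large numbers: rotating the code so that the large
entry comes first (cycle lemma) makes them independent. Up to \<open>o(sqrt n)\<close> the label process is therefore the
bridge of the large vertex, run at constant speed. Its steps have variance 2, so that division by \<open>sqrt (2 * k)\<close>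
leads to the Brownian bridge: the finite-dimensional distributions converge by characteristic functions, and
exponential moments control the oscillation.\<close>

subsection \<open>Stack walks and compositions\<close>

text \<open>The limit is shown separately for each good code, by averaging over the labels alone.
  The random tree then enters only through the claim that bad codes carry a vanishing share of the
  total weight, so constant factors in the tree estimates are harmless: it suffices that the weights
  of \<open>n - j\<close> and of \<open>n\<close> are comparable when \<open>n - j\<close> has order
  \<open>n\<close>. The main obstacle is the label contribution of the vertices other than the large
  one. Along an ancestral line it is a sum of independent bridge values whose exponential moments
  are governed by the sum \<open>K\<close> of the degrees met, so it is \<open>o(sqrt n)\<close> as
  soon as \<open>K\<close> is at most a power of \<open>n\<close> below one. Under (A1),
  subcriticality makes the sum of \<open>exp (\<theta> * K)\<close> over the stack a
  supermartingale; under (A2) the sum of all small degrees already has this order. On the side of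
  weak convergence, infimal convolution reduces bounded continuous functionals to Lipschitz ones,
  interpolation on a fixed grid leaves finitely many coordinates, and trigonometric polynomials
  connect these with characteristic functions.\<close>

definition avg :: "'b set => ('b => real) => real" where
 "avg A f = sum f A / real (card A)"

text \<open>The stack holds the white vertices found but not yet explored. Reading \<open>x\<close> replaces the top vertex \<open>a\<close>
by \<open>f a x\<close>, and \<open>outs\<close> lists the vertices that are replaced by nothing.\<close>

fun run :: "('e => 'x => 'e list) => 'x list => 'e list => 'e list" where
 "run f [] st = st"
| "run f (x # xs) [] = []"
| "run f (x # xs) (a # st) = run f xs (f a x @ st)"

fun outs :: "('e => 'x => 'e list) => 'x list => 'e list => 'e list" where
 "outs f [] st = []"
| "outs f (x # xs) [] = []"
| "outs f (x # xs) (a # st) = (if f a x = [] then [a] else []) @ outs f xs (f a x @ st)"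

definition comps :: "nat => nat => nat list set" where
 "comps l x = {ms. length ms = l \<and> sum_list ms = x}"

abbreviation "bcomp k \<equiv> comps k k"

definition bsum :: "nat list => nat => int" where
 "bsum ms j = int (sum_list (take j ms)) - int j"

text \<open>Entry 0 is the explored white vertex itself: it returns to the stack with label
  \<open>a\<close>, because its earlier black children are still unread. The other entries are the
  white children of the black vertex just read. A white vertex is emitted once the empty composition
  is read on it.\<close>

definition chl :: "int => nat list => int list" where
 "chl a ms = map (%j. a + bsum ms j) [0..<length ms]"

definition luk :: "nat => nat list set" where
 "luk n = {ks. length ks = n + 1 \<and> sum_list ks = n \<and> (\<forall>m\<le>n. m <= sum_list (take m ks))}"

definition dec :: "nat list => nat list list set" where
 "dec ks = listset (map bcomp ks)"

definition wt :: "(nat => real) => nat list => real" where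
 "wt w ks = prod_list (map w ks)"

section \<open>Weighted sums over words, compositions and their products\<close>

definition lsn :: "'b set => nat => 'b list set" where
 "lsn A n = {xs. set xs \<subseteq> A \<and> length xs = n}"

lemma finite_lsn: "finite A ==> finite (lsn A n)" unfolding lsn_def by (rule finite_lists_length_eq)

lemma sum_lsn_0: "sum f (lsn A 0) = f []"
proof -
 have "lsn A 0 = {[]}" by (auto simp: lsn_def)
 then show ?thesis by simp
qed

lemma lsn_Suc: "lsn A (Suc n) = (%(x, xs). x # xs) ` (A \<times> lsn A n)"
 by (auto simp: lsn_def length_Suc_conv image_iff)

lemma sum_lsn_Suc: "sum f (lsn A (Suc n)) = (\<Sum>x\<in>A. \<Sum>xs\<in>lsn A n. f (x # xs))"
 unfolding lsn_Suc by (subst sum.reindex) (auto simp: inj_on_def sum.cartesian_product split_def)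

lemma lsn_add: "lsn A (m + n) = (%(xs, ys). xs @ ys) ` (lsn A m \<times> lsn A n)"
proof (rule set_eqI, rule iffI)
 fix zs assume "zs \<in> lsn A (m + n)"
 then have "(take m zs, drop m zs) \<in> lsn A m \<times> lsn A n" by (auto simp: lsn_def dest: in_set_takeD in_set_dropD)
 then show "zs \<in> (%(xs, ys). xs @ ys) ` (lsn A m \<times> lsn A n)" by (rule rev_image_eqI) simp
qed (auto simp: lsn_def)

lemma sum_lsn_add: "sum f (lsn A (m + n)) = (\<Sum>xs\<in>lsn A m. \<Sum>ys\<in>lsn A n. f (xs @ ys))" unfolding lsn_add
 by (subst sum.reindex) (auto simp: inj_on_def lsn_def sum.cartesian_product split_def)

lemma wt_simps [simp]: "wt w [] = 1" "wt w (k # ks) = w k * wt w ks" "wt w (xs @ ys) = wt w xs * wt w ys" by (auto simp: wt_def)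

lemma wt_nonneg: "(\<And>i. w i >= 0) ==> wt w ks >= 0" by (induction ks) auto

lemma sum_wt_lsn: "(\<Sum>xs\<in>lsn A n. wt w xs) = (\<Sum>x\<in>A. w x) ^ n"
proof (induction n)
 case (Suc n)
 have "(\<Sum>xs\<in>lsn A (Suc n). wt w xs) = (\<Sum>x\<in>A. w x * (\<Sum>xs\<in>lsn A n. wt w xs))"
  unfolding sum_lsn_Suc by (simp add: sum_distrib_left)
 then show ?case unfolding Suc.IH by (simp add: sum_distrib_right)
qed (simp add: sum_lsn_0)

lemma wt_exp: "wt (%k. w k * exp (s * f k)) ks = wt w ks * exp (s * sum_list (map f ks))"
 by (induction ks) (auto simp: algebra_simps exp_add)

lemma wt_mult: "wt (%k. a k * b k) ks = wt a ks * wt b ks" by (induction ks) (auto simp: algebra_simps)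

lemma wt_power: "wt (%k. c ^ k) ks = c ^ sum_list ks" by (induction ks) (auto simp: power_add)

lemma wt_const: "wt (%k. c) ks = c ^ length ks" by (induction ks) auto

lemma finite_comps: "finite (comps l x)"
proof (rule finite_subset)
 show "comps l x \<subseteq> lsn {..x} l" by (auto simp: comps_def lsn_def intro: member_le_sum_list)
qed (simp add: finite_lsn)

lemma comps_0: "comps 0 x = (if x = 0 then {[]} else {})" by (auto simp: comps_def)

lemma comps_Suc: "comps (Suc l) x = (%(m, ms). m # ms) ` (SIGMA m:{..x}. comps l (x - m))"
 by (auto simp: comps_def length_Suc_conv image_iff)

lemma sum_comps_Suc: "sum f (comps (Suc l) x) = (\<Sum>m\<le>x. \<Sum>ms\<in>comps l (x - m). f (m # ms))" unfolding comps_Suc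
 by (subst sum.reindex) (auto simp: inj_on_def sum.Sigma finite_comps split_def)

lemma bcomp_nonempty: "bcomp k \<noteq> {}"
proof -
 have "replicate k 1 \<in> bcomp k" by (simp add: comps_def sum_list_replicate)
 then show ?thesis by blast
qed

lemma card_bcomp_pos: "card (bcomp k) > 0" using bcomp_nonempty finite_comps by (simp add: card_gt_0_iff)

lemma card_set_Cons: "card (set_Cons A B) = card A * card B"
proof -
 have "set_Cons A B = (%(x, xs). x # xs) ` (A \<times> B)" by (auto simp: set_Cons_def)
 moreover have "card ((%(x, xs). x # xs) ` (A \<times> B)) = card (A \<times> B)"
  by (rule card_image) (auto simp: inj_on_def)
 ultimately show ?thesis by (simp add: card_cartesian_product)
qed

lemma sum_set_Cons: "sum f (set_Cons A B) = (\<Sum>x\<in>A. \<Sum>xs\<in>B. f (x # xs))"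
proof -
 have "set_Cons A B = (%(x, xs). x # xs) ` (A \<times> B)" by (auto simp: set_Cons_def)
 then show ?thesis by (simp only:) (subst sum.reindex, auto simp: inj_on_def sum.cartesian_product split_def)
qed

lemma dec_simps [simp]: "dec [] = {[]}" "dec (k # ks) = set_Cons (bcomp k) (dec ks)" by (auto simp: dec_def)

lemma card_dec: "card (dec ks) = prod_list (map (%k. card (bcomp k)) ks)" by (induction ks) (auto simp: card_set_Cons)

lemma card_dec_pos: "card (dec ks) > 0" unfolding card_dec using card_bcomp_pos by (induction ks) auto

lemma dec_iff: "mss \<in> dec ks \<longleftrightarrow> list_all2 (%ms k. ms \<in> bcomp k) mss ks"
proof (induction ks arbitrary: mss)
 case (Cons k ks)
 show ?case by (auto simp: set_Cons_def list_all2_Cons2 Cons.IH)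
qed auto

lemma avg_dec_Cons: "avg (dec (k # ks)) f = avg (bcomp k) (%z. avg (dec ks) (%zs. f (z # zs)))"
 by (simp add: avg_def sum_set_Cons card_set_Cons sum_divide_distrib mult.commute)

lemma avg_const: "card A > 0 ==> avg A (%_. c) = c" by (cases "A = {}") (auto simp: avg_def)

lemma avg_dec_append: "avg (dec (xs @ ys)) f = avg (dec xs) (%us. avg (dec ys) (%vs. f (us @ vs)))"
proof (induction xs arbitrary: f)
 case Nil
 then show ?case by (simp add: avg_def)
next
 case (Cons x xs)
 then show ?case by (simp only: append_Cons avg_dec_Cons)
qed

lemma avg_mono: "(\<And>x. x \<in> A ==> f x <= g x) ==> avg A f <= avg A g"
 by (auto simp: avg_def intro!: divide_right_mono sum_mono)

lemma avg_add: "avg A (%x. f x + g x) = avg A f + avg A g" by (simp add: avg_def sum.distrib add_divide_distrib)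

lemma avg_cmult: "avg A (%x. c * f x) = c * avg A f" by (simp add: avg_def sum_distrib_left[symmetric])

lemma avg_sum: "avg A (%x. \<Sum>i\<in>I. f i x) = (\<Sum>i\<in>I. avg A (f i))"
 unfolding avg_def sum_divide_distrib[symmetric] by (subst sum.swap) (rule refl)

lemma avg_swap: "avg A (%x. avg B (%y. f x y)) = avg B (%y. avg A (%x. f x y))"
 unfolding avg_def sum_divide_distrib[symmetric] by (subst sum.swap) (simp add: divide_divide_eq_left mult.commute)

lemma avg_abs: "\<bar>avg A f\<bar> <= avg A (%x. \<bar>f x\<bar>)" by (simp add: avg_def divide_right_mono)

lemma avg_cong: "(\<And>x. x \<in> A ==> f x = g x) ==> avg A f = avg A g" by (simp add: avg_def)

subsection \<open>Bridges with geometric steps\<close>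

text \<open>For independent geometric variables \<open>X_j\<close> with
  \<open>P(X_j = m) = 2^-(m+1)\<close> this is the expectation of \<open>cis\<close> of the sum of
  \<open>\<theta>_j X_j\<close> on the event that the \<open>X_j\<close> add up to \<open>x\<close>.
  Every composition of \<open>x\<close> into \<open>l\<close> parts has the same probability
  \<open>2^-(x+l)\<close>, which makes the conditional law uniform.\<close>

fun qf :: "real list => nat => complex" where
 "qf [] x = (if x = 0 then 1 else 0)"
| "qf (\<theta> # \<theta>s) x = (\<Sum>m\<le>x. cis (\<theta> * real m) / 2 ^ (m + 1) * qf \<theta>s (x - m))"

lemma qf_eq:
 "qf \<theta>s x = (\<Sum>ms\<in>comps (length \<theta>s) x. cis (\<Sum>j<length \<theta>s. \<theta>s ! j * real (ms ! j))) / 2 ^ (x + length \<theta>s)"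
proof (induction \<theta>s arbitrary: x)
 case Nil
 then show ?case by (simp add: comps_0)
next
 case (Cons \<theta> \<theta>s)
 have "cis (\<theta> * real m) / 2 ^ (m + 1) * qf \<theta>s (x - m) =
   (\<Sum>ms\<in>comps (length \<theta>s) (x - m). cis (\<Sum>j<length (\<theta> # \<theta>s). (\<theta> # \<theta>s) ! j * real ((m # ms) ! j)))
    / 2 ^ (x + length (\<theta> # \<theta>s))" if "m <= x" for m
 proof -
  have "(2::complex) ^ (x + length (\<theta> # \<theta>s)) = 2 ^ (m + 1) * 2 ^ (x - m + length \<theta>s)"
   using that by (simp flip: power_add)
  moreover have "cis (\<Sum>j<length (\<theta> # \<theta>s). (\<theta> # \<theta>s) ! j * real ((m # ms) ! j))
    = cis (\<theta> * real m) * cis (\<Sum>j<length \<theta>s. \<theta>s ! j * real (ms ! j))" for ms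
   by (simp add: sum.lessThan_Suc_shift cis_mult del: sum.lessThan_Suc)
  ultimately show ?thesis unfolding Cons.IH by (simp only: sum_distrib_left[symmetric] times_divide_times_eq)
 qed
 then have "qf (\<theta> # \<theta>s) x = (\<Sum>m\<le>x. (\<Sum>ms\<in>comps (length \<theta>s) (x - m).
   cis (\<Sum>j<length (\<theta> # \<theta>s). (\<theta> # \<theta>s) ! j * real ((m # ms) ! j))) / 2 ^ (x + length (\<theta> # \<theta>s)))"
  by (simp del: sum.lessThan_Suc)
 also have "... = (\<Sum>m\<le>x. \<Sum>ms\<in>comps (length \<theta>s) (x - m).
   cis (\<Sum>j<length (\<theta> # \<theta>s). (\<theta> # \<theta>s) ! j * real ((m # ms) ! j))) / 2 ^ (x + length (\<theta> # \<theta>s))"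
  by (simp only: sum_divide_distrib)
 also have "... = (\<Sum>ms\<in>comps (length (\<theta> # \<theta>s)) x.
   cis (\<Sum>j<length (\<theta> # \<theta>s). (\<theta> # \<theta>s) ! j * real (ms ! j))) / 2 ^ (x + length (\<theta> # \<theta>s))"
  by (simp only: list.size(4) One_nat_def add_Suc_right add_0_right sum_comps_Suc)
 finally show ?case .
qed

lemma two_minus_cis: "norm (2 - cis t) >= 1"
proof -
 have "norm (2::complex) - norm (cis t) <= norm (2 - cis t)" by (rule norm_triangle_ineq2)
 then show ?thesis by simp
qed

text \<open>The recursion defining \<open>qf\<close> is a Cauchy product, so the Fourier series in
  \<open>u\<close> factorizes into geometric series with values
  \<open>1 / (2 - cis (\<theta> + u))\<close>. Absolute summability is carried along, since both the
  product and the later integration term by term rely on it.\<close>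

lemma qf_sums:
 "summable (%x. norm (qf \<theta>s x)) \<and>
  (%x. qf \<theta>s x * cis (u * real x)) sums prod_list (map (%\<theta>. 1 / (2 - cis (\<theta> + u))) \<theta>s)"
proof (induction \<theta>s)
 case Nil
 have "(%x. (if x = 0 then 1 else 0 :: real)) sums 1" using sums_single[of 0 "%_. 1::real"] by simp
 moreover have "(%x. (if x = 0 then 1 else 0) * cis (u * real x)) sums 1"
  using sums_single[of 0 "%x. cis (u * real x)"] by (simp add: if_distrib if_distribR cong: if_cong)
 moreover have "(%x. norm (qf [] x)) = (%x. (if x = 0 then 1 else 0 :: real))" by auto
 ultimately show ?case by (simp add: sums_iff)
next
 case (Cons \<theta> \<theta>s)
 let ?a = "%m. cis (\<theta> * real m) / 2 ^ (m + 1) * cis (u * real m)"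
 let ?b = "%k. qf \<theta>s k * cis (u * real k)"
 have na: "norm (?a m) = (1/2) ^ (m + 1)" for m by (simp add: norm_mult norm_divide norm_power power_divide)
 have sa: "summable (%m. (1/2::real) ^ (m + 1))" by (simp add: summable_mult)
 have nb: "norm (?b k) = norm (qf \<theta>s k)" for k by (simp add: norm_mult)
 have a_sums: "?a sums (1 / (2 - cis (\<theta> + u)))"
 proof -
  have eq: "?a m = 1/2 * (cis (\<theta> + u) / 2) ^ m" for m by (simp add: power_divide Complex.DeMoivre cis_mult algebra_simps)
  have "(%m. 1/2 * (cis (\<theta> + u) / 2) ^ m) sums (1/2 * (1 / (1 - cis (\<theta> + u) / 2)))"
   by (intro sums_mult geometric_sums) (simp add: norm_divide)
  moreover have "1/2 * (1 / (1 - cis (\<theta> + u) / 2)) = 1 / (2 - cis (\<theta> + u))"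
   using two_minus_cis[of "\<theta> + u"] by (auto simp: field_simps)
  ultimately show ?thesis unfolding eq by simp
 qed
 have 1: "(%k. \<Sum>i\<le>k. ?a i * ?b (k - i)) sums ((\<Sum>k. ?a k) * (\<Sum>k. ?b k))"
  by (rule Cauchy_product_sums) (simp_all only: na nb sa Cons.IH)
 have 2: "(\<Sum>i\<le>k. ?a i * ?b (k - i)) = qf (\<theta> # \<theta>s) k * cis (u * real k)" for k
 proof -
  have "?a i * ?b (k - i) = cis (\<theta> * real i) / 2 ^ (i + 1) * qf \<theta>s (k - i) * cis (u * real k)"
   if "i <= k" for i
  proof -
   have "u * real k = u * real i + u * real (k - i)" using that by (simp add: of_nat_diff algebra_simps)
   then have "cis (u * real k) = cis (u * real i) * cis (u * real (k - i))" by (simp only: cis_mult)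
   then show ?thesis by simp
  qed
  then show ?thesis unfolding qf.simps sum_distrib_right by (intro sum.cong) auto
 qed
 have 3: "summable (%x. norm (qf (\<theta> # \<theta>s) x))"
 proof (rule summable_comparison_test)
  show "summable (%k. \<Sum>i\<le>k. (1/2::real) ^ (i + 1) * norm (qf \<theta>s (k - i)))"
   using sa Cons.IH by (intro summable_Cauchy_product) simp_all
  have "norm (qf (\<theta> # \<theta>s) k) <= (\<Sum>i\<le>k. (1/2::real) ^ (i + 1) * norm (qf \<theta>s (k - i)))" for k
   by (simp, rule sum_norm_le) (simp add: norm_mult norm_divide norm_power power_divide)
  then show "\<exists>N. \<forall>n\<ge>N. norm (norm (qf (\<theta> # \<theta>s) n)) <= (\<Sum>i\<le>n. (1/2::real) ^ (i + 1) * norm (qf \<theta>s (n - i)))"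
   by auto
 qed
 show ?case using 1 3 a_sums Cons.IH unfolding 2 by (simp add: sums_iff)
qed

lemma integral_cis:
 fixes j :: int
 shows "(LINT u|lborel. indicator {-pi..pi} u *\<^sub>R cis (u * of_int j)) = (if j = 0 then 2 * pi else 0)"
proof (cases "j = 0")
 case True
 then show ?thesis by (simp add: scaleR_conv_of_real)
next
 case False
 let ?F = "%u. cis (u * of_int j) / (\<i> * of_int j)"
 have "(LINT u|lborel. indicator {-pi..pi} u *\<^sub>R cis (u * of_int j)) = ?F pi - ?F (-pi)"
 proof (rule integral_FTC_atLeastAtMost)
  fix x :: real
  have "((%u. cis (u * of_int j)) has_vector_derivative (of_int j * (\<i> * cis (x * of_int j)))) (at x within {- pi..pi})"
  proof -
   have "((%u. cis (u * of_int j)) has_vector_derivative (of_int j *\<^sub>R (\<i> * cis (x * of_int j)))) (at x within {- pi..pi})"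
    unfolding has_vector_derivative_def
    by (auto intro!: derivative_eq_intros simp: fun_eq_iff scaleR_conv_of_real algebra_simps)
   then show ?thesis by (simp add: scaleR_conv_of_real)
  qed
  from has_vector_derivative_mult_left[OF this, of "1 / (\<i> * of_int j)"]
  show "(?F has_vector_derivative cis (x * of_int j)) (at x within {- pi..pi})" using False by (simp add: field_simps)
 qed (auto intro!: continuous_intros)
 also have "cis (- pi * of_int j) = cis (pi * of_int j)"
 proof -
  have "cis (pi * of_int j) = cis (- pi * of_int j) * cis (2 * pi * of_int j)" by (simp add: cis_mult algebra_simps)
  moreover have "cis (2 * pi * of_int j) = 1" by (rule cis_multiple_2pi) simp
  ultimately show ?thesis by simp
 qed
 then have "?F pi - ?F (-pi) = 0" by simp
 finally show ?thesis using False by simp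
qed

text \<open>Fourier inversion: the series of \<open>qf_sums\<close> is integrated termwise against
  \<open>cis (- u y)\<close> and only the coefficient at \<open>y\<close> survives.\<close>

lemma qf_integral:
 "complex_of_real (2 * pi) * qf \<theta>s y =
   (LINT u|lborel. indicator {-pi..pi} u *\<^sub>R (cis (- (u * real y)) * prod_list (map (%\<theta>. 1 / (2 - cis (\<theta> + u))) \<theta>s)))"
proof -
 let ?f = "%x u. indicator {-pi..pi} u *\<^sub>R (qf \<theta>s x * cis (u * (real x - real y)))"
 have int: "integrable lborel (%u. indicator {-pi..pi} u *\<^sub>R (c * cis (u * z)))" for c z
  by (rule borel_integrable_compact) (auto intro!: continuous_intros)
 have nrm: "norm (?f x u) = norm (qf \<theta>s x) * indicator {-pi..pi} u" for x u by (simp add: norm_mult indicator_def)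
 have int_f: "(LINT u|lborel. ?f x u) = (if x = y then 2 * pi * qf \<theta>s y else 0)" for x
 proof -
  have "(LINT u|lborel. ?f x u) = qf \<theta>s x * (LINT u|lborel. indicator {-pi..pi} u *\<^sub>R cis (u * of_int (int x - int y)))"
   by (subst integral_mult_right_zero[symmetric]) (simp add: algebra_simps)
  then show ?thesis unfolding integral_cis by auto
 qed
 have sm: "summable (%x. norm (qf \<theta>s x))" using qf_sums by blast
 have A1: "(%x. LINT u|lborel. ?f x u) sums (LINT u|lborel. (\<Sum>x. ?f x u))"
 proof (rule sums_integral)
  show "integrable lborel (?f x)" for x by (rule int)
  show "AE u in lborel. summable (%x. norm (?f x u))" unfolding nrm using sm by (auto intro: summable_mult2)
  have "(LINT u|lborel. norm (?f x u)) = norm (qf \<theta>s x) * (2 * pi)" for x unfolding nrm by simp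
  then show "summable (%x. LINT u|lborel. norm (?f x u))" using sm by (simp add: summable_mult2)
 qed
 have A2: "(%x. LINT u|lborel. ?f x u) sums (2 * pi * qf \<theta>s y)"
  unfolding int_f using sums_single[of y "%_. 2 * pi * qf \<theta>s y"] by (simp add: eq_commute cong: if_cong)
 have A3: "(\<Sum>x. ?f x u) = indicator {-pi..pi} u *\<^sub>R (cis (- (u * real y)) * prod_list (map (%\<theta>. 1 / (2 - cis (\<theta> + u))) \<theta>s))" for u
 proof -
  have "(%x. qf \<theta>s x * cis (u * real x)) sums prod_list (map (%\<theta>. 1 / (2 - cis (\<theta> + u))) \<theta>s)"
   using qf_sums by blast
  then have "(%x. indicator {-pi..pi} u *\<^sub>R (cis (- (u * real y)) * (qf \<theta>s x * cis (u * real x)))) sums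
    (indicator {-pi..pi} u *\<^sub>R (cis (- (u * real y)) * prod_list (map (%\<theta>. 1 / (2 - cis (\<theta> + u))) \<theta>s)))"
   by (intro sums_scaleR_right sums_mult)
  moreover have "cis (- (u * real y)) * (qf \<theta>s x * cis (u * real x)) = qf \<theta>s x * cis (u * (real x - real y))" for x
   by (simp add: cis_mult algebra_simps)
  ultimately show ?thesis by (simp add: sums_iff)
 qed
 show ?thesis using sums_unique2[OF A1 A2] unfolding A3 by simp
qed

text \<open>The characteristic function of a geometric variable minus one. This step has mean 0 and
  variance 2, hence the comparison with \<open>exp (- t^2)\<close> below.\<close>

definition phi :: "real => complex" where
 "phi t = cis (- t) / (2 - cis t)"

text \<open>The integration over \<open>u\<close> expresses the conditioning on a total of
  \<open>k\<close>: each angle is shifted by \<open>u\<close>, and the integrand becomes a product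
  over independent steps. The factor \<open>4 ^ k\<close> is \<open>2 ^ (k + k)\<close> from
  \<open>qf_eq\<close>.\<close>

lemma comp_integral:
 "complex_of_real (2 * pi) * ((\<Sum>ms\<in>bcomp k. cis (\<Sum>j<k. \<theta> j * (real (ms ! j) - 1))) / 4 ^ k) =
  (LINT u|lborel. indicator {-pi..pi} u *\<^sub>R (\<Prod>j<k. phi (\<theta> j + u)))"
proof -
 let ?t = "map \<theta> [0..<k]"
 have pl: "prod_list (map f ?t) = (\<Prod>j<k. f (\<theta> j))" for f :: "real => complex" by (induction k) simp_all
 have "(\<Sum>ms\<in>bcomp k. cis (\<Sum>j<k. \<theta> j * (real (ms ! j) - 1))) / 4 ^ k = cis (- (\<Sum>j<k. \<theta> j)) * qf ?t k"
 proof -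
  have "cis (\<Sum>j<k. \<theta> j * (real (ms ! j) - 1)) = cis (- (\<Sum>j<k. \<theta> j)) * cis (\<Sum>j<k. \<theta> j * real (ms ! j))" for ms
   by (simp add: cis_mult algebra_simps sum_subtractf)
  moreover have "(4::complex) ^ k = 2 ^ (k + k)" by (simp add: power_add flip: power_mult_distrib)
  ultimately show ?thesis unfolding qf_eq by (simp add: sum_distrib_left)
 qed
 then have "complex_of_real (2 * pi) * ((\<Sum>ms\<in>bcomp k. cis (\<Sum>j<k. \<theta> j * (real (ms ! j) - 1))) / 4 ^ k)
   = cis (- (\<Sum>j<k. \<theta> j)) * (complex_of_real (2 * pi) * qf ?t k)" by simp
 also have "... = (LINT u|lborel. indicator {-pi..pi} u *\<^sub>R (cis (- (\<Sum>j<k. \<theta> j)) * (cis (- (u * real k)) * (\<Prod>j<k. 1 / (2 - cis (\<theta> j + u))))))"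
  unfolding qf_integral pl by (subst integral_mult_right_zero[symmetric]) (simp add: algebra_simps)
 also have "... = (LINT u|lborel. indicator {-pi..pi} u *\<^sub>R (\<Prod>j<k. phi (\<theta> j + u)))"
 proof (rule Bochner_Integration.integral_cong[OF refl])
  fix u :: real
  have "(\<Prod>j<k. cis (- (\<theta> j + u))) = cis (- (\<Sum>j<k. \<theta> j)) * cis (- (u * real k))" for k
   by (induction k) (simp_all add: cis_mult algebra_simps)
  then show "indicator {-pi..pi} u *\<^sub>R (cis (- (\<Sum>j<k. \<theta> j)) * (cis (- (u * real k)) * (\<Prod>j<k. 1 / (2 - cis (\<theta> j + u)))))
    = indicator {-pi..pi} u *\<^sub>R (\<Prod>j<k. phi (\<theta> j + u))"
   unfolding phi_def by (simp add: prod_dividef mult.assoc[symmetric])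
 qed
 finally show ?thesis .
qed

lemma norm_two_minus_cis: "(norm (2 - cis t))\<^sup>2 = 5 - 4 * cos t"
proof -
 have "(norm (2 - cis t))\<^sup>2 = (2 - cos t)\<^sup>2 + (sin t)\<^sup>2" by (simp add: cmod_power2)
 also have "... = 4 - 4 * cos t + ((sin t)\<^sup>2 + (cos t)\<^sup>2)" by (simp add: power2_eq_square algebra_simps)
 finally show ?thesis by simp
qed

lemma norm_phi_le_1: "norm (phi t) <= 1" using two_minus_cis[of t] by (simp add: phi_def norm_divide divide_le_eq)

lemma cos_upper: "cos t <= 1 - t\<^sup>2 / 2 + t ^ 4 / 24" for t :: real
proof -
 have "(\<Sum>k\<le>3. (\<i> * complex_of_real t) ^ k / fact k) = Complex (1 - t\<^sup>2 / 2) (t - t ^ 3 / 6)"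
  by (simp add: eval_nat_numeral complex_eq_iff algebra_simps fact_numeral)
 then have "cmod (iexp t - Complex (1 - t\<^sup>2 / 2) (t - t ^ 3 / 6)) <= t ^ 4 / 24"
  using iexp_approx1[of t 3] by (simp add: eval_nat_numeral fact_numeral)
 moreover have "\<bar>Re (iexp t - Complex (1 - t\<^sup>2 / 2) (t - t ^ 3 / 6))\<bar> <= cmod (iexp t - Complex (1 - t\<^sup>2 / 2) (t - t ^ 3 / 6))"
  by (rule abs_Re_le_cmod)
 ultimately show ?thesis by (simp add: Re_exp)
qed

lemma exp_le_linear: "exp s <= 1 + 4 * s" if "0 <= s" "s <= 2" for s :: real
proof -
 have "exp ((1 - s/2) *\<^sub>R 0 + (s/2) *\<^sub>R 2) <= (1 - s/2) * exp 0 + (s/2) * exp (2::real)"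
  using that by (intro convex_onD[OF exp_convex]) auto
 moreover have "exp (2::real) <= 9"
 proof -
  have "exp (2::real) = exp 1 * exp 1" by (simp flip: exp_add)
  also have "... <= 3 * 3" using exp_le by (intro mult_mono) auto
  finally show ?thesis by simp
 qed
 then have "(s/2) * exp 2 <= (s/2) * 9" using that by (intro mult_left_mono) auto
 ultimately show ?thesis by simp
qed

text \<open>With \<open>s = 1 - cos t\<close> the squared modulus is \<open>1 + 4 s\<close>, which
  dominates \<open>exp s\<close> on \<open>[0, 2]\<close> by convexity, while \<open>s\<close> is at
  least \<open>t^2 / 16\<close> by the quartic bound on the cosine. The range \<open>16/5\<close>
  exceeds \<open>pi\<close> slightly, which leaves room for angles shifted out of
  \<open>[-pi, pi]\<close>.\<close>

lemma inv_two_minus_cis: "1 / norm (2 - cis t) <= exp (- t\<^sup>2 / 32)" if "\<bar>t\<bar> <= 16/5"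
proof -
 let ?s = "1 - cos t"
 have t2: "t\<^sup>2 <= (16/5)\<^sup>2" using that by (intro abs_le_square_iff[THEN iffD1]) simp
 have "t ^ 4 = t\<^sup>2 * t\<^sup>2" by (simp add: power2_eq_square eval_nat_numeral)
 also have "... <= (16/5)\<^sup>2 * t\<^sup>2" using t2 by (intro mult_right_mono) auto
 finally have "t ^ 4 <= (16/5)\<^sup>2 * t\<^sup>2" .
 then have f1: "t ^ 4 <= 256 / 25 * t\<^sup>2" by (simp add: power_divide)
 have f2: "0 <= t\<^sup>2" by simp
 have "?s >= t\<^sup>2 / 16" using cos_upper[of t] f1 f2 by linarith
 then have "exp (t\<^sup>2 / 16) <= exp ?s" by simp
 also have "... <= 1 + 4 * ?s" using cos_ge_minus_one[of t] by (intro exp_le_linear) auto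
 also have "... = (norm (2 - cis t))\<^sup>2" by (simp add: norm_two_minus_cis)
 finally have "exp (t\<^sup>2 / 32) ^ 2 <= (norm (2 - cis t))\<^sup>2" by (simp add: exp_of_nat_mult[symmetric])
 then have "exp (t\<^sup>2 / 32) <= norm (2 - cis t)" by (rule power2_le_imp_le) simp
 then have "1 / norm (2 - cis t) <= 1 / exp (t\<^sup>2 / 32)" using two_minus_cis[of t] by (intro divide_left_mono mult_pos_pos) (auto simp del: zero_less_norm_iff)
 then show ?thesis by (simp add: exp_minus field_simps)
qed

lemma norm_phi_le: "\<bar>t\<bar> <= 16/5 ==> norm (phi t) <= exp (- t\<^sup>2 / 32)"
 using inv_two_minus_cis[of t] by (simp add: phi_def norm_divide)

lemma phi_approx: "norm (phi t - complex_of_real (exp (- t\<^sup>2))) <= 5 * \<bar>t\<bar> ^ 3"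
proof (cases "\<bar>t\<bar> <= 1")
 case False
 then have "(1::real) ^ 3 <= \<bar>t\<bar> ^ 3" by (intro power_mono) auto
 moreover have "norm (phi t - complex_of_real (exp (- t\<^sup>2))) <= norm (phi t) + norm (complex_of_real (exp (- t\<^sup>2)))"
  by (rule norm_triangle_ineq4)
 moreover have "exp (- t\<^sup>2) <= 1" by simp
 ultimately show ?thesis using norm_phi_le_1[of t] by (simp del: exp_le_one_iff)
next
 case True
 define z where "z = complex_of_real t"
 define R1 where "R1 = cis (- t) - (1 - \<i> * z - z\<^sup>2 / 2)"
 define R2 where "R2 = cis t - (1 + \<i> * z - z\<^sup>2 / 2)"
 define R3 where "R3 = exp (- t\<^sup>2) - (1 - t\<^sup>2)"
 have ap: "norm (cis s - (1 + \<i> * complex_of_real s - (complex_of_real s)\<^sup>2 / 2)) <= \<bar>s\<bar> ^ 3 / 6" for s :: real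
 proof -
  have "(\<Sum>k\<le>2. (\<i> * complex_of_real s) ^ k / fact k) = 1 + \<i> * complex_of_real s - (complex_of_real s)\<^sup>2 / 2"
  proof -
   have "{..2::nat} = {0, 1, 2}" by auto
   then show ?thesis by (simp add: power_mult_distrib)
  qed
  moreover have "norm (exp (\<i> * complex_of_real s) - (\<Sum>k\<le>2. (\<i> * complex_of_real s) ^ k / fact k)) <= \<bar>s\<bar> ^ Suc 2 / fact (Suc 2)"
   by (rule iexp_approx1)
  moreover have "\<bar>s\<bar> ^ Suc 2 / fact (Suc 2) = \<bar>s\<bar> ^ 3 / 6" by (simp add: fact_numeral eval_nat_numeral)
  ultimately show ?thesis by (simp only: cis_conv_exp)
 qed
 have r1: "norm R1 <= \<bar>t\<bar> ^ 3 / 6" using ap[of "-t"] by (simp add: R1_def z_def)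
 have r2: "norm R2 <= \<bar>t\<bar> ^ 3 / 6" using ap[of t] by (simp add: R2_def z_def)
 have t4: "t ^ 4 <= \<bar>t\<bar> ^ 3" using power_decreasing[of 3 4 "\<bar>t\<bar>"] True by simp
 have r3: "\<bar>R3\<bar> <= \<bar>t\<bar> ^ 3"
 proof -
  have "0 <= R3" unfolding R3_def using exp_ge_add_one_self[of "- t\<^sup>2"] by simp
  moreover have "exp (- t\<^sup>2) * exp (t\<^sup>2) = 1" by (simp flip: exp_add)
  moreover have "R3 <= t ^ 4"
  proof -
   have "exp (t\<^sup>2) >= 1 + t\<^sup>2" by (rule exp_ge_add_one_self)
   then have "exp (- t\<^sup>2) * (1 + t\<^sup>2) <= 1"
    using mult_left_mono[of "1 + t\<^sup>2" "exp (t\<^sup>2)" "exp (- t\<^sup>2)"] by (simp flip: exp_add)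
   then have "exp (- t\<^sup>2) <= 1 / (1 + t\<^sup>2)" by (simp add: field_simps add_pos_nonneg)
   also have "... <= 1 - t\<^sup>2 + t ^ 4"
   proof -
    have "(1 - t\<^sup>2 + t ^ 4) * (1 + t\<^sup>2) = 1 + t ^ 6" by (simp add: algebra_simps eval_nat_numeral)
    then have "1 <= (1 - t\<^sup>2 + t ^ 4) * (1 + t\<^sup>2)" by simp
    moreover have "0 < 1 + t\<^sup>2" by (simp add: add_pos_nonneg)
    ultimately show ?thesis by (simp add: pos_divide_le_eq)
   qed
   finally show ?thesis by (simp add: R3_def)
  qed
  ultimately show ?thesis using t4 by simp
 qed
 \<comment> \<open>Multiplying by \<open>2 - cis t\<close> removes the quotient. In the resulting
   difference all terms of order below three cancel, and only Taylor remainders and explicit powers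
   of \<open>z\<close> remain.\<close>
 have key: "phi t - complex_of_real (exp (- t\<^sup>2)) =
   (R1 - \<i> * z ^ 3 + z ^ 4 / 2 + complex_of_real (exp (- t\<^sup>2)) * R2 - complex_of_real R3 * (1 - \<i> * z + z\<^sup>2 / 2)) / (2 - cis t)"
 proof -
  have nz: "2 - cis t \<noteq> 0" using two_minus_cis[of t] by auto
  have "cis (- t) - complex_of_real (exp (- t\<^sup>2)) * (2 - cis t) =
   R1 - \<i> * z ^ 3 + z ^ 4 / 2 + complex_of_real (exp (- t\<^sup>2)) * R2 - complex_of_real R3 * (1 - \<i> * z + z\<^sup>2 / 2)"
  proof -
   have c1: "cis (- t) = R1 + (1 - \<i> * z - z\<^sup>2 / 2)" by (simp add: R1_def)
   have c2: "cis t = R2 + (1 + \<i> * z - z\<^sup>2 / 2)" by (simp add: R2_def)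
   have c3: "complex_of_real (exp (- t\<^sup>2)) = complex_of_real R3 + (1 - z\<^sup>2)" by (simp add: R3_def z_def)
   show ?thesis unfolding c1 c2 c3 by (simp add: algebra_simps eval_nat_numeral)
  qed
  moreover have "phi t - complex_of_real (exp (- t\<^sup>2)) =
    (cis (- t) - complex_of_real (exp (- t\<^sup>2)) * (2 - cis t)) / (2 - cis t)"
   using nz by (simp add: phi_def diff_divide_distrib)
  ultimately show ?thesis by simp
 qed
 have "norm (R1 - \<i> * z ^ 3 + z ^ 4 / 2 + complex_of_real (exp (- t\<^sup>2)) * R2 - complex_of_real R3 * (1 - \<i> * z + z\<^sup>2 / 2))
   <= \<bar>t\<bar> ^ 3 / 6 + \<bar>t\<bar> ^ 3 + \<bar>t\<bar> ^ 3 / 2 + \<bar>t\<bar> ^ 3 / 6 + \<bar>t\<bar> ^ 3 * (5/2) * 1"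
 proof -
  have n1: "norm (R1 - \<i> * z ^ 3 + z ^ 4 / 2 + complex_of_real (exp (- t\<^sup>2)) * R2 - complex_of_real R3 * (1 - \<i> * z + z\<^sup>2 / 2))
   <= norm R1 + norm (\<i> * z ^ 3) + norm (z ^ 4 / 2) + norm (complex_of_real (exp (- t\<^sup>2)) * R2)
    + norm (complex_of_real R3 * (1 - \<i> * z + z\<^sup>2 / 2))"
   by (intro order_trans[OF norm_triangle_ineq4] order_trans[OF norm_triangle_ineq] add_mono order_refl)
  have n2: "norm (\<i> * z ^ 3) = \<bar>t\<bar> ^ 3" by (simp add: norm_mult norm_power z_def)
  have n3: "norm (z ^ 4 / 2) <= \<bar>t\<bar> ^ 3 / 2" using t4 by (simp add: norm_divide norm_power z_def)
  have n4: "norm (complex_of_real (exp (- t\<^sup>2)) * R2) <= 1 * (\<bar>t\<bar> ^ 3 / 6)"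
   unfolding norm_mult using r2 by (intro mult_mono) auto
  have "norm (1 - \<i> * z + z\<^sup>2 / 2) <= norm (1::complex) + norm (\<i> * z) + norm (z\<^sup>2 / 2)"
   by (intro order_trans[OF norm_triangle_ineq] order_trans[OF norm_triangle_ineq4] add_mono order_refl)
  also have "... <= 1 + 1 + 1/2"
   using True power_le_one[of "\<bar>t\<bar>" 2] by (intro add_mono) (auto simp: norm_mult norm_divide norm_power z_def)
  finally have "norm (complex_of_real R3 * (1 - \<i> * z + z\<^sup>2 / 2)) <= \<bar>t\<bar> ^ 3 * (5/2)"
   unfolding norm_mult using r3 by (intro mult_mono) auto
  with n1 n2 n3 n4 r1 show ?thesis by simp
 qed
 also have "... <= 5 * \<bar>t\<bar> ^ 3" by simp
 finally have "norm (phi t - complex_of_real (exp (- t\<^sup>2))) <= 5 * \<bar>t\<bar> ^ 3 / norm (2 - cis t)"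
  unfolding key norm_divide by (intro divide_right_mono) auto
 also have "... <= 5 * \<bar>t\<bar> ^ 3 / 1" using two_minus_cis[of t] by (intro divide_left_mono) auto
 finally show ?thesis by simp
qed

lemma gauss_integral:
 assumes "c > 0"
 shows "integrable lborel (%v::real. exp (- c * (v + a)\<^sup>2))"
  and "(LINT v|lborel. exp (- c * (v + a)\<^sup>2)) = sqrt (pi / c)"
proof -
 define s where "s = 1 / sqrt (2 * c)"
 have s: "s > 0" "s\<^sup>2 = 1 / (2 * c)" using assms by (auto simp: s_def power_divide)
 have eq: "exp (- c * (v + a)\<^sup>2) = sqrt (pi / c) * normal_density (-a) s v" for v
 proof -
  have "normal_density (-a) s v = 1 / sqrt (pi / c) * exp (- c * (v + a)\<^sup>2)"
   unfolding normal_density_def s(2) using assms by (simp add: field_simps)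
  moreover have "sqrt (pi / c) \<noteq> 0" using assms by simp
  ultimately show ?thesis by simp
 qed
 show "integrable lborel (%v::real. exp (- c * (v + a)\<^sup>2))"
  unfolding eq using s(1) by (intro integrable_mult_right integrable_normal_density)
 show "(LINT v|lborel. exp (- c * (v + a)\<^sup>2)) = sqrt (pi / c)" unfolding eq using s(1) by simp
qed

text \<open>Otherwise \<open>8/5\<close> would lie in the interval where the cosine is nonnegative,
  against the quartic upper bound. The strict inequality provides the margin between
  \<open>pi\<close> and the range of \<open>norm_phi_le\<close>.\<close>

lemma pi_bound: "pi < 16/5"
proof (rule ccontr)
 assume "\<not> pi < 16/5"
 then have "cos (8/5 :: real) >= 0" by (intro cos_ge_zero) auto
 moreover have "cos (8/5 :: real) < 0" using cos_upper[of "8/5"] by (simp add: power_divide)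
 ultimately show False by simp
qed

lemma continuous_phi: "continuous_on UNIV phi"
proof -
 have "2 - cis t \<noteq> 0" for t using two_minus_cis[of t] by auto
 then show ?thesis unfolding phi_def by (intro continuous_intros) auto
qed

lemma measurable_phi [measurable]: "phi \<in> borel_measurable borel"
 using continuous_phi by (rule borel_measurable_continuous_onI)

text \<open>After the substitution \<open>u = v / sqrt k\<close> the product of the \<open>k\<close>
  factors tends to \<open>exp (- (\<alpha>2 + 2 \<alpha>1 v + v^2))\<close>. Completing the square
  in \<open>v\<close> yields the Gaussian constant and turns \<open>\<alpha>2\<close> into
  \<open>\<alpha>2 - \<alpha>1^2\<close>; the subtracted square is the effect of the conditioning on
  the total.\<close>

lemma fourier_limit:
 fixes a :: "nat => nat => real"
 assumes bd: "\<And>k j. \<bar>a k j\<bar> <= A"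
  and l1: "(%k. (\<Sum>j<k. a k j) / real k) \<longlonglongrightarrow> \<alpha>1"
  and l2: "(%k. (\<Sum>j<k. (a k j)\<^sup>2) / real k) \<longlonglongrightarrow> \<alpha>2"
 shows "(%k. complex_of_real (sqrt k) * ((\<Sum>ms\<in>bcomp k. cis (\<Sum>j<k. a k j / sqrt k * (real (ms ! j) - 1))) / 4 ^ k))
   \<longlonglongrightarrow> complex_of_real (exp (- (\<alpha>2 - \<alpha>1\<^sup>2)) / (2 * sqrt pi))"
proof -
 have A: "0 <= A" using bd[of 0 0] by simp
 define x where "x k j v = (a k j + v) / sqrt (real k)" for k j v
 define f where "f k v = indicator {-pi..pi} (v / sqrt (real k)) *\<^sub>R (\<Prod>j<k. phi (x k j v))" for k v
 define g where "g v = complex_of_real (exp (- (\<alpha>2 + 2 * \<alpha>1 * v + v\<^sup>2)))" for v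
 define S where "S k = (\<Sum>ms\<in>bcomp k. cis (\<Sum>j<k. a k j / sqrt k * (real (ms ! j) - 1))) / 4 ^ k" for k
 have S_eq: "complex_of_real (2 * pi) * (complex_of_real (sqrt k) * S k) = (LINT v|lborel. f k v)" if "k > 0" for k
 proof -
  have "complex_of_real (2 * pi) * S k = (LINT u|lborel. indicator {-pi..pi} u *\<^sub>R (\<Prod>j<k. phi (a k j / sqrt k + u)))"
   unfolding S_def by (rule comp_integral)
  also have "... = \<bar>1 / sqrt (real k)\<bar> *\<^sub>R (LINT v|lborel. indicator {-pi..pi} (0 + 1 / sqrt k * v) *\<^sub>R (\<Prod>j<k. phi (a k j / sqrt k + (0 + 1 / sqrt k * v))))"
   by (rule lborel_integral_real_affine) (use that in auto)
  also have "(LINT v|lborel. indicator {-pi..pi} (0 + 1 / sqrt k * v) *\<^sub>R (\<Prod>j<k. phi (a k j / sqrt k + (0 + 1 / sqrt k * v))))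
    = (LINT v|lborel. f k v)" unfolding f_def x_def by (simp add: add_divide_distrib)
  finally have "complex_of_real (2 * pi) * S k = complex_of_real (1 / sqrt (real k)) * (LINT v|lborel. f k v)"
   by (simp add: scaleR_conv_of_real)
  then have "complex_of_real (sqrt k) * (complex_of_real (2 * pi) * S k) =
    complex_of_real (sqrt k * (1 / sqrt (real k))) * (LINT v|lborel. f k v)" by (simp only: mult.assoc of_real_mult)
  then show ?thesis using that by (simp add: algebra_simps)
 qed
 have lim_x: "(%k. \<Sum>j<k. (x k j v)\<^sup>2) \<longlonglongrightarrow> \<alpha>2 + 2 * \<alpha>1 * v + v\<^sup>2" for v
 proof -
  have "(%k. (\<Sum>j<k. (a k j)\<^sup>2) / real k + 2 * ((\<Sum>j<k. a k j) / real k) * v + v\<^sup>2) \<longlonglongrightarrow> \<alpha>2 + 2 * \<alpha>1 * v + v\<^sup>2"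
   by (intro tendsto_intros l1 l2)
  moreover have "\<forall>\<^sub>F k in sequentially. (\<Sum>j<k. (a k j)\<^sup>2) / real k + 2 * ((\<Sum>j<k. a k j) / real k) * v + v\<^sup>2 = (\<Sum>j<k. (x k j v)\<^sup>2)"
  proof (rule eventually_sequentiallyI[of 1])
   fix k :: nat assume k: "1 <= k"
   have "(x k j v)\<^sup>2 = ((a k j)\<^sup>2 + 2 * (a k j) * v + v\<^sup>2) / real k" for j
    using k by (simp add: x_def power_divide power2_sum)
   then have "(\<Sum>j<k. (x k j v)\<^sup>2) = ((\<Sum>j<k. (a k j)\<^sup>2) + 2 * (\<Sum>j<k. a k j) * v + k * v\<^sup>2) / real k"
    by (simp add: sum_divide_distrib[symmetric] sum.distrib sum_distrib_left sum_distrib_right)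
   then show "(\<Sum>j<k. (a k j)\<^sup>2) / real k + 2 * ((\<Sum>j<k. a k j) / real k) * v + v\<^sup>2 = (\<Sum>j<k. (x k j v)\<^sup>2)"
    using k by (simp add: add_divide_distrib)
  qed
  ultimately show ?thesis by (rule Lim_transform_eventually)
 qed
 have lim_f: "(%k. f k v) \<longlonglongrightarrow> g v" for v
 proof -
  define c where "c = A + \<bar>v\<bar>"
  have xb: "\<bar>x k j v\<bar> <= c / sqrt (real k)" for k j
   unfolding x_def c_def abs_divide using bd[of k j] by (auto intro!: divide_right_mono)
  have "(%k. (\<Prod>j<k. phi (x k j v)) - (\<Prod>j<k. complex_of_real (exp (- (x k j v)\<^sup>2)))) \<longlonglongrightarrow> 0"
  proof (rule Lim_null_comparison)
   show "\<forall>\<^sub>F k in sequentially. norm ((\<Prod>j<k. phi (x k j v)) - (\<Prod>j<k. complex_of_real (exp (- (x k j v)\<^sup>2)))) <= 5 * c ^ 3 / sqrt (real k)"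
   proof (rule eventually_sequentiallyI[of 1])
    fix k :: nat assume k: "1 <= k"
    have "norm ((\<Prod>j<k. phi (x k j v)) - (\<Prod>j<k. complex_of_real (exp (- (x k j v)\<^sup>2))))
      <= (\<Sum>j<k. norm (phi (x k j v) - complex_of_real (exp (- (x k j v)\<^sup>2))))"
     by (rule norm_prod_diff) (auto simp: norm_phi_le_1)
    also have "... <= (\<Sum>j<k. 5 * (c / sqrt (real k)) ^ 3)"
     by (intro sum_mono order_trans[OF phi_approx] mult_left_mono power_mono xb) auto
    also have "... = 5 * c ^ 3 / sqrt (real k)" using k by (simp add: power_divide power3_eq_cube field_simps)
    finally show "norm ((\<Prod>j<k. phi (x k j v)) - (\<Prod>j<k. complex_of_real (exp (- (x k j v)\<^sup>2)))) <= 5 * c ^ 3 / sqrt (real k)" .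
   qed
   show "(%k. 5 * c ^ 3 / sqrt (real k)) \<longlonglongrightarrow> 0" by real_asymp
  qed
  moreover have "(%k. \<Prod>j<k. complex_of_real (exp (- (x k j v)\<^sup>2))) \<longlonglongrightarrow> g v"
  proof -
   have "(\<Prod>j<k. complex_of_real (exp (- (x k j v)\<^sup>2))) = complex_of_real (exp (- (\<Sum>j<k. (x k j v)\<^sup>2)))" for k
    by (simp add: exp_sum[symmetric] sum_negf of_real_prod[symmetric] del: of_real_prod)
   then show ?thesis unfolding g_def by (simp only:) (intro tendsto_intros lim_x)
  qed
  ultimately have "(%k. ((\<Prod>j<k. phi (x k j v)) - (\<Prod>j<k. complex_of_real (exp (- (x k j v)\<^sup>2)))) + (\<Prod>j<k. complex_of_real (exp (- (x k j v)\<^sup>2)))) \<longlonglongrightarrow> 0 + g v"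
   by (rule tendsto_add)
  then have "(%k. \<Prod>j<k. phi (x k j v)) \<longlonglongrightarrow> g v" by simp
  moreover have "\<forall>\<^sub>F k in sequentially. (\<Prod>j<k. phi (x k j v)) = f k v"
  proof -
   have "(%k. v / sqrt (real k)) \<longlonglongrightarrow> 0" by real_asymp
   then have "\<forall>\<^sub>F k in sequentially. dist (v / sqrt (real k)) 0 < pi" by (rule tendstoD) simp
   then show ?thesis by eventually_elim (auto simp: f_def dist_real_def indicator_def abs_if split: if_splits)
  qed
  ultimately show ?thesis by (rule Lim_transform_eventually)
 qed
 \<comment> \<open>From \<open>k0\<close> on the perturbation \<open>a k j / sqrt k\<close> fits
   between \<open>pi\<close> and \<open>16/5\<close>, so the Gaussian bound on \<open>phi\<close>
   holds on the whole range of integration and gives an integrable majorant.\<close>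
 obtain k0 where k0: "k0 > 0" "\<And>k. k >= k0 ==> A / sqrt (real k) <= 16/5 - pi"
 proof -
  have "(%k. A / sqrt (real k)) \<longlonglongrightarrow> 0" by real_asymp
  then have "\<forall>\<^sub>F k in sequentially. A / sqrt (real k) < 16/5 - pi" by (rule order_tendstoD) (use pi_bound in linarith)
  then obtain N where N: "\<And>k. k >= N ==> A / sqrt (real k) < 16/5 - pi" by (auto simp: eventually_sequentially)
  show ?thesis by (rule that[of "Suc N"]) (use N in \<open>auto intro: less_imp_le Suc_leD\<close>)
 qed
 define w where "w v = exp (A\<^sup>2 / 32) * exp (- (1/64) * (v + 0)\<^sup>2)" for v :: real
 have dom: "norm (f k v) <= w v" if "k >= k0" for k v
 proof (cases "v / sqrt (real k) \<in> {-pi..pi}")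
  case False
  then show ?thesis by (simp add: f_def w_def)
 next
  case True
  have k: "k > 0" using that k0(1) by simp
  have xx: "\<bar>x k j v\<bar> <= 16/5" for j
  proof -
   have "\<bar>a k j / sqrt k\<bar> <= A / sqrt k" unfolding abs_divide using bd[of k j] by (simp add: divide_right_mono)
   moreover have "A / sqrt k <= 16/5 - pi" using k0(2)[OF that] .
   moreover have "\<bar>v / sqrt k\<bar> <= pi" using True by (simp add: abs_le_iff) linarith
   moreover have "x k j v = a k j / sqrt k + v / sqrt k" by (simp add: x_def add_divide_distrib)
   ultimately show ?thesis by (simp only: abs_le_iff) linarith
  qed
  have sq: "(x k j v)\<^sup>2 >= (v\<^sup>2 / 2 - A\<^sup>2) / k" for j
  proof -
   have "(a k j)\<^sup>2 <= A\<^sup>2" using bd[of k j] A by (simp add: abs_le_square_iff[symmetric])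
   moreover have "0 <= (2 * a k j + v)\<^sup>2" by simp
   ultimately have "(a k j + v)\<^sup>2 >= v\<^sup>2 / 2 - A\<^sup>2" by (simp add: power2_eq_square algebra_simps)
   then show ?thesis using k by (simp add: x_def power_divide divide_right_mono)
  qed
  have "norm (f k v) = (\<Prod>j<k. norm (phi (x k j v)))" using True by (simp add: f_def prod_norm)
  also have "... <= (\<Prod>j<k. exp (- (x k j v)\<^sup>2 / 32))" by (intro prod_mono conjI norm_phi_le xx norm_ge_zero)
  also have "... <= (\<Prod>j<k. exp (- ((v\<^sup>2 / 2 - A\<^sup>2) / k) / 32))"
  proof (intro prod_mono conjI)
   fix j
   show "exp (- (x k j v)\<^sup>2 / 32) <= exp (- ((v\<^sup>2 / 2 - A\<^sup>2) / k) / 32)"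
    by (intro exp_le_cancel_iff[THEN iffD2] divide_right_mono le_imp_neg_le sq) simp
  qed simp
  also have "... = exp (- (v\<^sup>2 / 2 - A\<^sup>2) / 32)"
   using k by (simp add: exp_of_nat_mult[symmetric]) (simp add: field_simps)
  also have "... = w v" by (simp add: w_def exp_add[symmetric] field_simps)
  finally show ?thesis .
 qed
 have "(%k. LINT v|lborel. f (k + k0) v) \<longlonglongrightarrow> (LINT v|lborel. g v)"
 proof (rule integral_dominated_convergence)
  show "g \<in> borel_measurable lborel" unfolding g_def by measurable
  show "f (k + k0) \<in> borel_measurable lborel" for k unfolding f_def x_def by measurable
  show "integrable lborel w" unfolding w_def by (intro integrable_mult_right gauss_integral(1)) simp
  show "AE v in lborel. (%k. f (k + k0) v) \<longlonglongrightarrow> g v" by (intro AE_I2 LIMSEQ_ignore_initial_segment lim_f)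
  show "AE v in lborel. norm (f (k + k0) v) <= w v" for k by (intro AE_I2 dom) simp
 qed
 moreover have "(LINT v|lborel. g v) = complex_of_real (sqrt pi * exp (- (\<alpha>2 - \<alpha>1\<^sup>2)))"
 proof -
  have "exp (- (\<alpha>2 + 2 * \<alpha>1 * v + v\<^sup>2)) = exp (- (\<alpha>2 - \<alpha>1\<^sup>2)) * exp (- 1 * (v + \<alpha>1)\<^sup>2)" for v
   by (simp add: exp_add[symmetric] power2_eq_square algebra_simps)
  then have "(LINT v|lborel. exp (- (\<alpha>2 + 2 * \<alpha>1 * v + v\<^sup>2))) = exp (- (\<alpha>2 - \<alpha>1\<^sup>2)) * sqrt (pi / 1)"
   using gauss_integral(2)[of 1 \<alpha>1] by simp
  then show ?thesis unfolding g_def integral_complex_of_real by (simp add: mult.commute)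
 qed
 ultimately have "(%k. LINT v|lborel. f (k + k0) v) \<longlonglongrightarrow> complex_of_real (sqrt pi * exp (- (\<alpha>2 - \<alpha>1\<^sup>2)))" by simp
 then have "(%k. complex_of_real (1 / (2 * pi)) * (LINT v|lborel. f (k + k0) v)) \<longlonglongrightarrow>
   complex_of_real (1 / (2 * pi)) * complex_of_real (sqrt pi * exp (- (\<alpha>2 - \<alpha>1\<^sup>2)))"
  by (rule tendsto_mult_left)
 moreover have "complex_of_real (1 / (2 * pi)) * (LINT v|lborel. f (k + k0) v) = complex_of_real (sqrt (k + k0)) * S (k + k0)" for k
 proof -
  define Z where "Z = complex_of_real (sqrt (k + k0)) * S (k + k0)"
  have I: "(LINT v|lborel. f (k + k0) v) = complex_of_real (2 * pi) * Z" unfolding Z_def using S_eq[of "k + k0"] k0(1) by simp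
  have "complex_of_real (1 / (2 * pi)) * (complex_of_real (2 * pi) * Z) = complex_of_real (1 / (2 * pi) * (2 * pi)) * Z"
   by (simp only: mult.assoc of_real_mult)
  then show ?thesis unfolding I Z_def[symmetric] by simp
 qed
 moreover have "1 / (2 * pi) * (sqrt pi * exp (- (\<alpha>2 - \<alpha>1\<^sup>2))) = exp (- (\<alpha>2 - \<alpha>1\<^sup>2)) / (2 * sqrt pi)"
  by (simp add: field_simps real_div_sqrt)
 ultimately have "(%k. complex_of_real (sqrt (k + k0)) * S (k + k0)) \<longlonglongrightarrow> complex_of_real (exp (- (\<alpha>2 - \<alpha>1\<^sup>2)) / (2 * sqrt pi))"
  by (simp only: of_real_mult[symmetric])
 then have "(%k. complex_of_real (sqrt k) * S k) \<longlonglongrightarrow> complex_of_real (exp (- (\<alpha>2 - \<alpha>1\<^sup>2)) / (2 * sqrt pi))"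
  using LIMSEQ_offset[of "%k. complex_of_real (sqrt (real k)) * S k" k0] by simp
 then show ?thesis unfolding S_def .
qed

text \<open>The case of zero angles: the probability that \<open>k\<close> geometric variables add
  up to \<open>k\<close>, which is the normalization of the bridge.\<close>

lemma comps_return_limit:
 "(%k. sqrt (real k) * (real (card (bcomp k)) / 4 ^ k)) \<longlonglongrightarrow> 1 / (2 * sqrt pi)"
proof -
 have "(%k. complex_of_real (sqrt k) * ((\<Sum>ms\<in>bcomp k. cis (\<Sum>j<k. 0 / sqrt k * (real (ms ! j) - 1))) / 4 ^ k))
   \<longlonglongrightarrow> complex_of_real (exp (- (0 - 0\<^sup>2)) / (2 * sqrt pi))"
  by (rule fourier_limit[of "%_ _. 0" 0]) auto
 then have "(%k. complex_of_real (sqrt (real k) * (real (card (bcomp k)) / 4 ^ k))) \<longlonglongrightarrow> complex_of_real (1 / (2 * sqrt pi))"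
  by simp
 then show ?thesis unfolding tendsto_of_real_iff .
qed

theorem bridge_char_limit:
 fixes a :: "nat => nat => real"
 assumes bd: "\<And>k j. \<bar>a k j\<bar> <= A"
  and l1: "(%k. (\<Sum>j<k. a k j) / real k) \<longlonglongrightarrow> \<alpha>1"
  and l2: "(%k. (\<Sum>j<k. (a k j)\<^sup>2) / real k) \<longlonglongrightarrow> \<alpha>2"
 shows "(%k. (\<Sum>ms\<in>bcomp k. cis (\<Sum>j<k. a k j / sqrt k * (real (ms ! j) - 1))) / real (card (bcomp k)))
   \<longlonglongrightarrow> complex_of_real (exp (- (\<alpha>2 - \<alpha>1\<^sup>2)))"
proof -
 let ?S = "%k. \<Sum>ms\<in>bcomp k. cis (\<Sum>j<k. a k j / sqrt k * (real (ms ! j) - 1))"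
 have H1: "(%k. (complex_of_real (sqrt k) * (?S k / 4 ^ k)) / complex_of_real (sqrt (real k) * (real (card (bcomp k)) / 4 ^ k)))
   \<longlonglongrightarrow> complex_of_real (exp (- (\<alpha>2 - \<alpha>1\<^sup>2)) / (2 * sqrt pi)) / complex_of_real (1 / (2 * sqrt pi))"
  by (intro tendsto_divide fourier_limit[OF assms] tendsto_of_real comps_return_limit) auto
 have H2: "complex_of_real (exp (- (\<alpha>2 - \<alpha>1\<^sup>2)) / (2 * sqrt pi)) / complex_of_real (1 / (2 * sqrt pi)) = complex_of_real (exp (- (\<alpha>2 - \<alpha>1\<^sup>2)))"
  by (simp flip: of_real_divide)
 have H3: "\<forall>\<^sub>F k in sequentially. (complex_of_real (sqrt k) * (?S k / 4 ^ k)) / complex_of_real (sqrt (real k) * (real (card (bcomp k)) / 4 ^ k))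
   = ?S k / real (card (bcomp k))" by (rule eventually_sequentiallyI[of 1]) simp
 show ?thesis by (rule Lim_transform_eventually[OF H1[unfolded H2] H3])
qed

lemma comps_return_lower: "\<exists>c>0. \<forall>k\<ge>1. real (card (bcomp k)) / 4 ^ k >= c / sqrt (real k)"
proof -
 let ?f = "%k. sqrt (real k) * (real (card (bcomp k)) / 4 ^ k)"
 have "\<forall>\<^sub>F k in sequentially. ?f k > 1 / (4 * sqrt pi)"
  using comps_return_limit by (rule order_tendstoD) (simp add: field_simps)
 then obtain N where N: "\<And>k. k >= N ==> ?f k > 1 / (4 * sqrt pi)" by (auto simp: eventually_sequentially)
 define c where "c = Min (insert (1 / (4 * sqrt pi)) (?f ` {1..N}))"
 have "c > 0" unfolding c_def using card_bcomp_pos by (subst Min_gr_iff) auto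
 moreover have "?f k >= c" if "k >= 1" for k
 proof (cases "k <= N")
  case True
  then show ?thesis unfolding c_def using that by (intro Min_le) auto
 next
  case False
  have "c <= 1 / (4 * sqrt pi)" unfolding c_def by (intro Min_le) auto
  then show ?thesis using N[of k] False by simp
 qed
 then have "\<forall>k\<ge>1. real (card (bcomp k)) / 4 ^ k >= c / sqrt (real k)" by (auto simp: divide_le_eq mult.commute)
 ultimately show ?thesis by blast
qed

text \<open>In the inversion integral each of the \<open>l\<close> factors has modulus at most
  \<open>exp (- u^2 / 32)\<close>, so the integral is bounded by a Gaussian one of order
  \<open>1 / sqrt l\<close>, uniformly in \<open>x\<close>. The constant is
  \<open>sqrt (32 pi) / (2 pi)\<close>, which is at most 3.\<close>

lemma comps_upper: "l >= 1 ==> real (card (comps l x)) / 2 ^ (x + l) <= 3 / sqrt (real l)"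
proof -
 assume l: "l >= 1"
 have "qf (replicate l 0) x = of_nat (card (comps l x)) / 2 ^ (x + l)" unfolding qf_eq by simp
 then have "complex_of_real (2 * pi) * (of_nat (card (comps l x)) / 2 ^ (x + l)) =
   (LINT u|lborel. indicator {-pi..pi} u *\<^sub>R (cis (- (u * real x)) * (1 / (2 - cis u)) ^ l))"
  using qf_integral[of "replicate l 0" x] by (simp add: prod_list_replicate)
 then have "2 * pi * (real (card (comps l x)) / 2 ^ (x + l)) =
   norm (LINT u|lborel. indicator {-pi..pi} u *\<^sub>R (cis (- (u * real x)) * (1 / (2 - cis u)) ^ l))"
  by (metis (no_types, lifting) norm_mult norm_of_real norm_divide norm_of_nat norm_power norm_numeral abs_of_nonneg pi_ge_zero mult_nonneg_nonneg zero_le_numeral)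
 also have "... <= (LINT u|lborel. exp (- (real l / 32) * (u + 0)\<^sup>2))"
 proof (rule order_trans[OF integral_norm_bound integral_mono])
  have "2 - cis t \<noteq> 0" for t using two_minus_cis[of t] by auto
  then show "integrable lborel (%u. norm (indicator {-pi..pi} u *\<^sub>R (cis (- (u * real x)) * (1 / (2 - cis u)) ^ l)))"
   by (intro integrable_norm borel_integrable_compact continuous_intros) auto
  show "integrable lborel (%u. exp (- (real l / 32) * (u + 0)\<^sup>2))" by (rule gauss_integral) (use l in auto)
  fix u :: real
  show "norm (indicator {-pi..pi} u *\<^sub>R (cis (- (u * real x)) * (1 / (2 - cis u)) ^ l)) <= exp (- (real l / 32) * (u + 0)\<^sup>2)"
  proof (cases "u \<in> {-pi..pi}")
   case True
   then have "\<bar>u\<bar> <= 16/5" using pi_bound by (auto simp: abs_le_iff)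
   then have "(1 / norm (2 - cis u)) ^ l <= exp (- u\<^sup>2 / 32) ^ l" by (intro power_mono inv_two_minus_cis) auto
   also have "... = exp (- (real l / 32) * (u + 0)\<^sup>2)" by (simp add: exp_of_nat_mult[symmetric])
   finally show ?thesis using True by (simp add: norm_mult norm_power norm_divide)
  qed simp
 qed
 also have "... = sqrt (pi / (real l / 32))" by (rule gauss_integral) (use l in auto)
 also have "... = sqrt (32 * pi) / sqrt (real l)" by (simp add: real_sqrt_divide real_sqrt_mult field_simps)
 finally have "real (card (comps l x)) / 2 ^ (x + l) <= sqrt (32 * pi) / sqrt (real l) / (2 * pi)"
  by (subst pos_le_divide_eq) (auto simp: mult.commute)
 then have "real (card (comps l x)) / 2 ^ (x + l) <= sqrt (32 * pi) / (2 * pi) / sqrt (real l)"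
  by (simp only: divide_divide_eq_left mult.commute)
 also have "sqrt (32 * pi) <= 6 * pi"
 proof (rule real_le_lsqrt)
  have "32 <= 36 * pi" using pi_ge_two by simp
  then have "32 * pi <= 36 * pi * pi" by (intro mult_right_mono) auto
  then show "32 * pi <= (6 * pi)\<^sup>2" by (simp add: power2_eq_square)
 qed auto
 then have "sqrt (32 * pi) / (2 * pi) / sqrt (real l) <= 6 * pi / (2 * pi) / sqrt (real l)" by (intro divide_right_mono) auto
 finally show ?thesis by simp
qed

section \<open>Exponential moments and oscillation of the bridge\<close>

lemma exp_quad_abs: "exp \<theta> <= 1 + \<theta> + \<theta>\<^sup>2" if "\<bar>\<theta>\<bar> <= 1" for \<theta> :: real
proof (cases "\<theta> >= 0")
 case True
 then show ?thesis using that exp_bound[of \<theta>] by simp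
next
 case False
 define t where "t = - \<theta>"
 have t: "0 <= t" "t <= 1" using False that by (auto simp: t_def)
 have "1 + t + t\<^sup>2 / 2 <= exp t" using t exp_lower_Taylor_quadratic[of t] by simp
 moreover have q: "0 <= 1 - t + t\<^sup>2" using t by (simp add: add_nonneg_nonneg)
 ultimately have "(1 - t + t\<^sup>2) * (1 + t + t\<^sup>2 / 2) <= (1 - t + t\<^sup>2) * exp t" by (rule mult_left_mono)
 moreover have "(1 - t + t\<^sup>2) * (1 + t + t\<^sup>2 / 2) = 1 + t\<^sup>2 / 2 + t ^ 3 / 2 + t ^ 4 / 2"
  by (simp add: field_simps eval_nat_numeral)
 moreover have "1 <= 1 + t\<^sup>2 / 2 + t ^ 3 / 2 + t ^ 4 / 2" using t by simp
 ultimately have "1 <= (1 - t + t\<^sup>2) * exp t" by linarith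
 then have "exp (- t) <= 1 - t + t\<^sup>2" by (simp add: exp_minus divide_inverse[symmetric] field_simps)
 then show ?thesis by (simp add: t_def)
qed

text \<open>The linear term is kept exactly, so that it disappears after averaging a centred
  variable.\<close>

lemma exp_quad: "exp y <= 1 + y + y\<^sup>2 * exp \<bar>y\<bar>" for y :: real
proof (cases "y >= 0")
 case True
 show ?thesis
 proof (cases "y >= 1")
  case True
  then have e: "1 * exp y <= y\<^sup>2 * exp y" by (intro mult_right_mono) auto
  have "\<bar>y\<bar> = y" using True by simp
  then show ?thesis using e True by (simp only: mult_1)
 next
  case False
  have "(1 - y) * exp y <= exp (- y) * exp y" using exp_ge_add_one_self[of "- y"] by (intro mult_right_mono) auto
  then have "(1 - y) * exp y <= 1" by (simp flip: exp_add)
  then have "(1 + y) * ((1 - y) * exp y) <= (1 + y) * 1" using True by (intro mult_left_mono) auto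
  then show ?thesis using True by (simp add: algebra_simps power2_eq_square)
 qed
next
 case False
 have e: "y\<^sup>2 * 1 <= y\<^sup>2 * exp \<bar>y\<bar>" by (intro mult_left_mono) auto
 show ?thesis
 proof (cases "y >= -1")
  case True
  with False have "\<bar>y\<bar> <= 1" by simp
  from exp_quad_abs[OF this] e show ?thesis by linarith
 next
  case False
  then have "exp y <= 1" by simp
  moreover have "0 <= (- y) * (- y - 1)" using False by (intro mult_nonneg_nonneg) auto
  then have "0 <= y + y\<^sup>2" by (simp add: power2_eq_square algebra_simps)
  ultimately show ?thesis using e by linarith
 qed
qed

text \<open>The whole series has the value \<open>exp (- \<theta>) / (2 - exp \<theta>)\<close>.
  With \<open>exp \<theta> <= 1 + x\<close> for \<open>x = \<theta> + \<theta>^2\<close>, its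
  logarithm is at most \<open>- \<theta> + x + 2 x^2\<close>, and \<open>x^2 <= 2 \<theta>^2\<close>
  gives the constant 5.\<close>

lemma geo_mgf:
 fixes \<theta> :: real
 assumes "\<bar>\<theta>\<bar> <= 1/4"
 shows "(\<Sum>m\<le>k. (1/2) ^ (m + 1) * exp (\<theta> * (real m - 1))) <= exp (5 * \<theta>\<^sup>2)"
proof -
 define x where "x = \<theta> + \<theta>\<^sup>2"
 have t2: "\<theta>\<^sup>2 <= (1/4)\<^sup>2" using assms by (intro abs_le_square_iff[THEN iffD1]) simp
 have ex: "exp \<theta> <= 1 + x" using exp_quad_abs[of \<theta>] assms by (simp add: x_def)
 have xb: "\<bar>x\<bar> <= 1/2"
 proof -
  have "\<theta>\<^sup>2 <= 1/16" "0 <= \<theta>\<^sup>2" using t2 by (simp_all add: power_divide)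
  then show ?thesis using assms unfolding x_def by (simp only: abs_le_iff) linarith
 qed
 have r: "exp \<theta> / 2 < 1" using ex xb by linarith
 have "(1/2) ^ (m + 1) * exp (\<theta> * (real m - 1)) = exp (- \<theta>) / 2 * (exp \<theta> / 2) ^ m" for m
  by (simp add: power_divide exp_of_nat_mult[symmetric] exp_add[symmetric] field_simps)
 then have "(\<Sum>m\<le>k. (1/2) ^ (m + 1) * exp (\<theta> * (real m - 1))) = exp (- \<theta>) / 2 * (\<Sum>m\<le>k. (exp \<theta> / 2) ^ m)"
  by (simp only: sum_distrib_left)
 also have "(\<Sum>m\<le>k. (exp \<theta> / 2) ^ m) <= 1 / (1 - exp \<theta> / 2)"
 proof -
  have "(\<Sum>m\<le>k. (exp \<theta> / 2) ^ m) <= (\<Sum>m. (exp \<theta> / 2) ^ m)"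
   using r by (intro sum_le_suminf summable_geometric) auto
  then show ?thesis using r by (subst (asm) suminf_geometric) auto
 qed
 also have "exp (- \<theta>) / 2 * (1 / (1 - exp \<theta> / 2)) = exp (- \<theta>) / (2 - exp \<theta>)"
  using r by (simp add: field_simps)
 also have "... <= exp (- \<theta>) / (1 - x)"
  using ex xb by (intro divide_left_mono mult_pos_pos) (auto simp: abs_le_iff)
 also have "... = exp (- \<theta> - ln (1 - x))" using xb by (simp add: exp_diff abs_le_iff)
 also have "... <= exp (5 * \<theta>\<^sup>2)"
 proof -
  have "\<bar>ln (1 + (- x)) - (- x)\<bar> <= 2 * (- x)\<^sup>2" by (rule abs_ln_one_plus_x_minus_x_bound) (use xb in simp)
  then have "- ln (1 - x) <= x + 2 * x\<^sup>2" by (simp add: abs_le_iff)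
  moreover have "x\<^sup>2 <= 2 * \<theta>\<^sup>2"
  proof -
   have "x\<^sup>2 = \<theta>\<^sup>2 * (1 + \<theta>)\<^sup>2" by (simp add: x_def power2_eq_square algebra_simps)
   also have "(1 + \<theta>)\<^sup>2 <= (5/4)\<^sup>2" using assms by (intro power_mono) (auto simp: abs_le_iff)
   then have "\<theta>\<^sup>2 * (1 + \<theta>)\<^sup>2 <= \<theta>\<^sup>2 * (5/4)\<^sup>2" by (rule mult_left_mono) simp
   also have "... <= \<theta>\<^sup>2 * 2" by (rule mult_left_mono) (auto simp: power2_eq_square)
   finally show ?thesis by simp
  qed
  ultimately show ?thesis by (simp add: x_def)
 qed
 finally show ?thesis by (simp add: mult_left_mono)
qed

definition bdl :: "nat => nat => nat list set" where
 "bdl j k = {xs. length xs = j \<and> sum_list xs <= k}"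

lemma bdl_subset: "bdl j k \<subseteq> lsn {..k} j" by (auto simp: bdl_def lsn_def intro: order_trans[OF member_le_sum_list])

lemma finite_bdl: "finite (bdl j k)" by (rule finite_subset[OF bdl_subset]) (simp add: finite_lsn)

lemma comps_add: "comps (j + l) x = (%(xs, ys). xs @ ys) ` (SIGMA xs:bdl j x. comps l (x - sum_list xs))"
proof (rule set_eqI, rule iffI)
 fix zs assume zs: "zs \<in> comps (j + l) x"
 have "sum_list zs = sum_list (take j zs) + sum_list (drop j zs)"
  by (subst append_take_drop_id[symmetric, of zs j], subst sum_list_append) (rule refl)
 then have "(take j zs, drop j zs) \<in> (SIGMA xs:bdl j x. comps l (x - sum_list xs))"
  using zs by (auto simp: comps_def bdl_def)
 then show "zs \<in> (%(xs, ys). xs @ ys) ` (SIGMA xs:bdl j x. comps l (x - sum_list xs))" by (rule rev_image_eqI) simp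
qed (auto simp: comps_def bdl_def)

lemma sum_comps_take:
 fixes f :: "nat list => real"
 assumes "j <= n"
 shows "(\<Sum>ms\<in>comps n x. f (take j ms)) = (\<Sum>xs\<in>bdl j x. f xs * real (card (comps (n - j) (x - sum_list xs))))"
proof -
 obtain l where n: "n = j + l" using assms le_Suc_ex by blast
 have "(\<Sum>ms\<in>comps n x. f (take j ms)) =
   (\<Sum>(xs, ys)\<in>(SIGMA xs:bdl j x. comps l (x - sum_list xs)). f (take j (xs @ ys)))"
  unfolding n comps_add by (subst sum.reindex) (auto simp: inj_on_def bdl_def split_def)
 also have "... = (\<Sum>xs\<in>bdl j x. \<Sum>ys\<in>comps l (x - sum_list xs). f (take j (xs @ ys)))"
  by (rule sum.Sigma[symmetric]) (auto simp: finite_bdl finite_comps)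
 also have "... = (\<Sum>xs\<in>bdl j x. \<Sum>ys\<in>comps l (x - sum_list xs). f xs)"
  by (intro sum.cong refl) (simp add: bdl_def)
 finally show ?thesis by (simp add: n mult.commute)
qed

text \<open>The first half of the bridge has a bounded density with respect to the free walk: the
  numerator is an upper local bound for at least \<open>k / 2\<close> remaining steps, the
  denominator the lower bound for the return at time \<open>k\<close>.\<close>

lemma first_half:
 "\<exists>C\<ge>1. \<forall>k\<ge>1. \<forall>j f. 2 * j <= k --> (\<forall>xs. 0 <= f xs) -->
   avg (bcomp k) (%ms. f (take j ms)) <= C * (\<Sum>xs\<in>bdl j k. f xs * wt (%m. (1/2) ^ (m + 1)) xs)"
proof -
 obtain c where c: "c > 0" "\<And>k. k >= 1 ==> real (card (bcomp k)) / 4 ^ k >= c / sqrt (real k)"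
  using comps_return_lower by blast
 \<comment> \<open>The two local bounds contribute \<open>3 / c\<close>, and
   \<open>sqrt k / sqrt (k - j)\<close> is at most \<open>sqrt 2\<close> since
   \<open>2 * j <= k\<close>.\<close>
 define C where "C = max 1 (3 * sqrt 2 / c)"
 have "avg (bcomp k) (%ms. f (take j ms)) <= C * (\<Sum>xs\<in>bdl j k. f xs * wt (%m. (1/2) ^ (m + 1)) xs)"
  if k: "k >= 1" and j: "2 * j <= k" and f: "\<And>xs. 0 <= f xs" for k j and f :: "nat list => real"
 proof -
  have wt: "wt (%m. (1/2) ^ (m + 1)) xs = (1/2::real) ^ (sum_list xs + length xs)" for xs
   by (induction xs) (auto simp: power_add)
  have pos: "real (card (bcomp k)) > 0" using card_bcomp_pos by simp
  have "real (card (comps (k - j) (k - sum_list xs))) / real (card (bcomp k)) <= C * (1/2) ^ (sum_list xs + length xs)"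
   if xs: "xs \<in> bdl j k" for xs
  proof -
   define s where "s = sum_list xs"
   have s: "s <= k" "length xs = j" using xs by (auto simp: bdl_def s_def)
   have "sqrt (real k) <= sqrt (2 * real (k - j))" using j by (intro real_sqrt_le_mono) simp
   then have sq: "sqrt (real k) / sqrt (real (k - j)) <= sqrt 2"
    using k j by (subst pos_divide_le_eq) (simp_all only: real_sqrt_mult, simp)
   have "real (card (comps (k - j) (k - s))) <= 3 / sqrt (real (k - j)) * 2 ^ (k - s + (k - j))"
    using comps_upper[of "k - j" "k - s"] k j by (simp add: field_simps)
   moreover have "c / sqrt (real k) * 4 ^ k <= real (card (bcomp k))" using c(2)[OF k] by (simp add: field_simps)
   ultimately have "real (card (comps (k - j) (k - s))) / real (card (bcomp k))
     <= (3 / sqrt (real (k - j)) * 2 ^ (k - s + (k - j))) / (c / sqrt (real k) * 4 ^ k)"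
    using c(1) k by (intro frac_le mult_pos_pos divide_pos_pos) auto
   also have "... = 3 / c * (sqrt (real k) / sqrt (real (k - j))) * (2 ^ (k - s + (k - j)) / 4 ^ k)" by (simp add: mult_ac)
   also have "(2::real) ^ (k - s + (k - j)) / 4 ^ k = (1/2) ^ (s + j)"
   proof -
    have "(4::real) ^ k = 2 ^ (k - s + (k - j)) * 2 ^ (s + j)"
    proof -
     have "(4::real) ^ k = 2 ^ (k + k)" by (simp add: power_add flip: power_mult_distrib)
     moreover have "k + k = (k - s + (k - j)) + (s + j)" using s j by simp
     ultimately show ?thesis by (simp only: power_add)
    qed
    then show ?thesis by (simp add: power_divide)
   qed
   also have "3 / c * (sqrt (real k) / sqrt (real (k - j))) * (1/2) ^ (s + j) <= C * (1/2) ^ (s + j)"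
   proof (rule mult_right_mono)
    have "3 / c * (sqrt (real k) / sqrt (real (k - j))) <= 3 / c * sqrt 2" by (rule mult_left_mono[OF sq]) (use c in simp)
    then show "3 / c * (sqrt (real k) / sqrt (real (k - j))) <= C" by (simp add: C_def)
   qed simp
   finally show ?thesis using s by (simp add: s_def)
  qed
  then have "(\<Sum>xs\<in>bdl j k. f xs * (real (card (comps (k - j) (k - sum_list xs))) / real (card (bcomp k))))
    <= (\<Sum>xs\<in>bdl j k. f xs * (C * (1/2) ^ (sum_list xs + length xs)))"
   using f by (intro sum_mono mult_left_mono) auto
  then show ?thesis unfolding avg_def wt using j by (simp add: sum_comps_take sum_divide_distrib sum_distrib_left mult_ac)
 qed
 then show ?thesis by (intro exI[of _ C]) (auto simp: C_def)
qed

text \<open>Doob's inequality for the exponential supermartingale, by induction on the number of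
  steps with a variable starting height \<open>s\<close>: either the level is already reached, and
  the bound is at least 1, or the first step is split off and contributes one factor
  \<open>\<Psi>\<close>.\<close>

lemma maximal_ineq:
 fixes p :: "nat => real" and g :: "nat => real"
 assumes fin: "finite A" and p: "\<And>m. p m >= 0" "sum p A <= 1" and th: "\<theta> >= 0"
  and psi: "(\<Sum>m\<in>A. p m * exp (\<theta> * g m)) <= \<Psi>" "\<Psi> >= 1"
 shows "(\<Sum>xs\<in>lsn A j. wt p xs * of_bool (\<exists>i\<le>j. x <= s + sum_list (map g (take i xs)))) <= exp (\<theta> * (s - x)) * \<Psi> ^ j"
proof (induction j arbitrary: s)
 case 0
 then show ?case using th by (auto simp: sum_lsn_0 mult_nonneg_nonneg)
next
 case (Suc j)
 show ?case
 proof (cases "x <= s")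
  case True
  have "(\<Sum>xs\<in>lsn A (Suc j). wt p xs * of_bool (\<exists>i\<le>Suc j. x <= s + sum_list (map g (take i xs))))
    <= (\<Sum>xs\<in>lsn A (Suc j). wt p xs)" using p by (intro sum_mono) (auto simp: wt_nonneg)
  also have "... <= 1" unfolding sum_wt_lsn using p by (intro power_le_one sum_nonneg) auto
  also have "1 <= exp (\<theta> * (s - x)) * \<Psi> ^ Suc j"
  proof -
   have "1 * 1 <= exp (\<theta> * (s - x)) * \<Psi> ^ Suc j" using True th psi by (intro mult_mono one_le_power) auto
   then show ?thesis by simp
  qed
  finally show ?thesis .
 next
  case False
  have imp: "(\<exists>i\<le>Suc j. x <= s + sum_list (map g (take i (y # ys)))) \<longleftrightarrow> (\<exists>i\<le>j. x <= (s + g y) + sum_list (map g (take i ys)))" for y ys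
  proof
   assume "\<exists>i\<le>Suc j. x <= s + sum_list (map g (take i (y # ys)))"
   then obtain i where i: "i <= Suc j" "x <= s + sum_list (map g (take i (y # ys)))" by blast
   with False obtain i' where "i = Suc i'" by (cases i) auto
   with i show "\<exists>i\<le>j. x <= (s + g y) + sum_list (map g (take i ys))" by (auto simp: add.assoc)
  next
   assume "\<exists>i\<le>j. x <= (s + g y) + sum_list (map g (take i ys))"
   then obtain i where "i <= j" "x <= (s + g y) + sum_list (map g (take i ys))" by blast
   then show "\<exists>i\<le>Suc j. x <= s + sum_list (map g (take i (y # ys)))"
    by (intro exI[of _ "Suc i"]) (auto simp: add.assoc)
  qed
  have "(\<Sum>xs\<in>lsn A (Suc j). wt p xs * of_bool (\<exists>i\<le>Suc j. x <= s + sum_list (map g (take i xs))))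
    = (\<Sum>y\<in>A. p y * (\<Sum>ys\<in>lsn A j. wt p ys * of_bool (\<exists>i\<le>j. x <= (s + g y) + sum_list (map g (take i ys)))))"
   unfolding sum_lsn_Suc imp by (simp add: sum_distrib_left mult.assoc)
  also have "... <= (\<Sum>y\<in>A. p y * (exp (\<theta> * ((s + g y) - x)) * \<Psi> ^ j))"
   using p by (intro sum_mono mult_left_mono Suc.IH) auto
  also have "... = exp (\<theta> * (s - x)) * \<Psi> ^ j * (\<Sum>y\<in>A. p y * exp (\<theta> * g y))"
   unfolding sum_distrib_left by (intro sum.cong refl) (simp add: exp_add[symmetric] algebra_simps)
  also have "... <= exp (\<theta> * (s - x)) * \<Psi> ^ j * \<Psi>" using psi by (intro mult_left_mono) auto
  finally show ?thesis by (simp add: mult.assoc mult.commute)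
 qed
qed

lemma geo_sum_le: "(\<Sum>m\<le>k. (1/2::real) ^ (m + 1)) <= 1" using geo_mgf[of 0 k] by simp

lemma bsum_eq: "j <= length ms ==> real_of_int (bsum ms j) = sum_list (map (%m. real m - 1) (take j ms))"
proof -
 assume "j <= length ms"
 moreover have "sum_list (map (%m. real m - 1) xs) = real (sum_list xs) - real (length xs)" for xs by (induction xs) auto
 ultimately show ?thesis by (simp add: bsum_def)
qed

lemma bsum_0 [simp]: "bsum ms 0 = 0" by (simp add: bsum_def)

lemma bsum_full: "ms \<in> bcomp k ==> bsum ms k = 0" by (simp add: bsum_def comps_def)

lemma avg_rotate: "avg (comps n x) (%ms. f (rotate a ms)) = avg (comps n x) f"
proof -
 have "inj_on (rotate a) (comps n x)" by (rule inj_on_subset[of _ UNIV]) (auto intro: inj_onI simp: rotate_def bij_rotate1 bij_is_inj inj_fn[OF inj_rotate1, THEN injD])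
 moreover have "rotate a ` comps n x \<subseteq> comps n x"
 proof -
  have "sum_list (rotate a ms) = sum_list ms" for ms :: "nat list"
  proof (induction a)
   case (Suc a)
   have "sum_list (rotate1 xs) = sum_list xs" for xs :: "nat list" by (cases xs) auto
   then show ?case using Suc by simp
  qed simp
  then show ?thesis by (auto simp: comps_def)
 qed
 ultimately have "rotate a ` comps n x = comps n x" by (intro card_subset_eq) (auto simp: finite_comps card_image)
 with \<open>inj_on (rotate a) (comps n x)\<close> have "sum f (comps n x) = (\<Sum>ms\<in>comps n x. f (rotate a ms))"
  by (metis (no_types, lifting) sum.reindex_cong)
 then show ?thesis by (simp add: avg_def)
qed

lemma avg_rev: "avg (comps n x) (%ms. f (rev ms)) = avg (comps n x) f"
proof -
 have "(\<Sum>ms\<in>comps n x. f (rev ms)) = sum f (comps n x)"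
  by (rule sum.reindex_bij_witness[of _ rev rev]) (auto simp: comps_def)
 then show ?thesis by (simp add: avg_def)
qed

lemma bsum_rotate:
 assumes "ms \<in> bcomp k" "a + i <= k"
 shows "bsum (rotate a ms) i = bsum ms (a + i) - bsum ms a"
proof (cases "a = k")
 case True
 then have "rotate a ms = ms" "i = 0" using assms by (auto simp: comps_def)
 then show ?thesis by simp
next
 case False
 then have "rotate a ms = drop a ms @ take a ms" "i <= length (drop a ms)"
  using assms by (auto simp: comps_def rotate_drop_take)
 then have "take i (rotate a ms) = take i (drop a ms)" by simp
 moreover have "take (a + i) ms = take a ms @ take i (drop a ms)" by (rule take_add)
 ultimately show ?thesis by (simp add: bsum_def)
qed

lemma bsum_rev:
 assumes "ms \<in> bcomp k" "j <= k"
 shows "bsum ms j = - bsum (rev ms) (k - j)"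
proof -
 have "take (k - j) (rev ms) = rev (drop j ms)" using assms by (simp add: take_rev comps_def)
 moreover have "sum_list ms = sum_list (take j ms) + sum_list (drop j ms)"
  by (subst append_take_drop_id[symmetric, of ms j], subst sum_list_append) (rule refl)
 ultimately show ?thesis using assms by (simp add: bsum_def comps_def of_nat_diff)
qed

text \<open>A rotation of the composition moves the window to time 0 without changing the uniform
  law. There \<open>first_half\<close> compares with the free walk, and \<open>maximal_ineq\<close>
  applies to the steps and to their negatives.\<close>

theorem bridge_osc:
 "\<exists>C\<ge>1. \<forall>k\<ge>1. \<forall>a h x \<theta>. a + h <= k --> 2 * h <= k --> 0 <= \<theta> --> \<theta> <= 1/4 -->
   avg (bcomp k) (%ms. of_bool (\<exists>i\<le>h. x <= \<bar>real_of_int (bsum ms (a + i) - bsum ms a)\<bar>))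
    <= C * exp (- \<theta> * x + 5 * \<theta>\<^sup>2 * real h)"
proof -
 obtain C where C: "C >= 1" "\<And>k j f. k >= 1 ==> 2 * j <= k ==> (\<And>xs. 0 <= f xs) ==>
   avg (bcomp k) (%ms. f (take j ms)) <= C * (\<Sum>xs\<in>bdl j k. f xs * wt (%m. (1/2) ^ (m + 1)) xs)"
  using first_half by blast
 let ?p = "%m. (1/2::real) ^ (m + 1)"
 let ?S = "%i xs. sum_list (map (%m. real m - 1) (take i xs))"
 have "avg (bcomp k) (%ms. of_bool (\<exists>i\<le>h. x <= \<bar>real_of_int (bsum ms (a + i) - bsum ms a)\<bar>))
    <= 2 * C * exp (- \<theta> * x + 5 * \<theta>\<^sup>2 * real h)"
  if k: "k >= 1" and h: "a + h <= k" "2 * h <= k" and th: "0 <= \<theta>" "\<theta> <= 1/4" for k a h x \<theta>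
 proof -
  define f where "f xs = (of_bool (\<exists>i\<le>h. x <= \<bar>?S i xs\<bar>) :: real)" for xs
  have "avg (bcomp k) (%ms. of_bool (\<exists>i\<le>h. x <= \<bar>real_of_int (bsum ms (a + i) - bsum ms a)\<bar>))
    = avg (bcomp k) (%ms. f (take h (rotate a ms)))"
  proof (rule avg_cong)
   fix ms assume ms: "ms \<in> bcomp k"
   have "real_of_int (bsum ms (a + i) - bsum ms a) = ?S i (take h (rotate a ms))" if "i <= h" for i
   proof -
    have "i <= length (rotate a ms)" using that h ms by (simp add: comps_def)
    then show ?thesis using bsum_eq[of i "rotate a ms"] bsum_rotate[OF ms, of a i] h that by (simp add: take_take min_def)
   qed
   then show "of_bool (\<exists>i\<le>h. x <= \<bar>real_of_int (bsum ms (a + i) - bsum ms a)\<bar>) = f (take h (rotate a ms))"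
    unfolding f_def by (intro arg_cong[where f = of_bool]) auto
  qed
  also have "... = avg (bcomp k) (%ms. f (take h ms))" by (rule avg_rotate)
  also have "... <= C * (\<Sum>xs\<in>bdl h k. f xs * wt ?p xs)" by (rule C(2)[OF k h(2)]) (simp add: f_def)
  also have "(\<Sum>xs\<in>bdl h k. f xs * wt ?p xs) <= (\<Sum>xs\<in>lsn {..k} h. f xs * wt ?p xs)"
   by (intro sum_mono2 finite_lsn bdl_subset) (auto simp: f_def wt_nonneg)
  also have "... <= (\<Sum>xs\<in>lsn {..k} h. wt ?p xs * of_bool (\<exists>i\<le>h. x <= 0 + ?S i xs)
    + wt ?p xs * of_bool (\<exists>i\<le>h. x <= 0 + sum_list (map (%m. - (real m - 1)) (take i xs))))"
  proof (rule sum_mono)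
   fix xs
   have "sum_list (map (%m. - (real m - 1)) ys) = - sum_list (map (%m. real m - 1) ys)" for ys
    by (induction ys) auto
   then have "f xs <= of_bool (\<exists>i\<le>h. x <= 0 + ?S i xs) + of_bool (\<exists>i\<le>h. x <= 0 + sum_list (map (%m. - (real m - 1)) (take i xs)))"
    unfolding f_def by (auto simp: abs_real_def split: if_splits)
   moreover have "0 <= wt ?p xs" by (rule wt_nonneg) simp
   ultimately have "wt ?p xs * f xs <= wt ?p xs * (of_bool (\<exists>i\<le>h. x <= 0 + ?S i xs) + of_bool (\<exists>i\<le>h. x <= 0 + sum_list (map (%m. - (real m - 1)) (take i xs))))"
    by (rule mult_left_mono)
   then show "f xs * wt ?p xs <= wt ?p xs * of_bool (\<exists>i\<le>h. x <= 0 + ?S i xs)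
    + wt ?p xs * of_bool (\<exists>i\<le>h. x <= 0 + sum_list (map (%m. - (real m - 1)) (take i xs)))"
    by (simp only: mult.commute[of "f xs"] distrib_left)
  qed
  also have "... <= exp (\<theta> * (0 - x)) * exp (5 * \<theta>\<^sup>2) ^ h + exp (\<theta> * (0 - x)) * exp (5 * \<theta>\<^sup>2) ^ h"
   unfolding sum.distrib
  proof (intro add_mono maximal_ineq)
   show "(\<Sum>m\<le>k. ?p m * exp (\<theta> * (real m - 1))) <= exp (5 * \<theta>\<^sup>2)" using geo_mgf[of \<theta> k] th by simp
   show "(\<Sum>m\<le>k. ?p m * exp (\<theta> * - (real m - 1))) <= exp (5 * \<theta>\<^sup>2)"
   proof -
    have "\<bar>- \<theta>\<bar> <= 1/4" using th by simp
    from geo_mgf[OF this, of k] show ?thesis by (simp only: minus_mult_commute power2_minus)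
   qed
  qed (use th geo_sum_le in auto)
  also have "... = 2 * exp (- \<theta> * x + 5 * \<theta>\<^sup>2 * real h)"
   by (simp add: exp_of_nat_mult[symmetric] exp_add[symmetric] algebra_simps)
  finally show ?thesis using C(1) by (simp add: mult.assoc mult.left_commute)
 qed
 then show ?thesis using C(1) by (intro exI[of _ "2 * C"]) auto
qed

text \<open>By rotation invariance all parts have the same mean, and since they add up to
  \<open>k\<close> this mean is 1.\<close>

lemma avg_bsum_zero: "j <= k ==> avg (bcomp k) (%ms. real_of_int (bsum ms j)) = 0"
proof -
 assume j: "j <= k"
 have m1: "avg (bcomp k) (%ms. real (ms ! i)) = avg (bcomp k) (%ms. real (ms ! 0))" if "i < k" for i
 proof -
  have "avg (bcomp k) (%ms. real (ms ! i)) = avg (bcomp k) (%ms. real (rotate i ms ! 0))"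
   by (rule avg_cong) (use that in \<open>simp add: comps_def nth_rotate\<close>)
  then show ?thesis using avg_rotate[of k k "%ms. real (ms ! 0)" i] by simp
 qed
 have sl: "real (sum_list (take l ms)) = (\<Sum>i<l. real (ms ! i))" if "l <= length ms" for l and ms :: "nat list"
  using that by (induction l) (auto simp: take_Suc_conv_app_nth)
 have "real k * avg (bcomp k) (%ms. real (ms ! 0)) = (\<Sum>i<k. avg (bcomp k) (%ms. real (ms ! i)))"
 proof -
  have "(\<Sum>i<k. avg (bcomp k) (%ms. real (ms ! i))) = (\<Sum>i<k. avg (bcomp k) (%ms. real (ms ! 0)))"
   by (rule sum.cong[OF refl m1]) simp
  then show ?thesis by simp
 qed
 also have "... = avg (bcomp k) (%ms. \<Sum>i<k. real (ms ! i))" by (rule avg_sum[symmetric])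
 also have "... = avg (bcomp k) (%_. real k)"
 proof (rule avg_cong)
  fix ms assume "ms \<in> bcomp k"
  then show "(\<Sum>i<k. real (ms ! i)) = real k" using sl[of k ms] by (simp add: comps_def)
 qed
 also have "... = real k" by (rule avg_const[OF card_bcomp_pos])
 finally have one: "avg (bcomp k) (%ms. real (ms ! 0)) = 1" if "k > 0" using that by simp
 have "avg (bcomp k) (%ms. real_of_int (bsum ms j)) = avg (bcomp k) (%ms. (\<Sum>i<j. real (ms ! i)) + (- real j))"
 proof (rule avg_cong)
  fix ms assume "ms \<in> bcomp k"
  then show "real_of_int (bsum ms j) = (\<Sum>i<j. real (ms ! i)) + (- real j)"
   using sl[of j ms] j by (simp add: comps_def bsum_def)
 qed
 also have "... = (\<Sum>i<j. avg (bcomp k) (%ms. real (ms ! i))) + (- real j)"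
  unfolding avg_add avg_sum by (simp only: avg_const[OF card_bcomp_pos])
 also have "(\<Sum>i<j. avg (bcomp k) (%ms. real (ms ! i))) = (\<Sum>i<j. 1)"
 proof (rule sum.cong[OF refl])
  fix i assume "i \<in> {..<j}"
  then show "avg (bcomp k) (%ms. real (ms ! i)) = 1" using m1[of i] one j by simp
 qed
 finally show ?thesis by simp
qed

lemma bsum_abs_le: "ms \<in> bcomp k ==> j <= k ==> \<bar>bsum ms j\<bar> <= int k"
proof -
 assume ms: "ms \<in> bcomp k" and j: "j <= k"
 have "sum_list ms = sum_list (take j ms) + sum_list (drop j ms)"
  by (subst append_take_drop_id[symmetric, of ms j], subst sum_list_append) (rule refl)
 then show ?thesis using ms j by (auto simp: bsum_def comps_def)
qed

text \<open>The bound must carry no constant in front, because it is later multiplied along whole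
  ancestral lines. When \<open>\<theta>^2 k >= 1\<close> the constant from \<open>first_half\<close>
  is absorbed into the exponent; otherwise the centring of the bridge value removes the linear term
  and leaves a correction of order \<open>\<theta>^2 k\<close>.\<close>

theorem bridge_mgf:
 "\<exists>C\<ge>0. \<forall>k j \<theta>. j <= k --> \<bar>\<theta>\<bar> <= 1/8 -->
   avg (bcomp k) (%ms. exp (\<theta> * real_of_int (bsum ms j))) <= exp (C * \<theta>\<^sup>2 * real k)"
proof -
 obtain C where C: "C >= 1" "\<And>k j f. k >= 1 ==> 2 * j <= k ==> (\<And>xs. 0 <= f xs) ==>
   avg (bcomp k) (%ms. f (take j ms)) <= C * (\<Sum>xs\<in>bdl j k. f xs * wt (%m. (1/2) ^ (m + 1)) xs)"
  using first_half by blast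
 let ?E = "%k j \<theta>. avg (bcomp k) (%ms. exp (\<theta> * real_of_int (bsum ms j)))"
 let ?p = "%m. (1/2::real) ^ (m + 1)"
 have half: "?E k j \<theta> <= C * exp (5 * \<theta>\<^sup>2 * real k)" if "k >= 1" "2 * j <= k" "\<bar>\<theta>\<bar> <= 1/4" for k j \<theta>
 proof -
  define f where "f xs = exp (\<theta> * sum_list (map (%m. real m - 1) xs))" for xs :: "nat list"
  have "?E k j \<theta> = avg (bcomp k) (%ms. f (take j ms))"
   by (rule avg_cong) (use that bsum_eq in \<open>auto simp: comps_def f_def\<close>)
  also have "... <= C * (\<Sum>xs\<in>bdl j k. f xs * wt ?p xs)" by (rule C(2)[OF that(1,2)]) (simp add: f_def)
  also have "(\<Sum>xs\<in>bdl j k. f xs * wt ?p xs) <= (\<Sum>xs\<in>lsn {..k} j. f xs * wt ?p xs)"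
   by (intro sum_mono2 finite_lsn bdl_subset) (auto simp: f_def wt_nonneg)
  also have "... = (\<Sum>xs\<in>lsn {..k} j. wt (%m. ?p m * exp (\<theta> * (real m - 1))) xs)"
   unfolding f_def wt_exp by (intro sum.cong refl mult.commute)
  also have "... = (\<Sum>m\<le>k. ?p m * exp (\<theta> * (real m - 1))) ^ j" by (rule sum_wt_lsn)
  also have "... <= exp (5 * \<theta>\<^sup>2) ^ j" by (intro power_mono geo_mgf sum_nonneg) (use that in auto)
  also have "... <= exp (5 * \<theta>\<^sup>2) ^ k" by (rule power_increasing) (use that in auto)
  also have "... = exp (5 * \<theta>\<^sup>2 * real k)" by (simp add: exp_of_nat_mult[symmetric] mult.commute)
  finally show ?thesis using C(1) by simp
 qed
 have crude: "?E k j \<theta> <= C * exp (5 * \<theta>\<^sup>2 * real k)" if "k >= 1" "j <= k" "\<bar>\<theta>\<bar> <= 1/4" for k j \<theta>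
 proof (cases "2 * j <= k")
  case True
  then show ?thesis using half that by blast
 next
  case False
  have "?E k j \<theta> = avg (bcomp k) (%ms. exp (- \<theta> * real_of_int (bsum (rev ms) (k - j))))"
   by (rule avg_cong) (use bsum_rev that in auto)
  also have "... = ?E k (k - j) (- \<theta>)" by (rule avg_rev)
  also have "... <= C * exp (5 * (- \<theta>)\<^sup>2 * real k)" by (rule half) (use False that in auto)
  finally show ?thesis by simp
 qed
 \<comment> \<open>Each nonconstant summand serves one of the three cases: large
   \<open>\<theta>^2 k\<close>, small \<open>\<theta>^2 k\<close> with \<open>k >= 64\<close>, and
   \<open>k < 64\<close>.\<close>
 define K where "K = ln C + 5 + 4 * C * exp 20 + 64 * exp 8"
 have K: "ln C + 5 <= K" "4 * C * exp 20 <= K" "64 * exp 8 <= K" "0 <= K"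
  using C(1) by (auto simp: K_def add_nonneg_nonneg)
 have "?E k j \<theta> <= exp (K * \<theta>\<^sup>2 * real k)" if j: "j <= k" and th: "\<bar>\<theta>\<bar> <= 1/8" for k j \<theta>
 proof (cases "k = 0")
  case True
  then show ?thesis using j by (simp add: avg_const[OF card_bcomp_pos])
 next
  case False
  then have k: "k >= 1" by simp
  have quad: "?E k j \<theta> <= exp (K * \<theta>\<^sup>2 * real k)"
   if "avg (bcomp k) (%ms. (\<theta> * real_of_int (bsum ms j))\<^sup>2 * exp \<bar>\<theta> * real_of_int (bsum ms j)\<bar>) <= K * \<theta>\<^sup>2 * real k"
  proof -
   have "?E k j \<theta> <= avg (bcomp k) (%ms. (1 + \<theta> * real_of_int (bsum ms j)) + (\<theta> * real_of_int (bsum ms j))\<^sup>2 * exp \<bar>\<theta> * real_of_int (bsum ms j)\<bar>)"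
    by (rule avg_mono) (rule exp_quad)
   also have "... = 1 + \<theta> * 0 + avg (bcomp k) (%ms. (\<theta> * real_of_int (bsum ms j))\<^sup>2 * exp \<bar>\<theta> * real_of_int (bsum ms j)\<bar>)"
    unfolding avg_add avg_cmult avg_bsum_zero[OF j] avg_const[OF card_bcomp_pos] ..
   also have "... <= 1 + K * \<theta>\<^sup>2 * real k" using that by simp
   also have "... <= exp (K * \<theta>\<^sup>2 * real k)" by (rule exp_ge_add_one_self)
   finally show ?thesis .
  qed
  consider "\<theta>\<^sup>2 * real k >= 1" | "\<theta>\<^sup>2 * real k < 1" "k >= 64" | "k < 64" by linarith
  then show ?thesis
  proof cases
   case 1
   have "?E k j \<theta> <= C * exp (5 * \<theta>\<^sup>2 * real k)" using crude[OF k j] th by simp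
   also have "C = exp (ln C * 1)" using C(1) by simp
   also have "exp (ln C * 1) <= exp (ln C * (\<theta>\<^sup>2 * real k))"
    unfolding exp_le_cancel_iff using 1 C(1) by (intro mult_left_mono) auto
   then have "exp (ln C * 1) * exp (5 * \<theta>\<^sup>2 * real k) <= exp (ln C * (\<theta>\<^sup>2 * real k)) * exp (5 * \<theta>\<^sup>2 * real k)"
    by (rule mult_right_mono) simp
   also have "... = exp ((ln C + 5) * (\<theta>\<^sup>2 * real k))" by (simp add: exp_add[symmetric] algebra_simps)
   also have "... <= exp (K * (\<theta>\<^sup>2 * real k))" using K(1) by (simp add: mult_right_mono)
   finally show ?thesis by (simp add: mult.assoc)
  next
   case 2
   \<comment> \<open>A fixed multiple of the natural scale \<open>1 / sqrt k\<close>: there the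
     crude bound is the constant \<open>C * exp 20\<close>, \<open>k >= 64\<close> ensures
     \<open>t <= 1/4\<close>, and \<open>\<bar>\<theta>\<bar> <= t / 2\<close> lets these two
     moments dominate the quadratic remainder.\<close>
   define t where "t = 2 / sqrt (real k)"
   have t: "\<bar>t\<bar> <= 1/4" "\<bar>- t\<bar> <= 1/4" "t\<^sup>2 * real k = 4" "t > 0"
   proof -
    have "8 <= sqrt (real k)" using 2 real_sqrt_le_mono[of 64 "real k"] by simp
    then have "2 / sqrt (real k) <= 2 / 8" using k by (intro divide_left_mono) auto
    then show "\<bar>t\<bar> <= 1/4" "\<bar>- t\<bar> <= 1/4" by (auto simp: t_def)
   qed (use k in \<open>auto simp: t_def power_divide\<close>)
   have "\<bar>\<theta>\<bar> * sqrt (real k) <= 1"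
   proof -
    have "(\<bar>\<theta>\<bar> * sqrt (real k))\<^sup>2 <= 1\<^sup>2" using 2 by (simp add: power_mult_distrib)
    then show ?thesis by (rule power2_le_imp_le) simp
   qed
   then have th': "\<bar>\<theta>\<bar> <= t / 2" using k by (simp add: t_def pos_le_divide_eq)
   have pt: "(\<theta> * X)\<^sup>2 * exp \<bar>\<theta> * X\<bar> <= 2 * (\<theta>\<^sup>2 * real k) * (exp (t * X) + exp (- t * X))" for X
   proof -
    define u where "u = t / 2 * \<bar>X\<bar>"
    have u: "0 <= u" using t(4) by (simp add: u_def)
    have "u\<^sup>2 * real k = t\<^sup>2 * real k / 4 * X\<^sup>2" by (simp add: u_def power_mult_distrib power_divide)
    then have X2: "X\<^sup>2 = u\<^sup>2 * real k" using t(3) by simp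
    have "u\<^sup>2 <= 2 * exp u" using exp_lower_Taylor_quadratic[OF u] u by simp
    have "\<bar>\<theta> * X\<bar> <= u" unfolding u_def abs_mult by (rule mult_right_mono[OF th']) simp
    then have "(\<theta> * X)\<^sup>2 * exp \<bar>\<theta> * X\<bar> <= (\<theta> * X)\<^sup>2 * exp u" by (intro mult_left_mono) auto
    also have "... = \<theta>\<^sup>2 * real k * (u\<^sup>2 * exp u)" by (simp add: power_mult_distrib X2)
    also have "... <= \<theta>\<^sup>2 * real k * ((2 * exp u) * exp u)"
     using \<open>u\<^sup>2 <= 2 * exp u\<close> by (intro mult_left_mono mult_right_mono) auto
    also have "... = 2 * (\<theta>\<^sup>2 * real k) * exp (t * \<bar>X\<bar>)" by (simp add: u_def flip: exp_add)
    also have "exp (t * \<bar>X\<bar>) <= exp (t * X) + exp (- t * X)" by (cases "X >= 0") auto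
    finally show ?thesis by (simp add: mult_left_mono)
   qed
   have "avg (bcomp k) (%ms. (\<theta> * real_of_int (bsum ms j))\<^sup>2 * exp \<bar>\<theta> * real_of_int (bsum ms j)\<bar>)
     <= avg (bcomp k) (%ms. 2 * (\<theta>\<^sup>2 * real k) * (exp (t * real_of_int (bsum ms j)) + exp (- t * real_of_int (bsum ms j))))"
    by (rule avg_mono) (rule pt)
   also have "... = 2 * (\<theta>\<^sup>2 * real k) * (?E k j t + ?E k j (- t))" unfolding avg_cmult avg_add ..
   also have "... <= 2 * (\<theta>\<^sup>2 * real k) * (C * exp (5 * t\<^sup>2 * real k) + C * exp (5 * (- t)\<^sup>2 * real k))"
    by (intro mult_left_mono add_mono crude k j t) auto
   also have "... = 2 * (\<theta>\<^sup>2 * real k) * (2 * (C * exp 20))" using t(3) by (simp add: mult.assoc)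
   also have "... = (4 * C * exp 20) * (\<theta>\<^sup>2 * real k)" by simp
   also have "... <= K * (\<theta>\<^sup>2 * real k)" using K(2) by (intro mult_right_mono) auto
   finally show ?thesis by (intro quad) (simp add: mult.assoc)
  next
   \<comment> \<open>For bounded \<open>k\<close> the bridge is bounded by \<open>k < 64\<close>, so
     the quadratic remainder is estimated pointwise.\<close>
   case 3
   have "(\<theta> * real_of_int (bsum ms j))\<^sup>2 * exp \<bar>\<theta> * real_of_int (bsum ms j)\<bar> <= (64 * exp 8) * (\<theta>\<^sup>2 * real k)"
    if ms: "ms \<in> bcomp k" for ms
   proof -
    define X where "X = real_of_int (bsum ms j)"
    have "real_of_int \<bar>bsum ms j\<bar> <= real_of_int (int k)" by (subst of_int_le_iff) (rule bsum_abs_le[OF ms j])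
    then have X: "\<bar>X\<bar> <= real k" by (simp add: X_def)
    have "X\<^sup>2 <= (real k)\<^sup>2" using X by (simp add: abs_le_square_iff[symmetric])
    also have "... <= 64 * real k" unfolding power2_eq_square using 3 by (intro mult_right_mono) auto
    finally have X2: "X\<^sup>2 <= 64 * real k" .
    have "\<bar>\<theta> * X\<bar> <= 1/8 * 64" unfolding abs_mult using th X 3 by (intro mult_mono) auto
    then have "exp \<bar>\<theta> * X\<bar> <= exp 8" by simp
    then have "(\<theta> * X)\<^sup>2 * exp \<bar>\<theta> * X\<bar> <= (\<theta>\<^sup>2 * (64 * real k)) * exp 8"
     unfolding power_mult_distrib using X2 by (intro mult_mono mult_nonneg_nonneg) auto
    then show ?thesis by (simp add: X_def mult_ac)
   qed
   then have "avg (bcomp k) (%ms. (\<theta> * real_of_int (bsum ms j))\<^sup>2 * exp \<bar>\<theta> * real_of_int (bsum ms j)\<bar>)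
     <= avg (bcomp k) (%_. (64 * exp 8) * (\<theta>\<^sup>2 * real k))" by (rule avg_mono)
   also have "... = (64 * exp 8) * (\<theta>\<^sup>2 * real k)" by (rule avg_const[OF card_bcomp_pos])
   also have "... <= K * (\<theta>\<^sup>2 * real k)" using K(3) by (intro mult_right_mono) auto
   finally show ?thesis by (intro quad) (simp add: mult.assoc)
  qed
 qed
 then show ?thesis using K(4) by (intro exI[of _ K]) auto
qed

section \<open>Shapes: plane trees with white vertices as leaves\<close>

datatype sh = Sh "sh list"

text \<open>The number of children of the root of \<open>tr s\<close>, hence the letter under which
  the next black child is attached.\<close>

function nb :: "sh => nat" where
 "nb (Sh []) = 0"
| "nb (Sh (s # ss)) = Suc (nb s)" by pat_completeness auto
termination by (relation "Wellfounded.measure size") auto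

lemma size_nth_sh: "i < length ss ==> size (ss ! i) <= size_list size ss" for ss :: "sh list"
 by (rule size_list_estimation'[OF nth_mem]) auto

text \<open>In \<open>Sh (s # ss)\<close> the last black child of the root is singled out:
  \<open>s\<close> is the tree without it and \<open>ss\<close> are the subtrees at its white
  children. A black vertex of degree \<open>k\<close> thus becomes a node with \<open>k\<close>
  children and a white vertex becomes a leaf, which is the Janson-Stefansson bijection. In the
  preorder \<open>code\<close> an entry 0 is a white vertex and an entry \<open>k > 0\<close> a
  black one of degree \<open>k\<close>.\<close>

function tr :: "sh => nat list set" where
 "tr (Sh []) = {[]}"
| "tr (Sh (s # ss)) = tr s \<union> {[nb s]} \<union> (\<Union>i\<in>{..<length ss}. (%v. nb s # i # v) ` tr (ss ! i))"
 by pat_completeness auto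
termination by (relation "Wellfounded.measure size") (auto simp: less_Suc_eq_le intro: order_trans[OF size_nth_sh] le_SucI)

fun code :: "sh => nat list" where
 "code (Sh ss) = length ss # concat (map code ss)"

lemma sh_induct [case_names leaf node]:
 assumes "P (Sh [])" and "\<And>s ss. P s ==> (\<And>i. i < length ss ==> P (ss ! i)) ==> P (Sh (s # ss))"
 shows "P s"
proof (induction s rule: sh.induct)
 case (Sh ss)
 then show ?case using assms by (cases ss) auto
qed

subsection \<open>Codes\<close>

text \<open>\<open>r\<close> counts the shapes still to be read: the word must not exhaust them
  before its end and must leave none over. The freedom in \<open>r\<close> is what allows inductions
  over forests.\<close>

fun fok :: "nat => nat list => bool" where
 "fok r [] \<longleftrightarrow> r = 0"
| "fok r (k # ks) \<longleftrightarrow> r > 0 \<and> fok (r - 1 + k) ks"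

lemma fok_iff: "fok r ks \<longleftrightarrow> length ks = r + sum_list ks \<and> (\<forall>m<length ks. m < r + sum_list (take m ks))"
proof (induction ks arbitrary: r)
 case (Cons k ks)
 show ?case
 proof (cases "r > 0")
  case True
  have "(\<forall>m<length (k # ks). m < r + sum_list (take m (k # ks))) \<longleftrightarrow> (\<forall>m<length ks. m < r - 1 + k + sum_list (take m ks))"
  proof
   assume a: "\<forall>m<length (k # ks). m < r + sum_list (take m (k # ks))"
   show "\<forall>m<length ks. m < r - 1 + k + sum_list (take m ks)"
   proof (intro allI impI)
    fix m assume "m < length ks"
    then show "m < r - 1 + k + sum_list (take m ks)" using a[rule_format, of "Suc m"] True by simp
   qed
  next
   assume a: "\<forall>m<length ks. m < r - 1 + k + sum_list (take m ks)"
   show "\<forall>m<length (k # ks). m < r + sum_list (take m (k # ks))"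
   proof (intro allI impI)
    fix m assume "m < length (k # ks)"
    then show "m < r + sum_list (take m (k # ks))" using a[rule_format, of "m - 1"] True by (cases m) auto
   qed
  qed
  then show ?thesis using True Cons.IH[of "r - 1 + k"] by auto
 next
  case False
  then show ?thesis by (auto intro!: exI[of _ 0])
 qed
qed auto

lemma luk_fok: "ks \<in> luk n \<longleftrightarrow> fok 1 ks \<and> length ks = n + 1"
 unfolding luk_def fok_iff by (auto simp: less_Suc_eq_le)

text \<open>Replacing the first tree of a forest by the forest of its children removes exactly the
  first letter of the code. Induction on the code length along this replacement is also used for
  injectivity.\<close>

lemma fok_code: "fok (length ss) (concat (map code ss))"
proof (induction "length (concat (map code ss))" arbitrary: ss rule: less_induct)
 case less
 show ?case
 proof (cases ss)
  case (Cons s ss')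
  obtain ts where s: "s = Sh ts" by (cases s)
  have "fok (length (ts @ ss')) (concat (map code (ts @ ss')))" by (rule less) (simp add: Cons s)
  then show ?thesis by (simp add: Cons s add.commute)
 qed simp
qed

lemma code_inj: "length ss = length ss' ==> concat (map code ss) = concat (map code ss') ==> ss = ss'"
proof (induction "length (concat (map code ss))" arbitrary: ss ss' rule: less_induct)
 case less
 show ?case
 proof (cases ss)
  case Nil
  then show ?thesis using less by simp
 next
  case (Cons s us)
  then obtain s' us' where ss': "ss' = s' # us'" using less by (cases ss') auto
  obtain ts where s: "s = Sh ts" by (cases s)
  obtain ts' where s': "s' = Sh ts'" by (cases s')
  have len: "length ts = length ts'" using less.prems by (simp add: Cons s ss' s')
  have "ts @ us = ts' @ us'"
  proof (rule less.hyps)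
   show "length (concat (map code (ts @ us))) < length (concat (map code ss))" by (simp add: Cons s)
   show "length (ts @ us) = length (ts' @ us')" using less.prems len by (simp add: Cons ss')
   show "concat (map code (ts @ us)) = concat (map code (ts' @ us'))" using less.prems by (simp add: Cons s ss' s')
  qed
  then show ?thesis using len by (simp add: Cons s ss' s')
 qed
qed

lemma fok_surj: "fok r ks ==> \<exists>ss. length ss = r \<and> concat (map code ss) = ks"
proof (induction ks arbitrary: r)
 case (Cons k ks)
 have r: "r > 0" "fok (r - 1 + k) ks" using Cons.prems by (simp_all only: fok.simps)
 from Cons.IH[OF r(2)] obtain ss where ss: "length ss = r - 1 + k" "concat (map code ss) = ks" by blast
 have "concat (map code (take k ss)) @ concat (map code (drop k ss)) = ks"
  unfolding ss(2)[symmetric] by (simp flip: concat_append map_append)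
 then show ?case using ss r by (intro exI[of _ "Sh (take k ss) # drop k ss"]) auto
qed auto

lemma code_bij: "bij_betw code {s. length (code s) = n + 1} (luk n)" unfolding bij_betw_def
proof
 show "inj_on code {s. length (code s) = n + 1}"
  using code_inj[of "[s]" "[s']" for s s'] by (auto intro!: inj_onI simp del: code.simps)
 show "code ` {s. length (code s) = n + 1} = luk n"
 proof (rule set_eqI, rule iffI)
  fix ks assume "ks \<in> code ` {s. length (code s) = n + 1}"
  then obtain s where "ks = code s" "length ks = n + 1" by auto
  then show "ks \<in> luk n" using fok_code[of "[s]"] by (auto simp: luk_fok simp del: code.simps)
 next
  fix ks assume ks: "ks \<in> luk n"
  then obtain ss where "length ss = 1" "concat (map code ss) = ks" using fok_surj[of 1 ks] by (auto simp: luk_fok)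
  then obtain s where "code s = ks" by (cases ss) (auto simp del: code.simps)
  then show "ks \<in> code ` {s. length (code s) = n + 1}" using ks by (force simp: luk_fok)
 qed
qed

subsection \<open>Plane trees\<close>

lemma Nil_in_tr [simp]: "[] \<in> tr s" by (induction s rule: sh_induct) auto

lemma hd_tr: "v \<in> tr s ==> v \<noteq> [] ==> hd v < nb s"
 by (induction s arbitrary: v rule: sh_induct) (auto intro: less_SucI)

lemma single_in_tr: "[i] \<in> tr s \<longleftrightarrow> i < nb s" by (induction s rule: sh_induct) auto

lemma tr_node_iff:
 "v \<in> tr (Sh (s # ss)) \<longleftrightarrow> v \<in> tr s \<or> v = [nb s] \<or> (\<exists>i u. i < length ss \<and> u \<in> tr (ss ! i) \<and> v = nb s # i # u)"
 by auto

lemma tr_low: "v \<in> tr s \<longleftrightarrow> v \<in> tr (Sh (s # ss)) \<and> (v = [] \<or> hd v < nb s)"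
 using hd_tr[of v s] unfolding tr_node_iff by auto

lemma tr_high: "nb s # i # u \<in> tr (Sh (s # ss)) \<longleftrightarrow> i < length ss \<and> u \<in> tr (ss ! i)"
 using hd_tr[of "nb s # i # u" s] unfolding tr_node_iff by auto

declare tr.simps(2) [simp del]

lemma plane_tree_tr: "plane_tree (tr s)"
proof (induction s rule: sh_induct)
 case leaf
 then show ?case by (auto simp: plane_tree_def)
next
 case (node s ss)
 let ?B = "nb s" and ?T = "tr (Sh (s # ss))"
 have fin: "finite ?T" using node by (auto simp: plane_tree_def tr.simps(2))
 have snoc: "v \<in> ?T \<and> (\<forall>j<i. v @ [j] \<in> ?T)" if vi: "v @ [i] \<in> ?T" for v i
 proof -
  consider "v @ [i] \<in> tr s" | "v @ [i] = [?B]" | k u where "k < length ss" "u \<in> tr (ss ! k)" "v @ [i] = ?B # k # u"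
   using vi unfolding tr_node_iff by blast
  then show ?thesis
  proof cases
   case 1
   then have "v \<in> tr s" "\<forall>j<i. v @ [j] \<in> tr s" using node(1) unfolding plane_tree_def by blast+
   then show ?thesis unfolding tr_node_iff by blast
  next
   case 2
   then show ?thesis unfolding tr_node_iff by (auto simp: single_in_tr)
  next
   case 3
   show ?thesis
   proof (cases "u = []")
    case True
    then have "v = [?B]" "i = k" using 3 by (auto simp: append_eq_Cons_conv)
    then show ?thesis using 3 unfolding tr_node_iff by auto
   next
    case False
    then obtain u' where u: "u = u' @ [i]" "v = ?B # k # u'" using 3(3) by (cases u rule: rev_cases) auto
    then have "u' \<in> tr (ss ! k)" "\<forall>j<i. u' @ [j] \<in> tr (ss ! k)"
     using node(2)[OF 3(1)] 3(2) unfolding plane_tree_def by blast+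
    then show ?thesis using 3(1) u unfolding tr_node_iff by auto
   qed
  qed
 qed
 show ?case unfolding plane_tree_def using fin snoc by auto
qed

lemma finite_tr: "finite (tr s)" using plane_tree_tr by (auto simp: plane_tree_def)

lemma tr_disjoint:
 "tr s \<inter> {[nb s]} = {}"
 "(tr s \<union> {[nb s]}) \<inter> (\<Union>i\<in>{..<length ss}. (%v. nb s # i # v) ` tr (ss ! i)) = {}"
 using hd_tr[of _ s] by fastforce+

lemma sum_tr_node:
 fixes f :: "nat list => 'b::comm_monoid_mult"
 assumes "A \<subseteq> tr (Sh (s # ss))"
 shows "prod f A = prod f (A \<inter> tr s) * prod f (A \<inter> {[nb s]}) *
  (\<Prod>i<length ss. prod (%u. f (nb s # i # u)) {u \<in> tr (ss ! i). nb s # i # u \<in> A})"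
proof -
 let ?C = "%i. {u \<in> tr (ss ! i). nb s # i # u \<in> A}"
 have A: "A = (A \<inter> tr s \<union> A \<inter> {[nb s]}) \<union> (\<Union>i\<in>{..<length ss}. (%v. nb s # i # v) ` ?C i)"
  using assms by (auto simp: tr.simps(2))
 have "prod f A = prod f (A \<inter> tr s \<union> A \<inter> {[nb s]}) * prod f (\<Union>i\<in>{..<length ss}. (%v. nb s # i # v) ` ?C i)"
  by (subst A, rule prod.union_disjoint) (use tr_disjoint(1)[of s] tr_disjoint(2)[of s ss] finite_tr in \<open>auto dest: hd_tr\<close>)
 also have "prod f (A \<inter> tr s \<union> A \<inter> {[nb s]}) = prod f (A \<inter> tr s) * prod f (A \<inter> {[nb s]})"
  by (rule prod.union_disjoint) (use tr_disjoint(1)[of s] tr_disjoint(2)[of s ss] finite_tr in \<open>auto dest: hd_tr\<close>)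
 also have "prod f (\<Union>i\<in>{..<length ss}. (%v. nb s # i # v) ` ?C i) = (\<Prod>i<length ss. prod f ((%v. nb s # i # v) ` ?C i))"
  by (rule prod.UNION_disjoint) (use finite_tr in auto)
 also have "... = (\<Prod>i<length ss. prod (%u. f (nb s # i # u)) (?C i))"
 proof (rule prod.cong[OF refl])
  fix i
  show "prod f ((%v. nb s # i # v) ` ?C i) = prod (%u. f (nb s # i # u)) (?C i)"
   by (subst prod.reindex) (auto simp: inj_on_def comp_def)
 qed
 finally show ?thesis .
qed

lemma card_tr_node: "card (tr (Sh (s # ss))) = card (tr s) + 1 + (\<Sum>i<length ss. card (tr (ss ! i)))"
proof -
 let ?U = "\<Union>i\<in>{..<length ss}. (%v. nb s # i # v) ` tr (ss ! i)"
 have "card (tr (Sh (s # ss))) = card (tr s \<union> {[nb s]}) + card ?U"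
  unfolding tr.simps(2) by (rule card_Un_disjoint) (use tr_disjoint(1)[of s] tr_disjoint(2)[of s ss] finite_tr in \<open>auto dest: hd_tr\<close>)
 also have "card (tr s \<union> {[nb s]}) = card (tr s) + 1"
  using tr_disjoint(1)[of s] finite_tr by (subst card_Un_disjoint) auto
 also have "card ?U = (\<Sum>i<length ss. card ((%v. nb s # i # v) ` tr (ss ! i)))"
  by (rule card_UN_disjoint) (use finite_tr in auto)
 also have "... = (\<Sum>i<length ss. card (tr (ss ! i)))" by (intro sum.cong refl card_image) (auto simp: inj_on_def)
 finally show ?thesis .
qed

lemma length_code: "length (code s) = card (tr s)"
proof (induction s rule: sh_induct)
 case (node s ss)
 have "length (concat (map code ss)) = (\<Sum>i<length ss. length (code (ss ! i)))"
  by (simp add: length_concat sum_list_sum_nth atLeast0LessThan comp_def)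
 then show ?case using node by (simp add: card_tr_node)
qed auto

text \<open>The number of children of the root determines the letter \<open>nb s\<close>. The words
  that avoid this first letter form \<open>tr s\<close>, and those starting with it give the
  subtrees at the last black child.\<close>

lemma tr_inj: "tr s = tr s' ==> s = s'"
proof (induction s arbitrary: s' rule: sh_induct)
 case leaf
 show ?case
 proof (cases s')
  case (Sh ss)
  show ?thesis
  proof (cases ss)
   case (Cons t ts)
   then have "[nb t] \<in> tr s'" by (simp add: Sh tr_node_iff)
   then have "[nb t] \<in> tr (Sh [])" unfolding leaf .
   then show ?thesis by simp
  qed (simp add: Sh)
 qed
next
 case (node s ss)
 show ?case
 proof (cases s')
  case (Sh us)
  show ?thesis
  proof (cases us)
   case Nil
   have "[nb s] \<in> tr (Sh (s # ss))" by (simp add: tr_node_iff)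
   then show ?thesis using node.prems Nil Sh by simp
  next
   case (Cons t ts)
   have eq: "tr (Sh (s # ss)) = tr (Sh (t # ts))" using node.prems by (simp add: Sh Cons)
   have "i < nb (Sh (s # ss)) \<longleftrightarrow> i < nb (Sh (t # ts))" for i unfolding single_in_tr[symmetric] eq ..
   from this[of "nb s"] this[of "nb t"] have nb: "nb s = nb t" by simp
   have "tr s = tr t" by (intro set_eqI) (simp only: tr_low[of _ s ss] tr_low[of _ t ts] eq nb)
   then have s: "s = t" by (rule node.IH(1))
   have hi: "i < length ss \<and> u \<in> tr (ss ! i) \<longleftrightarrow> i < length ts \<and> u \<in> tr (ts ! i)" for i u
    using tr_high[of s i u ss] tr_high[of t i u ts] eq nb by simp
   have "i < length ss \<longleftrightarrow> i < length ts" for i using hi[of i "[]"] by simp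
   from this[of "length ss"] this[of "length ts"] have len: "length ss = length ts" by linarith
   have "ss ! i = ts ! i" if "i < length ss" for i by (rule node.IH(2)[OF that]) (use hi that len in auto)
   then have "ss = ts" using len by (simp add: nth_equalityI)
   then show ?thesis by (simp add: Sh Cons s)
  qed
 qed
qed

lemma downset_nat:
 fixes A :: "nat set"
 assumes "finite A" "\<And>i j. i \<in> A ==> j < i ==> j \<in> A"
 shows "A = {..<card A}"
proof -
 have "\<exists>c. A = {..<c}"
 proof (cases "A = {}")
  case False
  have "x \<in> A \<longleftrightarrow> x < Suc (Max A)" for x
  proof
   assume "x < Suc (Max A)"
   then consider "x = Max A" | "x < Max A" by linarith
   then show "x \<in> A" using assms(2)[of "Max A" x] Max_in[OF assms(1) False] by cases auto
  qed (simp add: Max_ge[OF assms(1)] less_Suc_eq_le)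
  then have "A = {..<Suc (Max A)}" by blast
  then show ?thesis by blast
 qed auto
 then show ?thesis by auto
qed

lemma plane_tree_prefix: "plane_tree T ==> u @ v \<in> T ==> u \<in> T"
proof (induction v rule: rev_induct)
 case (snoc x v)
 then have "(u @ v) @ [x] \<in> T" by simp
 then have "u @ v \<in> T" using snoc.prems(1) unfolding plane_tree_def by blast
 then show ?case using snoc by blast
qed auto

text \<open>Strong induction on the size, cutting off the last child of the root. What remains, and
  the subtrees at the children of the removed vertex, are smaller plane trees.\<close>

lemma tr_surj: "plane_tree T ==> \<exists>s. tr s = T"
proof (induction "card T" arbitrary: T rule: less_induct)
 case less
 note T = less.prems
 have fin: "finite T" and nil: "[] \<in> T" and par: "\<And>v i. v @ [i] \<in> T ==> v \<in> T"
  and sib: "\<And>v i j. v @ [i] \<in> T ==> j < i ==> v @ [j] \<in> T"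
  using T unfolding plane_tree_def by blast+
 define R where "R v = {i. v @ [i] \<in> T}" for v
 have R: "R v = {..<card (R v)}" for v
 proof (rule downset_nat)
  have "(%i. v @ [i]) ` R v \<subseteq> T" by (auto simp: R_def)
  then have "finite ((%i. v @ [i]) ` R v)" using fin finite_subset by blast
  then show "finite (R v)" by (rule finite_imageD) (auto simp: inj_on_def)
 qed (use sib in \<open>auto simp: R_def\<close>)
 have Riff: "v @ [i] \<in> T \<longleftrightarrow> i < card (R v)" for v i using R[of v] by (auto simp: R_def)
 show ?case
 proof (cases "card (R [])")
  case 0
  have "v = []" if "v \<in> T" for v
  proof (cases v)
   case (Cons a v')
   then have "[] @ [a] \<in> T" using plane_tree_prefix[OF T, of "[a]" v'] that by simp
   then show ?thesis unfolding Riff using 0 by simp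
  qed
  then have "T = {[]}" using nil by blast
  then show ?thesis by (intro exI[of _ "Sh []"]) simp
 next
  case (Suc B)
  have B: "[i] \<in> T \<longleftrightarrow> i < Suc B" for i using Riff[of "[]" i] Suc by simp
  define m where "m = card (R [B])"
  have m: "[B, i] \<in> T \<longleftrightarrow> i < m" for i using Riff[of "[B]" i] by (simp add: m_def)
  define T' where "T' = {v \<in> T. v = [] \<or> hd v < B}"
  define U where "U i = {u. B # i # u \<in> T}" for i
  have pT': "plane_tree T'" unfolding plane_tree_def
  proof (intro conjI allI impI)
   show "finite T'" using fin by (simp add: T'_def)
   show "[] \<in> T'" using nil by (simp add: T'_def)
  next
   fix v i assume "v @ [i] \<in> T'"
   then have "v @ [i] \<in> T" "hd (v @ [i]) < B" by (auto simp: T'_def)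
   then show "v \<in> T'" using par by (cases v) (auto simp: T'_def nil)
  next
   fix v i j assume "v @ [i] \<in> T' \<and> j < i"
   then have "v @ [i] \<in> T" "hd (v @ [i]) < B" "j < i" by (auto simp: T'_def)
   then show "v @ [j] \<in> T'" using sib[of v i j] by (cases v) (auto simp: T'_def)
  qed
  have cT': "card T' < card T"
  proof (rule psubset_card_mono[OF fin])
   have "[B] \<in> T" "[B] \<notin> T'" using B[of B] by (auto simp: T'_def)
   then show "T' \<subset> T" by (auto simp: T'_def)
  qed
  have pU: "plane_tree (U i)" and cU: "card (U i) < card T" if "i < m" for i
  proof -
   have im: "(%u. B # i # u) ` U i \<subseteq> T" by (auto simp: U_def)
   have finU: "finite (U i)" using finite_subset[OF im fin] by (rule finite_imageD) (auto simp: inj_on_def)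
   have "card (U i) = card ((%u. B # i # u) ` U i)" by (rule card_image[symmetric]) (auto simp: inj_on_def)
   also have "... < card T"
   proof (rule psubset_card_mono[OF fin])
    show "(%u. B # i # u) ` U i \<subset> T" using im nil by blast
   qed
   finally show "card (U i) < card T" .
   show "plane_tree (U i)" unfolding plane_tree_def
   proof (intro conjI allI impI)
    show "[] \<in> U i" using m that by (simp add: U_def)
    fix v k assume "v @ [k] \<in> U i"
    then show "v \<in> U i" using par[of "B # i # v" k] by (simp add: U_def)
   next
    fix v k j assume "v @ [k] \<in> U i \<and> j < k"
    then show "v @ [j] \<in> U i" using sib[of "B # i # v" k j] by (simp add: U_def)
   qed (rule finU)
  qed
  obtain s where s: "tr s = T'" using less.hyps[OF cT' pT'] by blast
  have "\<forall>i<m. \<exists>t. tr t = U i" using less.hyps[OF cU pU] by blast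
  then obtain t where t: "\<And>i. i < m ==> tr (t i) = U i" by metis
  have nb: "nb s = B"
  proof -
   have "i < nb s \<longleftrightarrow> i < B" for i
   proof -
    have "i < nb s \<longleftrightarrow> [i] \<in> T'" using single_in_tr[of i s] s by simp
    also have "... \<longleftrightarrow> [i] \<in> T \<and> i < B" by (simp add: T'_def)
    also have "... \<longleftrightarrow> i < B" using B[of i] by auto
    finally show ?thesis .
   qed
   from this[of "nb s"] this[of B] show ?thesis by linarith
  qed
  have "tr (Sh (s # map t [0..<m])) = T"
  proof (rule set_eqI)
   fix v
   show "v \<in> tr (Sh (s # map t [0..<m])) \<longleftrightarrow> v \<in> T"
   proof
    assume "v \<in> tr (Sh (s # map t [0..<m]))"
    then show "v \<in> T" unfolding tr_node_iff s nb using B t by (auto simp: T'_def U_def)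
   next
    assume v: "v \<in> T"
    show "v \<in> tr (Sh (s # map t [0..<m]))"
    proof (cases v)
     case Nil
     then show ?thesis by simp
    next
     case (Cons a r)
     have a: "a < Suc B" using plane_tree_prefix[OF T, of "[a]" r] v B Cons by simp
     show ?thesis
     proof (cases "a < B")
      case True
      then show ?thesis unfolding tr_node_iff s using v Cons by (auto simp: T'_def)
     next
      case False
      then have aB: "a = B" using a by simp
      show ?thesis
      proof (cases r)
       case Nil
       then show ?thesis unfolding tr_node_iff nb using Cons aB by simp
      next
       case (Cons i u)
       then have "i < m" using plane_tree_prefix[OF T, of "[B, i]" u] v m \<open>v = a # r\<close> aB by simp
       then show ?thesis unfolding tr_node_iff nb using v \<open>v = a # r\<close> Cons aB t by (auto simp: U_def)
      qed
     qed
    qed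
   qed
  qed
  then show ?thesis by blast
 qed
qed

lemma tr_bij: "bij_betw tr {s. length (code s) = n + 1} (Gamma n)" unfolding bij_betw_def
proof
 show "inj_on tr {s. length (code s) = n + 1}" by (rule inj_onI) (rule tr_inj)
 show "tr ` {s. length (code s) = n + 1} = Gamma n"
  using plane_tree_tr tr_surj by (force simp: Gamma_def length_code simp del: code.simps)
qed

subsection \<open>Degrees and weights\<close>

lemma num_children_low:
 assumes "v \<in> tr s" "v \<noteq> []"
 shows "num_children (tr (Sh (s # ss))) v = num_children (tr s) v"
proof -
 have "v @ [i] \<in> tr (Sh (s # ss)) \<longleftrightarrow> v @ [i] \<in> tr s" for i
  using tr_low[of "v @ [i]" s ss] hd_tr[OF assms] assms(2) by auto
 then show ?thesis by (simp add: num_children_def)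
qed

lemma num_children_root: "num_children (tr (Sh (s # ss))) [nb s] = length ss"
proof -
 have "[nb s] @ [i] \<in> tr (Sh (s # ss)) \<longleftrightarrow> i < length ss" for i using tr_high[of s i "[]" ss] by simp
 then show ?thesis by (simp add: num_children_def)
qed

lemma num_children_high:
 assumes "i < length ss"
 shows "num_children (tr (Sh (s # ss))) (nb s # i # u) = num_children (tr (ss ! i)) u"
proof -
 have "(nb s # i # u) @ [j] \<in> tr (Sh (s # ss)) \<longleftrightarrow> u @ [j] \<in> tr (ss ! i)" for j
  using tr_high[of s i "u @ [j]" ss] assms by simp
 then show ?thesis by (simp add: num_children_def)
qed

lemma deg_low: "v \<in> black (tr s) ==> deg (tr (Sh (s # ss))) v = deg (tr s) v"
 by (cases "v = []") (auto simp: deg_def num_children_low black_def)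

lemma deg_root: "deg (tr (Sh (s # ss))) [nb s] = Suc (length ss)" by (simp add: deg_def num_children_root)

lemma deg_high:
 "i < length ss ==> u \<in> black (tr (ss ! i)) ==> deg (tr (Sh (s # ss))) (nb s # i # u) = deg (tr (ss ! i)) u"
 by (cases "u = []") (auto simp: deg_def num_children_high black_def)

lemma black_node:
 "black (tr (Sh (s # ss))) \<inter> tr s = black (tr s)"
 "black (tr (Sh (s # ss))) \<inter> {[nb s]} = {[nb s]}"
 "i < length ss ==> {u \<in> tr (ss ! i). nb s # i # u \<in> black (tr (Sh (s # ss)))} = black (tr (ss ! i))"
 using tr_low[of _ s ss] by (auto simp: black_def tr_node_iff)

lemma black_node_iff:
 "v \<in> black (tr (Sh (s # ss))) \<longleftrightarrow> v \<in> black (tr s) \<or> v = [nb s] \<or>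
  (\<exists>i u. i < length ss \<and> u \<in> black (tr (ss ! i)) \<and> v = nb s # i # u)"
 by (auto simp: black_def tr_node_iff)

lemma wt_concat_map: "wt w (concat (map code ss)) = (\<Prod>i<length ss. wt w (code (ss ! i)))"
 by (induction ss) (auto simp: prod.lessThan_Suc_shift simp del: prod.lessThan_Suc code.simps)

text \<open>The entries 0 of the code, which stand for white vertices, contribute
  \<open>w 0 = 1\<close>; every other entry is the degree of its black vertex.\<close>

lemma tree_weight_code:
 assumes "w 0 = 1"
 shows "tree_weight w (tr s) = wt w (code s)"
proof (induction s rule: sh_induct)
 case leaf
 have "black (tr (Sh [])) = {}" by (auto simp: black_def)
 then show ?case by (simp add: tree_weight_def assms wt_def)
next
 case (node s ss)
 let ?T = "tr (Sh (s # ss))"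
 have "tree_weight w ?T = (\<Prod>v\<in>black (tr s). w (deg ?T v)) * w (deg ?T [nb s]) *
   (\<Prod>i<length ss. \<Prod>u\<in>black (tr (ss ! i)). w (deg ?T (nb s # i # u)))"
 proof -
  have sub: "black ?T \<subseteq> ?T" by (auto simp: black_def)
  have "(\<Prod>i<length ss. \<Prod>u\<in>{u \<in> tr (ss ! i). nb s # i # u \<in> black ?T}. w (deg ?T (nb s # i # u)))
    = (\<Prod>i<length ss. \<Prod>u\<in>black (tr (ss ! i)). w (deg ?T (nb s # i # u)))"
   by (rule prod.cong[OF refl]) (simp only: black_node lessThan_iff)
  then show ?thesis unfolding tree_weight_def sum_tr_node[OF sub] black_node(1,2) by simp
 qed
 also have "(\<Prod>v\<in>black (tr s). w (deg ?T v)) = tree_weight w (tr s)"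
  unfolding tree_weight_def by (intro prod.cong refl) (simp add: deg_low)
 also have "(\<Prod>i<length ss. \<Prod>u\<in>black (tr (ss ! i)). w (deg ?T (nb s # i # u))) = (\<Prod>i<length ss. tree_weight w (tr (ss ! i)))"
  unfolding tree_weight_def by (intro prod.cong refl) (simp add: deg_high)
 also have "... = (\<Prod>i<length ss. wt w (code (ss ! i)))" using node by (intro prod.cong) auto
 finally show ?case using node(1) by (simp add: deg_root wt_concat_map mult_ac)
qed

subsection \<open>White vertices\<close>

function wl :: "sh => nat list list" where
 "wl (Sh []) = [[]]"
| "wl (Sh (s # ss)) = wl s @ concat (map (%i. map (%v. nb s # i # v) (wl (ss ! i))) [0..<length ss])"
 by pat_completeness auto
termination by (relation "Wellfounded.measure size") (auto simp: less_Suc_eq_le intro: order_trans[OF size_nth_sh] le_SucI)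

lemma set_wl: "set (wl s) = white (tr s)"
proof (induction s rule: sh_induct)
 case (node s ss)
 have "white (tr (Sh (s # ss))) = white (tr s) \<union> (\<Union>i\<in>{0..<length ss}. (%v. nb s # i # v) ` white (tr (ss ! i)))"
  by (auto simp: white_def tr_node_iff)
 then show ?case using node by auto
qed (auto simp: white_def)

lemma sorted_wrt_concat_upt:
 assumes "\<And>i. i < m ==> sorted_wrt R (f i)"
  and "\<And>i j x y. i < j ==> j < m ==> x \<in> set (f i) ==> y \<in> set (f j) ==> R x y"
 shows "sorted_wrt R (concat (map f [0..<m]))" using assms
proof (induction m)
 case (Suc m)
 then show ?case by (auto simp: sorted_wrt_append)
qed simp

lemma sorted_wl: "sorted_wrt (<) (wl s)"
proof (induction s rule: sh_induct)
 case (node s ss)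
 have 1: "sorted_wrt (<) (concat (map (%i. map (%v. nb s # i # v) (wl (ss ! i))) [0..<length ss]))"
  by (rule sorted_wrt_concat_upt) (use node in \<open>auto simp: sorted_wrt_map\<close>)
 have 2: "x < nb s # r" if "x \<in> set (wl s)" for x r
 proof -
  have "x \<in> tr s" using that by (simp add: set_wl white_def)
  then show ?thesis using hd_tr[of x s] by (cases x) auto
 qed
 show ?case using node(1) 1 2 by (auto simp: sorted_wrt_append)
qed simp

lemma white_list_tr: "white_list (tr s) = wl s"
proof -
 have "finite (white (tr s))" using finite_tr by (simp add: white_def)
 moreover have "distinct (wl s)" using sorted_wl[of s] strict_sorted_iff by blast
 ultimately show ?thesis unfolding white_list_def
  using sorted_wl[of s] set_wl[of s] by (metis sorted_list_of_set.idem_if_sorted_distinct strict_sorted_iff)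
qed

subsection \<open>Labelings\<close>

text \<open>The local condition of \<open>admissible\<close> without the normalization at the root
  and outside the tree, so that it passes to subtrees and is invariant under adding
  constants.\<close>

definition adm :: "nat list set => (nat list => int) => bool" where
 "adm T l \<longleftrightarrow> (\<forall>u\<in>black T. \<forall>j<deg T u. l (nbr T u (Suc j)) >= l (nbr T u j) - 1)"

text \<open>The labels met clockwise around the last black child \<open>[B]\<close> with
  \<open>m\<close> children; the indices 0 and \<open>Suc m\<close> both stand for its parent, the
  root, as in \<open>nbr\<close>.\<close>

definition around :: "(nat list => int) => nat => nat => nat => int" where
 "around l B m j = (if j = 0 \<or> j = Suc m then l [] else l [B, j - 1])"

lemma adm_node:
 "adm (tr (Sh (s # ss))) l \<longleftrightarrow> adm (tr s) l \<and>
   (\<forall>j\<le>length ss. around l (nb s) (length ss) (Suc j) >= around l (nb s) (length ss) j - 1) \<and>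
   (\<forall>i<length ss. adm (tr (ss ! i)) (%u. l (nb s # i # u)))"
proof -
 let ?T = "tr (Sh (s # ss))" and ?B = "nb s"
 let ?P = "%u. \<forall>j<deg ?T u. l (nbr ?T u (Suc j)) >= l (nbr ?T u j) - 1"
 have "adm ?T l \<longleftrightarrow> (\<forall>u\<in>black (tr s). ?P u) \<and> ?P [?B] \<and> (\<forall>i<length ss. \<forall>u\<in>black (tr (ss ! i)). ?P (?B # i # u))"
  unfolding adm_def Ball_def black_node_iff by blast
 also have "(\<forall>u\<in>black (tr s). ?P u) \<longleftrightarrow> adm (tr s) l"
  unfolding adm_def by (intro ball_cong refl) (simp add: nbr_def deg_low)
 also have "?P [?B] \<longleftrightarrow> (\<forall>j\<le>length ss. around l ?B (length ss) (Suc j) >= around l ?B (length ss) j - 1)"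
  unfolding deg_root nbr_def around_def by (simp add: less_Suc_eq_le)
 also have "(\<forall>i<length ss. \<forall>u\<in>black (tr (ss ! i)). ?P (?B # i # u)) \<longleftrightarrow>
   (\<forall>i<length ss. adm (tr (ss ! i)) (%u. l (?B # i # u)))"
 proof (intro all_cong imp_cong refl)
  fix i assume i: "i < length ss"
  have "nbr ?T (?B # i # u) j = ?B # i # nbr (tr (ss ! i)) u j" if "u \<in> black (tr (ss ! i))" for u j
   using that deg_high[OF i that] by (cases "u = []") (auto simp: nbr_def black_def)
  then show "(\<forall>u\<in>black (tr (ss ! i)). ?P (?B # i # u)) \<longleftrightarrow> adm (tr (ss ! i)) (%u. l (?B # i # u))"
   unfolding adm_def by (intro ball_cong refl) (simp add: deg_high[OF i])
 qed
 finally show ?thesis .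
qed

text \<open>The increments around a black vertex, raised by one. Admissibility makes them
  nonnegative before \<open>nat\<close> is applied, and closing up around the vertex makes their sum
  equal to their number, so they form an element of \<open>bcomp\<close>.\<close>

definition steps :: "(nat => int) => nat => nat list" where
 "steps a m = map (%j. nat (a (Suc j) - a j + 1)) [0..<Suc m]"

lemma bsum_Suc: "j < length ms ==> bsum ms (Suc j) = bsum ms j + (int (ms ! j) - 1)"
 by (simp add: bsum_def take_Suc_conv_app_nth)

lemma bsum_steps:
 assumes "\<forall>j\<le>m. a (Suc j) >= a j - 1" "j <= Suc m"
 shows "bsum (steps a m) j = a j - a 0" using assms(2)
proof (induction j)
 case (Suc j)
 have "bsum (steps a m) (Suc j) = bsum (steps a m) j + (int (steps a m ! j) - 1)"
  using Suc by (intro bsum_Suc) (simp add: steps_def)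
 moreover have "steps a m ! j = nat (a (Suc j) - a j + 1)"
  using Suc.prems unfolding steps_def by (subst nth_map) (auto simp del: upt_Suc)
 moreover have "a (Suc j) >= a j - 1" using assms(1) Suc.prems by simp
 ultimately show ?case using Suc by simp
qed simp

lemma steps_comp:
 assumes "\<forall>j\<le>m. a (Suc j) >= a j - 1" "a (Suc m) = a 0"
 shows "steps a m \<in> bcomp (Suc m)"
proof -
 have len: "length (steps a m) = Suc m" by (simp add: steps_def)
 have "bsum (steps a m) (Suc m) = 0" using bsum_steps[OF assms(1), of "Suc m"] assms(2) by simp
 then have "int (sum_list (steps a m)) = int (Suc m)" using len unfolding bsum_def by simp
 then show ?thesis using len by (simp only: comps_def mem_Collect_eq of_nat_eq_iff)
qed

text \<open>One composition for every letter of \<open>code\<close>, in the same order; a leaf gets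
  the empty composition. The recursion passes relabelled subtrees whose root label need not be 0,
  which is harmless since only differences of labels enter.\<close>

function dc :: "sh => (nat list => int) => nat list list" where
 "dc (Sh []) l = [[]]"
| "dc (Sh (s # ss)) l = steps (around l (nb s) (length ss)) (length ss) # dc s l @
   concat (map (%i. dc (ss ! i) (%u. l (nb s # i # u))) [0..<length ss])" by pat_completeness auto
termination
 by (relation "Wellfounded.measure (%(s, l). size s)") (auto simp: less_Suc_eq_le intro: order_trans[OF size_nth_sh] le_SucI)

lemma dec_append: "mss \<in> dec xs ==> nss \<in> dec ys ==> mss @ nss \<in> dec (xs @ ys)"
 unfolding dec_iff by (rule list_all2_appendI)

lemma dec_concat: "(\<And>i. i < m ==> f i \<in> dec (g i)) ==> concat (map f [0..<m]) \<in> dec (concat (map g [0..<m]))"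
 by (induction m) (auto intro: dec_append)

lemma code_node: "code (Sh (s # ss)) = Suc (length ss) # code s @ concat (map (%i. code (ss ! i)) [0..<length ss])"
proof -
 have "map code ss = map (%i. code (ss ! i)) [0..<length ss]" by (rule nth_equalityI) auto
 then show ?thesis by (simp del: code.simps add: code.simps[of "s # ss"])
qed

lemma dc_dec: "adm (tr s) l ==> dc s l \<in> dec (code s)"
proof (induction s arbitrary: l rule: sh_induct)
 case leaf
 then show ?case by (simp add: set_Cons_def comps_0)
next
 case (node s ss)
 from node.prems have a: "adm (tr s) l"
  "\<forall>j\<le>length ss. around l (nb s) (length ss) (Suc j) >= around l (nb s) (length ss) j - 1"
  "\<And>i. i < length ss ==> adm (tr (ss ! i)) (%u. l (nb s # i # u))" unfolding adm_node by auto
 have "steps (around l (nb s) (length ss)) (length ss) \<in> bcomp (Suc (length ss))"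
  by (rule steps_comp[OF a(2)]) (simp add: around_def)
 moreover have "dc s l \<in> dec (code s)" by (rule node.IH(1)[OF a(1)])
 moreover have "concat (map (%i. dc (ss ! i) (%u. l (nb s # i # u))) [0..<length ss]) \<in>
   dec (concat (map (%i. code (ss ! i)) [0..<length ss]))" by (rule dec_concat) (use node.IH(2) a(3) in blast)
 ultimately show ?case unfolding code_node dc.simps dec_simps set_Cons_def by (auto intro: dec_append)
qed

lemma run_append: "run f (xs @ ys) st = run f ys (run f xs st)"
proof (induction f xs st rule: run.induct)
 case (2 f x xs)
 have "run f ys [] = []" by (cases ys) auto
 then show ?case by simp
qed auto

lemma outs_append: "outs f (xs @ ys) st = outs f xs st @ outs f ys (run f xs st)"
proof (induction f xs st rule: run.induct)
 case (2 f x xs)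
 have "outs f ys [] = []" by (cases ys) auto
 then show ?case by simp
qed auto

text \<open>The stack walk inverts the encoding. The arbitrary rest \<open>st\<close> of the stack
  is left untouched, which is what makes the induction over consecutive subtrees work.\<close>

lemma dc_outs:
 assumes "adm (tr s) l"
 shows "run chl (dc s l) (l [] # st) = st \<and> outs chl (dc s l) (l [] # st) = map l (wl s)" using assms
proof (induction s arbitrary: l st rule: sh_induct)
 case leaf
 then show ?case by (simp add: chl_def)
next
 case (node s ss)
 let ?m = "length ss" and ?B = "nb s"
 from node.prems have a: "adm (tr s) l"
  "\<forall>j\<le>?m. around l ?B ?m (Suc j) >= around l ?B ?m j - 1"
  "\<And>i. i < ?m ==> adm (tr (ss ! i)) (%u. l (?B # i # u))" unfolding adm_node by auto
 let ?ms = "steps (around l ?B ?m) ?m"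
 have "chl (l []) ?ms = map (%j. around l ?B ?m j) [0..<Suc ?m]" unfolding chl_def
  by (rule nth_equalityI) (use bsum_steps[OF a(2)] in \<open>auto simp: steps_def around_def simp del: upt_Suc\<close>)
 also have "... = l [] # map (%i. l [?B, i]) [0..<?m]"
  by (rule nth_equalityI) (auto simp: around_def nth_Cons' simp del: upt_Suc)
 finally have ch: "chl (l []) ?ms = l [] # map (%i. l [?B, i]) [0..<?m]" .
 have seq: "n <= ?m ==> run chl (concat (map (%i. dc (ss ! i) (%u. l (?B # i # u))) [0..<n])) (map (%i. l [?B, i]) [0..<n] @ st') = st' \<and>
   outs chl (concat (map (%i. dc (ss ! i) (%u. l (?B # i # u))) [0..<n])) (map (%i. l [?B, i]) [0..<n] @ st') =
    concat (map (%i. map (%u. l (?B # i # u)) (wl (ss ! i))) [0..<n])" for n st'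
 proof (induction n arbitrary: st')
  case (Suc n)
  have IH: "run chl (concat (map (%i. dc (ss ! i) (%u. l (?B # i # u))) [0..<n])) (map (%i. l [?B, i]) [0..<n] @ (l [?B, n] # st')) = l [?B, n] # st' \<and>
   outs chl (concat (map (%i. dc (ss ! i) (%u. l (?B # i # u))) [0..<n])) (map (%i. l [?B, i]) [0..<n] @ (l [?B, n] # st')) =
    concat (map (%i. map (%u. l (?B # i # u)) (wl (ss ! i))) [0..<n])" by (rule Suc.IH) (use Suc.prems in simp)
  have st: "run chl (dc (ss ! n) (%u. l (?B # n # u))) (l [?B, n] # st') = st' \<and>
    outs chl (dc (ss ! n) (%u. l (?B # n # u))) (l [?B, n] # st') = map (%u. l (?B # n # u)) (wl (ss ! n))"
   using node.IH(2)[of n "%u. l (?B # n # u)" st'] a(3)[of n] Suc.prems by simp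
  show ?case using IH st by (simp add: run_append outs_append)
 qed simp
 show ?case using node.IH(1)[OF a(1), of "map (%i. l [?B, i]) [0..<?m] @ st"] seq[of ?m st]
  by (simp add: ch run_append outs_append map_concat comp_def)
qed

lemma dc_cong:
 assumes "\<And>v. v \<in> white (tr s) ==> l v = l' v"
 shows "dc s l = dc s l'" using assms
proof (induction s arbitrary: l l' rule: sh_induct)
 case (node s ss)
 have root: "l [] = l' []" by (rule node.prems) (simp add: white_def)
 have "l [nb s, i] = l' [nb s, i]" if "i < length ss" for i
  by (rule node.prems) (use that in \<open>simp add: white_def tr_node_iff\<close>)
 then have "steps (around l (nb s) (length ss)) (length ss) = steps (around l' (nb s) (length ss)) (length ss)"
  unfolding steps_def by (intro map_cong refl) (auto simp: around_def root)
 moreover have "dc s l = dc s l'" by (rule node.IH(1)) (rule node.prems, auto simp: white_def tr_node_iff)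
 moreover have "dc (ss ! i) (%u. l (nb s # i # u)) = dc (ss ! i) (%u. l' (nb s # i # u))" if "i < length ss" for i
  by (rule node.IH(2)[OF that]) (rule node.prems, use that in \<open>auto simp: white_def tr_node_iff\<close>)
 then have "concat (map (%i. dc (ss ! i) (%u. l (nb s # i # u))) [0..<length ss]) = concat (map (%i. dc (ss ! i) (%u. l' (nb s # i # u))) [0..<length ss])"
  by (intro arg_cong[where f = concat] map_cong refl) auto
 ultimately show ?case by simp
qed simp

lemma dc_shift: "dc s (%u. c + l u) = dc s l"
proof (induction s arbitrary: l rule: sh_induct)
 case (node s ss)
 have "steps (around (%u. c + l u) (nb s) (length ss)) (length ss) = steps (around l (nb s) (length ss)) (length ss)"
  unfolding steps_def by (intro map_cong refl) (auto simp: around_def)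
 moreover have "concat (map (%i. dc (ss ! i) (%u. c + l (nb s # i # u))) [0..<length ss]) = concat (map (%i. dc (ss ! i) (%u. l (nb s # i # u))) [0..<length ss])"
  by (intro arg_cong[where f = concat] map_cong refl) (use node in auto)
 ultimately show ?case using node(1) by simp
qed simp

lemma adm_shift: "adm T (%u. c + l u) \<longleftrightarrow> adm T l" by (simp add: adm_def add_diff_eq[symmetric])

lemma nbr_white:
 assumes "u \<in> black (tr s)" "j <= deg (tr s) u"
 shows "nbr (tr s) u j \<in> white (tr s)"
proof (cases "j = 0 \<or> j = deg (tr s) u")
 case True
 have u: "u \<noteq> []" using assms by (auto simp: black_def)
 then have "butlast u \<in> tr s" using assms plane_tree_prefix[OF plane_tree_tr, of "butlast u" "[last u]" s] by (simp add: black_def)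
 then show ?thesis using True assms u by (auto simp: nbr_def white_def black_def)
next
 case False
 have u: "u \<noteq> []" using assms by (auto simp: black_def)
 have "finite {i. u @ [i] \<in> tr s}"
  by (rule finite_imageD[of "%i. u @ [i]"]) (auto simp: inj_on_def intro: finite_subset[OF _ finite_tr[of s]])
 then have "{i. u @ [i] \<in> tr s} = {..<num_children (tr s) u}"
  unfolding num_children_def by (rule downset_nat) (use plane_tree_tr[of s] in \<open>auto simp: plane_tree_def\<close>)
 moreover have "j - 1 < num_children (tr s) u" using False assms u by (auto simp: deg_def)
 ultimately have "u @ [j - 1] \<in> tr s" by blast
 then show ?thesis using False assms by (auto simp: nbr_def white_def black_def)
qed

lemma adm_cong:
 assumes "\<And>v. v \<in> white (tr s) ==> l v = l' v"
 shows "adm (tr s) l \<longleftrightarrow> adm (tr s) l'"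
 unfolding adm_def by (intro ball_cong refl all_cong1 imp_cong) (use assms nbr_white in auto)

lemma dc_surj: "mss \<in> dec (code s) ==> \<exists>l. adm (tr s) l \<and> l [] = 0 \<and> dc s l = mss"
proof (induction s arbitrary: mss rule: sh_induct)
 case leaf
 have "mss = [[]]" using leaf by (simp add: set_Cons_def comps_0)
 then show ?case by (intro exI[of _ "%_. 0"]) (auto simp: adm_def black_def)
next
 case (node s ss)
 let ?m = "length ss" and ?B = "nb s"
 obtain ms m0 rest where mss: "mss = ms # m0 @ rest" and ms: "ms \<in> bcomp (Suc ?m)" and m0: "m0 \<in> dec (code s)"
  and rest: "rest \<in> dec (concat (map (%i. code (ss ! i)) [0..<?m]))"
  using node.prems unfolding code_node dec_iff list_all2_Cons2 list_all2_append2 by blast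
 have "\<exists>f. rest = concat (map f [0..<n]) \<and> (\<forall>i<n. f i \<in> dec (g i))" if "rest \<in> dec (concat (map g [0..<n]))" for n g and rest :: "nat list list"
  using that
 proof (induction n arbitrary: rest)
  case (Suc n)
  then obtain r1 r2 where r: "rest = r1 @ r2" "r1 \<in> dec (concat (map g [0..<n]))" "r2 \<in> dec (g n)"
   by (auto simp: dec_iff list_all2_append2)
  from Suc.IH[OF r(2)] obtain f where f: "r1 = concat (map f [0..<n])" "\<forall>i<n. f i \<in> dec (g i)" by blast
  have "map (f(n := r2)) [0..<n] = map f [0..<n]" by (intro map_cong) auto
  then have eqn: "rest = concat (map (f(n := r2)) [0..<Suc n])" using r(1) f(1) by (simp del: fun_upd_apply) simp
  have "\<forall>i<Suc n. (f(n := r2)) i \<in> dec (g i)" using r f by (auto simp: less_Suc_eq)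
  with eqn show ?case by blast
 qed simp
 from this[OF rest] obtain f where f: "rest = concat (map f [0..<?m])" "\<And>i. i < ?m ==> f i \<in> dec (code (ss ! i))" by auto
 obtain l0 where l0: "adm (tr s) l0" "l0 [] = 0" "dc s l0 = m0" using node.IH(1)[OF m0] by blast
 have "\<forall>i<?m. \<exists>l. adm (tr (ss ! i)) l \<and> l [] = 0 \<and> dc (ss ! i) l = f i" using node.IH(2) f(2) by blast
 then obtain li where li: "\<And>i. i < ?m ==> adm (tr (ss ! i)) (li i)" "\<And>i. i < ?m ==> li i [] = 0" "\<And>i. i < ?m ==> dc (ss ! i) (li i) = f i"
  by metis
 \<comment> \<open>The labeling is glued together: \<open>l0\<close> on the part before the last
   black child, and on the subtree at its child \<open>i\<close> the labeling \<open>li i\<close>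
   shifted by the bridge value at \<open>Suc i\<close>, since position 0 of the bridge belongs to
   the parent.\<close>
 define l where "l v = (if v \<in> tr s then l0 v else bsum ms (Suc (hd (tl v))) + li (hd (tl v)) (tl (tl v)))" for v
 have l_low: "l v = l0 v" if "v \<in> white (tr s)" for v using that by (simp add: l_def white_def)
 have "?B # r \<notin> tr s" for r using hd_tr[of "?B # r" s] by auto
 then have l_high: "(%u. l (?B # i # u)) = (%u. bsum ms (Suc i) + li i u)" for i by (simp add: l_def)
 have len: "length ms = Suc ?m" using ms by (simp add: comps_def)
 have ar: "around l ?B ?m j = bsum ms j" if "j <= Suc ?m" for j
 proof -
  have "l [] = 0" using l0(2) by (simp add: l_def)
  moreover have "l [?B, j - 1] = bsum ms j" if "0 < j" "j <= ?m" for j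
   using fun_cong[OF l_high[of "j - 1"], of "[]"] li(2)[of "j - 1"] that by simp
  moreover have "bsum ms (Suc ?m) = 0" using ms by (simp add: bsum_def comps_def)
  ultimately show ?thesis using that by (auto simp: around_def le_Suc_eq)
 qed
 have "adm (tr (Sh (s # ss))) l" unfolding adm_node
 proof (intro conjI allI impI)
  show "adm (tr s) l" using l0(1) adm_cong[of s l l0] l_low by simp
  fix j assume j: "j <= ?m"
  have "bsum ms (Suc j) >= bsum ms j - 1" using bsum_Suc[of j ms] len j by simp
  then show "around l ?B ?m j - 1 <= around l ?B ?m (Suc j)" using ar[of j] ar[of "Suc j"] j by simp
 next
  fix i assume "i < ?m"
  then show "adm (tr (ss ! i)) (%u. l (?B # i # u))" unfolding l_high adm_shift by (rule li(1))
 qed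
 moreover have "l [] = 0" using l0(2) by (simp add: l_def)
 moreover have "dc (Sh (s # ss)) l = mss"
 proof -
  have "steps (around l ?B ?m) ?m = ms"
  proof (rule nth_equalityI)
   show "length (steps (around l ?B ?m) ?m) = length ms" by (simp add: steps_def len)
   fix j assume "j < length (steps (around l ?B ?m) ?m)"
   then have j: "j <= ?m" by (simp add: steps_def)
   have "steps (around l ?B ?m) ?m ! j = nat (around l ?B ?m (Suc j) - around l ?B ?m j + 1)"
    using j unfolding steps_def by (subst nth_map) (auto simp del: upt_Suc)
   then show "steps (around l ?B ?m) ?m ! j = ms ! j" using ar[of j] ar[of "Suc j"] bsum_Suc[of j ms] len j by simp
  qed
  moreover have "dc s l = m0" using dc_cong[of s l l0] l_low l0(3) by simp
  moreover have eq: "map (%i. dc (ss ! i) (%u. l (?B # i # u))) [0..<?m] = map f [0..<?m]"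
   by (intro map_cong refl) (auto simp: l_high dc_shift li)
  ultimately show ?thesis unfolding dc.simps eq mss f(1) by simp
 qed
 ultimately show ?case by blast
qed

lemma labelings_adm:
 "l \<in> labelings (tr s) \<longleftrightarrow> l [] = 0 \<and> (\<forall>v. v \<notin> white (tr s) --> l v = 0) \<and> adm (tr s) l"
 by (auto simp: labelings_def admissible_def adm_def)

text \<open>Injectivity holds because the labels are read off again by \<open>outs\<close>, and both
  labelings vanish away from the white vertices.\<close>

lemma labelings_bij: "bij_betw (dc s) (labelings (tr s)) (dec (code s))" unfolding bij_betw_def
proof
 show "inj_on (dc s) (labelings (tr s))"
 proof (rule inj_onI)
  fix l l' assume l: "l \<in> labelings (tr s)" and l': "l' \<in> labelings (tr s)" and eq: "dc s l = dc s l'"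
  have "map l (wl s) = map l' (wl s)" using dc_outs[of s l "[]"] dc_outs[of s l' "[]"] l l' eq by (simp add: labelings_adm)
  then have "l v = l' v" if "v \<in> white (tr s)" for v using that by (simp add: set_wl)
  then show "l = l'" using l l' by (intro ext) (metis labelings_adm)
 qed
 show "dc s ` labelings (tr s) = dec (code s)"
 proof (rule set_eqI, rule iffI)
  fix mss assume "mss \<in> dc s ` labelings (tr s)"
  then show "mss \<in> dec (code s)" using dc_dec by (auto simp: labelings_adm)
 next
  fix mss assume "mss \<in> dec (code s)"
  then obtain l where l: "adm (tr s) l" "l [] = 0" "dc s l = mss" using dc_surj by blast
  define l' where "l' v = (if v \<in> white (tr s) then l v else 0)" for v
  have "adm (tr s) l'" using l(1) adm_cong[of s l' l] by (simp add: l'_def)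
  moreover have "dc s l' = mss" using l(3) dc_cong[of s l' l] by (simp add: l'_def)
  moreover have "l' [] = 0" by (simp add: l'_def l(2))
  ultimately show "mss \<in> dc s ` labelings (tr s)" by (intro image_eqI[of _ _ l']) (auto simp: labelings_adm l'_def)
 qed
qed

text \<open>The tree law becomes the weight law on codes, and a uniform admissible labeling becomes
  independent uniform compositions, one per letter.\<close>

theorem mobile_expect_code:
 assumes w0: "w 0 = 1"
 shows "mobile_expect w n (%T l. \<Psi> (map l (white_list T))) =
  (\<Sum>ks\<in>luk n. wt w ks * avg (dec ks) (%mss. \<Psi> (outs chl mss [0]))) / (\<Sum>ks\<in>luk n. wt w ks)"
proof -
 let ?S = "{s. length (code s) = n + 1}"
 have inner: "(\<Sum>l\<in>labelings (tr s). \<Psi> (map l (white_list (tr s)))) / real (card (labelings (tr s)))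
   = avg (dec (code s)) (%mss. \<Psi> (outs chl mss [0]))" for s
 proof -
  have "map l (white_list (tr s)) = outs chl (dc s l) [0]" if "l \<in> labelings (tr s)" for l
   using dc_outs[of s l "[]"] that by (simp add: labelings_adm white_list_tr)
  then have "(\<Sum>l\<in>labelings (tr s). \<Psi> (map l (white_list (tr s)))) = (\<Sum>l\<in>labelings (tr s). \<Psi> (outs chl (dc s l) [0]))"
   by (intro sum.cong) auto
  also have "... = (\<Sum>mss\<in>dec (code s). \<Psi> (outs chl mss [0]))" by (rule sum.reindex_bij_betw[OF labelings_bij])
  finally show ?thesis by (simp add: avg_def bij_betw_same_card[OF labelings_bij])
 qed
 have "(\<Sum>T\<in>Gamma n. tree_weight w T * ((\<Sum>l\<in>labelings T. \<Psi> (map l (white_list T))) / real (card (labelings T))))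
   = (\<Sum>s\<in>?S. wt w (code s) * avg (dec (code s)) (%mss. \<Psi> (outs chl mss [0])))"
  by (subst sum.reindex_bij_betw[OF tr_bij, symmetric]) (simp only: inner tree_weight_code[where w=w, OF w0])
 also have "... = (\<Sum>ks\<in>luk n. wt w ks * avg (dec ks) (%mss. \<Psi> (outs chl mss [0])))"
  by (rule sum.reindex_bij_betw[OF code_bij])
 finally have 1: "(\<Sum>T\<in>Gamma n. tree_weight w T * ((\<Sum>l\<in>labelings T. \<Psi> (map l (white_list T))) / real (card (labelings T))))
   = (\<Sum>ks\<in>luk n. wt w ks * avg (dec ks) (%mss. \<Psi> (outs chl mss [0])))" .
 have "(\<Sum>T\<in>Gamma n. tree_weight w T) = (\<Sum>s\<in>?S. wt w (code s))"
  by (subst sum.reindex_bij_betw[OF tr_bij, symmetric]) (simp only: tree_weight_code[where w=w, OF w0])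
 also have "... = (\<Sum>ks\<in>luk n. wt w ks)" by (rule sum.reindex_bij_betw[OF code_bij])
 finally have 2: "(\<Sum>T\<in>Gamma n. tree_weight w T) = (\<Sum>ks\<in>luk n. wt w ks)" .
 show ?thesis unfolding mobile_expect_def 1 2 ..
qed

text \<open>The default value 0 closes the path, since after the last white vertex the process
  returns to the root, whose label is 0.\<close>

definition lpath :: "real => int list => real => real" where
 "lpath c ls t = (let s = t * real (length ls); k = nat \<lfloor>s\<rfloor>; v = (%i. if i < length ls then real_of_int (ls ! i) else 0)
   in (v k + (s - real k) * (v (Suc k) - v k)) / c)"

lemma label_seq_list:
 assumes len: "length ls = card (white T)" and l0: "l [] = 0" and ls: "ls = map l (white_list T)"
 shows "label_seq T l = (%i. if i < length ls then real_of_int (ls ! i) else 0)"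
  proof (rule ext)
   fix i
   show "label_seq T l i = (if i < length ls then real_of_int (ls ! i) else 0)"
   proof (cases "i < length ls")
    case True
    then have "ls ! i = l (white_list T ! i)" by (simp add: ls)
    then show ?thesis using True by (simp only: label_seq_def len if_True)
   next case False then show ?thesis by (simp add: label_seq_def len l0)
  qed
 qed
lemma scaled_proc_lpath:
 assumes len: "length ls = card (white T)" and v: "label_seq T l = (%i. if i < length ls then real_of_int (ls ! i) else 0)"
 shows "scaled_proc w n T l t = lpath (sqrt (2 * (1 - kappa w) * real n)) ls t"
 unfolding scaled_proc_def label_proc_def lpath_def
 apply (subst v)+ unfolding len Let_def by (rule refl)
theorem mobile_expect_lpath:
 assumes w0: "w 0 = 1"
 shows "mobile_expect w n (%T l. F (scaled_proc w n T l)) =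
  (\<Sum>ks\<in>luk n. wt w ks * avg (dec ks) (%mss. F (lpath (sqrt (2 * (1 - kappa w) * real n)) (outs chl mss [0]))))
   / (\<Sum>ks\<in>luk n. wt w ks)"
proof -
 have eq: "scaled_proc w n T l = lpath (sqrt (2 * (1 - kappa w) * real n)) (map l (white_list T))"
  if "l \<in> labelings T" for T l
 proof (rule ext)
  fix t
  have len: "length (map l (white_list T)) = card (white T)" by (simp add: white_list_def)
  have l0: "l [] = 0" using that by (simp add: labelings_def admissible_def)
  show "scaled_proc w n T l t = lpath (sqrt (2 * (1 - kappa w) * real n)) (map l (white_list T)) t"
   by (rule scaled_proc_lpath[OF len label_seq_list[OF len l0 refl]])
 qed
 have "(\<Sum>l\<in>labelings T. F (scaled_proc w n T l)) =
   (\<Sum>l\<in>labelings T. F (lpath (sqrt (2 * (1 - kappa w) * real n)) (map l (white_list T))))" for T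
  by (rule sum.cong[OF refl]) (simp only: eq)
 then have "mobile_expect w n (%T l. F (scaled_proc w n T l)) = mobile_expect w n (%T l. F (lpath (sqrt (2 * (1 - kappa w) * real n)) (map l (white_list T))))"
  unfolding mobile_expect_def by (simp only:)
 also have "... = (\<Sum>ks\<in>luk n. wt w ks * avg (dec ks) (%mss. F (lpath (sqrt (2 * (1 - kappa w) * real n)) (outs chl mss [0]))))
   / (\<Sum>ks\<in>luk n. wt w ks)" by (rule mobile_expect_code[where w=w, OF w0])
 finally show ?thesis .
qed

subsection \<open>The cycle lemma\<close>

text \<open>If both blocks were nonempty, each would be a proper prefix of a code and would have sum
  at least its length. Adding the two gives a total of at least \<open>n + 1\<close>, a
  contradiction.\<close>

lemma luk_cyclic_unique:
 assumes "xs @ ys \<in> luk n" "ys @ xs \<in> luk n"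
 shows "xs = [] \<or> ys = []"
proof (rule ccontr)
 assume ne: "\<not> (xs = [] \<or> ys = [])"
 have len: "length xs + length ys = n + 1" "sum_list xs + sum_list ys = n" using assms by (auto simp: luk_def)
 have "length xs <= n" "length ys <= n" using ne len by (auto simp: Suc_le_eq neq_Nil_conv)
 then have "length xs <= sum_list (take (length xs) (xs @ ys))" "length ys <= sum_list (take (length ys) (ys @ xs))"
  using assms by (auto simp: luk_def simp del: take_append)
 then show False using len by simp
qed

text \<open>A code is determined by one of its letters together with the cyclic word of the others
  read from that letter on: two different cuts would give two rotations of one word that are both
  codes.\<close>

lemma luk_split_inj:
 assumes "pre @ k # post \<in> luk n" "pre' @ k # post' \<in> luk n" "post @ pre = post' @ pre'"
 shows "pre = pre' \<and> post = post'"
proof -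
 have key: "us = []" if "post1 = post2 @ us" "pre2 = us @ pre1" "pre1 @ k # post1 \<in> luk n" "pre2 @ k # post2 \<in> luk n"
  for us pre1 pre2 post1 post2
 proof -
  have "(pre1 @ k # post2) @ us \<in> luk n" "us @ (pre1 @ k # post2) \<in> luk n" using that by simp_all
  from luk_cyclic_unique[OF this] show ?thesis by simp
 qed
 from assms(3) obtain us where "(post = post' @ us \<and> us @ pre = pre') \<or> (post @ us = post' \<and> pre = us @ pre')"
  by (auto simp: append_eq_append_conv2)
 then show ?thesis
 proof
  assume a: "post = post' @ us \<and> us @ pre = pre'"
  then have "us = []" using key[of post post' us pre' pre] assms by simp
  then show ?thesis using a by simp
 next
  assume a: "post @ us = post' \<and> pre = us @ pre'"
  then have "us = []" using key[of post' post us pre pre'] assms by simp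
  then show ?thesis using a by simp
 qed
qed

text \<open>The cycle lemma: the word is cut at the first time its walk attains its minimum over
  \<open>{..n}\<close>.\<close>

lemma luk_rotation_ex:
 assumes len: "length xs = n + 1" and sum: "sum_list xs = n"
 shows "\<exists>m\<le>n. drop m xs @ take m xs \<in> luk n"
proof -
 define S where "S i = int (sum_list (take i xs)) - int i" for i
 define M where "M = Min (S ` {..n})"
 define m where "m = (LEAST i. i <= n \<and> S i = M)"
 have "M \<in> S ` {..n}" unfolding M_def by (rule Min_in) auto
 then obtain i0 where "i0 <= n \<and> S i0 = M" by auto
 then have m: "m <= n" "S m = M" unfolding m_def by (metis (mono_tags, lifting) LeastI)+
 have Mle: "M <= S i" if "i <= n" for i unfolding M_def using that by (intro Min_le) auto
 have Mlt: "M < S i" if "i < m" for i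
  using not_less_Least[of i "%i. i <= n \<and> S i = M"] that m Mle[of i] unfolding m_def[symmetric] by force
 have Sn: "S (Suc n) = -1" using len sum by (simp add: S_def)
 have S0: "S 0 = 0" by (simp add: S_def)
 have "drop m xs @ take m xs \<in> luk n" unfolding luk_def
 proof (intro CollectI conjI allI impI)
  show "length (drop m xs @ take m xs) = n + 1" using len m by simp
  have "sum_list xs = sum_list (take m xs) + sum_list (drop m xs)"
   by (subst append_take_drop_id[symmetric, of xs m], subst sum_list_append) (rule refl)
  then show "sum_list (drop m xs @ take m xs) = n" using sum by simp
  fix j assume j: "j <= n"
  show "j <= sum_list (take j (drop m xs @ take m xs))"
  proof (cases "m + j <= n + 1")
   case True
   have "take (m + j) xs = take m xs @ take j (drop m xs)" by (rule take_add)
   then have "int (sum_list (take j (drop m xs))) = S (m + j) - S m + int j" by (simp add: S_def)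
   moreover have "S (m + j) >= S m"
   proof (cases "m + j <= n")
    case True
    then show ?thesis using Mle m by simp
   next
    \<comment> \<open>The rotated prefix ends exactly with the original word, where the walk has the
      value -1; as \<open>m >= 1\<close> is the first minimum, the value at \<open>m\<close> is
      already negative.\<close>
    case False
    then have e: "m + j = Suc n" "m >= 1" using True j by auto
    then have "S m < 0" using Mlt[of 0] S0 m by simp
    then show ?thesis unfolding e(1) Sn by simp
   qed
   ultimately show ?thesis using True len by simp
  next
   case False
   define i where "i = m + j - (n + 1)"
   have i: "i < m" "j = (n + 1 - m) + i" using False j m by (auto simp: i_def)
   have "take j (drop m xs @ take m xs) = drop m xs @ take i xs" using i len m by (simp add: min_def)
   moreover have "sum_list xs = sum_list (take m xs) + sum_list (drop m xs)"
    by (subst append_take_drop_id[symmetric, of xs m], subst sum_list_append) (rule refl)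
   ultimately have "int (sum_list (take j (drop m xs @ take m xs))) = int n - (S m + int m) + (S i + int i)"
    using sum by (simp add: S_def)
   moreover have "S i > S m" using Mlt[OF i(1)] m by simp
   moreover have "int j = int n + 1 - int m + int i" using i m by simp
   ultimately show ?thesis by linarith
  qed
 qed
 then show ?thesis using m by blast
qed

lemma luk_insert_ex:
 assumes "length rest = n" "k + sum_list rest = n"
 shows "\<exists>pre post. pre @ k # post \<in> luk n \<and> post @ pre = rest"
proof -
 obtain m where m: "m <= n" "drop m (k # rest) @ take m (k # rest) \<in> luk n"
  using luk_rotation_ex[of "k # rest" n] assms by auto
 show ?thesis
 proof (cases m)
  case 0
  then show ?thesis using m by (intro exI[of _ "[]"] exI[of _ rest]) simp
 next
  case (Suc i)
  then show ?thesis using m by (intro exI[of _ "drop i rest"] exI[of _ "take i rest"]) simp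
 qed
qed

lemma finite_luk: "finite (luk n)"
proof (rule finite_subset)
 show "luk n \<subseteq> lsn {..n} (n + 1)" by (auto simp: luk_def lsn_def intro: order_trans[OF member_le_sum_list])
qed (simp add: finite_lsn)

text \<open>Rotating a code so that its first entry exceeding \<open>y\<close> comes first turns the tree
 condition into no condition at all.\<close>

lemma luk_sum_upper:
 assumes w: "\<And>i. w i >= 0"
  and bad: "\<And>pre k post. pre @ k # post \<in> luk n ==> y < k ==> P (pre @ k # post) ==> Q (post @ pre)"
 shows "(\<Sum>ks\<in>{ks \<in> luk n. P ks}. wt w ks) \<le>
   (\<Sum>ks\<in>{ks \<in> luk n. set ks \<subseteq> {..y}}. wt w ks) +
   (\<Sum>rest\<in>{rest \<in> lsn {..n} n. sum_list rest + y < n \<and> Q rest}. w (n - sum_list rest) * wt w rest)"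
proof -
 define D where "D = {ks \<in> luk n. P ks \<and> \<not> set ks \<subseteq> {..y}}"
 have "\<forall>ks\<in>D. \<exists>t. case t of (pre, k, post) => ks = pre @ k # post \<and> y < k"
 proof
  fix ks assume "ks \<in> D"
  then obtain k where "k \<in> set ks" "y < k" by (auto simp: D_def subset_iff not_le)
  then obtain pre post where "ks = pre @ k # post" by (meson split_list)
  then show "\<exists>t. case t of (pre, k, post) => ks = pre @ k # post \<and> y < k"
   using \<open>y < k\<close> by (intro exI[of _ "(pre, k, post)"]) simp
 qed
 then obtain T where T': "\<forall>ks\<in>D. (case T ks of (pre, k, post) => ks = pre @ k # post \<and> y < k)"
  by (rule bchoice[THEN exE])
 note T = T'[rule_format]
 define R where "R ks = (case T ks of (pre, k, post) => post @ pre)" for ks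
 have R: "\<exists>pre k post. ks = pre @ k # post \<and> y < k \<and> R ks = post @ pre \<and> k = n - sum_list (R ks)
   \<and> length (R ks) = n \<and> sum_list (R ks) + k = n" if "ks \<in> D" for ks
 proof -
  obtain pre k post where t: "T ks = (pre, k, post)" by (cases "T ks")
  have ks: "ks = pre @ k # post" "y < k" using T[OF that] t by auto
  have r: "R ks = post @ pre" by (simp add: R_def t)
  have "sum_list pre + (k + sum_list post) = n" "length pre + length post = n" using that ks by (auto simp: D_def luk_def)
  then show ?thesis using ks r by (intro exI[of _ pre] exI[of _ k] exI[of _ post]) auto
 qed
 \<comment> \<open>The removed letter is recovered as \<open>n\<close> minus the sum of the rest,
   and then the cut by \<open>luk_split_inj\<close>.\<close>
 have inj: "inj_on R D"
 proof (rule inj_onI)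
  fix ks ks' assume a: "ks \<in> D" "ks' \<in> D" "R ks = R ks'"
  obtain pre k post where 1: "ks = pre @ k # post" "R ks = post @ pre" "k = n - sum_list (R ks)" using R[OF a(1)] by blast
  obtain pre' k' post' where 2: "ks' = pre' @ k' # post'" "R ks' = post' @ pre'" "k' = n - sum_list (R ks')" using R[OF a(2)] by blast
  have "k = k'" using 1(3) 2(3) a(3) by (simp only:)
  have "ks \<in> luk n" "ks' \<in> luk n" using a(1,2) unfolding D_def by blast+
  then have "pre @ k # post \<in> luk n" "pre' @ k # post' \<in> luk n" unfolding 1(1) 2(1) \<open>k = k'\<close> .
  moreover have "post @ pre = post' @ pre'" using a(3) unfolding 1(2) 2(2) .
  ultimately have "pre = pre' \<and> post = post'" by (rule luk_split_inj)
  then show "ks = ks'" unfolding 1(1) 2(1) using \<open>k = k'\<close> by blast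
 qed
 have "(\<Sum>ks\<in>D. wt w ks) = (\<Sum>ks\<in>D. w (n - sum_list (R ks)) * wt w (R ks))"
 proof (rule sum.cong[OF refl])
  fix ks assume "ks \<in> D"
  from R[OF this] obtain pre k post where "ks = pre @ k # post" "R ks = post @ pre" "k = n - sum_list (R ks)" by blast
  then show "wt w ks = w (n - sum_list (R ks)) * wt w (R ks)" by simp
 qed
 also have "... = (\<Sum>rest\<in>R ` D. w (n - sum_list rest) * wt w rest)" by (simp add: sum.reindex[OF inj])
 also have "... <= (\<Sum>rest\<in>{rest \<in> lsn {..n} n. sum_list rest + y < n \<and> Q rest}. w (n - sum_list rest) * wt w rest)"
 proof (rule sum_mono2)
  show "R ` D \<subseteq> {rest \<in> lsn {..n} n. sum_list rest + y < n \<and> Q rest}"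
  proof clarify
   fix ks assume ks: "ks \<in> D"
   from R[OF ks] obtain pre k post where r: "ks = pre @ k # post" "y < k" "R ks = post @ pre"
    "length (R ks) = n" "sum_list (R ks) + k = n" by blast
   have "Q (post @ pre)" by (rule bad[of pre k post]) (use ks r in \<open>auto simp: D_def\<close>)
   moreover have "R ks \<in> lsn {..n} n" using r by (auto simp: lsn_def intro: order_trans[OF member_le_sum_list])
   ultimately show "R ks \<in> lsn {..n} n \<and> sum_list (R ks) + y < n \<and> Q (R ks)" using r by simp
  qed
 qed (auto simp: finite_lsn w wt_nonneg)
 finally have D: "(\<Sum>ks\<in>D. wt w ks) <= (\<Sum>rest\<in>{rest \<in> lsn {..n} n. sum_list rest + y < n \<and> Q rest}. w (n - sum_list rest) * wt w rest)" .
 have "{ks \<in> luk n. P ks} \<subseteq> {ks \<in> luk n. set ks \<subseteq> {..y}} \<union> D" by (auto simp: D_def)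
 then have "(\<Sum>ks\<in>{ks \<in> luk n. P ks}. wt w ks) <= (\<Sum>ks\<in>{ks \<in> luk n. set ks \<subseteq> {..y}} \<union> D. wt w ks)"
  by (intro sum_mono2) (auto simp: D_def finite_luk wt_nonneg w)
 also have "... <= (\<Sum>ks\<in>{ks \<in> luk n. set ks \<subseteq> {..y}}. wt w ks) + (\<Sum>ks\<in>D. wt w ks)"
  by (subst sum.union_disjoint) (auto simp: D_def finite_luk)
 finally show ?thesis using D by linarith
qed

text \<open>The converse estimate: a letter exceeding \<open>y\<close> is inserted into a word of
  letters at most \<open>y\<close> at the place provided by the cycle lemma. It is the only large
  letter of the code, so the word can be recovered and the map is injective.\<close>

lemma luk_sum_lower:
 assumes w: "\<And>i. w i >= 0"
  and G: "\<And>rest. rest \<in> G ==> length rest = n \<and> set rest \<subseteq> {..y} \<and> sum_list rest + y < n"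
 shows "(\<Sum>rest\<in>G. w (n - sum_list rest) * wt w rest) <= (\<Sum>ks\<in>luk n. wt w ks)"
proof -
 have "\<forall>rest\<in>G. \<exists>t. case t of (pre, post) => pre @ (n - sum_list rest) # post \<in> luk n \<and> post @ pre = rest"
 proof
  fix rest assume "rest \<in> G"
  then have "length rest = n" "(n - sum_list rest) + sum_list rest = n" using G by force+
  from luk_insert_ex[OF this] show "\<exists>t. case t of (pre, post) => pre @ (n - sum_list rest) # post \<in> luk n \<and> post @ pre = rest"
   by auto
 qed
 then obtain T where T': "\<forall>rest\<in>G. (case T rest of (pre, post) => pre @ (n - sum_list rest) # post \<in> luk n \<and> post @ pre = rest)"
  by (rule bchoice[THEN exE])
 note T = T'[rule_format]
 define R where "R rest = (case T rest of (pre, post) => pre @ (n - sum_list rest) # post)" for rest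
 have R: "\<exists>pre post. R rest = pre @ (n - sum_list rest) # post \<and> R rest \<in> luk n \<and> post @ pre = rest" if "rest \<in> G" for rest
  using T[OF that] by (auto simp: R_def split: prod.splits)
 have inj: "inj_on R G"
 proof (rule inj_onI)
  fix r r' assume a: "r \<in> G" "r' \<in> G" "R r = R r'"
  obtain pre post where 1: "R r = pre @ (n - sum_list r) # post" "post @ pre = r" using R[OF a(1)] by blast
  obtain pre' post' where 2: "R r' = pre' @ (n - sum_list r') # post'" "post' @ pre' = r'" using R[OF a(2)] by blast
  have s: "\<forall>x\<in>set pre. x <= y" "\<forall>x\<in>set post. x <= y" "y < n - sum_list r" using G[OF a(1)] 1(2) by auto
  have s': "\<forall>x\<in>set pre'. x <= y" "\<forall>x\<in>set post'. x <= y" "y < n - sum_list r'" using G[OF a(2)] 2(2) by auto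
  have f: "filter (%x. x <= y) (R r) = pre @ post" "filter (%x. x <= y) (R r') = pre' @ post'"
   using s s' unfolding 1(1) 2(1) by (auto simp: filter_id_conv)
  have t: "takeWhile (%x. x <= y) (R r) = pre" "takeWhile (%x. x <= y) (R r') = pre'"
   using s s' unfolding 1(1) 2(1) by (subst takeWhile_append2; auto)+
  have "pre = pre'" using t a(3) by simp
  moreover have "post = post'" using f a(3) calculation by simp
  ultimately show "r = r'" using 1 2 by simp
 qed
 have fin: "finite G"
 proof (rule finite_subset[of _ "lsn {..y} n"])
  show "G \<subseteq> lsn {..y} n" unfolding lsn_def using G by blast
 qed (simp add: finite_lsn)
 have "(\<Sum>rest\<in>G. w (n - sum_list rest) * wt w rest) = (\<Sum>rest\<in>G. wt w (R rest))"
 proof (rule sum.cong[OF refl])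
  fix rest assume "rest \<in> G"
  from R[OF this] obtain pre post where "R rest = pre @ (n - sum_list rest) # post" "post @ pre = rest" by blast
  then show "w (n - sum_list rest) * wt w rest = wt w (R rest)" by (auto simp: mult_ac)
 qed
 also have "... = (\<Sum>ks\<in>R ` G. wt w ks)" by (simp add: sum.reindex[OF inj])
 also have "... <= (\<Sum>ks\<in>luk n. wt w ks)"
  by (rule sum_mono2) (use R in \<open>auto simp: finite_luk wt_nonneg w\<close>)
 finally show ?thesis .
qed

subsection \<open>Good degree sequences\<close>

text \<open>Applied to a code this counts white vertices.\<close>

definition zeros :: "nat list => nat" where
 "zeros xs = length (filter (%k. k = 0) xs)"

text \<open>A law of large numbers uniform over prefixes, for the degrees and for the number of
  white vertices. It concerns the cyclic word left after the removal of the large letter, with both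
  errors measured against the full length \<open>n\<close>.\<close>

definition lln :: "real => real => real => nat => nat list => bool" where
 "lln \<kappa> p0 e n rest \<longleftrightarrow> (\<forall>s\<le>n. \<bar>real (sum_list (take s rest)) - \<kappa> * real s\<bar> <= e * real n \<and>
   \<bar>real (zeros (take s rest)) - p0 * real s\<bar> <= e * real n)"

definition kst :: "nat => nat => nat list" where
 "kst a k = replicate k (a + k)"

definition bigst :: "nat => nat list => nat list" where
 "bigst k S = (case S of [] => [] | a # st => replicate k a @ st)"

text \<open>The stack entry of a vertex is the sum of the degrees of its ancestors; the
 distinguished vertex of degree \<open>k\<close> is not counted.\<close>

definition kbd :: "real => nat list => nat => nat list => bool" where
 "kbd X pre k post \<longleftrightarrow>
   (\<forall>i\<le>length pre. \<forall>b\<in>set (run kst (take i pre) [0]). real b <= X) \<and>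
   (\<forall>i\<le>length post. \<forall>b\<in>set (run kst (take i post) (bigst k (run kst pre [0]))). real b <= X)"

definition good :: "real => real => real => real => nat => nat list => bool" where
 "good \<kappa> p0 e X n ks \<longleftrightarrow> (\<exists>pre k post. ks = pre @ k # post \<and> k >= 1 \<and> lln \<kappa> p0 e n (post @ pre) \<and> kbd X pre k post)"

abbreviation badw :: "(nat => real) => real => real => real => real => nat => real" where
 "badw w \<kappa> p0 e X n \<equiv> \<Sum>ks\<in>{ks \<in> luk n. \<not> good \<kappa> p0 e X n ks}. wt w ks"

text \<open>The place of the large letter after undoing the rotation, and its size, depend on the
  whole word. Requiring the bound for every cut \<open>m\<close> and every \<open>k\<close> makes
  the condition one on the independent letters alone, at the price of a polynomial union
  bound.\<close>

definition kall :: "real => nat => nat list => bool" where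
 "kall X n rest \<longleftrightarrow> (\<forall>m\<le>n. \<forall>k\<le>n. kbd X (drop m rest) k (take m rest))"

lemma good_insert:
 assumes "pre @ k # post \<in> luk n" "k >= 1" "lln \<kappa> p0 e n (post @ pre)" "kall X n (post @ pre)"
 shows "good \<kappa> p0 e X n (pre @ k # post)"
proof -
 have "length post <= n" "k <= n" using assms(1) by (auto simp: luk_def)
 then have "kbd X (drop (length post) (post @ pre)) k (take (length post) (post @ pre))"
  using assms(4) unfolding kall_def by blast
 then show ?thesis using assms unfolding good_def by (intro exI[of _ pre] exI[of _ k] exI[of _ post]) simp
qed

subsection \<open>Exponential bounds\<close>

lemma chernoff:
 fixes p :: "nat => real"
 assumes A: "finite A" and p: "\<And>i. p i >= 0"
 shows "(\<Sum>xs\<in>lsn A t. wt p xs * of_bool (a <= sum_list (map f xs))) <= exp (- a) * (\<Sum>k\<in>A. p k * exp (f k)) ^ t"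
proof -
 have "wt p xs * of_bool (a <= sum_list (map f xs)) <= exp (- a) * wt (%k. p k * exp (1 * f k)) xs" for xs
 proof -
  have "of_bool (a <= sum_list (map f xs)) <= exp (- a) * exp (1 * sum_list (map f xs))"
   by (auto simp: exp_add[symmetric])
  then have "wt p xs * of_bool (a <= sum_list (map f xs)) <= wt p xs * (exp (- a) * exp (1 * sum_list (map f xs)))"
   by (rule mult_left_mono) (simp add: wt_nonneg p)
  then show ?thesis unfolding wt_exp by (simp add: mult_ac)
 qed
 then have "(\<Sum>xs\<in>lsn A t. wt p xs * of_bool (a <= sum_list (map f xs))) <= (\<Sum>xs\<in>lsn A t. exp (- a) * wt (%k. p k * exp (1 * f k)) xs)"
  by (rule sum_mono)
 also have "... = exp (- a) * (\<Sum>k\<in>A. p k * exp (f k)) ^ t" unfolding sum_distrib_left[symmetric] sum_wt_lsn by simp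
 finally show ?thesis .
qed

lemma sum_lsn_take:
 fixes p :: "nat => real"
 assumes A: "finite A" and p: "\<And>i. p i >= 0" "sum p A <= 1" and g: "\<And>xs. g xs >= 0" and t: "t <= n"
 shows "(\<Sum>xs\<in>lsn A n. wt p xs * g (take t xs)) <= (\<Sum>xs\<in>lsn A t. wt p xs * g xs)"
proof -
 obtain r where n: "n = t + r" using t le_Suc_ex by blast
 have "(\<Sum>xs\<in>lsn A n. wt p xs * g (take t xs)) = (\<Sum>xs\<in>lsn A t. \<Sum>ys\<in>lsn A r. (wt p xs * g xs) * wt p ys)"
  unfolding n sum_lsn_add by (intro sum.cong refl) (simp add: lsn_def mult_ac)
 also have "... = (\<Sum>xs\<in>lsn A t. (wt p xs * g xs) * (sum p A) ^ r)"
  by (simp only: sum_distrib_left[symmetric] sum_wt_lsn)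
 also have "... <= (\<Sum>xs\<in>lsn A t. (wt p xs * g xs) * 1)"
  using p g by (intro sum_mono mult_left_mono power_le_one sum_nonneg mult_nonneg_nonneg wt_nonneg) auto
 finally show ?thesis by simp
qed

lemma sum_lsn_drop:
 fixes p :: "nat => real"
 assumes A: "finite A" and p: "\<And>i. p i >= 0" "sum p A <= 1" and g: "\<And>xs. g xs >= 0" and t: "t <= n"
 shows "(\<Sum>xs\<in>lsn A n. wt p xs * g (drop t xs)) <= (\<Sum>xs\<in>lsn A (n - t). wt p xs * g xs)"
proof -
 obtain r where n: "n = t + r" using t le_Suc_ex by blast
 have "(\<Sum>xs\<in>lsn A n. wt p xs * g (drop t xs)) = (\<Sum>xs\<in>lsn A t. wt p xs * (\<Sum>ys\<in>lsn A r. wt p ys * g ys))"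
  unfolding n sum_lsn_add sum_distrib_left by (intro sum.cong refl) (simp add: lsn_def mult_ac)
 also have "... = (sum p A) ^ t * (\<Sum>ys\<in>lsn A r. wt p ys * g ys)"
  by (simp only: sum_distrib_right[symmetric] sum_wt_lsn)
 also have "... <= 1 * (\<Sum>ys\<in>lsn A r. wt p ys * g ys)"
  using p g by (intro mult_right_mono power_le_one sum_nonneg mult_nonneg_nonneg wt_nonneg) auto
 finally show ?thesis by (simp add: n)
qed

definition kexp :: "real => nat list => real" where
 "kexp \<theta> st = sum_list (map (%b. exp (\<theta> * real b)) st)"

lemma kexp_simps [simp]: "kexp \<theta> [] = 0" "kexp \<theta> (a # st) = exp (\<theta> * real a) + kexp \<theta> st"
 "kexp \<theta> (st @ st') = kexp \<theta> st + kexp \<theta> st'" "kexp \<theta> (replicate k a) = real k * exp (\<theta> * real a)"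
 by (auto simp: kexp_def sum_list_replicate)

lemma kexp_nonneg: "0 <= kexp \<theta> st" by (induction st) auto

lemma kexp_member: "b \<in> set st ==> exp (\<theta> * real b) <= kexp \<theta> st"
 by (induction st) (auto simp: kexp_nonneg add_increasing add_increasing2)

text \<open>Reading \<open>k\<close> replaces an entry \<open>a\<close> by \<open>k\<close> copies
  of \<open>a + k\<close>, so \<open>exp (\<theta> * a)\<close> is multiplied on average by the sum
  of \<open>p k * k * exp (\<theta> * k)\<close>. As this is at most 1, the sum of exponentials over
  the stack is a supermartingale.\<close>

lemma kexp_run:
 fixes p :: "nat => real"
 assumes A: "finite A" and p: "\<And>i. p i >= 0" "sum p A <= 1"
  and m: "(\<Sum>k\<in>A. p k * (real k * exp (\<theta> * real k))) <= 1"
 shows "(\<Sum>xs\<in>lsn A t. wt p xs * kexp \<theta> (run kst xs st)) <= kexp \<theta> st"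
proof (induction t arbitrary: st)
 case 0
 then show ?case by (simp add: sum_lsn_0)
next
 case (Suc t)
 show ?case
 proof (cases st)
  case Nil
  then show ?thesis by (simp add: sum_lsn_Suc)
 next
  case (Cons a st')
  have "(\<Sum>xs\<in>lsn A (Suc t). wt p xs * kexp \<theta> (run kst xs st)) =
    (\<Sum>k\<in>A. p k * (\<Sum>xs\<in>lsn A t. wt p xs * kexp \<theta> (run kst xs (kst a k @ st'))))"
   unfolding sum_lsn_Suc Cons by (simp add: sum_distrib_left mult.assoc)
  also have "... <= (\<Sum>k\<in>A. p k * kexp \<theta> (kst a k @ st'))" by (intro sum_mono mult_left_mono Suc.IH p)
  also have "... = exp (\<theta> * real a) * (\<Sum>k\<in>A. p k * (real k * exp (\<theta> * real k))) + sum p A * kexp \<theta> st'"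
   unfolding sum_distrib_left sum_distrib_right sum.distrib[symmetric]
   by (intro sum.cong refl) (simp add: kst_def algebra_simps exp_add)
  also have "... <= exp (\<theta> * real a) * 1 + 1 * kexp \<theta> st'"
   by (intro add_mono mult_left_mono mult_right_mono m p kexp_nonneg) auto
  finally show ?thesis by (simp add: Cons)
 qed
qed

lemma kexp_bigst: "k <= n ==> n >= 1 ==> kexp \<theta> (bigst k S) <= real n * kexp \<theta> S"
proof -
 assume a: "k <= n" "n >= 1"
 show ?thesis
 proof (cases S)
  case (Cons b st)
  have "real k * exp (\<theta> * real b) + 1 * kexp \<theta> st <= real n * exp (\<theta> * real b) + real n * kexp \<theta> st"
   using a by (intro add_mono mult_right_mono kexp_nonneg) auto
  then show ?thesis by (simp add: Cons bigst_def algebra_simps)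
 qed (simp add: bigst_def)
qed

lemma sum_mult_swap:
 fixes c :: "'b => real"
 shows "(\<Sum>x\<in>S. c x * (\<Sum>m\<in>M. h m x)) = (\<Sum>m\<in>M. \<Sum>x\<in>S. c x * h m x)"
 unfolding sum_distrib_left by (rule sum.swap)

text \<open>Markov's inequality for \<open>kexp\<close>, with a union over the cuts, the sizes
  \<open>k\<close> and the times \<open>i\<close>. The large vertex multiplies \<open>kexp\<close>
  by at most \<open>n\<close>, so all events together cost a polynomial of degree 4 in
  \<open>n + 1\<close>.\<close>

lemma kall_fail:
 fixes p :: "nat => real"
 assumes A: "finite A" and p: "\<And>i. p i >= 0" "sum p A <= 1" and lam: "\<theta> >= 0"
  and m: "(\<Sum>k\<in>A. p k * (real k * exp (\<theta> * real k))) <= 1" and n: "n >= 1"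
 shows "(\<Sum>xs\<in>lsn A n. wt p xs * of_bool (\<not> kall X n xs)) <= 2 * real (n + 1) ^ 4 * exp (- \<theta> * X)"
proof -
 define E where "E = exp (- \<theta> * X)"
 have mark: "1 <= E * kexp \<theta> st" if b: "b \<in> set st" "real b > X" for st b
 proof -
  have "\<theta> * X <= \<theta> * real b" using b lam by (intro mult_left_mono) auto
  then have "1 <= E * exp (\<theta> * real b)" unfolding E_def by (simp add: exp_add[symmetric])
  also have "... <= E * kexp \<theta> st" by (intro mult_left_mono kexp_member b) (simp add: E_def)
  finally show ?thesis .
 qed
 define F1 where "F1 m i xs = E * kexp \<theta> (run kst (take i (drop m xs)) [0])" for m i and xs :: "nat list"
 define F2 where "F2 m k i xs = E * kexp \<theta> (run kst (take i (take m xs)) (bigst k (run kst (drop m xs) [0])))" for m k i and xs :: "nat list"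
 have F: "0 <= F1 m i xs" "0 <= F2 m k i xs" for m i k xs by (auto simp: F1_def F2_def E_def kexp_nonneg)
 have pt: "of_bool (\<not> kall X n xs) <= (\<Sum>m\<le>n. (\<Sum>i\<le>n. F1 m i xs) + (\<Sum>k\<le>n. \<Sum>i\<le>n. F2 m k i xs))"
  if xs: "length xs = n" for xs
 proof (cases "kall X n xs")
  case True
  then show ?thesis by (simp add: sum_nonneg F)
 next
  case False
  then obtain m k where mk: "m <= n" "k <= n" "\<not> kbd X (drop m xs) k (take m xs)" by (auto simp: kall_def)
  have ge: "(\<Sum>i\<le>n. F1 m i xs) + (\<Sum>k\<le>n. \<Sum>i\<le>n. F2 m k i xs) <= (\<Sum>m\<le>n. (\<Sum>i\<le>n. F1 m i xs) + (\<Sum>k\<le>n. \<Sum>i\<le>n. F2 m k i xs))"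
   by (rule member_le_sum) (use mk in \<open>auto simp: sum_nonneg F\<close>)
  define S1 where "S1 i = set (run kst (take i (drop m xs)) [0])" for i
  define S2 where "S2 i = set (run kst (take i (take m xs)) (bigst k (run kst (drop m xs) [0])))" for i
  have "(\<exists>i\<le>n. \<exists>b\<in>S1 i. real b > X) \<or> (\<exists>i\<le>n. \<exists>b\<in>S2 i. real b > X)"
  proof (rule ccontr)
   assume "\<not> ?thesis"
   then have a: "\<And>i b. i <= n ==> b \<in> S1 i ==> real b <= X" "\<And>i b. i <= n ==> b \<in> S2 i ==> real b <= X"
    by (auto simp: not_less)
   have l: "i <= length (drop m xs) ==> i <= n" "i <= length (take m xs) ==> i <= n" for i using xs by auto
   have "kbd X (drop m xs) k (take m xs)" unfolding kbd_def S1_def[symmetric] S2_def[symmetric] using a l by blast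
   then show False using mk(3) by blast
  qed
  then have "1 <= (\<Sum>i\<le>n. F1 m i xs) + (\<Sum>k\<le>n. \<Sum>i\<le>n. F2 m k i xs)"
  proof (elim disjE exE conjE bexE)
   fix i b assume b: "i <= n" "b \<in> S1 i" "real b > X"
   have "1 <= F1 m i xs" unfolding F1_def by (rule mark[of b]) (use b in \<open>auto simp: S1_def\<close>)
   also have "... <= (\<Sum>i\<le>n. F1 m i xs)" by (rule member_le_sum) (use b F in auto)
   finally have "1 <= (\<Sum>i\<le>n. F1 m i xs)" .
   moreover have "0 <= (\<Sum>k\<le>n. \<Sum>i\<le>n. F2 m k i xs)" by (intro sum_nonneg F)
   ultimately show ?thesis by linarith
  next
   fix i b assume b: "i <= n" "b \<in> S2 i" "real b > X"
   have "1 <= F2 m k i xs" unfolding F2_def by (rule mark[of b]) (use b in \<open>simp_all only: S2_def\<close>)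
   also have "... <= (\<Sum>i\<le>n. F2 m k i xs)" by (rule member_le_sum) (use b F in auto)
   also have "... <= (\<Sum>k\<le>n. \<Sum>i\<le>n. F2 m k i xs)" by (rule member_le_sum) (use mk F in \<open>auto simp: sum_nonneg\<close>)
   finally have "1 <= (\<Sum>k\<le>n. \<Sum>i\<le>n. F2 m k i xs)" .
   moreover have "0 <= (\<Sum>i\<le>n. F1 m i xs)" by (intro sum_nonneg F)
   ultimately show ?thesis by linarith
  qed
  then have "1 <= (\<Sum>m\<le>n. (\<Sum>i\<le>n. F1 m i xs) + (\<Sum>k\<le>n. \<Sum>i\<le>n. F2 m k i xs))" using ge by linarith
  then show ?thesis using False by simp
 qed
 have s1: "(\<Sum>xs\<in>lsn A n. wt p xs * F1 m i xs) <= E" if mn: "m <= n" for m i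
 proof -
  define i' where "i' = min i (n - m)"
  have "(\<Sum>xs\<in>lsn A n. wt p xs * F1 m i xs) <= (\<Sum>xs\<in>lsn A (n - m). wt p xs * (E * kexp \<theta> (run kst (take i xs) [0])))"
   unfolding F1_def by (rule sum_lsn_drop[where g = "%ys. E * kexp \<theta> (run kst (take i ys) [0])"]) (use A p mn in \<open>auto simp: E_def kexp_nonneg\<close>)
  also have "... = (\<Sum>xs\<in>lsn A (n - m). wt p xs * (E * kexp \<theta> (run kst (take i' xs) [0])))"
   by (intro sum.cong refl) (simp add: lsn_def i'_def min_def)
  also have "... <= (\<Sum>xs\<in>lsn A i'. wt p xs * (E * kexp \<theta> (run kst xs [0])))"
   by (rule sum_lsn_take[where g = "%ys. E * kexp \<theta> (run kst ys [0])"]) (use A p in \<open>auto simp: E_def kexp_nonneg i'_def\<close>)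
  also have "... = E * (\<Sum>xs\<in>lsn A i'. wt p xs * kexp \<theta> (run kst xs [0]))"
   by (simp add: sum_distrib_left mult_ac)
  also have "... <= E * kexp \<theta> [0]" by (intro mult_left_mono kexp_run A p m) (simp add: E_def)
  finally show ?thesis by simp
 qed
 have s2: "(\<Sum>xs\<in>lsn A n. wt p xs * F2 m k i xs) <= E * real n" if mn: "m <= n" "k <= n" for m k i
 proof -
  define i' where "i' = min i m"
  obtain r where nr: "n = m + r" using mn le_Suc_ex by blast
  have "(\<Sum>xs\<in>lsn A n. wt p xs * F2 m k i xs) =
    (\<Sum>xs\<in>lsn A m. \<Sum>ys\<in>lsn A r. wt p ys * (wt p xs * (E * kexp \<theta> (run kst (take i' xs) (bigst k (run kst ys [0]))))))"
   unfolding nr sum_lsn_add by (intro sum.cong refl) (auto simp: F2_def lsn_def i'_def min_def mult_ac)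
  also have "... = (\<Sum>ys\<in>lsn A r. wt p ys * (\<Sum>xs\<in>lsn A m. wt p xs * (E * kexp \<theta> (run kst (take i' xs) (bigst k (run kst ys [0]))))))"
   unfolding sum_distrib_left by (rule sum.swap)
  also have "... <= (\<Sum>ys\<in>lsn A r. wt p ys * (E * (real n * kexp \<theta> (run kst ys [0]))))"
  proof (intro sum_mono mult_left_mono)
   fix ys
   have "(\<Sum>xs\<in>lsn A m. wt p xs * (E * kexp \<theta> (run kst (take i' xs) (bigst k (run kst ys [0])))))
     <= (\<Sum>xs\<in>lsn A i'. wt p xs * (E * kexp \<theta> (run kst xs (bigst k (run kst ys [0])))))"
    by (rule sum_lsn_take[where g = "%xs. E * kexp \<theta> (run kst xs (bigst k (run kst ys [0])))"]) (use A p in \<open>auto simp: E_def kexp_nonneg i'_def\<close>)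
   also have "... = E * (\<Sum>xs\<in>lsn A i'. wt p xs * kexp \<theta> (run kst xs (bigst k (run kst ys [0]))))"
    by (simp add: sum_distrib_left mult_ac)
   also have "... <= E * kexp \<theta> (bigst k (run kst ys [0]))" by (intro mult_left_mono kexp_run A p m) (simp add: E_def)
   also have "... <= E * (real n * kexp \<theta> (run kst ys [0]))" by (intro mult_left_mono kexp_bigst mn n) (simp add: E_def)
   finally show "(\<Sum>xs\<in>lsn A m. wt p xs * (E * kexp \<theta> (run kst (take i' xs) (bigst k (run kst ys [0])))))
     <= E * (real n * kexp \<theta> (run kst ys [0]))" .
  qed (simp add: wt_nonneg p)
  also have "... = E * real n * (\<Sum>ys\<in>lsn A r. wt p ys * kexp \<theta> (run kst ys [0]))"
   by (simp add: sum_distrib_left mult_ac)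
  also have "... <= E * real n * kexp \<theta> [0]" by (intro mult_left_mono kexp_run A p m) (simp add: E_def)
  finally show ?thesis by simp
 qed
 have "(\<Sum>xs\<in>lsn A n. wt p xs * of_bool (\<not> kall X n xs)) \<le>
   (\<Sum>xs\<in>lsn A n. wt p xs * (\<Sum>m\<le>n. (\<Sum>i\<le>n. F1 m i xs) + (\<Sum>k\<le>n. \<Sum>i\<le>n. F2 m k i xs)))"
  by (intro sum_mono mult_left_mono pt wt_nonneg p) (simp add: lsn_def)
 also have "... = (\<Sum>m\<le>n. (\<Sum>i\<le>n. \<Sum>xs\<in>lsn A n. wt p xs * F1 m i xs) + (\<Sum>k\<le>n. \<Sum>i\<le>n. \<Sum>xs\<in>lsn A n. wt p xs * F2 m k i xs))"
  by (simp only: sum_mult_swap distrib_left sum.distrib)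
 also have "... <= (\<Sum>m\<le>n. (\<Sum>i\<le>n. E) + (\<Sum>k\<le>n. \<Sum>i\<le>n. E * real n))"
  by (intro sum_mono add_mono) (auto intro: s1 s2)
 also have "... = E * (real (n + 1) ^ 2 + real (n + 1) ^ 3 * real n)"
  by (simp add: power2_eq_square power3_eq_cube algebra_simps)
 also have "... <= E * (real (n + 1) ^ 4 + real (n + 1) ^ 4)"
 proof (intro mult_left_mono add_mono)
  show "real (n + 1) ^ 2 <= real (n + 1) ^ 4" by (rule power_increasing) auto
  have "real (n + 1) ^ 3 * real n <= real (n + 1) ^ 3 * real (n + 1)" by (intro mult_left_mono) auto
  then show "real (n + 1) ^ 3 * real n <= real (n + 1) ^ 4" by (simp add: eval_nat_numeral mult_ac)
 qed (simp add: E_def)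
 finally show ?thesis unfolding E_def by (simp only: mult.commute mult_2[symmetric])
qed

subsection \<open>Slowly varying functions\<close>

text \<open>The uniform convergence theorem for slowly varying functions in additive form. For a
  sequence of counterexamples \<open>x n\<close>, \<open>x n + u n\<close>, the shifts in
  \<open>[0, 3]\<close> with small increments from either base point have measure above 2 for a
  large index. After translation by \<open>u n\<close> the two sets meet, and a common shift bounds
  the increment between the base points by \<open>1/2 + 1/2\<close>.\<close>

lemma uniform_convergence_log:
 fixes h :: "real => real"
 assumes meas: "h \<in> borel_measurable borel"
  and lim: "\<And>v. ((%x. h (x + v) - h x) \<longlongrightarrow> 0) at_top"
 shows "\<exists>X. \<forall>x\<ge>X. \<forall>u\<in>{0..1}. \<bar>h (x + u) - h x\<bar> <= 1"
proof (rule ccontr)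
 assume "\<not> ?thesis"
 then have ex: "\<exists>x u. x >= real n \<and> u \<in> {0..1} \<and> \<bar>h (x + u) - h x\<bar> > 1" for n
  unfolding not_ex not_all not_imp not_le Bex_def[symmetric] by (meson not_le)
 define P where "P n t \<longleftrightarrow> fst t >= real n \<and> snd t \<in> {0..1} \<and> \<bar>h (fst t + snd t) - h (fst t)\<bar> > 1" for n t
 define t where "t n = (SOME t. P n t)" for n
 have P: "P n (t n)" for n unfolding t_def by (rule someI_ex) (use ex[of n] in \<open>auto simp: P_def\<close>)
 define x where "x n = fst (t n)" for n
 define u where "u n = snd (t n)" for n
 have xu: "x n >= real n" "u n \<in> {0..1}" "\<bar>h (x n + u n) - h (x n)\<bar> > 1" for n
  using P[of n] by (auto simp: x_def u_def P_def)
 have big: "\<exists>N. measure lebesgue {v \<in> {0..3}. \<forall>m\<ge>N. \<bar>h (z m + v) - h (z m)\<bar> <= 1/2} > 2"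
  if z: "\<And>n. z n >= real n" for z :: "nat => real"
 proof -
  define U where "U N = {v \<in> {0..3}. \<forall>m\<ge>N. \<bar>h (z m + v) - h (z m)\<bar> <= 1/2}" for N
  have [measurable]: "h \<in> borel_measurable borel" by (rule meas)
  have Ub: "U N \<in> sets borel" for N unfolding U_def by measurable
  then have Ul: "U N \<in> sets lebesgue" for N by simp
  have zlim: "filterlim z at_top sequentially" by (rule filterlim_at_top_mono[OF filterlim_real_sequentially]) (use z in auto)
  have un: "(\<Union>N. U N) = {0..3}"
  proof (intro equalityI subsetI)
   fix v assume v: "v \<in> {0..3::real}"
   have "(%m. h (z m + v) - h (z m)) \<longlonglongrightarrow> 0" using filterlim_compose[OF lim zlim] .
   then have "\<forall>\<^sub>F m in sequentially. dist (h (z m + v) - h (z m)) 0 < 1/2" by (rule tendstoD) simp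
   then obtain N where "\<forall>m\<ge>N. dist (h (z m + v) - h (z m)) 0 < 1/2" by (auto simp: eventually_sequentially)
   then have "v \<in> U N" using v by (auto simp: U_def dist_real_def less_imp_le)
   then show "v \<in> (\<Union>N. U N)" by blast
  qed (auto simp: U_def)
  have "(%N. measure lebesgue (U N)) \<longlonglongrightarrow> measure lebesgue (\<Union>N. U N)"
  proof (rule Lim_measure_incseq)
   show "incseq U" by (rule incseq_SucI) (auto simp: U_def)
   show "emeasure lebesgue (\<Union>N. U N) \<noteq> \<infinity>" unfolding un by simp
  qed (use Ul in auto)
  then have "(%N. measure lebesgue (U N)) \<longlonglongrightarrow> 3" unfolding un by simp
  then have "\<forall>\<^sub>F N in sequentially. measure lebesgue (U N) > 2" by (rule order_tendstoD) simp
  then show ?thesis unfolding U_def by (auto simp: eventually_sequentially)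
 qed
 have xu_ge: "x n + u n >= real n" for n using xu(1,2)[of n] by simp
 obtain N1 where N1: "measure lebesgue {v \<in> {0..3}. \<forall>m\<ge>N1. \<bar>h (x m + v) - h (x m)\<bar> <= 1/2} > 2"
  using big[of x] xu(1) by blast
 obtain N2 where N2: "measure lebesgue {v \<in> {0..3}. \<forall>m\<ge>N2. \<bar>h ((x m + u m) + v) - h (x m + u m)\<bar> <= 1/2} > 2"
  using big[of "%m. x m + u m"] xu_ge by blast
 define N where "N = max N1 N2"
 define U where "U = {v \<in> {0..3}. \<bar>h (x N + v) - h (x N)\<bar> <= 1/2}"
 define V where "V = {v \<in> {0..3}. \<bar>h ((x N + u N) + v) - h (x N + u N)\<bar> <= 1/2}"
 have [measurable]: "h \<in> borel_measurable borel" by (rule meas)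
 have "U \<in> sets borel" "V \<in> sets borel" unfolding U_def V_def by measurable
 then have UV: "U \<in> sets lebesgue" "V \<in> sets lebesgue" by simp_all
 have lmU: "U \<in> lmeasurable" by (rule bounded_set_imp_lmeasurable[OF _ UV(1)]) (auto simp: U_def intro: bounded_subset[of "{0..3}"])
 have lmV: "V \<in> lmeasurable" by (rule bounded_set_imp_lmeasurable[OF _ UV(2)]) (auto simp: V_def intro: bounded_subset[of "{0..3}"])
 have mU: "measure lebesgue U > 2" by (rule less_le_trans[OF N1 measure_mono_fmeasurable[OF _ _ lmU]]) (auto simp: U_def N_def)
 have mV: "measure lebesgue V > 2" by (rule less_le_trans[OF N2 measure_mono_fmeasurable[OF _ _ lmV]]) (auto simp: V_def N_def)
 define V' where "V' = (%v. u N + v) ` V"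
 have mV': "measure lebesgue V' > 2" unfolding V'_def by (simp add: measure_translation mV)
 have lmV': "V' \<in> lmeasurable" unfolding V'_def using lmV by (rule measurable_translation)
 \<comment> \<open>Both sets lie in \<open>[0, 4]\<close> and have measure greater than 2.\<close>
 have "U \<inter> V' \<noteq> {}"
 proof
  assume e: "U \<inter> V' = {}"
  have "measure lebesgue (U \<union> V') = measure lebesgue U + measure lebesgue V'"
   by (rule measure_Union[OF _ _ _ _ e]) (use lmU lmV' in \<open>auto simp: fmeasurable_def\<close>)
  moreover have "measure lebesgue (U \<union> V') <= measure lebesgue {0..4::real}"
  proof (rule measure_mono_fmeasurable)
   have "0 <= u N" "u N <= 1" using xu(2)[of N] by simp_all
   then have "V' \<subseteq> {0..4}" unfolding V'_def V_def by force
   moreover have "U \<subseteq> {0..4}" unfolding U_def by force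
   ultimately show "U \<union> V' \<subseteq> {0..4}" by blast
   show "U \<union> V' \<in> sets lebesgue" using lmU lmV' by (intro sets.Un fmeasurableD)
  qed simp
  ultimately show False using mU mV' by simp
 qed
 then obtain v where v: "u N + v \<in> U" "v \<in> V" by (auto simp: V'_def)
 have a: "\<bar>h (x N + (u N + v)) - h (x N)\<bar> <= 1/2" using v(1) by (simp add: U_def)
 have b: "\<bar>h (x N + (u N + v)) - h (x N + u N)\<bar> <= 1/2" using v(2) by (simp add: V_def add.assoc)
 show False using a b xu(3)[of N] by linarith
qed

definition lnL :: "(real => real) => real => real" where
 "lnL L x = ln (L (exp x))"

lemma lnL_lim:
 assumes "slowly_varying L"
 shows "((%x. lnL L (x + v) - lnL L x) \<longlongrightarrow> 0) at_top"
proof -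
 have pos: "L x > 0" if "x > 0" for x using assms that by (simp add: slowly_varying_def)
 have "((%x. L (exp v * x) / L x) \<longlongrightarrow> 1) at_top" using assms by (simp add: slowly_varying_def)
 then have "((%x. L (exp v * exp x) / L (exp x)) \<longlongrightarrow> 1) at_top"
  by (rule filterlim_compose) (rule exp_at_top)
 then have "((%x. ln (L (exp v * exp x) / L (exp x))) \<longlongrightarrow> ln 1) at_top" by (rule tendsto_ln) simp
 moreover have "ln (L (exp v * exp x) / L (exp x)) = lnL L (x + v) - lnL L x" for x
  unfolding lnL_def by (simp add: ln_div pos exp_add mult.commute less_imp_neq[OF pos, symmetric])
 ultimately show ?thesis by simp
qed

lemma lnL_uct:
 assumes "slowly_varying L"
 obtains X where "\<And>x u. x >= X ==> 0 <= u ==> u <= 1 ==> \<bar>lnL L (x + u) - lnL L x\<bar> <= 1"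
proof -
 have "L \<in> borel_measurable borel" using assms by (simp add: slowly_varying_def)
 then have "(%x. lnL L x) \<in> borel_measurable borel" unfolding lnL_def by measurable
 from uniform_convergence_log[OF this lnL_lim[OF assms]] show ?thesis using that by force
qed

text \<open>In logarithmic coordinates \<open>k\<close> and \<open>n\<close> are at distance at most
  \<open>ln (1 / \<epsilon>)\<close>, which is covered by boundedly many steps of length at most
  one, each changing \<open>ln L\<close> by at most 1.\<close>

lemma sv_regular:
 assumes sv: "slowly_varying L" and eps: "0 < \<epsilon>" "\<epsilon> < 1"
 shows "\<exists>c\<ge>1. \<exists>N\<ge>1. \<forall>n\<ge>N. \<forall>k. \<epsilon> * real n <= real k --> k <= n --> L (real k) <= c * L (real n) \<and> L (real n) <= c * L (real k)"
proof -
 obtain X where X: "\<And>x u. x >= X ==> 0 <= u ==> u <= 1 ==> \<bar>lnL L (x + u) - lnL L x\<bar> <= 1"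
  using lnL_uct[OF sv] by blast
 have pos: "L x > 0" if "x > 0" for x using sv that by (simp add: slowly_varying_def)
 have step: "\<bar>lnL L (x + real j) - lnL L x\<bar> <= real j" if "x >= X" for x j
 proof (induction j)
  case (Suc j)
  have "\<bar>lnL L ((x + real j) + 1) - lnL L (x + real j)\<bar> <= 1" by (rule X) (use that in auto)
  then have "\<bar>lnL L ((x + real j) + 1) - lnL L x\<bar> <= real j + 1" using Suc by linarith
  then show ?case by (simp add: add_ac)
 qed simp
 define m where "m = nat \<lceil>ln (1/\<epsilon>)\<rceil> + 1"
 have far: "\<bar>lnL L (x + u) - lnL L x\<bar> <= real m" if "x >= X" "0 <= u" "u <= ln (1/\<epsilon>)" for x u
 proof -
  define j where "j = nat \<lfloor>u\<rfloor>"
  have j: "real j <= u" "u <= real j + 1" using that by (auto simp: j_def)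
  have "\<bar>lnL L ((x + real j) + (u - real j)) - lnL L (x + real j)\<bar> <= 1" by (rule X) (use that j in auto)
  moreover have "\<bar>lnL L (x + real j) - lnL L x\<bar> <= real j" by (rule step[OF that(1)])
  ultimately have "\<bar>lnL L (x + u) - lnL L x\<bar> <= real j + 1" by (simp add: algebra_simps)
  moreover have "real j + 1 <= real m"
  proof -
   have "real j <= ln (1/\<epsilon>)" using j that by linarith
   then show ?thesis unfolding m_def by linarith
  qed
  ultimately show ?thesis by linarith
 qed
 define N where "N = nat \<lceil>exp X / \<epsilon>\<rceil> + 1"
 have "L (real k) <= exp (real m) * L (real n) \<and> L (real n) <= exp (real m) * L (real k)"
  if n: "n >= N" and k: "\<epsilon> * real n <= real k" "k <= n" for n k
 proof -
  have n0: "n > 0" using n by (simp add: N_def)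
  have "0 < \<epsilon> * real n" using eps n0 by simp
  then have k0: "real k > 0" using k(1) by linarith
  have "exp X / \<epsilon> <= real n" using n unfolding N_def by linarith
  then have "exp X <= \<epsilon> * real n" using eps by (simp add: pos_divide_le_eq mult.commute)
  then have "exp X <= real k" using k by linarith
  then have x: "ln (real k) >= X" using k0 by (simp add: ln_ge_iff)
  have u1: "0 <= ln (real n) - ln (real k)" using k k0 n0 by simp
  have "real n / real k <= 1 / \<epsilon>" using k k0 eps by (simp add: field_simps)
  then have "ln (real n / real k) <= ln (1 / \<epsilon>)" using k0 n0 eps by (subst ln_le_cancel_iff) auto
  then have u2: "ln (real n) - ln (real k) <= ln (1 / \<epsilon>)" using k0 n0 by (simp add: ln_div)
  have "\<bar>lnL L (ln (real k) + (ln (real n) - ln (real k))) - lnL L (ln (real k))\<bar> <= real m" by (rule far[OF x u1 u2])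
  then have "\<bar>ln (L (real n)) - ln (L (real k))\<bar> <= real m" using k0 n0 by (simp add: lnL_def)
  then have "ln (L (real k)) <= ln (exp (real m) * L (real n))" "ln (L (real n)) <= ln (exp (real m) * L (real k))"
   using pos[OF k0] pos[of "real n"] n0 by (auto simp: ln_mult)
  then show ?thesis using pos[OF k0] pos[of "real n"] n0 by simp
 qed
 then show ?thesis by (intro exI[of _ "exp (real m)"] conjI exI[of _ N]) (auto simp: N_def)
qed

text \<open>A Potter bound: in logarithmic coordinates unit increments of \<open>ln L\<close>
  eventually stay below \<open>\<eta>\<close>, so \<open>ln L\<close> grows at most with slope
  \<open>\<eta>\<close>; the finitely many initial indices go into \<open>C\<close>.\<close>

lemma sv_potter:
 assumes sv: "slowly_varying L" and eta: "\<eta> > 0"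
 shows "\<exists>C\<ge>0. \<forall>i\<ge>1. \<bar>ln (L (real i))\<bar> <= \<eta> * ln (real i) + C"
proof -
 obtain X0 where X0: "\<And>x u. x >= X0 ==> 0 <= u ==> u <= 1 ==> \<bar>lnL L (x + u) - lnL L x\<bar> <= 1"
  using lnL_uct[OF sv] by blast
 have "\<forall>\<^sub>F x in at_top. dist (lnL L (x + 1) - lnL L x) 0 < \<eta>" by (rule tendstoD[OF lnL_lim[OF sv] eta])
 then obtain X1 where X1: "\<And>x. x >= X1 ==> \<bar>lnL L (x + 1) - lnL L x\<bar> <= \<eta>"
  by (force simp: eventually_at_top_linorder dist_real_def intro: less_imp_le)
 define X where "X = max 0 (max X0 X1)"
 have step: "\<bar>lnL L (X + real j) - lnL L X\<bar> <= \<eta> * real j" for j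
 proof (induction j)
  case (Suc j)
  have "\<bar>lnL L ((X + real j) + 1) - lnL L (X + real j)\<bar> <= \<eta>" by (rule X1) (simp add: X_def)
  then have "\<bar>lnL L ((X + real j) + 1) - lnL L X\<bar> <= \<eta> * real j + \<eta>" using Suc by linarith
  then show ?case by (simp add: algebra_simps)
 qed simp
 have far: "\<bar>lnL L x\<bar> <= \<eta> * x + (1 + \<bar>lnL L X\<bar>)" if x: "x >= X" for x
 proof -
  define j where "j = nat \<lfloor>x - X\<rfloor>"
  have j: "real j <= x - X" "x - X <= real j + 1" using x by (auto simp: j_def)
  have "\<bar>lnL L ((X + real j) + (x - X - real j)) - lnL L (X + real j)\<bar> <= 1" by (rule X0) (use j in \<open>auto simp: X_def\<close>)
  then have "\<bar>lnL L x - lnL L (X + real j)\<bar> <= 1" by simp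
  moreover have "\<eta> * real j <= \<eta> * x" using j eta by (intro mult_left_mono) (auto simp: X_def)
  ultimately show ?thesis using step[of j] by linarith
 qed
 define S where "S = insert (1 + \<bar>lnL L X\<bar>) ((%i. \<bar>ln (L (real i))\<bar>) ` {..nat \<lceil>exp X\<rceil>})"
 define C where "C = Max S"
 have fin: "finite S" by (simp add: S_def)
 have C: "1 + \<bar>lnL L X\<bar> <= C" unfolding C_def using fin by (intro Max_ge) (auto simp: S_def)
 have "\<bar>ln (L (real i))\<bar> <= \<eta> * ln (real i) + C" if i: "i >= 1" for i
 proof (cases "ln (real i) >= X")
  case True
  have "\<bar>lnL L (ln (real i))\<bar> <= \<eta> * ln (real i) + (1 + \<bar>lnL L X\<bar>)" by (rule far[OF True])
  then show ?thesis using C i by (simp add: lnL_def)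
 next
  case False
  then have "exp (ln (real i)) < exp X" by simp
  then have "real i < exp X" using i by simp
  then have "i <= nat \<lceil>exp X\<rceil>" by linarith
  then have "\<bar>ln (L (real i))\<bar> <= C" unfolding C_def using fin by (intro Max_ge) (auto simp: S_def)
  moreover have "0 <= \<eta> * ln (real i)" using eta i by simp
  ultimately show ?thesis by linarith
 qed
 moreover have "C >= 0" using C by linarith
 ultimately show ?thesis by blast
qed

section \<open>Subcritical laws with a moment of order between one and two\<close>

lemma exp_powr_bounds:
 fixes x :: real
 assumes x: "0 <= x" "x <= 1" and q: "1 < q" "q <= 2"
 shows "exp x <= 1 + x + x powr q" and "exp (- x) <= 1 - x + x powr q" and "exp x <= 1 + 2 * x powr (q - 1)"
proof -
 have e: "exp z <= 1 + z + z\<^sup>2" if "\<bar>z\<bar> <= 1" for z :: real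
 proof (cases "z >= 0")
  case True
  then show ?thesis using that exp_bound[of z] by simp
 next
  case False
  define t where "t = - z"
  have t: "0 <= t" "t <= 1" using False that by (auto simp: t_def)
  have "1 <= (1 - t + t\<^sup>2) * (1 + t)" using t by (simp add: algebra_simps power2_eq_square eval_nat_numeral)
  also have "... <= (1 - t + t\<^sup>2) * exp t" using t exp_ge_add_one_self[of t] by (intro mult_left_mono) auto
  finally have "exp (- t) <= 1 - t + t\<^sup>2" by (simp add: exp_minus divide_inverse[symmetric] field_simps)
  then show ?thesis by (simp add: t_def)
 qed
 have x2: "x\<^sup>2 <= x powr q"
 proof (cases "x = 0")
  case False
  then have "x powr 2 <= x powr q" using x q by (intro powr_mono') auto
  then show ?thesis using False x by (simp add: powr_numeral)
 qed simp
 show "exp x <= 1 + x + x powr q" using e[of x] x x2 by linarith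
 show "exp (- x) <= 1 - x + x powr q" using e[of "- x"] x x2 by simp
 have "x\<^sup>2 <= x" using x by (simp add: power2_eq_square mult_left_le)
 moreover have "x <= x powr (q - 1)"
 proof (cases "x = 0")
  case False
  then have "x powr 1 <= x powr (q - 1)" using x q by (intro powr_mono') auto
  then show ?thesis using False x by simp
 qed simp
 ultimately show "exp x <= 1 + 2 * x powr (q - 1)" using e[of x] x by linarith
qed

text \<open>A remainder of order \<open>q\<close> instead of 2, because the law may have no second
  moment. The factor \<open>exp x\<close> replaces the restriction to \<open>x <= 1\<close>.\<close>

lemma exp_powr_global:
 fixes x :: real
 assumes x: "0 <= x" and q: "1 < q" "q <= 2"
 shows "exp x <= 1 + x + x powr q * exp x"
proof (cases "x <= 1")
 case True
 have "x powr q * 1 <= x powr q * exp x" using x by (intro mult_left_mono) auto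
 then show ?thesis using exp_powr_bounds(1)[OF x True q] by linarith
next
 case False
 then have "1 * exp x <= x powr q * exp x" using q by (intro mult_right_mono ge_one_powr_ge_zero) auto
 then show ?thesis using x by linarith
qed

text \<open>\<open>p\<close> is the weight sequence normalized to a probability.
  \<open>regular\<close> makes the weights of a letter of order \<open>n\<close> comparable, and
  \<open>lower\<close> prevents the weight of one large letter from being smaller than
  polynomial.\<close>

locale subcritical =
 fixes p :: "nat => real" and \<kappa> d m b C0 :: real
 assumes p_nonneg: "\<And>k. p k >= 0"
  and p_sums: "p sums 1"
  and mean: "(%k. real k * p k) sums \<kappa>"
  and subcrit: "\<kappa> < 1"
  and d: "0 < d" "d <= 1"
  and moment: "(%k. real k powr (1 + d) * p k) sums m"
  and regular: "\<And>\<epsilon>. 0 < \<epsilon> ==> \<epsilon> < 1 ==> \<exists>c\<ge>1. \<exists>N\<ge>1. \<forall>n\<ge>N. \<forall>k. \<epsilon> * real n <= real k --> k <= n --> p k <= c * p n \<and> p n <= c * p k"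
  and lower: "C0 > 0" "\<And>n. n >= 1 ==> C0 * real n powr (- b) <= p n"
begin

abbreviation "q \<equiv> 1 + d"

lemma q: "1 < q" "q <= 2" using d by auto

lemma kappa_nonneg: "0 <= \<kappa>" using mean p_nonneg by (auto intro!: sums_le[OF _ sums_zero mean])

lemma m_nonneg: "0 <= m" using moment p_nonneg by (auto intro!: sums_le[OF _ sums_zero moment])

lemma part_le:
 assumes "f sums (s::real)" "\<And>k. 0 <= f k"
 shows "(\<Sum>k\<le>y. f k) <= s" using sum_le_suminf[of f "{..y}"] assms by (auto simp: sums_iff)

lemma p_part: "(\<Sum>k\<le>y. p k) <= 1" by (rule part_le[OF p_sums p_nonneg])

lemma mean_part: "(\<Sum>k\<le>y. real k * p k) <= \<kappa>" by (rule part_le[OF mean]) (simp add: p_nonneg)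

lemma moment_part: "(\<Sum>k\<le>y. real k powr q * p k) <= m" by (rule part_le[OF moment]) (simp add: p_nonneg)

lemma p0_le_1: "p 0 <= 1" using p_part[of 0] by simp

lemma tail_bound: "1 - (\<Sum>k\<le>y. p k) <= m / real (y + 1) powr q"
proof -
 have lim: "(%N. \<Sum>k\<le>N. p k) \<longlonglongrightarrow> 1" using p_sums by (simp add: sums_def_le)
 have "\<forall>N\<ge>y. (\<Sum>k\<le>N. p k) <= (\<Sum>k\<le>y. p k) + m / real (y + 1) powr q"
 proof (intro allI impI)
  fix N assume N: "y <= N"
  have "{..N} = {..y} \<union> {y<..N}" using N by auto
  then have "(\<Sum>k\<le>N. p k) = (\<Sum>k\<le>y. p k) + (\<Sum>k\<in>{y<..N}. p k)"
   by (simp only:) (rule sum.union_disjoint, auto)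
  also have "(\<Sum>k\<in>{y<..N}. p k) <= (\<Sum>k\<in>{y<..N}. real k powr q * p k / real (y + 1) powr q)"
  proof (rule sum_mono)
   fix k assume "k \<in> {y<..N}"
   then have "real (y + 1) powr q <= real k powr q" using q by (intro powr_mono2) auto
   then have "p k * real (y + 1) powr q <= p k * real k powr q" by (rule mult_left_mono) (rule p_nonneg)
   then show "p k <= real k powr q * p k / real (y + 1) powr q" by (simp add: pos_le_divide_eq mult.commute)
  qed
  also have "... <= (\<Sum>k\<le>N. real k powr q * p k) / real (y + 1) powr q"
   unfolding sum_divide_distrib[symmetric] by (intro divide_right_mono sum_mono2) (auto simp: p_nonneg)
  also have "... <= m / real (y + 1) powr q" by (intro divide_right_mono moment_part) simp
  finally show "(\<Sum>k\<le>N. p k) <= (\<Sum>k\<le>y. p k) + m / real (y + 1) powr q" by simp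
 qed
 then have "1 <= (\<Sum>k\<le>y. p k) + m / real (y + 1) powr q" by (intro LIMSEQ_le_const2[OF lim]) blast
 then show ?thesis by simp
qed

lemma powr_sk: "0 <= s ==> (s * real k) powr q = s powr q * real k powr q" by (simp add: powr_mult)

lemma mgf_upper:
 assumes "0 <= s" "s * real y <= 1"
 shows "(\<Sum>k\<le>y. p k * exp (s * real k)) <= exp (s * \<kappa> + s powr q * m)"
proof -
 have "(\<Sum>k\<le>y. p k * exp (s * real k)) <= (\<Sum>k\<le>y. p k + s * (real k * p k) + s powr q * (real k powr q * p k))"
 proof (rule sum_mono)
  fix k assume "k \<in> {..y}"
  then have "s * real k <= s * real y" using assms by (intro mult_left_mono) auto
  then have "exp (s * real k) <= 1 + s * real k + (s * real k) powr q" using assms q by (intro exp_powr_bounds(1)) auto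
  then have "p k * exp (s * real k) <= p k * (1 + s * real k + (s * real k) powr q)" by (rule mult_left_mono) (rule p_nonneg)
  then show "p k * exp (s * real k) <= p k + s * (real k * p k) + s powr q * (real k powr q * p k)"
   by (simp add: powr_sk assms algebra_simps)
 qed
 also have "... = (\<Sum>k\<le>y. p k) + s * (\<Sum>k\<le>y. real k * p k) + s powr q * (\<Sum>k\<le>y. real k powr q * p k)"
  by (simp add: sum.distrib sum_distrib_left)
 also have "... <= 1 + s * \<kappa> + s powr q * m"
  using assms by (intro add_mono mult_left_mono p_part mean_part moment_part) auto
 also have "... <= exp (s * \<kappa> + s powr q * m)" unfolding add.assoc by (rule exp_ge_add_one_self)
 finally show ?thesis .
qed

text \<open>The price for dropping \<open>s * y <= 1\<close> is the factor
  \<open>exp (s * y)\<close>. This form is used with \<open>s\<close> of order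
  \<open>ln n / n\<close> and \<open>y\<close> of order \<open>n\<close>, where that factor is a
  small power of \<open>n\<close>.\<close>

lemma mgf_upper_global:
 assumes "0 <= s"
 shows "(\<Sum>k\<le>y. p k * exp (s * real k)) <= exp (s * \<kappa> + s powr q * exp (s * real y) * m)"
proof -
 have "(\<Sum>k\<le>y. p k * exp (s * real k)) <= (\<Sum>k\<le>y. p k + s * (real k * p k) + s powr q * exp (s * real y) * (real k powr q * p k))"
 proof (rule sum_mono)
  fix k assume "k \<in> {..y}"
  then have "s * real k <= s * real y" using assms by (intro mult_left_mono) auto
  then have "(s * real k) powr q * exp (s * real k) <= (s * real k) powr q * exp (s * real y)" by (intro mult_left_mono) auto
  moreover have "exp (s * real k) <= 1 + s * real k + (s * real k) powr q * exp (s * real k)"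
   using assms q by (intro exp_powr_global) auto
  ultimately have "exp (s * real k) <= 1 + s * real k + (s * real k) powr q * exp (s * real y)" by linarith
  then have "p k * exp (s * real k) <= p k * (1 + s * real k + (s * real k) powr q * exp (s * real y))" by (rule mult_left_mono) (rule p_nonneg)
  then show "p k * exp (s * real k) <= p k + s * (real k * p k) + s powr q * exp (s * real y) * (real k powr q * p k)"
   by (simp add: powr_sk assms algebra_simps)
 qed
 also have "... = (\<Sum>k\<le>y. p k) + s * (\<Sum>k\<le>y. real k * p k) + s powr q * exp (s * real y) * (\<Sum>k\<le>y. real k powr q * p k)"
  by (simp add: sum.distrib sum_distrib_left)
 also have "... <= 1 + s * \<kappa> + s powr q * exp (s * real y) * m"
  using assms by (intro add_mono mult_left_mono p_part mean_part moment_part) auto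
 also have "... <= exp (s * \<kappa> + s powr q * exp (s * real y) * m)" unfolding add.assoc by (rule exp_ge_add_one_self)
 finally show ?thesis .
qed

lemma mgf_lower:
 assumes "0 <= s" "s * real y <= 1"
 shows "(\<Sum>k\<le>y. p k * exp (- (s * real k))) <= exp (- s * (\<Sum>k\<le>y. real k * p k) + s powr q * m)"
proof -
 have "(\<Sum>k\<le>y. p k * exp (- (s * real k))) <= (\<Sum>k\<le>y. p k + - s * (real k * p k) + s powr q * (real k powr q * p k))"
 proof (rule sum_mono)
  fix k assume "k \<in> {..y}"
  then have "s * real k <= s * real y" using assms by (intro mult_left_mono) auto
  then have "exp (- (s * real k)) <= 1 - s * real k + (s * real k) powr q" using assms q by (intro exp_powr_bounds(2)) auto
  then have "p k * exp (- (s * real k)) <= p k * (1 - s * real k + (s * real k) powr q)" by (rule mult_left_mono) (rule p_nonneg)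
  then show "p k * exp (- (s * real k)) <= p k + - s * (real k * p k) + s powr q * (real k powr q * p k)"
   by (simp add: powr_sk assms algebra_simps)
 qed
 also have "... = (\<Sum>k\<le>y. p k) + - s * (\<Sum>k\<le>y. real k * p k) + s powr q * (\<Sum>k\<le>y. real k powr q * p k)"
  by (simp only: sum.distrib sum_distrib_left)
 also have "... <= 1 + - s * (\<Sum>k\<le>y. real k * p k) + s powr q * m"
  using assms by (intro add_mono mult_left_mono p_part moment_part order_refl) auto
 also have "... <= exp (- s * (\<Sum>k\<le>y. real k * p k) + s powr q * m)"
  unfolding add.assoc by (rule exp_ge_add_one_self)
 finally show ?thesis .
qed

lemma mgf_zero:
 assumes "\<bar>c\<bar> <= 1" and e: "exp c <= 1 + c + r" "0 <= r"
 shows "(\<Sum>k\<le>y. p k * exp (c * of_bool (k = 0))) <= exp (p 0 * c + r)"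
proof -
 have "(\<Sum>k\<le>y. p k * exp (c * of_bool (k = 0))) = (\<Sum>k\<le>y. p k + (if k = 0 then p 0 * (exp c - 1) else 0))"
  by (intro sum.cong refl) (auto simp: algebra_simps)
 also have "... = (\<Sum>k\<le>y. p k) + p 0 * (exp c - 1)" by (simp add: sum.distrib)
 also have "... <= 1 + p 0 * (c + r)" using e by (intro add_mono p_part mult_left_mono p_nonneg) auto
 also have "... <= 1 + (p 0 * c + r)" using mult_right_mono[OF p0_le_1 e(2)] by (simp add: algebra_simps)
 also have "... <= exp (p 0 * c + r)" by (rule exp_ge_add_one_self)
 finally show ?thesis .
qed

lemma prefix_chernoff:
 assumes t: "t <= n" and f: "(\<Sum>k\<le>y. p k * exp (f k)) <= exp c" and R: "real t * c - a <= R"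
 shows "(\<Sum>xs\<in>lsn {..y} n. wt p xs * of_bool (a <= sum_list (map f (take t xs)))) <= exp R"
proof -
 have "(\<Sum>xs\<in>lsn {..y} n. wt p xs * of_bool (a <= sum_list (map f (take t xs)))) \<le>
   (\<Sum>xs\<in>lsn {..y} t. wt p xs * of_bool (a <= sum_list (map f xs)))"
  by (rule sum_lsn_take[where g = "%xs. of_bool (a <= sum_list (map f xs))"]) (use t p_part p_nonneg in auto)
 also have "... <= exp (- a) * (\<Sum>k\<le>y. p k * exp (f k)) ^ t" by (rule chernoff) (auto simp: p_nonneg)
 also have "... <= exp (- a) * exp c ^ t" by (intro mult_left_mono power_mono f sum_nonneg) (auto simp: p_nonneg)
 also have "... = exp (real t * c - a)" by (simp add: exp_of_nat_mult[symmetric] exp_add[symmetric])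
 also have "... <= exp R" using R by simp
 finally show ?thesis .
qed

text \<open>The factor 4 counts two quantities with two signs, the factor \<open>n + 1\<close> the
  prefixes; each event is bounded by Chernoff's method with the same \<open>s\<close>. The
  truncation at \<open>y\<close> enters through the deficit of the truncated mean.\<close>

lemma lln_fail:
 assumes s: "0 <= s" "s * real y <= 1" "s <= 1" and y: "1 <= y"
 shows "(\<Sum>xs\<in>lsn {..y} n. wt p xs * of_bool (\<not> lln \<kappa> (p 0) e n xs)) \<le>
  4 * real (n + 1) * exp (- s * e * real n + real n * (s * (\<kappa> - (\<Sum>k\<le>y. real k * p k)) + s powr q * (m + 1)))"
proof -
 define \<tau> where "\<tau> = \<kappa> - (\<Sum>k\<le>y. real k * p k)"
 have tau: "0 <= \<tau>" using mean_part[of y] by (simp add: \<tau>_def)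
 define R where "R = - s * e * real n + real n * (s * \<tau> + s powr q * (m + 1))"
 define f1 where "f1 k = s * real k" for k :: nat
 define f2 where "f2 k = - (s * real k)" for k :: nat
 define f3 where "f3 k = s * of_bool (k = 0)" for k :: nat
 define f4 where "f4 k = - s * of_bool (k = 0)" for k :: nat
 have sm: "sum_list (map f1 ys) = s * real (sum_list ys)" "sum_list (map f2 ys) = - (s * real (sum_list ys))"
  "sum_list (map f3 ys) = s * real (zeros ys)" "sum_list (map f4 ys) = - (s * real (zeros ys))" for ys
  by (induction ys) (auto simp: f1_def f2_def f3_def f4_def zeros_def algebra_simps)
 define a1 where "a1 t = s * (\<kappa> * real t + e * real n)" for t :: nat
 define a2 where "a2 t = - (s * (\<kappa> * real t - e * real n))" for t :: nat
 define a3 where "a3 t = s * (p 0 * real t + e * real n)" for t :: nat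
 define a4 where "a4 t = - (s * (p 0 * real t - e * real n))" for t :: nat
 define B where "B t xs = of_bool (a1 t <= sum_list (map f1 (take t xs))) + of_bool (a2 t <= sum_list (map f2 (take t xs)))
   + of_bool (a3 t <= sum_list (map f3 (take t xs))) + (of_bool (a4 t <= sum_list (map f4 (take t xs))) :: real)" for t xs
 have B0: "0 <= B t xs" for t xs by (simp add: B_def)
 have pt: "of_bool (\<not> lln \<kappa> (p 0) e n xs) <= (\<Sum>t\<le>n. B t xs)" for xs
 proof (cases "lln \<kappa> (p 0) e n xs")
  case True
  then show ?thesis by (simp add: sum_nonneg B0)
 next
  case False
  then obtain t where t: "t <= n" "\<not> (\<bar>real (sum_list (take t xs)) - \<kappa> * real t\<bar> <= e * real n \<and>
    \<bar>real (zeros (take t xs)) - p 0 * real t\<bar> <= e * real n)" by (auto simp: lln_def)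
  then consider "\<kappa> * real t + e * real n <= real (sum_list (take t xs))" | "real (sum_list (take t xs)) <= \<kappa> * real t - e * real n"
   | "p 0 * real t + e * real n <= real (zeros (take t xs))" | "real (zeros (take t xs)) <= p 0 * real t - e * real n"
   by linarith
  then have "1 <= B t xs"
  proof cases
   case 1
   then have "a1 t <= sum_list (map f1 (take t xs))" unfolding sm a1_def using s by (intro mult_left_mono) auto
   then show ?thesis by (simp add: B_def)
  next
   case 2
   then have "a2 t <= sum_list (map f2 (take t xs))" unfolding sm a2_def neg_le_iff_le using s by (intro mult_left_mono) auto
   then show ?thesis by (simp add: B_def)
  next
   case 3
   then have "a3 t <= sum_list (map f3 (take t xs))" unfolding sm a3_def using s by (intro mult_left_mono) auto
   then show ?thesis by (simp add: B_def)
  next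
   case 4
   then have "a4 t <= sum_list (map f4 (take t xs))" unfolding sm a4_def neg_le_iff_le using s by (intro mult_left_mono) auto
   then show ?thesis by (simp add: B_def)
  qed
  also have "B t xs <= (\<Sum>t\<le>n. B t xs)" by (rule member_le_sum) (use t B0 in auto)
  finally show ?thesis using False by simp
 qed
 have sq0: "0 <= s powr q" by simp
 have nonneg: "0 <= real t * (s * \<tau>)" "real t * (s * \<tau>) <= real n * (s * \<tau>)"
   "real t * (s powr q * m) <= real n * (s powr q * (m + 1))" "real t * (s powr q) <= real n * (s powr q * (m + 1))" if "t <= n" for t
 proof -
  show "0 <= real t * (s * \<tau>)" using s tau by simp
  show "real t * (s * \<tau>) <= real n * (s * \<tau>)" using that s tau by (intro mult_right_mono) auto
  show "real t * (s powr q * m) <= real n * (s powr q * (m + 1))" using that m_nonneg by (intro mult_mono mult_left_mono) auto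
  have "s powr q * 1 <= s powr q * (m + 1)" using m_nonneg by (intro mult_left_mono) auto
  then show "real t * (s powr q) <= real n * (s powr q * (m + 1))" using that by (intro mult_mono) auto
 qed
 have each: "(\<Sum>xs\<in>lsn {..y} n. wt p xs * B t xs) <= 4 * exp R" if t: "t <= n" for t
 proof -
  have 1: "(\<Sum>xs\<in>lsn {..y} n. wt p xs * of_bool (a1 t <= sum_list (map f1 (take t xs)))) <= exp R"
  proof (rule prefix_chernoff[OF t])
   show "(\<Sum>k\<le>y. p k * exp (f1 k)) <= exp (s * \<kappa> + s powr q * m)" unfolding f1_def by (rule mgf_upper[OF s(1,2)])
   have "real t * (s * \<kappa> + s powr q * m) - a1 t = real t * (s powr q * m) - s * e * real n"
    by (simp add: a1_def algebra_simps)
   then show "real t * (s * \<kappa> + s powr q * m) - a1 t <= R"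
    using nonneg[OF t] unfolding R_def distrib_left[of "real n"] by linarith
  qed
  have 2: "(\<Sum>xs\<in>lsn {..y} n. wt p xs * of_bool (a2 t <= sum_list (map f2 (take t xs)))) <= exp R"
  proof (rule prefix_chernoff[OF t])
   show "(\<Sum>k\<le>y. p k * exp (f2 k)) <= exp (- s * (\<Sum>k\<le>y. real k * p k) + s powr q * m)"
    unfolding f2_def by (rule mgf_lower[OF s(1,2)])
   have "real t * (- s * (\<Sum>k\<le>y. real k * p k) + s powr q * m) - a2 t = real t * (s * \<tau>) + real t * (s powr q * m) - s * e * real n"
    unfolding a2_def \<tau>_def by (simp add: algebra_simps)
   then show "real t * (- s * (\<Sum>k\<le>y. real k * p k) + s powr q * m) - a2 t <= R"
    using nonneg[OF t] unfolding R_def distrib_left[of "real n"] by linarith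
  qed
  have 3: "(\<Sum>xs\<in>lsn {..y} n. wt p xs * of_bool (a3 t <= sum_list (map f3 (take t xs)))) <= exp R"
  proof (rule prefix_chernoff[OF t])
   show "(\<Sum>k\<le>y. p k * exp (f3 k)) <= exp (p 0 * s + s powr q)"
    unfolding f3_def by (rule mgf_zero) (use s exp_powr_bounds(1)[OF s(1,3) q] in auto)
   have "real t * (p 0 * s + s powr q) - a3 t = real t * (s powr q) - s * e * real n" by (simp add: a3_def algebra_simps)
   then show "real t * (p 0 * s + s powr q) - a3 t <= R"
    using nonneg[OF t] unfolding R_def distrib_left[of "real n"] by linarith
  qed
  have 4: "(\<Sum>xs\<in>lsn {..y} n. wt p xs * of_bool (a4 t <= sum_list (map f4 (take t xs)))) <= exp R"
  proof (rule prefix_chernoff[OF t])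
   show "(\<Sum>k\<le>y. p k * exp (f4 k)) <= exp (p 0 * (- s) + s powr q)"
    unfolding f4_def by (rule mgf_zero) (use s exp_powr_bounds(2)[OF s(1,3) q] in auto)
   have "real t * (p 0 * (- s) + s powr q) - a4 t = real t * (s powr q) - s * e * real n" by (simp add: a4_def algebra_simps)
   then show "real t * (p 0 * (- s) + s powr q) - a4 t <= R"
    using nonneg[OF t] unfolding R_def distrib_left[of "real n"] by linarith
  qed
  show ?thesis using 1 2 3 4 unfolding B_def distrib_left sum.distrib by linarith
 qed
 have "(\<Sum>xs\<in>lsn {..y} n. wt p xs * of_bool (\<not> lln \<kappa> (p 0) e n xs)) <= (\<Sum>xs\<in>lsn {..y} n. wt p xs * (\<Sum>t\<le>n. B t xs))"
  by (intro sum_mono mult_left_mono pt wt_nonneg p_nonneg)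
 also have "... = (\<Sum>t\<le>n. \<Sum>xs\<in>lsn {..y} n. wt p xs * B t xs)" by (rule sum_mult_swap)
 also have "... <= (\<Sum>t\<le>n. 4 * exp R)" by (rule sum_mono) (simp add: each)
 finally show ?thesis by (simp add: R_def \<tau>_def algebra_simps)
qed

text \<open>This verifies the hypothesis of \<open>kexp_run\<close>: as \<open>s\<close> tends to 0
  the right hand side tends to \<open>\<kappa> < 1\<close>, which is where subcriticality controls
  the ancestral degree sums.\<close>

lemma mgf_size_biased:
 assumes "0 <= s" "s * real y <= 1"
 shows "(\<Sum>k\<le>y. p k * (real k * exp (s * real k))) <= \<kappa> + 2 * s powr d * m"
proof -
 have "(\<Sum>k\<le>y. p k * (real k * exp (s * real k))) <= (\<Sum>k\<le>y. real k * p k + 2 * s powr d * (real k powr q * p k))"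
 proof (rule sum_mono)
  fix k assume "k \<in> {..y}"
  then have "s * real k <= s * real y" using assms by (intro mult_left_mono) auto
  then have "exp (s * real k) <= 1 + 2 * (s * real k) powr (q - 1)" using assms q by (intro exp_powr_bounds(3)) auto
  then have "real k * exp (s * real k) <= real k * (1 + 2 * (s powr d * real k powr d))"
   using assms by (intro mult_left_mono) (auto simp: powr_mult)
  also have "... = real k + 2 * s powr d * real k powr q"
   using powr_add[of "real k" 1 d] by (cases "k = 0") (auto simp: algebra_simps)
  finally have "p k * (real k * exp (s * real k)) <= p k * (real k + 2 * s powr d * real k powr q)"
   by (rule mult_left_mono) (rule p_nonneg)
  then show "p k * (real k * exp (s * real k)) <= real k * p k + 2 * s powr d * (real k powr q * p k)"
   by (simp add: algebra_simps)
 qed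
 also have "... = (\<Sum>k\<le>y. real k * p k) + 2 * s powr d * (\<Sum>k\<le>y. real k powr q * p k)"
  by (simp only: sum.distrib sum_distrib_left)
 also have "... <= \<kappa> + 2 * s powr d * m" by (intro add_mono mult_left_mono mean_part moment_part) auto
 finally show ?thesis .
qed

text \<open>Chosen so that \<open>(1 - gam) * (1 + d) = 1 + d / 2\<close>. The truncation level
  \<open>n^(1 - gam)\<close> is then exceeded by some of \<open>n\<close> letters with probability
  of order \<open>n^(- d / 2)\<close>, while with the tilt \<open>ss n = n^-(1 - gam)\<close> the
  product \<open>n * ss n = n^gam\<close> still diverges.\<close>

definition gam :: real where "gam = d / (2 * (1 + d))"

definition yy :: "nat => nat" where "yy n = nat \<lfloor>real n powr (1 - gam)\<rfloor>"

definition ss :: "nat => real" where "ss n = real n powr (- (1 - gam))"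

lemma gam: "0 < gam" "gam <= 1/4" "(1 - gam) * q = 1 + d / 2"
proof -
 show "0 < gam" using d by (simp add: gam_def)
 show "gam <= 1/4" using d by (simp add: gam_def divide_le_eq)
 show "(1 - gam) * q = 1 + d / 2" using d by (simp add: gam_def field_simps)
qed

text \<open>A bound for the probability that \<open>n\<close> independent letters fail: some letter
  exceeds the truncation level, the law of large numbers is violated, or an ancestral degree sum
  exceeds \<open>n^(1 - gam / 2)\<close>.\<close>

definition PB :: "real => nat => real" where
 "PB e n = (1 - (\<Sum>k\<le>yy n. p k) ^ n)
   + (\<Sum>xs\<in>lsn {..yy n} n. wt p xs * of_bool (\<not> lln \<kappa> (p 0) e n xs))
   + (\<Sum>xs\<in>lsn {..yy n} n. wt p xs * of_bool (\<not> kall (real n powr (1 - gam / 2)) n xs))"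

lemma yy_bounds: "n >= 1 ==> 1 <= yy n" "real (yy n) <= real n powr (1 - gam)" "real n powr (1 - gam) <= real (yy n + 1)"
 "n >= 1 ==> yy n <= n"
proof -
 show le: "real (yy n) <= real n powr (1 - gam)" unfolding yy_def by simp
 show "real n powr (1 - gam) <= real (yy n + 1)" unfolding yy_def by linarith
 assume n: "n >= 1"
 have "1 <= real n powr (1 - gam)" using n gam by (intro ge_one_powr_ge_zero) auto
 then show "1 <= yy n" unfolding yy_def by linarith
 have "real n powr (1 - gam) <= real n powr 1" using n gam by (intro powr_mono) auto
 then have "real (yy n) <= real n" using le n by simp
 then show "yy n <= n" by simp
qed

lemma PB_tendsto: assumes e: "e > 0" shows "PB e \<longlonglongrightarrow> 0"
proof -
 have ylim: "filterlim yy at_top sequentially"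
 proof -
  have "filterlim (%n. real n powr (1 - gam)) at_top sequentially"
  proof -
   have "0 < 1 - gam" using gam by simp
   then show ?thesis by real_asymp
  qed
  then have "filterlim (%n. \<lfloor>real n powr (1 - gam)\<rfloor>) at_top sequentially"
   by (rule filterlim_compose[OF filterlim_floor_sequentially])
  then show ?thesis unfolding yy_def by (rule filterlim_compose[OF filterlim_nat_sequentially])
 qed
 have t1: "(%n. 1 - (\<Sum>k\<le>yy n. p k) ^ n) \<longlonglongrightarrow> 0"
 proof (rule tendsto_sandwich[of "%_. 0"])
  show "\<forall>\<^sub>F n in sequentially. 0 <= 1 - (\<Sum>k\<le>yy n. p k) ^ n"
   by (intro always_eventually allI) (simp add: power_le_one sum_nonneg p_nonneg p_part)
  show "\<forall>\<^sub>F n in sequentially. 1 - (\<Sum>k\<le>yy n. p k) ^ n <= m * real n powr (- d / 2)"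
  proof (rule eventually_sequentiallyI[of 1])
   fix n :: nat assume n: "1 <= n"
   define \<tau> where "\<tau> = 1 - (\<Sum>k\<le>yy n. p k)"
   have t: "0 <= \<tau>" "\<tau> <= 1" using p_part[of "yy n"] by (auto simp: \<tau>_def sum_nonneg p_nonneg)
   have "\<tau> <= m / real (yy n + 1) powr q" unfolding \<tau>_def by (rule tail_bound)
   also have "... <= m / (real n powr (1 - gam)) powr q"
    using yy_bounds[of n] n q by (intro divide_left_mono m_nonneg powr_mono2 mult_pos_pos) auto
   also have "... = m * real n powr (- (1 + d/2))" unfolding powr_powr gam(3) powr_minus_divide by simp
   finally have "real n * \<tau> <= real n * (m * real n powr (- (1 + d/2)))" by (intro mult_left_mono) auto
   also have "... = m * (real n powr 1 * real n powr (- (1 + d/2)))" using n by simp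
   also have "... = m * real n powr (- d/2)" unfolding powr_add[symmetric] by simp
   finally have nt: "real n * \<tau> <= m * real n powr (- d/2)" .
   have "1 + real n * (- \<tau>) <= (1 + (- \<tau>)) ^ n" using t by (intro Bernoulli_inequality) auto
   then have B: "1 - real n * \<tau> <= (1 - \<tau>) ^ n" by simp
   have "(\<Sum>k\<le>yy n. p k) = 1 - \<tau>" by (simp add: \<tau>_def)
   then show "1 - (\<Sum>k\<le>yy n. p k) ^ n <= m * real n powr (- d / 2)" using nt B by (simp only:)
  qed
  have "- d / 2 < 0" using d by simp
  then have "(%n. real n powr (- d / 2)) \<longlonglongrightarrow> 0"
   by (intro tendsto_neg_powr filterlim_real_sequentially)
  from tendsto_mult_left[OF this, of m] show "(%n. m * real n powr (- d / 2)) \<longlonglongrightarrow> 0" by simp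
 qed simp
 have s_ok: "0 <= ss n" "ss n * real (yy n) <= 1" "ss n <= 1" "real n * ss n = real n powr gam" "ss n * real n powr (1 - gam / 2) = real n powr (gam / 2)"
  if n: "n >= 1" for n
 proof -
  show "0 <= ss n" by (simp add: ss_def)
  have "ss n * real (yy n) <= ss n * real n powr (1 - gam)" by (intro mult_left_mono yy_bounds) (simp add: ss_def)
  also have "... = 1" using n by (simp add: ss_def powr_add[symmetric])
  finally show "ss n * real (yy n) <= 1" .
  have "real n powr (- (1 - gam)) <= real n powr 0" using n gam by (intro powr_mono) auto
  then show "ss n <= 1" using n by (simp add: ss_def)
  have "real n powr 1 * real n powr (- (1 - gam)) = real n powr gam" unfolding powr_add[symmetric] by simp
  then show "real n * ss n = real n powr gam" using n by (simp add: ss_def)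
  show "ss n * real n powr (1 - gam / 2) = real n powr (gam / 2)" unfolding ss_def powr_add[symmetric] by simp
 qed
 have slim: "ss \<longlonglongrightarrow> 0"
  unfolding ss_def using gam by (intro tendsto_neg_powr filterlim_real_sequentially) auto
 have sdlim: "(%n. ss n powr d) \<longlonglongrightarrow> 0"
  using tendsto_zero_powrI[OF slim tendsto_const[of d]] d by (simp add: ss_def)
 have taulim: "(%n. \<kappa> - (\<Sum>k\<le>yy n. real k * p k)) \<longlonglongrightarrow> 0"
 proof -
  have "(%N. \<Sum>k\<le>N. real k * p k) \<longlonglongrightarrow> \<kappa>" using mean by (simp add: sums_def_le)
  then have "(%n. \<Sum>k\<le>yy n. real k * p k) \<longlonglongrightarrow> \<kappa>" using ylim by (rule filterlim_compose)
  from tendsto_diff[OF tendsto_const[of \<kappa>] this] show ?thesis by simp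
 qed
 have t2: "(%n. \<Sum>xs\<in>lsn {..yy n} n. wt p xs * of_bool (\<not> lln \<kappa> (p 0) e n xs)) \<longlonglongrightarrow> 0"
 proof (rule tendsto_sandwich[of "%_. 0"])
  have "(%n. (\<kappa> - (\<Sum>k\<le>yy n. real k * p k)) + ss n powr d * (m + 1)) \<longlonglongrightarrow> 0 + 0 * (m + 1)"
   by (intro tendsto_intros taulim sdlim)
  then have ev: "\<forall>\<^sub>F n in sequentially. (\<kappa> - (\<Sum>k\<le>yy n. real k * p k)) + ss n powr d * (m + 1) < e / 2"
   by (rule order_tendstoD) (use e in simp)
  show "\<forall>\<^sub>F n in sequentially. (\<Sum>xs\<in>lsn {..yy n} n. wt p xs * of_bool (\<not> lln \<kappa> (p 0) e n xs)) <= 4 * real (n + 1) * exp (- (e / 2) * real n powr gam)"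
   using ev eventually_ge_at_top[of 1]
  proof eventually_elim
   case (elim n)
   let ?\<tau> = "\<kappa> - (\<Sum>k\<le>yy n. real k * p k)"
   note s = s_ok[OF elim(2)]
   have "ss n powr q = ss n * ss n powr d" using s(1) powr_add[of "ss n" 1 d] by (cases "ss n = 0") auto
   then have "- ss n * e * real n + real n * (ss n * ?\<tau> + ss n powr q * (m + 1)) = (real n * ss n) * ((?\<tau> + ss n powr d * (m + 1)) - e)"
    by (simp add: algebra_simps)
   also have "... <= real n powr gam * (- (e / 2))" unfolding s(4) using elim(1) by (intro mult_left_mono) auto
   also have "... = - (e / 2) * real n powr gam" by simp
   finally have ex: "- ss n * e * real n + real n * (ss n * ?\<tau> + ss n powr q * (m + 1)) <= - (e / 2) * real n powr gam" .
   have "(\<Sum>xs\<in>lsn {..yy n} n. wt p xs * of_bool (\<not> lln \<kappa> (p 0) e n xs)) \<le>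
     4 * real (n + 1) * exp (- ss n * e * real n + real n * (ss n * ?\<tau> + ss n powr q * (m + 1)))"
    by (rule lln_fail[OF s(1-3)]) (use yy_bounds(1) elim in auto)
   also have "... <= 4 * real (n + 1) * exp (- (e / 2) * real n powr gam)" using ex by (intro mult_left_mono) auto
   finally show ?case .
  qed
  show "(%n. 4 * real (n + 1) * exp (- (e / 2) * real n powr gam)) \<longlonglongrightarrow> 0"
   using e gam(1) by real_asymp
 qed (auto intro!: always_eventually sum_nonneg mult_nonneg_nonneg wt_nonneg p_nonneg)
 have t3: "(%n. \<Sum>xs\<in>lsn {..yy n} n. wt p xs * of_bool (\<not> kall (real n powr (1 - gam / 2)) n xs)) \<longlonglongrightarrow> 0"
 proof (rule tendsto_sandwich[of "%_. 0"])
  have "(%n. \<kappa> + 2 * ss n powr d * m) \<longlonglongrightarrow> \<kappa> + 2 * 0 * m"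
   by (intro tendsto_intros sdlim)
  then have ev: "\<forall>\<^sub>F n in sequentially. \<kappa> + 2 * ss n powr d * m < 1"
   by (rule order_tendstoD) (use subcrit in simp)
  show "\<forall>\<^sub>F n in sequentially. (\<Sum>xs\<in>lsn {..yy n} n. wt p xs * of_bool (\<not> kall (real n powr (1 - gam / 2)) n xs)) <= 2 * real (n + 1) ^ 4 * exp (- (real n powr (gam / 2)))"
   using ev eventually_ge_at_top[of 1]
  proof eventually_elim
   case (elim n)
   note s = s_ok[OF elim(2)]
   have "(\<Sum>k\<le>yy n. p k * (real k * exp (ss n * real k))) <= 1" using mgf_size_biased[OF s(1,2)] elim(1) by linarith
   from kall_fail[of "{..yy n}" p "ss n" n "real n powr (1 - gam / 2)", OF _ p_nonneg p_part s(1) this elim(2)]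
   show ?case using s(5) by simp
  qed
  show "(%n. 2 * real (n + 1) ^ 4 * exp (- (real n powr (gam / 2)))) \<longlonglongrightarrow> 0"
   using gam(1) by real_asymp
 qed (auto intro!: always_eventually sum_nonneg mult_nonneg_nonneg wt_nonneg p_nonneg)
 have "(%n. PB e n) \<longlonglongrightarrow> 0 + 0 + 0" unfolding PB_def by (intro tendsto_add t1 t2 t3)
 then show ?thesis by simp
qed


text \<open>A code has letter sum \<open>n\<close>, whereas the mean sum of its \<open>n + 1\<close>
  letters is about \<open>\<kappa> * n\<close>. With all letters at most \<open>y\<close> this
  deviation can be estimated by an exponential moment.\<close>

lemma nobig_sum:
 "(\<Sum>ks\<in>{ks \<in> luk n. set ks \<subseteq> {..y}}. wt p ks) <= exp (- (s * real n) + real (n + 1) * (s * \<kappa> + s powr q * exp (s * real y) * m))"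
 if s: "0 <= s"
proof -
 have "(\<Sum>ks\<in>{ks \<in> luk n. set ks \<subseteq> {..y}}. wt p ks) <= (\<Sum>ks\<in>lsn {..y} (n + 1). wt p ks * of_bool (s * real n <= sum_list (map (%k. s * real k) ks)))"
 proof (rule sum_le_included[where i = id])
  show "\<forall>ks\<in>{ks \<in> luk n. set ks \<subseteq> {..y}}. \<exists>ks'\<in>lsn {..y} (n + 1). id ks' = ks \<and> wt p ks <= wt p ks' * of_bool (s * real n <= sum_list (map (%k. s * real k) ks'))"
  proof
   fix ks assume ks: "ks \<in> {ks \<in> luk n. set ks \<subseteq> {..y}}"
   have "sum_list (map (%k. s * real k) xs) = s * real (sum_list xs)" for xs :: "nat list"
    by (induction xs) (auto simp: algebra_simps)
   then show "\<exists>ks'\<in>lsn {..y} (n + 1). id ks' = ks \<and> wt p ks <= wt p ks' * of_bool (s * real n <= sum_list (map (%k. s * real k) ks'))"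
    using ks by (intro bexI[of _ ks]) (auto simp: luk_def lsn_def)
  qed
 qed (auto simp: finite_luk finite_lsn wt_nonneg p_nonneg)
 also have "... <= exp (- (s * real n)) * (\<Sum>k\<le>y. p k * exp (s * real k)) ^ (n + 1)"
  by (rule chernoff) (auto simp: p_nonneg)
 also have "... <= exp (- (s * real n)) * exp (s * \<kappa> + s powr q * exp (s * real y) * m) ^ (n + 1)"
  by (intro mult_left_mono power_mono mgf_upper_global s sum_nonneg) (auto simp: p_nonneg)
 also have "... = exp (- (s * real n) + real (n + 1) * (s * \<kappa> + s powr q * exp (s * real y) * m))"
  by (simp only: exp_of_nat_mult[symmetric] exp_add[symmetric])
 finally show ?thesis .
qed

text \<open>Codes without a letter above \<open>\<epsilon> * n\<close> are negligible against
  \<open>p n\<close>. For the others the cycle lemma frees the remaining letters, which are bad with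
  probability at most \<open>PB e n\<close>, and the large letter weighs at most
  \<open>c * p n\<close>. The same construction bounds the total weight from below by a multiple of
  \<open>p n\<close>.\<close>

theorem good_tendsto:
 assumes e: "e > 0"
 shows "(%n. badw p \<kappa> (p 0) e (real n powr (1 - gam / 2)) n / (\<Sum>ks\<in>luk n. wt p ks)) \<longlonglongrightarrow> 0"
proof -
 \<comment> \<open>With the tilt \<open>s = a * ln n / n\<close> the main term of the exponent is
   \<open>- a * (1 - \<kappa>) * ln n\<close>, which beats the lower bound \<open>n^(- b)\<close>
   for \<open>p n\<close> by a factor \<open>n^-2\<close>.\<close>
 define a where "a = (\<bar>b\<bar> + 2) / (1 - \<kappa>)"
 have a: "a > 0" "a * (1 - \<kappa>) = \<bar>b\<bar> + 2" using subcrit by (auto simp: a_def)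
 \<comment> \<open>The first bound leaves room for a large letter beside a typical sum
   \<open>\<kappa> * n\<close>; the second keeps \<open>exp (s * \<epsilon> * n)\<close> below
   \<open>n^(d / 2)\<close>.\<close>
 define \<epsilon> where "\<epsilon> = min ((1 - \<kappa>) / 2) (d / (2 * a))"
 have eps: "0 < \<epsilon>" "\<epsilon> < 1" "\<epsilon> <= (1 - \<kappa>) / 2" "\<epsilon> * a <= d / 2"
 proof -
  show "0 < \<epsilon>" using a d subcrit by (simp add: \<epsilon>_def)
  show "\<epsilon> <= (1 - \<kappa>) / 2" unfolding \<epsilon>_def by (rule min.cobounded1)
  then have "2 * \<epsilon> <= 1 - \<kappa>" by (simp add: pos_le_divide_eq mult.commute)
  then show "\<epsilon> < 1" using kappa_nonneg by simp
  have "\<epsilon> <= d / (2 * a)" by (simp add: \<epsilon>_def)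
  then show "\<epsilon> * a <= d / 2" using a(1) by (simp add: pos_le_divide_eq mult.commute)
 qed
 obtain c N where c: "c >= 1" "N >= 1" "\<And>n k. n >= N ==> \<epsilon> * real n <= real k ==> k <= n ==> p k <= c * p n \<and> p n <= c * p k"
  using regular[OF eps(1,2)] by blast
 \<comment> \<open>A fixed tolerance for the lower bound on the total weight, independent of the
   given \<open>e\<close>; it satisfies \<open>\<kappa> + e0 + \<epsilon> < 1\<close>.\<close>
 define e0 where "e0 = (1 - \<kappa>) / 4"
 have e0: "e0 > 0" using subcrit by (simp add: e0_def)
 define y where "y n = nat \<lfloor>\<epsilon> * real n\<rfloor>" for n
 have y: "real (y n) <= \<epsilon> * real n" "\<epsilon> * real n < real (y n) + 1" for n using eps by (auto simp: y_def)
 define s where "s n = a * ln (real n) / real n" for n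
 define Z where "Z n = (\<Sum>ks\<in>luk n. wt p ks)" for n
 define X where "X n = real n powr (1 - gam / 2)" for n
 define NB where "NB n = (\<Sum>ks\<in>{ks \<in> luk n. set ks \<subseteq> {..y n}}. wt p ks)" for n
 have lowp: "p n > 0" if "n >= 1" for n
 proof -
  have "0 < C0 * real n powr (- b)" using lower(1) that by simp
  then show ?thesis using lower(2)[OF that] by linarith
 qed
 have upper: "badw p \<kappa> (p 0) e (X n) n <= NB n + c * p n * PB e n"
  if n: "n >= N" for n
 proof -
  have n1: "n >= 1" using n c by simp
  let ?Q = "%rest. \<not> (lln \<kappa> (p 0) e n rest \<and> kall (X n) n rest)"
  have "badw p \<kappa> (p 0) e (X n) n <= NB n +
    (\<Sum>rest\<in>{rest \<in> lsn {..n} n. sum_list rest + y n < n \<and> ?Q rest}. p (n - sum_list rest) * wt p rest)"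
   unfolding NB_def
  proof (rule luk_sum_upper[OF p_nonneg])
   fix pre k post assume "pre @ k # post \<in> luk n" "y n < k" "\<not> good \<kappa> (p 0) e (X n) n (pre @ k # post)"
   then show "?Q (post @ pre)" using good_insert[of pre k post n \<kappa> "p 0" e "X n"] by auto
  qed
  also have "(\<Sum>rest\<in>{rest \<in> lsn {..n} n. sum_list rest + y n < n \<and> ?Q rest}. p (n - sum_list rest) * wt p rest)
    <= (\<Sum>rest\<in>{rest \<in> lsn {..n} n. ?Q rest}. c * p n * wt p rest)"
  proof (rule order_trans[OF sum_mono sum_mono2])
   fix rest assume "rest \<in> {rest \<in> lsn {..n} n. sum_list rest + y n < n \<and> ?Q rest}"
   then have "sum_list rest + y n < n" by blast
   \<comment> \<open>The strict excess over \<open>y n\<close> matters: \<open>y n\<close> rounds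
     \<open>\<epsilon> * n\<close> down, and only the next integer is certain to lie in the range of
     \<open>regular\<close>.\<close>
   then have "y n + 1 <= n - sum_list rest" by arith
   then have "real (y n) + 1 <= real (n - sum_list rest)" by linarith
   then have "\<epsilon> * real n <= real (n - sum_list rest)" using y[of n] by linarith
   then have "p (n - sum_list rest) <= c * p n" using c(3)[OF n, of "n - sum_list rest"] by simp
   then show "p (n - sum_list rest) * wt p rest <= c * p n * wt p rest" by (intro mult_right_mono wt_nonneg p_nonneg)
  qed (use c in \<open>auto simp: finite_lsn intro!: mult_nonneg_nonneg wt_nonneg p_nonneg\<close>)
  also have "... = c * p n * (\<Sum>rest\<in>{rest \<in> lsn {..n} n. ?Q rest}. wt p rest)" by (simp add: sum_distrib_left)
  also have "... <= c * p n * PB e n"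
  proof (intro mult_left_mono)
   have sub: "lsn {..yy n} n \<subseteq> lsn {..n} n" using yy_bounds(4)[OF n1] by (auto simp: lsn_def)
   have "(\<Sum>rest\<in>{rest \<in> lsn {..n} n. ?Q rest}. wt p rest)
     <= (\<Sum>rest\<in>(lsn {..n} n - lsn {..yy n} n) \<union> {rest \<in> lsn {..yy n} n. ?Q rest}. wt p rest)"
    by (rule sum_mono2) (auto simp: finite_lsn wt_nonneg p_nonneg)
   also have "... = (\<Sum>rest\<in>lsn {..n} n - lsn {..yy n} n. wt p rest) + (\<Sum>rest\<in>{rest \<in> lsn {..yy n} n. ?Q rest}. wt p rest)"
    by (rule sum.union_disjoint) (auto simp: finite_lsn)
   also have "(\<Sum>rest\<in>lsn {..n} n - lsn {..yy n} n. wt p rest) = (\<Sum>k\<le>n. p k) ^ n - (\<Sum>k\<le>yy n. p k) ^ n"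
    by (subst sum_diff) (auto simp: finite_lsn sub sum_wt_lsn)
   also have "(\<Sum>k\<le>n. p k) ^ n <= 1" by (intro power_le_one p_part sum_nonneg p_nonneg)
   also have "(\<Sum>rest\<in>{rest \<in> lsn {..yy n} n. ?Q rest}. wt p rest) = (\<Sum>rest\<in>lsn {..yy n} n. wt p rest * of_bool (?Q rest))"
    by (rule sum.mono_neutral_cong_left) (auto simp: finite_lsn)
   also have "... <= (\<Sum>rest\<in>lsn {..yy n} n. wt p rest * of_bool (\<not> lln \<kappa> (p 0) e n rest) + wt p rest * of_bool (\<not> kall (X n) n rest))"
    by (rule sum_mono) (auto simp: wt_nonneg p_nonneg)
   finally show "(\<Sum>rest\<in>{rest \<in> lsn {..n} n. ?Q rest}. wt p rest) <= PB e n"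
    unfolding PB_def X_def sum.distrib by linarith
  qed (use c p_nonneg in auto)
  finally show ?thesis by simp
 qed
 \<comment> \<open>At least half of the mass of the independent letters lies in \<open>G\<close>,
   and each such word extends to a code by a letter of weight at least
   \<open>p n / c\<close>.\<close>
 have Zlow: "\<forall>\<^sub>F n in sequentially. p n / (2 * c) <= Z n"
 proof -
  have ev1: "\<forall>\<^sub>F n in sequentially. PB e0 n < 1/2" by (rule order_tendstoD[OF PB_tendsto[OF e0]]) simp
  have ev2: "\<forall>\<^sub>F n in sequentially. real n powr (- gam) < \<epsilon> / 2"
  proof -
   have "(%n. real n powr (- gam)) \<longlonglongrightarrow> 0" using gam(1) by (intro tendsto_neg_powr filterlim_real_sequentially) auto
   then show ?thesis by (rule order_tendstoD) (use eps in simp)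
  qed
  have ev3: "\<forall>\<^sub>F n in sequentially. real n > 2 / \<epsilon>"
   using filterlim_real_sequentially unfolding filterlim_at_top_dense by blast
  show ?thesis using ev1 ev2 ev3 eventually_ge_at_top[of N]
  proof eventually_elim
   case (elim n)
   have n1: "n >= 1" using elim c by simp
   have yyy: "yy n <= y n"
   proof -
    have "real (yy n) <= real n powr 1 * real n powr (- gam)"
     using yy_bounds(2)[of n] unfolding powr_add[symmetric] by simp
    also have "... <= real n * (\<epsilon> / 2)" using n1 elim(2) by (simp add: mult_left_mono)
    finally have "real (yy n) <= \<epsilon> * real n / 2" by (simp add: mult.commute)
    moreover have "\<epsilon> * real n / 2 > 1" using elim(3) eps(1) by (simp add: field_simps)
    ultimately have "real (yy n) < real (y n)" using y(2)[of n] by linarith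
    then show ?thesis by simp
   qed
   define G where "G = {rest \<in> lsn {..yy n} n. lln \<kappa> (p 0) e0 n rest}"
   have Gp: "length rest = n" "set rest \<subseteq> {..y n}" "sum_list rest + y n < n" "\<epsilon> * real n <= real (n - sum_list rest)" if "rest \<in> G" for rest
   proof -
    show len: "length rest = n" using that by (simp add: G_def lsn_def)
    show "set rest \<subseteq> {..y n}" using that yyy by (auto simp: G_def lsn_def)
    have "\<bar>real (sum_list (take n rest)) - \<kappa> * real n\<bar> <= e0 * real n" using that by (auto simp: G_def lln_def)
    then have "real (sum_list rest) <= (\<kappa> + e0) * real n" using len by (simp add: algebra_simps)
    moreover have "(\<kappa> + e0) * real n + \<epsilon> * real n < real n"
    proof -
     have "\<kappa> + e0 + \<epsilon> < 1"
     proof -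
      have "2 * \<epsilon> <= 1 - \<kappa>" using eps(3) by (simp add: pos_le_divide_eq mult.commute)
      moreover have "4 * e0 = 1 - \<kappa>" by (simp add: e0_def)
      ultimately have "4 * (\<kappa> + e0 + \<epsilon>) < 4" using subcrit by simp
      then show ?thesis by simp
     qed
     then have "(\<kappa> + e0 + \<epsilon>) * real n < 1 * real n" using n1 by (intro mult_strict_right_mono) auto
     then show ?thesis by (simp add: algebra_simps)
    qed
    ultimately have lt: "real (sum_list rest) + \<epsilon> * real n < real n" by linarith
    then have "real (sum_list rest) + real (y n) < real n" using y(1)[of n] by linarith
    then show "sum_list rest + y n < n" by linarith
    show "\<epsilon> * real n <= real (n - sum_list rest)" using lt by linarith
   qed
   have "p n / c * (\<Sum>rest\<in>G. wt p rest) <= (\<Sum>rest\<in>G. p (n - sum_list rest) * wt p rest)"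
    unfolding sum_distrib_left
   proof (rule sum_mono)
    fix rest assume "rest \<in> G"
    then have "p n <= c * p (n - sum_list rest)" using c(3)[OF elim(4), of "n - sum_list rest"] Gp(4) by simp
    then have "p n / c <= p (n - sum_list rest)" using c(1) by (simp add: pos_divide_le_eq mult.commute)
    then show "p n / c * wt p rest <= p (n - sum_list rest) * wt p rest" by (intro mult_right_mono wt_nonneg p_nonneg)
   qed
   also have "... <= Z n" unfolding Z_def by (rule luk_sum_lower[OF p_nonneg, where y = "y n"]) (use Gp in blast)
   finally have 1: "p n / c * (\<Sum>rest\<in>G. wt p rest) <= Z n" .
   have "(\<Sum>rest\<in>lsn {..yy n} n. wt p rest) <= (\<Sum>rest\<in>lsn {..yy n} n. wt p rest * of_bool (rest \<in> G) + wt p rest * of_bool (\<not> lln \<kappa> (p 0) e0 n rest))"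
    by (rule sum_mono) (auto simp: G_def)
   also have "... = (\<Sum>rest\<in>G. wt p rest) + (\<Sum>rest\<in>lsn {..yy n} n. wt p rest * of_bool (\<not> lln \<kappa> (p 0) e0 n rest))"
   proof -
    have "(\<Sum>rest\<in>lsn {..yy n} n. wt p rest * of_bool (rest \<in> G)) = (\<Sum>rest\<in>G. wt p rest)"
     by (rule sum.mono_neutral_cong_right) (auto simp: finite_lsn G_def)
    then show ?thesis by (simp add: sum.distrib)
   qed
   finally have "(\<Sum>k\<le>yy n. p k) ^ n <= (\<Sum>rest\<in>G. wt p rest) + (\<Sum>rest\<in>lsn {..yy n} n. wt p rest * of_bool (\<not> lln \<kappa> (p 0) e0 n rest))"
    by (simp add: sum_wt_lsn)
   moreover have "0 <= (\<Sum>xs\<in>lsn {..yy n} n. wt p xs * of_bool (\<not> kall (real n powr (1 - gam / 2)) n xs))"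
    by (intro sum_nonneg mult_nonneg_nonneg wt_nonneg p_nonneg) auto
   ultimately have "1 / 2 <= (\<Sum>rest\<in>G. wt p rest)" using elim(1) unfolding PB_def by linarith
   then have "p n / c * (1 / 2) <= p n / c * (\<Sum>rest\<in>G. wt p rest)" using c p_nonneg by (intro mult_left_mono) auto
   then show ?case using 1 by simp
  qed
 qed
 have nbl: "(%n. NB n / p n) \<longlonglongrightarrow> 0"
 proof (rule tendsto_sandwich[of "%_. 0"])
  define r where "r n = a * \<kappa> * ln (real n) / real n + 2 * m * (real n * (a * ln (real n) / real n) powr q * real n powr (d / 2))" for n :: nat
  show "\<forall>\<^sub>F n in sequentially. NB n / p n <= 1 / C0 * (real n powr (- 2) * exp (r n))"
  proof (rule eventually_sequentiallyI[of 1])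
   fix n :: nat assume n: "1 <= n"
   have s0: "0 <= s n" using a n by (simp add: s_def)
   have es: "exp (s n * real (y n)) <= real n powr (d / 2)"
   proof -
    have "s n * real (y n) <= s n * (\<epsilon> * real n)" by (intro mult_left_mono y s0)
    also have "... = (\<epsilon> * a) * ln (real n)" using n by (simp add: s_def)
    also have "... <= d / 2 * ln (real n)" using eps(4) n by (intro mult_right_mono) auto
    finally have "exp (s n * real (y n)) <= exp (d / 2 * ln (real n))" by simp
    then show ?thesis using n by (simp add: powr_def)
   qed
   have "real (n + 1) * (s n powr q * exp (s n * real (y n)) * m) <= (2 * real n) * (s n powr q * real n powr (d / 2) * m)"
    using n es m_nonneg by (intro mult_mono mult_right_mono mult_left_mono) auto
   moreover have "- (s n * real n) + real (n + 1) * (s n * \<kappa>) = - (\<bar>b\<bar> + 2) * ln (real n) + a * \<kappa> * ln (real n) / real n"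
   proof -
    have sn: "s n * real n = a * ln (real n)" using n by (simp add: s_def)
    have "- (s n * real n) + real (n + 1) * (s n * \<kappa>) = - (s n * real n) * (1 - \<kappa>) + s n * \<kappa>"
     by (simp add: algebra_simps)
    also have "... = - (a * (1 - \<kappa>)) * ln (real n) + s n * \<kappa>" unfolding sn by simp
    finally show ?thesis unfolding a(2) by (simp add: s_def mult_ac)
   qed
   ultimately have "- (s n * real n) + real (n + 1) * (s n * \<kappa> + s n powr q * exp (s n * real (y n)) * m) <= - (\<bar>b\<bar> + 2) * ln (real n) + r n"
    unfolding r_def s_def[symmetric] distrib_left by (simp add: mult_ac)
   then have "NB n <= exp (- (\<bar>b\<bar> + 2) * ln (real n) + r n)"
    unfolding NB_def by (intro order_trans[OF nobig_sum[OF s0]] exp_le_cancel_iff[THEN iffD2])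
   also have "... = real n powr (- (\<bar>b\<bar> + 2)) * exp (r n)" using n by (simp add: powr_def exp_add)
   finally have nb: "NB n <= real n powr (- (\<bar>b\<bar> + 2)) * exp (r n)" .
   have "C0 * real n powr (- \<bar>b\<bar>) <= C0 * real n powr (- b)" using n lower(1) by (intro mult_left_mono powr_mono) auto
   then have pl: "C0 * real n powr (- \<bar>b\<bar>) <= p n" using lower(2)[OF n] by linarith
   have "NB n / p n <= (real n powr (- (\<bar>b\<bar> + 2)) * exp (r n)) / (C0 * real n powr (- \<bar>b\<bar>))"
    using nb pl lower(1) n lowp[OF n] by (intro frac_le) auto
   also have "... = 1 / C0 * (real n powr (- (\<bar>b\<bar> + 2)) / real n powr (- \<bar>b\<bar>) * exp (r n))" by simp
   also have "real n powr (- (\<bar>b\<bar> + 2)) / real n powr (- \<bar>b\<bar>) = real n powr (- 2)"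
    by (simp add: powr_diff[symmetric])
   finally show "NB n / p n <= 1 / C0 * (real n powr (- 2) * exp (r n))" .
  qed
  have r: "r \<longlonglongrightarrow> 0"
  proof -
   have 1: "(%n. a * \<kappa> * ln (real n) / real n) \<longlonglongrightarrow> 0" by real_asymp
   have 2: "(%n. real n * (a * ln (real n) / real n) powr q * real n powr (d / 2)) \<longlonglongrightarrow> 0"
   proof (rule Lim_transform_eventually)
    have "0 < d / 2" using d by simp
    then have "(%n. a powr q * (ln (real n) powr q * real n powr (- (d / 2)))) \<longlonglongrightarrow> 0" by real_asymp
    then show "(%n. a powr q * (ln (real n) powr q * real n powr (- (d / 2)))) \<longlonglongrightarrow> 0" .
    show "\<forall>\<^sub>F n in sequentially. a powr q * (ln (real n) powr q * real n powr (- (d / 2))) = real n * (a * ln (real n) / real n) powr q * real n powr (d / 2)"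
    proof (rule eventually_sequentiallyI[of 1])
     fix n :: nat assume n: "1 <= n"
     have "(a * ln (real n) / real n) powr q = a powr q * ln (real n) powr q * real n powr (- q)"
     proof -
      have "(a * ln (real n) / real n) powr q = a powr q * ln (real n) powr q / real n powr q"
       using n a by (simp add: powr_divide powr_mult)
      then show ?thesis unfolding powr_minus_divide by simp
     qed
     then have "real n * (a * ln (real n) / real n) powr q * real n powr (d / 2) = a powr q * (ln (real n) powr q * (real n powr 1 * real n powr (- q) * real n powr (d / 2)))"
      using n by simp
     also have "real n powr 1 * real n powr (- q) * real n powr (d / 2) = real n powr (- (d / 2))"
      unfolding powr_add[symmetric] by simp
     finally show "a powr q * (ln (real n) powr q * real n powr (- (d / 2))) = real n * (a * ln (real n) / real n) powr q * real n powr (d / 2)" ..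
    qed
   qed
   have "(%n. a * \<kappa> * ln (real n) / real n + 2 * m * (real n * (a * ln (real n) / real n) powr q * real n powr (d / 2))) \<longlonglongrightarrow> 0 + 2 * m * 0"
    by (intro tendsto_add 1 tendsto_mult tendsto_const 2)
   then show ?thesis unfolding r_def by simp
  qed
  have "(%n. real n powr (- 2)) \<longlonglongrightarrow> 0" by (intro tendsto_neg_powr filterlim_real_sequentially) auto
  then have "(%n. 1 / C0 * (real n powr (- 2) * exp (r n))) \<longlonglongrightarrow> 1 / C0 * (0 * exp 0)" by (intro tendsto_intros r)
  then show "(%n. 1 / C0 * (real n powr (- 2) * exp (r n))) \<longlonglongrightarrow> 0" by simp
 qed (auto intro!: always_eventually divide_nonneg_nonneg sum_nonneg wt_nonneg p_nonneg simp: NB_def)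
 show ?thesis
 proof (rule tendsto_sandwich[of "%_. 0"])
  show "\<forall>\<^sub>F n in sequentially. badw p \<kappa> (p 0) e (real n powr (1 - gam / 2)) n / (\<Sum>ks\<in>luk n. wt p ks)
    <= 2 * c * (NB n / p n) + 2 * c\<^sup>2 * PB e n" using Zlow eventually_ge_at_top[of N]
  proof eventually_elim
   case (elim n)
   have pn: "p n > 0" using lowp elim c by simp
   have "badw p \<kappa> (p 0) e (X n) n / Z n <= (NB n + c * p n * PB e n) / (p n / (2 * c))"
   proof (rule frac_le)
    have "0 <= badw p \<kappa> (p 0) e (X n) n" by (intro sum_nonneg wt_nonneg p_nonneg)
    then show "0 <= NB n + c * p n * PB e n" using upper[OF elim(2)] by linarith
    show "0 < p n / (2 * c)" using pn c(1) by (intro divide_pos_pos) auto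
   qed (rule upper[OF elim(2)], rule elim(1))
   also have "... = 2 * c * (NB n / p n) + 2 * c\<^sup>2 * PB e n" using pn c by (simp add: field_simps power2_eq_square)
   finally show ?case unfolding Z_def X_def .
  qed
  have "(%n. 2 * c * (NB n / p n) + 2 * c\<^sup>2 * PB e n) \<longlonglongrightarrow> 2 * c * 0 + 2 * c\<^sup>2 * 0"
   by (intro tendsto_intros nbl PB_tendsto e)
  then show "(%n. 2 * c * (NB n / p n) + 2 * c\<^sup>2 * PB e n) \<longlonglongrightarrow> 0" by simp
 qed (auto intro!: always_eventually divide_nonneg_nonneg sum_nonneg wt_nonneg p_nonneg)
qed

end

text \<open>All that the label part uses about the weights. \<open>p0\<close> is the limiting
  proportion of white vertices per edge, and \<open>1 - \<delta>\<close> the exponent that bounds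
  the ancestral degree sums.\<close>

definition deg_good :: "(nat => real) => real => real => bool" where
 "deg_good w p0 \<delta> \<longleftrightarrow> 0 < p0 \<and> 0 < \<delta> \<and> 0 <= kappa w \<and> kappa w < 1 \<and> (\<forall>n. 0 < (\<Sum>ks\<in>luk n. wt w ks)) \<and>
   (\<forall>e>0. (%n. badw w (kappa w) p0 e (real n powr (1 - \<delta>)) n / (\<Sum>ks\<in>luk n. wt w ks)) \<longlonglongrightarrow> 0)"

lemma star_in_luk: "n # replicate n 0 \<in> luk n" unfolding luk_def by (auto simp: sum_list_replicate take_Cons')

lemma wt_replicate: "wt w (replicate n k) = w k ^ n" by (induction n) auto

text \<open>The star, a single black vertex of degree \<open>n\<close> whose neighbours are all
  leaves of the shape, already contributes \<open>w n\<close>.\<close>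

lemma luk_sum_ge:
 assumes "w 0 = 1" "\<And>i. w i >= 0"
 shows "w n <= (\<Sum>ks\<in>luk n. wt w ks)"
proof -
 have e: "wt w (n # replicate n 0) = w n" using assms by (simp add: wt_replicate)
 have "wt w (n # replicate n 0) <= (\<Sum>ks\<in>luk n. wt w ks)"
  by (rule member_le_sum) (use assms star_in_luk finite_luk in \<open>auto simp del: wt_simps intro: wt_nonneg\<close>)
 then show ?thesis unfolding e .
qed

lemma powr_pow: "0 <= c ==> (c powr a) ^ i = (c ^ i) powr a" for c a :: real
 by (induction i) (simp_all add: powr_mult)

subsection \<open>Condition (A1)\<close>

lemma abel_limit:
 fixes a :: "nat => real"
 assumes a: "\<And>n. 0 <= a n" "summable a"
 shows "((%t. \<Sum>n. a n * t ^ n) \<longlongrightarrow> (\<Sum>n. a n)) (at_left 1)"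
proof -
 have "uniform_limit {0..1} (%N t. \<Sum>n<N. a n * t ^ n) (%t. \<Sum>n. a n * t ^ n) sequentially"
 proof (rule Weierstrass_m_test)
  fix n and t :: real assume t: "t \<in> {0..1}"
  then have "t ^ n <= 1" by (intro power_le_one) auto
  then have "a n * t ^ n <= a n * 1" using a by (intro mult_left_mono) auto
  then show "norm (a n * t ^ n) <= a n" using a t by (simp add: abs_mult)
 qed (rule a(2))
 then have "continuous_on {0..1} (%t. \<Sum>n. a n * t ^ n)"
  by (rule uniform_limit_theorem[rotated]) (auto intro!: always_eventually continuous_intros)
 then have "\<forall>x\<in>{0..1}. ((%t. \<Sum>n. a n * t ^ n) \<longlongrightarrow> (\<Sum>n. a n * x ^ n)) (at x within {0..1})"
  unfolding continuous_on_def .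
 from bspec[OF this, of 1] show ?thesis by (simp add: at_within_Icc_at_left)
qed

text \<open>Identifies the extended real filter in the definition of \<open>kappa\<close> with the
  ordinary left neighbourhoods when the radius is finite.\<close>

lemma filtercomap_at_left: "filtercomap ereal (at_left (ereal x)) = at_left x"
 unfolding at_left_ereal filter_eq_iff eventually_filtercomap eventually_filtermap
 by (auto elim!: eventually_mono intro!: exI[of _ "%y. \<forall>x. y = ereal x --> P x" for P])

text \<open>Abel's theorem for the generating function and for its derivative, both of which
  converge at the radius 1, identifies the limit as \<open>g'(1) / g(1)\<close>.\<close>

lemma kappa_eq:
 fixes w :: "nat => real"
 assumes w: "\<And>i. 0 <= w i" "w 0 = 1" and sw: "summable w" and sk: "summable (%k. real k * w k)" and cr: "conv_radius w = 1"
 shows "kappa w = (\<Sum>k. real k * w k) / (\<Sum>k. w k)"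
proof -
 have g_pos: "(\<Sum>k. w k) >= 1" using sum_le_suminf[OF sw, of "{0}"] w by auto
 have dsum: "summable (diffs w)" "(\<Sum>n. diffs w n) = (\<Sum>k. real k * w k)"
 proof -
  have e: "diffs w n = real (Suc n) * w (Suc n)" for n by (simp add: diffs_def)
  show "summable (diffs w)" unfolding e using sk by (subst summable_Suc_iff)
  show "(\<Sum>n. diffs w n) = (\<Sum>k. real k * w k)" unfolding e using suminf_split_head[OF sk] by simp
 qed
 have l1: "((%t. \<Sum>n. w n * t ^ n) \<longlongrightarrow> (\<Sum>n. w n)) (at_left 1)" by (rule abel_limit[OF w(1) sw])
 have l2: "((%t. \<Sum>n. diffs w n * t ^ n) \<longlongrightarrow> (\<Sum>k. real k * w k)) (at_left 1)"
  unfolding dsum(2)[symmetric] by (rule abel_limit[OF _ dsum(1)]) (simp add: diffs_def w)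
 have "((%t. t * (\<Sum>n. diffs w n * t ^ n) / (\<Sum>n. w n * t ^ n)) \<longlongrightarrow> 1 * (\<Sum>k. real k * w k) / (\<Sum>n. w n)) (at_left 1)"
  by (intro tendsto_intros l1 l2) (use g_pos in auto)
 moreover have "\<forall>\<^sub>F t in at_left 1. t * (\<Sum>n. diffs w n * t ^ n) / (\<Sum>n. w n * t ^ n) = t * deriv (gen_fun w) t / gen_fun w t"
 proof -
  have "\<forall>\<^sub>F t::real in at_left 1. t \<in> {0<..<1}" by (rule eventually_at_leftI[of 0]) auto
  then show ?thesis
  proof eventually_elim
   case (elim t)
   have "((%x. \<Sum>n. w n * x ^ n) has_field_derivative (\<Sum>n. diffs w n * t ^ n)) (at t)"
    by (rule termdiffs_strong[of w 1]) (use sw elim in auto)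
   then have "deriv (gen_fun w) t = (\<Sum>n. diffs w n * t ^ n)" unfolding gen_fun_def[abs_def] by (rule DERIV_imp_deriv)
   then show ?case by (simp add: gen_fun_def)
  qed
 qed
 ultimately have "((%t. t * deriv (gen_fun w) t / gen_fun w t) \<longlongrightarrow> 1 * (\<Sum>k. real k * w k) / (\<Sum>n. w n)) (at_left 1)"
  by (rule Lim_transform_eventually)
 then have "Lim (at_left 1) (%t. t * deriv (gen_fun w) t / gen_fun w t) = 1 * (\<Sum>k. real k * w k) / (\<Sum>n. w n)"
  by (intro tendsto_Lim) auto
 moreover have "filtercomap ereal (at_left (conv_radius w)) = at_left 1" unfolding cr one_ereal_def by (rule filtercomap_at_left)
 ultimately show ?thesis unfolding kappa_def using cr by simp
qed

theorem deg_A1: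
 fixes w :: "nat => real"
 assumes w0: "w 0 = 1" and wnn: "\<And>i. w i >= 0" and A1: "condA1 w"
 shows "\<exists>p0 \<delta>. deg_good w p0 \<delta>"
proof -
 obtain \<beta> L where beta: "\<beta> > 2" and sv: "slowly_varying L" and wL: "\<And>i. i >= 1 ==> w i = L (real i) * real i powr (- \<beta>)"
  and kap: "kappa w < 1" using A1 unfolding condA1_def by blast
 \<comment> \<open>With \<open>\<eta> = (\<beta> - 2) / 4\<close> and
   \<open>d <= (\<beta> - 2) / 2\<close> the exponent \<open>1 + d + \<eta> - \<beta>\<close> stays
   below -1, so the moment of order \<open>1 + d\<close> is finite in spite of the slowly varying
   factor.\<close>
 define \<eta> where "\<eta> = (\<beta> - 2) / 4"
 define d where "d = min 1 ((\<beta> - 2) / 2)"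
 have d: "0 < d" "d <= 1" "d <= (\<beta> - 2) / 2"
  using beta min.cobounded2[of 1 "(\<beta> - 2) / 2"] by (simp_all only: d_def) auto
 have eta: "\<eta> > 0" using beta by (simp add: \<eta>_def)
 obtain C where C: "C >= 0" "\<And>i. i >= 1 ==> \<bar>ln (L (real i))\<bar> <= \<eta> * ln (real i) + C"
  using sv_potter[OF sv eta] by blast
 have Lpos: "L (real i) > 0" if "i >= 1" for i using sv that by (simp add: slowly_varying_def)
 have Lup: "L (real i) <= exp C * real i powr \<eta>" and Llow: "exp (- C) * real i powr (- \<eta>) <= L (real i)" if i: "i >= 1" for i
 proof -
  have ab: "\<bar>ln (L (real i))\<bar> <= \<eta> * ln (real i) + C" by (rule C(2)[OF i])
  have "exp (ln (L (real i))) <= exp (\<eta> * ln (real i) + C)" using ab by (simp add: abs_le_iff)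
  then show "L (real i) <= exp C * real i powr \<eta>" using Lpos[OF i] i by (simp add: powr_def exp_add mult.commute)
  have "exp (- (\<eta> * ln (real i) + C)) <= exp (ln (L (real i)))" using ab by (simp add: abs_le_iff)
  then show "exp (- C) * real i powr (- \<eta>) <= L (real i)" using Lpos[OF i] i by (simp add: powr_def exp_add[symmetric] algebra_simps)
 qed
 have mom: "summable (%k. real k powr (1 + d) * w k)"
 proof (rule summable_comparison_test)
  show "\<exists>N. \<forall>k\<ge>N. norm (real k powr (1 + d) * w k) <= exp C * real k powr (1 + d + \<eta> - \<beta>)"
  proof (intro exI[of _ 1] allI impI)
   fix k :: nat assume k: "1 <= k"
   have "real k powr (1 + d) * w k <= real k powr (1 + d) * ((exp C * real k powr \<eta>) * real k powr (- \<beta>))"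
    unfolding wL[OF k] by (intro mult_left_mono mult_right_mono Lup k) auto
   also have "... = exp C * (real k powr (1 + d) * real k powr \<eta> * real k powr (- \<beta>))" by simp
   also have "real k powr (1 + d) * real k powr \<eta> * real k powr (- \<beta>) = real k powr (1 + d + \<eta> - \<beta>)"
    unfolding powr_add[symmetric] by simp
   finally show "norm (real k powr (1 + d) * w k) <= exp C * real k powr (1 + d + \<eta> - \<beta>)" using wnn by simp
  qed
  have "1 + d + \<eta> - \<beta> < -1"
  proof -
   have "4 * \<eta> = \<beta> - 2" by (simp add: \<eta>_def)
   moreover have "2 * d <= \<beta> - 2" using d(3) by simp
   ultimately show ?thesis using beta by linarith
  qed
  then show "summable (%k. exp C * real k powr (1 + d + \<eta> - \<beta>))"
   by (intro summable_mult) (simp add: summable_real_powr_iff)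
 qed
 have sk: "summable (%k. real k * w k)"
 proof (rule summable_comparison_test[OF _ mom], intro exI[of _ 1] allI impI)
  fix k :: nat assume k: "1 <= k"
  have "real k powr 1 <= real k powr (1 + d)" using k d by (intro powr_mono) auto
  then have "real k * w k <= real k powr (1 + d) * w k" using k wnn by (intro mult_right_mono) auto
  then show "norm (real k * w k) <= real k powr (1 + d) * w k" using wnn by simp
 qed
 have sw: "summable w"
 proof (rule summable_comparison_test[OF _ sk], intro exI[of _ 1] allI impI)
  fix k :: nat assume k: "1 <= k"
  have "1 * w k <= real k * w k" using k wnn by (intro mult_right_mono) auto
  then show "norm (w k) <= real k * w k" using wnn by simp
 qed
 define g where "g = (\<Sum>k. w k)"
 have g: "g >= 1" unfolding g_def using sum_le_suminf[OF sw, of "{0}"] wnn w0 by auto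
 define p where "p k = w k / g" for k
 define b where "b = \<eta> + \<beta>"
 define C0 where "C0 = exp (- C) / g"
 have plow: "C0 * real n powr (- b) <= p n" if n: "n >= 1" for n
 proof -
  have "exp (- C) * real n powr (- b) = (exp (- C) * real n powr (- \<eta>)) * real n powr (- \<beta>)"
   unfolding b_def by (simp add: powr_add[symmetric])
  also have "... <= w n" unfolding wL[OF n] by (intro mult_right_mono Llow n) simp
  finally show ?thesis using g by (simp add: C0_def p_def divide_right_mono)
 qed
 \<comment> \<open>Summability at 1 gives one inequality; a larger radius would contradict the
   polynomial lower bound on the weights.\<close>
 have cr: "conv_radius w = 1"
 proof (rule antisym)
  show "1 <= conv_radius w" using conv_radius_geI[of w 1] sw by (simp add: one_ereal_def)
  show "conv_radius w <= 1"
  proof (rule ccontr)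
   assume "\<not> conv_radius w <= 1"
   then obtain r where r: "1 < ereal r" "ereal r < conv_radius w" using ereal_dense2[of 1 "conv_radius w"] by (auto simp: not_le)
   then have r1: "r > 1" by (simp add: one_ereal_def)
   have "summable (%n. w n * r ^ n)" by (rule summable_in_conv_radius) (use r r1 in simp)
   then have z: "(%n. w n * r ^ n) \<longlonglongrightarrow> 0" by (rule summable_LIMSEQ_zero)
   have "filterlim (%n. real n powr (- b) * r ^ n) at_top sequentially" using r1 by real_asymp
   then have "\<forall>\<^sub>F n in sequentially. exp C <= real n powr (- b) * r ^ n" by (simp add: filterlim_at_top)
   moreover have "\<forall>\<^sub>F n in sequentially. w n * r ^ n < 1/2" using z by (rule order_tendstoD) simp
   ultimately have "\<forall>\<^sub>F n in sequentially. False" using eventually_ge_at_top[of 1]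
   proof eventually_elim
    case (elim n)
    have "exp (- C) * exp C <= exp (- C) * (real n powr (- b) * r ^ n)" using elim(1) by (intro mult_left_mono) auto
    also have "... = (g * (C0 * real n powr (- b))) * r ^ n" using g by (simp add: C0_def)
    also have "... <= (g * p n) * r ^ n" using plow[OF elim(3)] g r1 by (intro mult_right_mono mult_left_mono) auto
    also have "... = w n * r ^ n" using g by (simp add: p_def)
    finally show False using elim(2) by (simp flip: exp_add)
   qed
   then show False by simp
  qed
 qed
 have kw: "kappa w = (\<Sum>k. real k * w k) / g" unfolding g_def by (rule kappa_eq[OF wnn w0 sw sk cr])
 interpret subcritical p "kappa w" d "(\<Sum>k. real k powr (1 + d) * w k) / g" b C0
 proof
  show "p k >= 0" for k using wnn g by (simp add: p_def)
  show "p sums 1" unfolding p_def using sums_divide[OF summable_sums[OF sw], of g] g by (simp add: g_def)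
  show "(%k. real k * p k) sums kappa w" unfolding kw p_def using sums_divide[OF summable_sums[OF sk], of g] by simp
  show "(%k. real k powr (1 + d) * p k) sums ((\<Sum>k. real k powr (1 + d) * w k) / g)"
   unfolding p_def using sums_divide[OF summable_sums[OF mom], of g] by simp
  show "C0 > 0" using g by (simp add: C0_def)
  show "kappa w < 1" by (rule kap)
  show "0 < d" "d <= 1" by (rule d)+
  show "C0 * real n powr (- b) <= p n" if "1 <= n" for n by (rule plow[OF that])
  fix \<epsilon> :: real assume eps: "0 < \<epsilon>" "\<epsilon> < 1"
  obtain c N where c: "c >= 1" "N >= 1" "\<And>n k. n >= N ==> \<epsilon> * real n <= real k ==> k <= n ==> L (real k) <= c * L (real n) \<and> L (real n) <= c * L (real k)"
   using sv_regular[OF sv eps] by blast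
  \<comment> \<open>The factor \<open>\<epsilon> powr (- \<beta>)\<close> accounts for the ratio of
    the powers at \<open>k\<close> and \<open>n\<close> when
    \<open>k >= \<epsilon> * n\<close>.\<close>
  define c' where "c' = c * \<epsilon> powr (- \<beta>)"
  have e1: "1 <= \<epsilon> powr (- \<beta>)" using eps beta powr_mono'[of "- \<beta>" 0 \<epsilon>] by simp
  have cc: "c <= c'" using c(1) e1 mult_left_mono[of 1 "\<epsilon> powr (- \<beta>)" c] by (simp add: c'_def)
  show "\<exists>c\<ge>1. \<exists>N\<ge>1. \<forall>n\<ge>N. \<forall>k. \<epsilon> * real n <= real k --> k <= n --> p k <= c * p n \<and> p n <= c * p k"
  proof (intro exI[of _ c'] exI[of _ N] conjI allI impI)
   show "1 <= c'" using c cc by simp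
   show "1 <= N" by (rule c(2))
   fix n k assume n: "N <= n" and k: "\<epsilon> * real n <= real k" "k <= n"
   have n1: "n >= 1" using n c by simp
   have en: "0 < \<epsilon> * real n" using eps n1 by simp
   then have k1: "k >= 1" using k(1) by (cases k) auto
   note L = c(3)[OF n k]
   have "real k powr (- \<beta>) <= (\<epsilon> * real n) powr (- \<beta>)" using en k beta by (intro powr_mono2') auto
   also have "... = \<epsilon> powr (- \<beta>) * real n powr (- \<beta>)" using eps by (simp add: powr_mult)
   finally have kb: "real k powr (- \<beta>) <= \<epsilon> powr (- \<beta>) * real n powr (- \<beta>)" .
   have "w k <= (c * L (real n)) * (\<epsilon> powr (- \<beta>) * real n powr (- \<beta>))"
    unfolding wL[OF k1] using L kb c(1) Lpos[OF n1] by (intro mult_mono) auto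
   then have "w k <= c' * w n" unfolding wL[OF n1] c'_def by (simp add: mult_ac)
   then have "w k / g <= c' * w n / g" by (rule divide_right_mono) (use g in simp)
   then show "p k <= c' * p n" by (simp add: p_def)
   have "real n powr (- \<beta>) <= real k powr (- \<beta>)" using k1 k beta by (intro powr_mono2') auto
   then have "w n <= (c * L (real k)) * real k powr (- \<beta>)"
    unfolding wL[OF n1] using L c(1) Lpos[OF k1] by (intro mult_mono) auto
   then have "w n <= c * w k" unfolding wL[OF k1] by (simp add: mult_ac)
   also have "... <= c' * w k" using cc wnn by (intro mult_right_mono) auto
   finally have "w n / g <= c' * w k / g" by (rule divide_right_mono) (use g in simp)
   then show "p n <= c' * p k" by (simp add: p_def)
  qed
 qed
 have wtp: "wt w ks = g ^ (n + 1) * wt p ks" if "ks \<in> luk n" for n ks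
 proof -
  have "wt w ks = wt (%k. g * p k) ks" using g by (simp add: p_def)
  also have "... = g ^ length ks * wt p ks" by (simp only: wt_mult wt_const)
  finally show ?thesis using that by (simp add: luk_def)
 qed
 \<comment> \<open>All codes in \<open>luk n\<close> have \<open>n + 1\<close> letters, so the
   normalization multiplies numerator and denominator by the same power of \<open>g\<close>.\<close>
 have ratio: "(\<Sum>ks\<in>{ks \<in> luk n. P ks}. wt w ks) / (\<Sum>ks\<in>luk n. wt w ks) = (\<Sum>ks\<in>{ks \<in> luk n. P ks}. wt p ks) / (\<Sum>ks\<in>luk n. wt p ks)" for n P
 proof -
  have 1: "(\<Sum>ks\<in>{ks \<in> luk n. P ks}. wt w ks) = g ^ (n + 1) * (\<Sum>ks\<in>{ks \<in> luk n. P ks}. wt p ks)"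
   unfolding sum_distrib_left by (rule sum.cong) (auto simp: wtp)
  have 2: "(\<Sum>ks\<in>luk n. wt w ks) = g ^ (n + 1) * (\<Sum>ks\<in>luk n. wt p ks)"
   unfolding sum_distrib_left by (rule sum.cong) (auto simp: wtp)
  have "g ^ (n + 1) \<noteq> 0" using g by simp
  then show ?thesis unfolding 1 2 by (rule mult_divide_mult_cancel_left)
 qed
 have "deg_good w (p 0) (gam / 2)" unfolding deg_good_def
 proof (intro conjI allI impI)
  show "0 < p 0" using g w0 by (simp add: p_def)
  show "0 < gam / 2" using gam by simp
  show "0 <= kappa w" by (rule kappa_nonneg)
  show "kappa w < 1" by (rule kap)
  fix n :: nat
  have "0 < w n"
  proof (cases n)
   case 0 then show ?thesis using w0 by simp
  next
   case (Suc k)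
   then show ?thesis using wL[of n] Lpos[of n] by simp
  qed
  then show "0 < (\<Sum>ks\<in>luk n. wt w ks)" using luk_sum_ge[of w n] w0 wnn by simp
 next
  fix e :: real assume "0 < e"
  from good_tendsto[OF this]
  show "(%n. badw w (kappa w) (p 0) e (real n powr (1 - gam / 2)) n / (\<Sum>ks\<in>luk n. wt w ks)) \<longlonglongrightarrow> 0"
   unfolding ratio .
 qed
 then show ?thesis by blast
qed

subsection \<open>Condition (A2)\<close>

lemma fact_lower: "(real n / exp 1) ^ n <= fact n"
proof -
 have "real n ^ n / fact n <= (\<Sum>k. real n ^ k / fact k)"
  using sum_le_suminf[of "%k. real n ^ k / fact k" "{n}"] summable_exp_generic[of "real n"]
  by (simp add: divide_inverse mult.commute)
 also have "... = exp (real n)" unfolding exp_def by (simp add: divide_inverse mult.commute)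
 also have "... = exp 1 ^ n" by (simp flip: exp_of_nat_mult)
 finally show ?thesis by (simp add: power_divide field_simps)
qed

lemma fact_upper: "i >= 1 ==> fact i <= exp 1 * real i * (real i / exp 1) ^ i"
proof (induction i rule: dec_induct)
 case base
 then show ?case by simp
next
 case (step i)
 have i: "real i > 0" using step by simp
 have "1 - 1 / real (Suc i) <= exp (- (1 / real (Suc i)))" using exp_ge_add_one_self[of "- (1 / real (Suc i))"] by simp
 moreover have "1 - 1 / real (Suc i) = real i / real (Suc i)" by (simp add: field_simps)
 ultimately have "(real i / real (Suc i)) ^ Suc i <= exp (- (1 / real (Suc i))) ^ Suc i" by (intro power_mono) auto
 also have "... = exp (-1)" by (simp only: exp_of_nat_mult[symmetric]) (simp add: field_simps)
 finally have "real i ^ Suc i <= exp (-1) * real (Suc i) ^ Suc i" by (simp only: power_divide) (simp add: divide_le_eq)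
 then have a: "real i * (real i / exp 1) ^ i <= (real (Suc i) / exp 1) ^ Suc i"
  by (simp add: power_divide exp_minus field_simps)
 have "fact (Suc i) = real (Suc i) * fact i" by simp
 also have "... <= real (Suc i) * (exp 1 * real i * (real i / exp 1) ^ i)" by (intro mult_left_mono step.IH) simp
 also have "... = exp 1 * real (Suc i) * (real i * (real i / exp 1) ^ i)" by simp
 also have "... <= exp 1 * real (Suc i) * (real (Suc i) / exp 1) ^ Suc i" by (intro mult_left_mono a) auto
 finally show ?case .
qed

text \<open>Each of the \<open>m\<close> leading factors removed from \<open>fact n\<close> exceeds
  \<open>N\<close>.\<close>

lemma fact_diff_bound:
 assumes "m <= n" "N < n - m \<or> m = 0"
 shows "real (N ^ m) * fact (n - m) <= fact n" using assms
proof (induction m)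
 case (Suc m)
 have "real N <= real (n - m)" using Suc.prems by simp
 then have "real N ^ m * (real N * fact (n - Suc m)) <= real N ^ m * (real (n - m) * fact (n - Suc m))"
  by (intro mult_left_mono mult_right_mono) auto
 also have "real (n - m) * fact (n - Suc m) = fact (n - m)" using Suc.prems by (simp add: Suc_diff_Suc[symmetric] fact_reduce)
 also have "real N ^ m * fact (n - m) <= fact n"
 proof -
  have "m <= n" "N < n - m \<or> m = 0" using Suc.prems by auto
  from Suc.IH[OF this] show ?thesis by simp
 qed
 finally show ?case by (simp add: mult_ac)
qed simp

text \<open>A crude bound by the sum of all letters read. It is used when the small degrees together
  are already of smaller order than \<open>n\<close>.\<close>

lemma run_kst_le: "(\<And>a. a \<in> set st ==> a <= A) ==> b \<in> set (run kst xs st) ==> b <= A + sum_list xs"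
proof (induction xs arbitrary: st A)
 case (Cons x xs)
 show ?case
 proof (cases st)
  case (Cons a st')
  have "b <= (A + x) + sum_list xs"
  proof (rule Cons.IH)
   show "b \<in> set (run kst xs (kst a x @ st'))" using Cons.prems(2) Cons by simp
   fix c assume "c \<in> set (kst a x @ st')"
   then show "c <= A + x" using Cons.prems(1)[of a] Cons.prems(1)[of c] Cons by (auto simp: kst_def intro: le_trans split: if_splits)
  qed
  then show ?thesis by simp
 qed (use Cons in auto)
qed (auto intro: le_SucI)

lemma kbd_sum: "real (sum_list pre + sum_list post) <= X ==> kbd X pre k post"
proof -
 assume X: "real (sum_list pre + sum_list post) <= X"
 have tk: "sum_list (take i xs) <= sum_list xs" for i and xs :: "nat list"
  by (subst (2) append_take_drop_id[of i xs, symmetric]) (simp only: sum_list_append le_add1)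
 have "real b <= X" if "b \<in> set (run kst (take i pre) [0])" for i b
 proof -
  have "b <= 0 + sum_list (take i pre)" using that by (rule run_kst_le[rotated]) simp
  then show ?thesis using tk[of i pre] X by linarith
 qed
 moreover have "real b <= X" if b: "b \<in> set (run kst (take i post) (bigst k (run kst pre [0])))" for i b
 proof -
  have "b <= sum_list pre + sum_list (take i post)"
  proof (rule run_kst_le[OF _ b])
   fix a assume "a \<in> set (bigst k (run kst pre [0]))"
   then have "a \<in> set (run kst pre [0])" by (cases "run kst pre [0]") (auto simp: bigst_def split: if_splits)
   then have "a <= 0 + sum_list pre" by (rule run_kst_le[rotated]) simp
   then show "a <= sum_list pre" by simp
  qed
  then show ?thesis using tk[of i post] X by linarith
 qed
 ultimately show ?thesis by (auto simp: kbd_def)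
qed

lemma zeros_bounds: "zeros xs <= length xs" "length xs <= zeros xs + sum_list xs"
proof -
 show "zeros xs <= length xs" by (simp add: zeros_def)
 show "length xs <= zeros xs + sum_list xs" by (induction xs) (auto simp: zeros_def)
qed

text \<open>The case \<open>\<kappa> = 0\<close>, \<open>p0 = 1\<close>: a small total sum bounds
  every partial sum and also the number of nonzero letters.\<close>

lemma lln_zero:
 assumes "length rest = n" "real (sum_list rest) <= e * real n"
 shows "lln 0 1 e n rest"
proof -
 have tk: "sum_list (take s rest) <= sum_list rest" for s
  by (subst (2) append_take_drop_id[of s rest, symmetric]) (simp only: sum_list_append le_add1)
 show ?thesis unfolding lln_def
 proof (intro allI impI conjI)
  fix s assume s: "s <= n"
  show "\<bar>real (sum_list (take s rest)) - 0 * real s\<bar> <= e * real n" using tk[of s] assms by simp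
  have "zeros (take s rest) <= s" "s <= zeros (take s rest) + sum_list rest"
   using zeros_bounds[of "take s rest"] tk[of s] s assms by auto
  then show "\<bar>real (zeros (take s rest)) - 1 * real s\<bar> <= e * real n" using assms(2) by linarith
 qed
qed

text \<open>All weight ratios are taken against the star \<open>w n\<close>. The factorial growth
  makes it so expensive to move mass \<open>j\<close> away from the large vertex that the remaining
  letters have sum at most \<open>n^(1 - \<delta>)\<close>, which implies both conditions of
  \<open>good\<close>.\<close>

theorem deg_A2:
 fixes w :: "nat => real"
 assumes A2: "condA2 w"
 shows "\<exists>p0 \<delta>. deg_good w p0 \<delta>"
proof -
 obtain \<alpha> where al: "\<alpha> > 0" and w: "\<And>i. w i = fact i powr \<alpha>" using A2 unfolding condA2_def by blast
 have w0: "w 0 = 1" and wpos: "w i > 0" for i by (simp_all add: w)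
 then have wnn: "\<And>i. w i >= 0" by (simp add: less_imp_le)
 \<comment> \<open>The quotient of consecutive weights is \<open>Suc n powr \<alpha>\<close>, which
   is unbounded, so no positive radius is possible and \<open>kappa\<close> takes its default
   value.\<close>
 have kap: "kappa w = 0"
 proof -
  have "\<not> conv_radius w > 0"
  proof
   assume "conv_radius w > 0"
   then obtain r where "0 < ereal r" "ereal r < conv_radius w" using ereal_dense2[of 0 "conv_radius w"] by auto
   then have r: "r > 0" "ereal (norm r) < conv_radius w" by auto
   have "summable (%n. w n * r ^ n)" by (rule summable_in_conv_radius) (rule r(2))
   then have z: "(%n. w n * r ^ n) \<longlonglongrightarrow> 0" by (rule summable_LIMSEQ_zero)
   have "filterlim (%n. real (Suc n) powr \<alpha>) at_top sequentially" using al by real_asymp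
   then have "\<forall>\<^sub>F n in sequentially. 1 / r <= real (Suc n) powr \<alpha>" by (simp add: filterlim_at_top)
   then obtain N where N: "\<And>n. n >= N ==> 1 / r <= real (Suc n) powr \<alpha>" by (auto simp: eventually_sequentially)
   have "w N * r ^ N <= w n * r ^ n" if "n >= N" for n using that
   proof (induction n rule: dec_induct)
    case (step n)
    have "w (Suc n) = real (Suc n) powr \<alpha> * w n" unfolding w by (simp add: powr_mult)
    then have "w (Suc n) * r ^ Suc n = (real (Suc n) powr \<alpha> * r) * (w n * r ^ n)" by simp
    moreover have "1 <= real (Suc n) powr \<alpha> * r" using N[of n] step r by (simp add: pos_divide_le_eq)
    then have "1 * (w n * r ^ n) <= (real (Suc n) powr \<alpha> * r) * (w n * r ^ n)" using wnn r by (intro mult_right_mono) auto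
    ultimately show ?case using step by linarith
   qed simp
   then have "w N * r ^ N <= 0" by (intro LIMSEQ_le_const[OF z]) auto
   moreover have "0 < w N * r ^ N" using wpos[of N] r by simp
   ultimately show False by linarith
  qed
  then show ?thesis by (simp add: kappa_def)
 qed
 \<comment> \<open>Below \<open>\<alpha>\<close>, so that the gain of order
   \<open>n^(1 - \<delta>)\<close> in the exponent dominates the loss \<open>h n\<close> of order
   \<open>n^(1 - \<alpha>)\<close>.\<close>
 define \<delta> where "\<delta> = min \<alpha> 1 / 2"
 have del: "0 < \<delta>" "\<delta> < \<alpha>" "\<delta> < 1" using al by (auto simp: \<delta>_def)
 define cc where "cc i = (exp 1 * real i ^ 2 * exp (- real i / 2)) powr \<alpha>" for i :: nat
 have scc: "summable cc"
 proof (rule summable_comparison_test_ev)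
  have "(%i. (exp 1 * real i ^ 2 * exp (- real i / 2)) powr \<alpha> * real i ^ 2) \<longlonglongrightarrow> 0" using al by real_asymp
  then have "\<forall>\<^sub>F i in sequentially. (exp 1 * real i ^ 2 * exp (- real i / 2)) powr \<alpha> * real i ^ 2 < 1" by (rule order_tendstoD) simp
  then show "\<forall>\<^sub>F i in sequentially. norm (cc i) <= 1 / real i ^ 2" using eventually_ge_at_top[of 1]
  proof eventually_elim
   case (elim i)
   then show ?case by (simp add: cc_def pos_le_divide_eq)
  qed
  show "summable (%i. 1 / real i ^ 2)" using inverse_power_summable[of 2] by (simp add: inverse_eq_divide)
 qed
 define C where "C = (\<Sum>i. cc i)"
 have C0: "C >= 0" unfolding C_def by (rule suminf_nonneg[OF scc]) (simp add: cc_def)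
 define NN where "NN n = n div 2" for n :: nat
 \<comment> \<open>A tilting parameter for letters up to \<open>NN n\<close>: by Stirling
   \<open>w i * s n ^ i\<close> is at most \<open>cc i * NN n powr (- \<alpha>)\<close>, so that
   \<open>G n\<close> is close to 1. The factor \<open>exp (1/2)\<close> is small enough for
   summability and leaves a spare exponential factor to be gained below.\<close>
 define s where "s n = (exp (1/2) / real (NN n)) powr \<alpha>" for n
 define G where "G n = (\<Sum>i\<le>NN n. w i * s n ^ i)" for n
 have s_pos: "s n > 0" if "n >= 2" for n using that by (simp add: s_def NN_def)
 have G: "G n <= exp (C * real (NN n) powr (- \<alpha>))" if n: "n >= 2" for n
 proof -
  define N where "N = NN n"
  have N: "N >= 1" using n by (auto simp: N_def NN_def)
  have trm: "w i * s n ^ i <= real N powr (- \<alpha>) * cc i" if i: "1 <= i" "i <= N" for i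
  proof -
   have "w i * s n ^ i = (fact i * (exp (1/2) / real N) ^ i) powr \<alpha>"
    unfolding w s_def N_def[symmetric] by (simp add: powr_mult powr_pow)
   also have "... <= (exp 1 * real i ^ 2 * exp (- real i / 2) / real N) powr \<alpha>"
   proof (rule powr_mono2)
    have "fact i * (exp (1/2) / real N) ^ i <= (exp 1 * real i * (real i / exp 1) ^ i) * (exp (1/2) / real N) ^ i"
     by (intro mult_right_mono fact_upper i) auto
    also have "... = exp 1 * real i * ((real i / real N) ^ i * (exp (1/2) / exp 1) ^ i)"
     by (simp add: power_divide power_mult_distrib field_simps)
    also have "(exp (1/2) / exp 1) ^ i = exp (- real i / 2 :: real)"
     by (simp only: exp_diff[symmetric] exp_of_nat_mult[symmetric]) simp
    also have "(real i / real N) ^ i <= (real i / real N) ^ 1" using i N by (intro power_decreasing) auto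
    then have "exp 1 * real i * ((real i / real N) ^ i * exp (- real i / 2)) <= exp 1 * real i * ((real i / real N) ^ 1 * exp (- real i / 2))"
     by (intro mult_left_mono mult_right_mono) auto
    also have "... = exp 1 * real i ^ 2 * exp (- real i / 2) / real N" by (simp add: power2_eq_square)
    finally show "fact i * (exp (1/2) / real N) ^ i <= exp 1 * real i ^ 2 * exp (- real i / 2) / real N" .
   qed (use al in auto)
   also have "... = real N powr (- \<alpha>) * cc i" unfolding cc_def by (simp add: powr_divide powr_minus_divide)
   finally show ?thesis .
  qed
  have "G n = 1 + (\<Sum>i\<in>{1..N}. w i * s n ^ i)"
  proof -
   have "{..N} = insert 0 {1..N}" by auto
   then show ?thesis unfolding G_def N_def[symmetric] by (simp add: w0)
  qed
  also have "(\<Sum>i\<in>{1..N}. w i * s n ^ i) <= (\<Sum>i\<in>{1..N}. real N powr (- \<alpha>) * cc i)"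
   by (rule sum_mono) (simp add: trm)
  also have "... <= real N powr (- \<alpha>) * C" unfolding sum_distrib_left[symmetric] C_def
   by (intro mult_left_mono sum_le_suminf scc) (auto simp: cc_def)
  also have "1 + real N powr (- \<alpha>) * C <= exp (C * real N powr (- \<alpha>))"
   using exp_ge_add_one_self[of "C * real N powr (- \<alpha>)"] by (simp add: mult.commute)
  finally show ?thesis by (simp add: N_def)
 qed
 have G0: "G n >= 0" for n unfolding G_def by (intro sum_nonneg mult_nonneg_nonneg wnn zero_le_power) (simp add: s_def)
 define h where "h n = real (n + 1) * (C * real (NN n) powr (- \<alpha>))" for n
 have Gpow: "G n ^ j <= exp (h n)" if "n >= 2" "j <= n + 1" for n j
 proof -
  have "G n ^ j <= exp (C * real (NN n) powr (- \<alpha>)) ^ j" by (intro power_mono G G0 that)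
  also have "... <= exp (C * real (NN n) powr (- \<alpha>)) ^ (n + 1)" by (intro power_increasing that) (simp add: C0)
  finally show ?thesis unfolding h_def exp_of_nat_mult .
 qed
 have NNb: "real n / 3 <= real (NN n)" "2 * NN n <= n" "n <= 2 * NN n + 1" if "n >= 2" for n
 proof -
  show a: "2 * NN n <= n" "n <= 2 * NN n + 1" unfolding NN_def by auto
  have "n <= 3 * NN n" using a that by linarith
  then show "real n / 3 <= real (NN n)" by linarith
 qed
 have hb: "h n <= (C * 2 * 3 powr \<alpha>) * real n powr (1 - \<alpha>)" if n: "n >= 2" for n
 proof -
  have "real (NN n) powr (- \<alpha>) <= (real n / 3) powr (- \<alpha>)" using NNb(1)[OF n] n al by (intro powr_mono2') auto
  also have "... = 3 powr \<alpha> * real n powr (- \<alpha>)" using n by (simp add: powr_divide powr_minus field_simps)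
  finally have "h n <= (2 * real n) * (C * (3 powr \<alpha> * real n powr (- \<alpha>)))"
   unfolding h_def using n C0 by (intro mult_mono mult_left_mono) auto
  also have "... = (C * 2 * 3 powr \<alpha>) * (real n powr 1 * real n powr (- \<alpha>))" using n by simp
  also have "real n powr 1 * real n powr (- \<alpha>) = real n powr (1 - \<alpha>)" unfolding powr_add[symmetric] by simp
  finally show ?thesis .
 qed
 \<comment> \<open>Since the letters sum to \<open>n\<close>, tilting costs exactly
   \<open>1 / s n ^ n\<close>. With \<open>NN n <= n / 2\<close>, Stirling and
   \<open>exp (2/3) <= 2\<close>, this is smaller than \<open>w n\<close> by the factor
   \<open>exp (- \<alpha> n / 6)\<close>.\<close>
 have nobig: "(\<Sum>ks\<in>{ks \<in> luk n. set ks \<subseteq> {..NN n}}. wt w ks) <= w n * exp (- (\<alpha> / 6) * real n + h n)" if n: "n >= 2" for n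
 proof -
  have N: "NN n >= 1" using n by (auto simp: NN_def)
  have "(\<Sum>ks\<in>{ks \<in> luk n. set ks \<subseteq> {..NN n}}. wt w ks) = (\<Sum>ks\<in>{ks \<in> luk n. set ks \<subseteq> {..NN n}}. (1 / s n ^ n) * wt (%i. w i * s n ^ i) ks)"
  proof (rule sum.cong[OF refl])
   fix ks assume "ks \<in> {ks \<in> luk n. set ks \<subseteq> {..NN n}}"
   then have "sum_list ks = n" by (simp add: luk_def)
   then have "wt (%i. w i * s n ^ i) ks = wt w ks * s n ^ n" by (simp only: wt_mult wt_power)
   then show "wt w ks = (1 / s n ^ n) * wt (%i. w i * s n ^ i) ks" using s_pos[OF n] by simp
  qed
  also have "... <= (\<Sum>ks\<in>lsn {..NN n} (n + 1). (1 / s n ^ n) * wt (%i. w i * s n ^ i) ks)"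
  proof (rule sum_mono2)
   show "finite (lsn {..NN n} (n + 1))" by (simp add: finite_lsn)
   show "{ks \<in> luk n. set ks \<subseteq> {..NN n}} \<subseteq> lsn {..NN n} (n + 1)" by (auto simp: luk_def lsn_def)
   show "0 <= 1 / s n ^ n * wt (%i. w i * s n ^ i) ks" for ks
    using s_pos[OF n] wnn by (intro mult_nonneg_nonneg wt_nonneg) auto
  qed
  also have "... = (1 / s n ^ n) * G n ^ (n + 1)" unfolding sum_distrib_left[symmetric] sum_wt_lsn G_def ..
  also have "... <= (1 / s n ^ n) * exp (h n)" using s_pos[OF n] by (intro mult_left_mono Gpow n) auto
  also have "1 / s n ^ n <= w n * exp (- (\<alpha> / 6) * real n)"
  proof -
   have "1 / s n ^ n = ((real (NN n) / exp (1/2)) ^ n) powr \<alpha>"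
   proof -
    have "s n ^ n * ((real (NN n) / exp (1/2)) ^ n) powr \<alpha> = ((exp (1/2) / real (NN n) * (real (NN n) / exp (1/2))) ^ n) powr \<alpha>"
     unfolding s_def by (simp add: powr_pow powr_mult[symmetric] power_mult_distrib[symmetric])
    also have "... = 1" using N by simp
    finally show ?thesis using s_pos[OF n] by (simp add: divide_eq_eq mult.commute)
   qed
   also have "... <= (fact n * exp (- real n / 6)) powr \<alpha>"
   proof (rule powr_mono2)
    have "real (NN n) / exp (1/2) <= (real n / 2) / exp (1/2)" using NNb(2)[OF n] by (intro divide_right_mono) auto
    also have "... <= real n / exp 1 * exp (- 1 / 6)"
    proof -
     have "exp (2/3) <= (2::real)" using ln2_ge_two_thirds by (subst ln_ge_iff[symmetric]) auto
     then have "exp (1 + 1/6 - 1/2) <= (2::real)" by simp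
     then have "exp 1 * exp (1/6) / exp (1/2) <= (2::real)" by (simp only: exp_add exp_diff)
     then have "1 / 2 / exp (1/2) <= 1 / exp 1 * exp (- 1 / 6 :: real)" by (simp add: exp_minus field_simps)
     then have "real n * (1 / 2 / exp (1/2)) <= real n * (1 / exp 1 * exp (- 1 / 6))" by (intro mult_left_mono) auto
     then show ?thesis by simp
    qed
    finally have "(real (NN n) / exp (1/2)) ^ n <= (real n / exp 1 * exp (- 1 / 6)) ^ n" by (intro power_mono) auto
    also have "... = (real n / exp 1) ^ n * exp (- real n / 6)" by (simp only: power_mult_distrib exp_of_nat_mult[symmetric]) simp
    also have "... <= fact n * exp (- real n / 6)" by (intro mult_right_mono fact_lower) auto
    finally show "(real (NN n) / exp (1/2)) ^ n <= fact n * exp (- real n / 6)" .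
   qed (use al in auto)
   also have "... = w n * exp (- (\<alpha> / 6) * real n)" unfolding w by (simp add: powr_mult exp_powr_real mult.commute)
   finally show ?thesis .
  qed
  then have "(1 / s n ^ n) * exp (h n) <= (w n * exp (- (\<alpha> / 6) * real n)) * exp (h n)" by (rule mult_right_mono) simp
  also have "... = w n * exp (- (\<alpha> / 6) * real n + h n)" by (simp only: exp_add mult.assoc)
  finally show ?thesis .
 qed
 \<comment> \<open>Moving total mass \<open>j\<close> to the small letters lowers the weight of the
   large one by \<open>NN n powr (- \<alpha> j)\<close>, of which the tilt by \<open>s n\<close>
   absorbs all but \<open>exp (- \<alpha> j / 2)\<close>.\<close>
 have big: "(\<Sum>rest\<in>{rest \<in> lsn {..n} n. sum_list rest + NN n < n \<and> M < real (sum_list rest)}. w (n - sum_list rest) * wt w rest)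
   <= w n * exp (- (\<alpha> / 2) * M + h n)" if n: "n >= 2" for n M
 proof -
  have N: "NN n >= 1" using n by (auto simp: NN_def)
  let ?S = "{rest \<in> lsn {..n} n. sum_list rest + NN n < n \<and> M < real (sum_list rest)}"
  have "(\<Sum>rest\<in>?S. w (n - sum_list rest) * wt w rest) <= (\<Sum>rest\<in>?S. (w n * exp (- (\<alpha> / 2) * M)) * wt (%i. w i * s n ^ i) rest)"
  proof (rule sum_mono)
   fix rest assume r: "rest \<in> ?S"
   define j where "j = sum_list rest"
   have j: "j <= n" "NN n < n - j" "M < real j" using r by (auto simp: j_def)
   have "real (NN n ^ j) * fact (n - j) <= fact n" using j by (intro fact_diff_bound) auto
   then have "(real (NN n ^ j) * fact (n - j)) powr \<alpha> <= fact n powr \<alpha>" using al by (intro powr_mono2) auto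
   then have "(real (NN n) powr \<alpha>) ^ j * w (n - j) <= w n" unfolding w by (simp add: powr_mult powr_pow)
   then have "w (n - j) <= w n / (real (NN n) powr \<alpha>) ^ j" using N by (simp add: pos_le_divide_eq mult.commute)
   also have "... = w n * (exp (- (\<alpha> / 2)) * s n) ^ j"
   proof -
    have "exp (- (\<alpha> / 2)) * s n = 1 / real (NN n) powr \<alpha>"
     unfolding s_def by (simp add: powr_divide exp_powr_real exp_minus)
    then show ?thesis by (simp add: power_divide)
   qed
   also have "... = w n * exp (- (\<alpha> / 2) * real j) * s n ^ j"
    by (simp add: power_mult_distrib exp_of_nat_mult[symmetric] mult.commute)
   also have "... <= w n * exp (- (\<alpha> / 2) * M) * s n ^ j"
    using j al wnn s_pos[OF n] by (intro mult_right_mono mult_left_mono) auto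
   finally have "w (n - j) * wt w rest <= (w n * exp (- (\<alpha> / 2) * M) * s n ^ j) * wt w rest"
    by (intro mult_right_mono wt_nonneg wnn)
   also have "... = (w n * exp (- (\<alpha> / 2) * M)) * wt (%i. w i * s n ^ i) rest"
    by (simp only: wt_mult wt_power j_def mult_ac)
   finally show "w (n - sum_list rest) * wt w rest <= (w n * exp (- (\<alpha> / 2) * M)) * wt (%i. w i * s n ^ i) rest"
    by (simp add: j_def)
  qed
  also have "... <= (\<Sum>rest\<in>lsn {..NN n} n. (w n * exp (- (\<alpha> / 2) * M)) * wt (%i. w i * s n ^ i) rest)"
  proof (rule sum_mono2)
   show "?S \<subseteq> lsn {..NN n} n"
   proof
    fix rest assume r: "rest \<in> ?S"
    \<comment> \<open>The large letter exceeds \<open>NN n\<close>, so the others sum to less than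
      \<open>n - NN n\<close>, which is at most \<open>NN n + 1\<close>.\<close>
    have "x <= NN n" if "x \<in> set rest" for x using member_le_sum_list[OF that] r NNb(3)[OF n] by simp
    then show "rest \<in> lsn {..NN n} n" using r by (auto simp: lsn_def)
   qed
  qed (use wnn s_pos[OF n] in \<open>auto simp: finite_lsn intro!: mult_nonneg_nonneg wt_nonneg\<close>)
  also have "... = (w n * exp (- (\<alpha> / 2) * M)) * G n ^ n" unfolding sum_distrib_left[symmetric] sum_wt_lsn G_def ..
  also have "... <= (w n * exp (- (\<alpha> / 2) * M)) * exp (h n)" using wnn by (intro mult_left_mono Gpow n) auto
  also have "... = w n * exp (- (\<alpha> / 2) * M + h n)" by (simp only: exp_add mult.assoc)
  finally show ?thesis .
 qed
 have "deg_good w 1 \<delta>" unfolding deg_good_def kap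
 proof (intro conjI allI impI)
  show "0 < (\<Sum>ks\<in>luk n. wt w ks)" for n using luk_sum_ge[of w n] w0 wnn wpos[of n] by simp
 next
  fix e :: real assume e: "0 < e"
  show "(%n. badw w 0 1 e (real n powr (1 - \<delta>)) n / (\<Sum>ks\<in>luk n. wt w ks)) \<longlonglongrightarrow> 0"
  proof (rule tendsto_sandwich[of "%_. 0"])
   define K where "K = C * 2 * 3 powr \<alpha>"
   have "\<forall>\<^sub>F n in sequentially. real n powr (- \<delta>) < e"
   proof -
    have "(%n. real n powr (- \<delta>)) \<longlonglongrightarrow> 0" using del by (intro tendsto_neg_powr filterlim_real_sequentially) auto
    then show ?thesis by (rule order_tendstoD) (rule e)
   qed
   then show "\<forall>\<^sub>F n in sequentially. badw w 0 1 e (real n powr (1 - \<delta>)) n / (\<Sum>ks\<in>luk n. wt w ks)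
     <= exp (- (\<alpha> / 6) * real n + K * real n powr (1 - \<alpha>)) + exp (- (\<alpha> / 2) * real n powr (1 - \<delta>) + K * real n powr (1 - \<alpha>))"
    using eventually_ge_at_top[of 2]
   proof eventually_elim
    case (elim n)
    define X where "X = real n powr (1 - \<delta>)"
    have "X = real n powr 1 * real n powr (- \<delta>)" unfolding X_def powr_add[symmetric] by simp
    also have "... <= real n * e" using elim by (simp add: mult_left_mono)
    finally have Xe: "X <= e * real n" by (simp add: mult.commute)
    have "badw w 0 1 e X n <= (\<Sum>ks\<in>{ks \<in> luk n. set ks \<subseteq> {..NN n}}. wt w ks) +
     (\<Sum>rest\<in>{rest \<in> lsn {..n} n. sum_list rest + NN n < n \<and> X < real (sum_list rest)}. w (n - sum_list rest) * wt w rest)"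
    proof (rule luk_sum_upper[OF wnn])
     fix pre k post assume a: "pre @ k # post \<in> luk n" "NN n < k" "\<not> good 0 1 e X n (pre @ k # post)"
     show "X < real (sum_list (post @ pre))"
     proof (rule ccontr)
      assume "\<not> X < real (sum_list (post @ pre))"
      then have le: "real (sum_list (post @ pre)) <= X" by simp
      have "lln 0 1 e n (post @ pre)" by (rule lln_zero) (use a(1) le Xe in \<open>auto simp: luk_def\<close>)
      moreover have "kbd X pre k post" by (rule kbd_sum) (use le in \<open>simp add: add.commute\<close>)
      ultimately show False using a unfolding good_def by force
     qed
    qed
    also have "... <= w n * exp (- (\<alpha> / 6) * real n + h n) + w n * exp (- (\<alpha> / 2) * X + h n)"
     by (intro add_mono nobig big elim)
    also have "... <= w n * exp (- (\<alpha> / 6) * real n + K * real n powr (1 - \<alpha>)) + w n * exp (- (\<alpha> / 2) * X + K * real n powr (1 - \<alpha>))"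
     using hb[of n] elim wnn unfolding K_def by (intro add_mono mult_left_mono) auto
    finally have 1: "badw w 0 1 e X n \<le>
      w n * (exp (- (\<alpha> / 6) * real n + K * real n powr (1 - \<alpha>)) + exp (- (\<alpha> / 2) * X + K * real n powr (1 - \<alpha>)))"
     by (simp only: distrib_left)
    have "badw w 0 1 e X n / (\<Sum>ks\<in>luk n. wt w ks)
      <= (w n * (exp (- (\<alpha> / 6) * real n + K * real n powr (1 - \<alpha>)) + exp (- (\<alpha> / 2) * X + K * real n powr (1 - \<alpha>)))) / w n"
     by (rule frac_le) (use 1 wpos[of n] luk_sum_ge[of w n] w0 wnn in \<open>auto intro!: mult_nonneg_nonneg add_nonneg_nonneg\<close>)
    then show ?case using wpos[of n] unfolding X_def by simp
   qed
   have d1: "1 - \<alpha> < 1 - \<delta>" "0 < 1 - \<delta>" "0 < \<alpha> / 6" "0 < \<alpha> / 2" using del al by auto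
   have l1: "(%n. exp (- (\<alpha> / 6) * real n + K * real n powr (1 - \<alpha>))) \<longlonglongrightarrow> 0"
   proof -
    have fb: "filterlim (%n. (K * real n powr (- \<alpha>) - \<alpha> / 6) * real n) at_bot sequentially"
    proof (rule filterlim_tendsto_neg_mult_at_bot[of _ "- (\<alpha> / 6)"])
     have "(%n. K * real n powr (- \<alpha>) - \<alpha> / 6) \<longlonglongrightarrow> K * 0 - \<alpha> / 6"
      using al by (intro tendsto_intros tendsto_neg_powr filterlim_real_sequentially) auto
     then show "(%n. K * real n powr (- \<alpha>) - \<alpha> / 6) \<longlonglongrightarrow> - (\<alpha> / 6)" by simp
    qed (use al filterlim_real_sequentially in auto)
    have ev: "\<forall>\<^sub>F n in sequentially. (K * real n powr (- \<alpha>) - \<alpha> / 6) * real n = - (\<alpha> / 6) * real n + K * real n powr (1 - \<alpha>)"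
    proof (rule eventually_sequentiallyI[of 1])
     fix n :: nat assume "1 <= n"
     then have "real n powr (1 - \<alpha>) = real n * real n powr (- \<alpha>)" using powr_add[of "real n" 1 "- \<alpha>"] by simp
     then show "(K * real n powr (- \<alpha>) - \<alpha> / 6) * real n = - (\<alpha> / 6) * real n + K * real n powr (1 - \<alpha>)" by (simp add: algebra_simps)
    qed
    have "filterlim (%n. - (\<alpha> / 6) * real n + K * real n powr (1 - \<alpha>)) at_bot sequentially"
     using fb filterlim_cong[OF refl refl ev] by blast
    then show ?thesis by (rule filterlim_compose[OF exp_at_bot])
   qed
   have l2: "(%n. exp (- (\<alpha> / 2) * real n powr (1 - \<delta>) + K * real n powr (1 - \<alpha>))) \<longlonglongrightarrow> 0"
   proof -
    have up: "filterlim (%n. real n powr (1 - \<delta>)) at_top sequentially" using d1(2) by real_asymp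
    have "filterlim (%n. (K * real n powr (\<delta> - \<alpha>) - \<alpha> / 2) * real n powr (1 - \<delta>)) at_bot sequentially"
    proof (rule filterlim_tendsto_neg_mult_at_bot[of _ "- (\<alpha> / 2)"])
     have "(%n. K * real n powr (\<delta> - \<alpha>) - \<alpha> / 2) \<longlonglongrightarrow> K * 0 - \<alpha> / 2"
      using del by (intro tendsto_intros tendsto_neg_powr filterlim_real_sequentially) auto
     then show "(%n. K * real n powr (\<delta> - \<alpha>) - \<alpha> / 2) \<longlonglongrightarrow> - (\<alpha> / 2)" by simp
    qed (use al up in auto)
    moreover have "(K * real n powr (\<delta> - \<alpha>) - \<alpha> / 2) * real n powr (1 - \<delta>) = - (\<alpha> / 2) * real n powr (1 - \<delta>) + K * real n powr (1 - \<alpha>)" for n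
    proof -
     have "real n powr (\<delta> - \<alpha>) * real n powr (1 - \<delta>) = real n powr (1 - \<alpha>)" unfolding powr_add[symmetric] by simp
     then show ?thesis by (simp add: algebra_simps)
    qed
    ultimately show ?thesis by (simp only:) (rule filterlim_compose[OF exp_at_bot])
   qed
   show "(%n. exp (- (\<alpha> / 6) * real n + K * real n powr (1 - \<alpha>)) + exp (- (\<alpha> / 2) * real n powr (1 - \<delta>) + K * real n powr (1 - \<alpha>))) \<longlonglongrightarrow> 0"
    using tendsto_add[OF l1 l2] by simp
  qed (auto intro!: always_eventually divide_nonneg_nonneg sum_nonneg wt_nonneg wnn)
 qed (use del in auto)
 then show ?thesis by blast
qed

subsection \<open>Labels along the depth-first walk\<close>

text \<open>A projection principle: a statistic of the stack entries with its own replacement rule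
  performs a stack walk by itself. It extracts labels, degree sums and block indices from one
  decorated walk.\<close>

lemma run_map:
 assumes "\<And>a x. x \<in> set xs ==> map h (f a x) = g (h a) (u x)"
 shows "map h (run f xs st) = run g (map u xs) (map h st)"
  and "map h (outs f xs st) = outs g (map u xs) (map h st)" using assms
proof (induction f xs st rule: run.induct)
 case (3 f x xs a st)
 { case 1 then show ?case using "3.IH"(1) by simp
 next
  case 2
  have "f a x = [] \<longleftrightarrow> g (h a) (u x) = []" by (metis 2 list.set_intros(1) map_is_Nil_conv)
  then show ?case using "3.IH"(2) 2 by simp }
qed auto

lemma outs_nth:
 assumes "i < length (outs f xs st)"
 shows "\<exists>t st'. t < length xs \<and> run f (take t xs) st = outs f xs st ! i # st' \<and> i = length (outs f (take t xs) st)"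
 using assms
proof (induction f xs st arbitrary: i rule: outs.induct)
 case (3 f x xs a st)
 show ?case
 proof (cases "f a x = [] \<and> i = 0")
  case True
  then show ?thesis by (intro exI[of _ 0]) auto
 next
  case False
  define o1 where "o1 = (if f a x = [] then [a] else [])"
  have o: "outs f (x # xs) (a # st) = o1 @ outs f xs (f a x @ st)" by (simp add: o1_def)
  have le: "length o1 <= i" using False by (auto simp: o1_def)
  have "i - length o1 < length (outs f xs (f a x @ st))" using "3.prems" le unfolding o by simp
  from "3.IH"[OF this] obtain t st' where t: "t < length xs"
   "run f (take t xs) (f a x @ st) = outs f xs (f a x @ st) ! (i - length o1) # st'"
   "i - length o1 = length (outs f (take t xs) (f a x @ st))" by blast
  have "outs f (take (Suc t) (x # xs)) (a # st) = o1 @ outs f (take t xs) (f a x @ st)" by (simp add: o1_def)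
  then have "i = length (outs f (take (Suc t) (x # xs)) (a # st))" using t(3) le by simp
  moreover have "outs f (x # xs) (a # st) ! i = outs f xs (f a x @ st) ! (i - length o1)"
   unfolding o using le by (simp add: nth_append)
  ultimately show ?thesis using t by (intro exI[of _ "Suc t"]) auto
 qed
qed auto

lemma zeros_simps [simp]: "zeros [] = 0" "zeros (k # ks) = of_bool (k = 0) + zeros ks" "zeros (xs @ ys) = zeros xs + zeros ys"
 by (auto simp: zeros_def)

lemma run_length:
 assumes "\<And>a x. x \<in> set xs ==> length (f a x) = u x"
  and "\<And>m. m < length xs ==> m < length st + sum_list (take m (map u xs))"
 shows "length (run f xs st) + length xs = length st + sum_list (map u xs)"
  and "length (outs f xs st) = zeros (map u xs)" using assms
proof (induction f xs st rule: run.induct)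
 case (3 f x xs a st)
 have "length (f a x) = u x" if "\<And>a' x'. x' \<in> set (x # xs) ==> length (f a' x') = u x'" by (simp add: that)
 moreover have "m < length (f a x @ st) + sum_list (take m (map u xs))"
  if "\<And>a' x'. x' \<in> set (x # xs) ==> length (f a' x') = u x'" "m < length xs"
   "\<And>m. m < length (x # xs) ==> m < length (a # st) + sum_list (take m (map u (x # xs)))" for m
  using that(1)[of x a] that(2) that(3)[of "Suc m"] by simp
 ultimately have IH: "length (run f xs (f a x @ st)) + length xs = length (f a x @ st) + sum_list (map u xs)"
  "length (outs f xs (f a x @ st)) = zeros (map u xs)" "length (f a x) = u x"
  if "\<And>a' x'. x' \<in> set (x # xs) ==> length (f a' x') = u x'"
   "\<And>m. m < length (x # xs) ==> m < length (a # st) + sum_list (take m (map u (x # xs)))"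
  using "3.IH" that by (simp_all add: "3.IH")
 { case 1 from IH[OF this] show ?case by simp
 next
  case 2 from IH[OF this] show ?case by auto }
next
 case (2 f x xs)
 { case 1 from this(2)[of 0] show ?case by simp
 next
  case 2 from this(2)[of 0] show ?case by simp }
qed auto

section \<open>The stack walk around the large vertex\<close>

definition jst :: "nat => nat => nat list" where
 "jst J k = replicate k J"

text \<open>A block is exhausted whenever the walk with steps \<open>x - 1\<close> reaches a new
  minimum, so the index on top follows minus the running minimum: it is at least the current deficit
  and equals the deficit at the time the block was entered. Index \<open>k\<close> collects
  everything below the blocks and escapes the first bound.\<close>

lemma jst_index:
 fixes q z :: nat
 assumes "run jst xs (replicate (Suc q) J @ [Suc J..<k] @ replicate z k) = J' # st" "J <= k"
 shows "J <= J' \<and> J' <= k \<and> (J' = k \<or> int (length xs) + int J <= int (sum_list xs) + int q + int J') \<and>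
  (J' = J \<or> (\<exists>s\<le>length xs. int s + int J = int (sum_list (take s xs)) + int q + int J'))" using assms
proof (induction xs arbitrary: q J z)
 case (Cons x xs)
 show ?case
 proof (cases "x + q")
  case (Suc q')
  have "replicate x J @ replicate q J = replicate (Suc q') J" unfolding Suc[symmetric] by (simp add: replicate_add)
  then have "run jst xs (replicate (Suc q') J @ [Suc J..<k] @ replicate z k) = J' # st"
   using Cons.prems(1) by (simp add: jst_def[of J x] flip: append_assoc)
  note IH = Cons.IH[OF this Cons.prems(2)]
  have "\<exists>s\<le>length (x # xs). int s + int J = int (sum_list (take s (x # xs))) + int q + int J'" if ne: "J' \<noteq> J"
  proof -
   obtain s where "s <= length xs" "int s + int J = int (sum_list (take s xs)) + int q' + int J'" using IH ne by blast
   then show ?thesis using Suc by (intro exI[of _ "Suc s"]) auto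
  qed
  then show ?thesis using IH Suc by auto
 next
  case 0
  then have xq: "x = 0" "q = 0" by auto
  have r: "run jst xs ([Suc J..<k] @ replicate z k) = J' # st" using Cons.prems(1) by (simp add: jst_def[of J 0] xq)
  show ?thesis
  proof (cases "Suc J < k")
   case True
   then have "[Suc J..<k] @ replicate z k = replicate (Suc 0) (Suc J) @ [Suc (Suc J)..<k] @ replicate z k"
    by (simp add: upt_conv_Cons)
   with r have "run jst xs (replicate (Suc 0) (Suc J) @ [Suc (Suc J)..<k] @ replicate z k) = J' # st" by simp
   note IH = Cons.IH[OF this]
   have "\<exists>s\<le>length (x # xs). int s + int J = int (sum_list (take s (x # xs))) + int q + int J'"
   proof (cases "J' = Suc J")
    case True
    then show ?thesis using xq by (intro exI[of _ "Suc 0"]) auto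
   next
    case ne: False
    obtain s where "s <= length xs" "int s + int (Suc J) = int (sum_list (take s xs)) + int 0 + int J'" using IH ne True by auto
    then show ?thesis using xq by (intro exI[of _ "Suc s"]) auto
   qed
   then show ?thesis using IH True xq by auto
  next
   case False
   have "run jst xs (replicate z k) = J' # st" using r False by simp
   moreover from this have "z \<noteq> 0" by (cases xs; cases z) auto
   then have "replicate z k = replicate (Suc (z - 1)) k @ [Suc k..<k] @ replicate 0 k" by simp
   ultimately have "run jst xs (replicate (Suc (z - 1)) k @ [Suc k..<k] @ replicate 0 k) = J' # st" by metis
   from Cons.IH[OF this] have "J' = k" by simp
   moreover have "J = k \<or> Suc J = k" using False Cons.prems(2) by linarith
   ultimately show ?thesis using xq by (auto intro!: exI[of _ "Suc 0"])
  qed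
 qed
qed simp

text \<open>An entry \<open>(d, K, J)\<close> consists of the label without the contribution of the large vertex, the sum of the
degrees of the other ancestors, and the block of the large vertex below which the entry lies.\<close>

definition tf :: "int \<times> nat \<times> nat => nat list => (int \<times> nat \<times> nat) list" where
 "tf = (%(d, K, J) ms. map (%j. (d + bsum ms j, K + length ms, J)) [0..<length ms])"

text \<open>The stack just after the large vertex is read, without its bridge. Its slots receive the
  indices \<open>0, ..., k - 1\<close>, the older entries the index \<open>k\<close>, where the
  bridge is back at 0; thus \<open>d + bsum ms J\<close> is the true label in every case.\<close>

definition pst :: "nat => (int \<times> nat \<times> nat) list => (int \<times> nat \<times> nat) list" where
 "pst k S = (case S of [] => [] | (d, K, J) # st => map (%j. (d, K, j)) [0..<k] @ map (%(d, K, J). (d, K, k)) st)"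

abbreviation "st0 \<equiv> [(0::int, 0::nat, 0::nat)]"

lemma dec_length: "zs \<in> dec ks ==> map length zs = ks"
 unfolding dec_iff by (induction zs ks rule: list_all2_induct) (auto simp: comps_def)

lemma tf_fst: "map fst (run tf zs st) = run chl zs (map fst st)" "map fst (outs tf zs st) = outs chl zs (map fst st)"
 by (rule run_map[of zs fst tf chl "%x. x", simplified], simp add: tf_def chl_def split_def comp_def)+

lemma tf_K: "map (fst \<circ> snd) (run tf zs st) = run kst (map length zs) (map (fst \<circ> snd) st)"
 by (rule run_map) (auto simp: tf_def kst_def split_def comp_def map_replicate_const)

lemma tf_J: "map (snd \<circ> snd) (run tf zs st) = run jst (map length zs) (map (snd \<circ> snd) st)"
 "map (snd \<circ> snd) (outs tf zs st) = outs jst (map length zs) (map (snd \<circ> snd) st)"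
 by (rule run_map; auto simp: tf_def jst_def split_def comp_def map_replicate_const)+

lemma tf_label: "map (%(d, K, J). d + bsum ms J) (outs tf zs st) = outs chl zs (map (%(d, K, J). d + bsum ms J) st)"
 by (rule run_map(2)[of zs _ tf chl "%x. x", simplified]) (auto simp: tf_def chl_def)

text \<open>Neither the component \<open>d\<close> nor the index \<open>J\<close> involves the large
  bridge \<open>ms\<close>, so the bridge can be averaged separately from the displacement.\<close>

lemma outs_decomp:
 assumes ms: "ms \<in> bcomp k" and k: "k >= 1" and ne: "run tf a st0 \<noteq> []"
 shows "outs chl (a @ ms # c) [0] =
  map fst (outs tf a st0) @ map (%(d, K, J). d + bsum ms J) (outs tf c (pst k (run tf a st0)))"
proof -
 obtain d K J st where e: "run tf a st0 = (d, K, J) # st" using ne by (metis list.exhaust prod.collapse)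
 have r: "run chl a [0] = d # map fst st" using tf_fst(1)[of a st0] unfolding e by simp
 have len: "length ms = k" using ms by (simp add: comps_def)
 have "chl d ms @ map fst st = map (%(d, K, J). d + bsum ms J) (pst k (run tf a st0))"
  unfolding e pst_def chl_def using len bsum_full[OF ms] by (auto simp: split_def)
 moreover have "chl d ms \<noteq> []" using len k by (auto simp: chl_def)
 moreover have "outs chl a [0] = map fst (outs tf a st0)" using tf_fst(2)[of a st0] by simp
 ultimately show ?thesis by (simp add: outs_append r tf_label)
qed

text \<open>The entry at position \<open>p\<close> of the final stack descends from one entry
  \<open>q\<close> of the initial stack, and \<open>q\<close> depends on the degrees only. Along
  this line every vertex of degree \<open>k\<close> costs at most
  \<open>exp (c \<theta>^2 k)\<close>, which the component \<open>K\<close> compensates, so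
  \<open>\<phi>\<close> is a supermartingale.\<close>

lemma tf_index:
 fixes \<theta> c :: real
 defines "\<phi> \<equiv> %s :: int \<times> nat \<times> nat. exp (\<theta> * real_of_int (fst s) - c * \<theta>^2 * real (fst (snd s)))"
 assumes mg: "\<And>k j. j <= k ==> avg (bcomp k) (%ms. exp (\<theta> * real_of_int (bsum ms j))) <= exp (c * \<theta>^2 * real k)"
  and p: "p < length (run jst ks (replicate L 0))"
 shows "\<exists>q<L. \<forall>st. length st = L --> avg (dec ks) (%zs. \<phi> (run tf zs st ! p)) <= \<phi> (st ! q)"
 using p
proof (induction ks arbitrary: L)
 case Nil
 then show ?case by (auto simp: avg_def)
next
 case (Cons k ks)
 then obtain L1 where L: "L = Suc L1" by (cases L) auto
 have "p < length (run jst ks (replicate (k + L1) 0))" using Cons.prems unfolding L by (simp add: jst_def[of 0 k] replicate_add)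
 from Cons.IH[OF this] obtain q where q: "q < k + L1"
  and IH: "\<And>st. length st = k + L1 ==> avg (dec ks) (%zs. \<phi> (run tf zs st ! p)) <= \<phi> (st ! q)" by blast
 \<comment> \<open>One letter earlier: the first \<open>k\<close> positions all come from the top
   entry, the later ones are shifted by \<open>k - 1\<close>.\<close>
 define q' where "q' = (if q < k then 0 else Suc (q - k))"
 show ?case
 proof (intro exI[of _ q'] conjI allI impI)
  show "q' < L" using q unfolding q'_def L by auto
  fix st :: "(int \<times> nat \<times> nat) list" assume "length st = L"
  then obtain d K J st1 where st: "st = (d, K, J) # st1" "length st1 = L1" unfolding L by (cases st) auto
  have "avg (dec (k # ks)) (%zs. \<phi> (run tf zs st ! p)) = avg (bcomp k) (%z. avg (dec ks) (%zs. \<phi> (run tf zs (tf (d, K, J) z @ st1) ! p)))"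
   unfolding avg_dec_Cons st by simp
  also have "... <= avg (bcomp k) (%z. \<phi> ((tf (d, K, J) z @ st1) ! q))"
   by (intro avg_mono IH) (auto simp: tf_def comps_def st)
  also have "... <= \<phi> (st ! q')"
  proof (cases "q < k")
   case True
   have "avg (bcomp k) (%z. \<phi> ((tf (d, K, J) z @ st1) ! q)) =
    avg (bcomp k) (%z. exp (\<theta> * d - c * \<theta>\<^sup>2 * real (K + k)) * exp (\<theta> * real_of_int (bsum z q)))"
    using True by (intro avg_cong) (simp add: comps_def tf_def nth_append \<phi>_def algebra_simps flip: exp_add)
   also have "... <= exp (\<theta> * d - c * \<theta>\<^sup>2 * real (K + k)) * exp (c * \<theta>^2 * real k)"
    unfolding avg_cmult using True by (intro mult_left_mono mg) auto
   also have "... = \<phi> (st ! q')" using True by (simp add: q'_def st \<phi>_def algebra_simps flip: exp_add)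
   finally show ?thesis .
  next
   case False
   have "avg (bcomp k) (%z. \<phi> ((tf (d, K, J) z @ st1) ! q)) = avg (bcomp k) (%z. \<phi> (st ! q'))"
    using False by (intro avg_cong) (simp add: comps_def tf_def nth_append q'_def st)
   then show ?thesis using avg_const[OF card_bcomp_pos] by simp
  qed
  finally show "avg (dec (k # ks)) (%zs. \<phi> (run tf zs st ! p)) <= \<phi> (st ! q')" .
 qed
qed


lemma outs_hd:
 assumes "e \<in> set (outs f xs st)"
 shows "\<exists>t<length xs. run f (take t xs) st \<noteq> [] \<and> run f (take t xs) st ! 0 = e"
proof -
 obtain i where i: "i < length (outs f xs st)" "outs f xs st ! i = e" using assms by (auto simp: in_set_conv_nth)
 from outs_nth[OF i(1)] i(2) obtain t st' where "t < length xs" "run f (take t xs) st = e # st'" by auto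
 then show ?thesis by (intro exI[of _ t]) auto
qed

lemma pst_K: "map (fst \<circ> snd) (pst k S) = bigst k (map (fst \<circ> snd) S)"
 by (auto simp: pst_def bigst_def split_def comp_def map_replicate_const split: list.splits)

lemma length_tf_run: "length (run tf zs st) = length (run jst (map length zs) (replicate (length st) 0))"
proof -
 have "map (%_. 0 :: nat) (run tf zs st) = run jst (map length zs) (map (%_. 0) st)"
  by (rule run_map) (auto simp: tf_def jst_def split_def comp_def map_replicate_const)
 from arg_cong[OF this, of length] show ?thesis by (simp add: map_replicate_const)
qed

lemma avg_dec_take:
 assumes "card (dec (drop t ks)) > 0"
 shows "avg (dec ks) (%zs. f (take t zs)) = avg (dec (take t ks)) f"
proof -
 have "avg (dec (take t ks @ drop t ks)) (%zs. f (take t zs)) =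
  avg (dec (take t ks)) (%us. avg (dec (drop t ks)) (%vs. f us))"
 proof (subst avg_dec_append, intro avg_cong)
  fix us vs assume "us \<in> dec (take t ks)" "vs \<in> dec (drop t ks)"
  then have "length us = min t (length ks)" "length vs = length ks - t" by (auto simp: dec_iff dest!: list_all2_lengthD)
  then show "f (take t (us @ vs)) = f us" by (cases "t <= length ks") auto
 qed
 then show ?thesis using avg_const[OF assms] by simp
qed

text \<open>Every emitted entry was on top of the stack at some time. A union over these times and
  both signs of \<open>\<theta>\<close> with the exponential Markov inequality gives the bound,
  since \<open>kbd\<close> limits \<open>K\<close> by \<open>X\<close>.\<close>

lemma disp_bound:
 fixes c \<theta> X x :: real
 assumes mg: "\<And>k j \<theta>'. j <= k ==> \<bar>\<theta>'\<bar> <= \<theta> ==> avg (bcomp k) (%ms. exp (\<theta>' * real_of_int (bsum ms j))) <= exp (c * \<theta>'^2 * real k)"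
  and \<theta>: "0 <= \<theta>" and c: "0 <= c" and kbd: "kbd X pre k post" and ne: "run jst pre [0] \<noteq> []"
 shows "avg (dec pre) (%a. avg (dec post) (%v.
   of_bool (\<exists>e\<in>set (outs tf a st0) \<union> set (outs tf v (pst k (run tf a st0))). x <= \<bar>real_of_int (fst e)\<bar>)))
  <= 2 * real (length pre + length post) * exp (- \<theta> * x + c * \<theta>^2 * X)"
proof -
 define \<phi> where "\<phi> = (%\<theta>' (s :: int \<times> nat \<times> nat). exp (\<theta>' * real_of_int (fst s) - c * \<theta>'^2 * real (fst (snd s))))"
 define T where "T = {\<theta>, -\<theta>}"
 define B where "B = exp (- \<theta> * x + c * \<theta>^2 * X)"
 define g where "g = (%\<theta>' st. of_bool (st \<noteq> []) * \<phi> \<theta>' (st ! 0))"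
 have T: "\<bar>\<theta>'\<bar> <= \<theta>" "\<theta>'^2 = \<theta>^2" if "\<theta>' \<in> T" for \<theta>' using that \<theta> by (auto simp: T_def)
 have key: "of_bool (x <= \<bar>real_of_int (fst e)\<bar>) <= B * (\<Sum>\<theta>'\<in>{0,1::nat}. \<phi> (if \<theta>' = 0 then \<theta> else - \<theta>) e)"
  if "real (fst (snd e)) <= X" for e
 proof (cases "x <= \<bar>real_of_int (fst e)\<bar>")
  case True
  have cx: "c * \<theta>^2 * real (fst (snd e)) <= c * \<theta>^2 * X" using that c by (intro mult_left_mono) auto
  have "\<theta> * x <= \<theta> * real_of_int (fst e) \<or> \<theta> * x <= \<theta> * - real_of_int (fst e)"
   using True \<theta> mult_left_mono[of x "\<bar>real_of_int (fst e)\<bar>" \<theta>] by (cases "fst e >= 0") auto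
  then have "1 <= exp (- \<theta> * x + c * \<theta>^2 * X + (\<theta> * real_of_int (fst e) - c * \<theta>^2 * real (fst (snd e))))
   \<or> 1 <= exp (- \<theta> * x + c * \<theta>^2 * X + (- \<theta> * real_of_int (fst e) - c * \<theta>^2 * real (fst (snd e))))"
   using cx by auto
  then have "1 <= B * \<phi> \<theta> e \<or> 1 <= B * \<phi> (- \<theta>) e" unfolding B_def \<phi>_def exp_add by simp
  moreover have "0 <= B * \<phi> \<theta> e" "0 <= B * \<phi> (-\<theta>) e" by (auto simp: B_def \<phi>_def)
  ultimately show ?thesis using True by (auto simp: distrib_left)
 qed (auto simp: B_def \<phi>_def)
 define G where "G = (%st. B * (\<Sum>i\<in>{0,1::nat}. g (if i = 0 then \<theta> else - \<theta>) st))"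
 have g0: "g \<theta>' st >= 0" for \<theta>' st by (auto simp: g_def \<phi>_def)
 have G0: "G st >= 0" for st unfolding G_def B_def by (intro mult_nonneg_nonneg sum_nonneg g0) auto
 have key2: "of_bool (x <= \<bar>real_of_int (fst (st ! 0))\<bar>) <= G st"
  if "st \<noteq> []" "\<forall>b\<in>set (map (fst \<circ> snd) st). real b <= X" for st
  using key[of "st ! 0"] that by (simp add: G_def g_def nth_mem)
 have point: "of_bool (\<exists>e\<in>set (outs tf a st0) \<union> set (outs tf v (pst k (run tf a st0))). x <= \<bar>real_of_int (fst e)\<bar>)
   <= (\<Sum>t<length pre. G (run tf (take t a) st0)) + (\<Sum>t<length post. G (run tf (take t v) (pst k (run tf a st0))))"
  (is "_ <= ?R")
  if a: "a \<in> dec pre" and v: "v \<in> dec post" for a v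
 proof (cases "\<exists>e\<in>set (outs tf a st0) \<union> set (outs tf v (pst k (run tf a st0))). x <= \<bar>real_of_int (fst e)\<bar>")
  case True
  have la: "map length a = pre" "map length v = post" using a v dec_length by auto
  then have len: "length a = length pre" "length v = length post" by auto
  from True consider e where "e \<in> set (outs tf a st0)" "x <= \<bar>real_of_int (fst e)\<bar>"
   | e where "e \<in> set (outs tf v (pst k (run tf a st0)))" "x <= \<bar>real_of_int (fst e)\<bar>" by blast
  then have "1 <= ?R"
  proof cases
   case 1
   from outs_hd[OF 1(1)] obtain t where t: "t < length pre" "run tf (take t a) st0 \<noteq> []" "run tf (take t a) st0 ! 0 = e"
    unfolding len by blast
   have "\<forall>b\<in>set (map (fst \<circ> snd) (run tf (take t a) st0)). real b <= X"
    using kbd t(1) unfolding tf_K kbd_def take_map[symmetric] la by (metis less_imp_le list.map(1) list.map(2) comp_apply fst_conv snd_conv)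
   from key2[OF t(2) this] 1(2) t(3) have "1 <= G (run tf (take t a) st0)" by simp
   also have "... <= (\<Sum>t<length pre. G (run tf (take t a) st0))" using t(1) G0 by (intro member_le_sum) auto
   finally show ?thesis using sum_nonneg[of "{..<length post}" "%t. G (run tf (take t v) (pst k (run tf a st0)))"] G0 by fastforce
  next
   case 2
   let ?S = "pst k (run tf a st0)"
   from outs_hd[OF 2(1)] obtain t where t: "t < length post" "run tf (take t v) ?S \<noteq> []" "run tf (take t v) ?S ! 0 = e"
    unfolding len by blast
   have "\<forall>b\<in>set (map (fst \<circ> snd) (run tf (take t v) ?S)). real b <= X"
    using kbd t(1) unfolding tf_K pst_K kbd_def take_map[symmetric] la
    by (metis less_imp_le list.map(1) list.map(2) comp_apply fst_conv snd_conv)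
   from key2[OF t(2) this] 2(2) t(3) have "1 <= G (run tf (take t v) ?S)" by simp
   also have "... <= (\<Sum>t<length post. G (run tf (take t v) ?S))" using t(1) G0 by (intro member_le_sum) auto
   finally show ?thesis using sum_nonneg[of "{..<length pre}" "%t. G (run tf (take t a) st0)"] G0 by fastforce
  qed
  then show ?thesis using True by simp
 next
  case False
  then show ?thesis using G0 by (simp add: sum_nonneg add_nonneg_nonneg)
 qed
 have mg': "j <= k ==> avg (bcomp k) (%ms. exp (\<theta>' * real_of_int (bsum ms j))) <= exp (c * \<theta>'^2 * real k)"
  if "\<theta>' \<in> T" for \<theta>' k j using mg T(1)[OF that] by blast
 have ipre: "avg (dec ks) (%a. \<phi> \<theta>' (run tf a st0 ! p)) <= 1"
  if "\<theta>' \<in> T" "p < length (run jst ks [0])" for \<theta>' p ks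
  using tf_index[of \<theta>' c p ks 1, OF mg'[OF that(1)]] that(2) unfolding \<phi>_def by (auto dest!: spec[of _ st0])
 have gpre: "avg (dec pre) (%a. g \<theta>' (run tf (take t a) st0)) <= 1" if th: "\<theta>' \<in> T" for \<theta>' t
 proof -
  have "avg (dec pre) (%a. g \<theta>' (run tf (take t a) st0)) = avg (dec (take t pre)) (%a. g \<theta>' (run tf a st0))"
   by (rule avg_dec_take[OF card_dec_pos])
  also have "... <= 1"
  proof (cases "run jst (take t pre) [0] = []")
   case True
   have "avg (dec (take t pre)) (%a. g \<theta>' (run tf a st0)) = avg (dec (take t pre)) (%a. 0)"
   proof (intro avg_cong)
    fix a assume "a \<in> dec (take t pre)"
    then have "length (run tf a st0) = 0" unfolding length_tf_run using True dec_length by simp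
    then show "g \<theta>' (run tf a st0) = 0" by (simp add: g_def)
   qed
   then show ?thesis using avg_const[OF card_dec_pos] by simp
  next
   case False
   have "avg (dec (take t pre)) (%a. g \<theta>' (run tf a st0)) <= avg (dec (take t pre)) (%a. \<phi> \<theta>' (run tf a st0 ! 0))"
    by (intro avg_mono) (auto simp: g_def \<phi>_def)
   then show ?thesis using ipre[OF th, of 0 "take t pre"] False by fastforce
  qed
  finally show ?thesis .
 qed
 have gpost: "avg (dec pre) (%a. avg (dec post) (%v. g \<theta>' (run tf (take t v) (pst k (run tf a st0))))) <= 1"
  if th: "\<theta>' \<in> T" for \<theta>' t
 proof -
  obtain L where L: "length (run jst pre [0]) = Suc L" using ne by (cases "run jst pre [0]") auto
  have la: "length (run tf a st0) = Suc L" if "a \<in> dec pre" for a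
   using length_tf_run[of a st0] dec_length[OF that] L by simp
  have lp: "length (pst k (run tf a st0)) = k + L" if "a \<in> dec pre" for a
   using la[OF that] by (auto simp: pst_def split: list.splits)
  have "avg (dec pre) (%a. avg (dec post) (%v. g \<theta>' (run tf (take t v) (pst k (run tf a st0))))) =
   avg (dec pre) (%a. avg (dec (take t post)) (%v. g \<theta>' (run tf v (pst k (run tf a st0)))))"
   by (intro avg_cong avg_dec_take[OF card_dec_pos])
  also have "... <= 1"
  proof (cases "run jst (take t post) (replicate (k + L) 0) = []")
   case True
   have "avg (dec pre) (%a. avg (dec (take t post)) (%v. g \<theta>' (run tf v (pst k (run tf a st0))))) =
     avg (dec pre) (%a. avg (dec (take t post)) (%v. 0))"
   proof (intro avg_cong)
    fix a v assume "a \<in> dec pre" "v \<in> dec (take t post)"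
    then have "length (run tf v (pst k (run tf a st0))) = 0" unfolding length_tf_run using True dec_length lp by simp
    then show "g \<theta>' (run tf v (pst k (run tf a st0))) = 0" by (simp add: g_def)
   qed
   then show ?thesis using avg_const[OF card_dec_pos] by simp
  next
   case False
   then obtain q where q: "q < k + L" "\<And>st. length st = k + L ==>
     avg (dec (take t post)) (%zs. \<phi> \<theta>' (run tf zs st ! 0)) <= \<phi> \<theta>' (st ! q)"
    using tf_index[of \<theta>' c 0 "take t post" "k + L", OF mg'[OF th]] unfolding \<phi>_def by auto
   \<comment> \<open>The parent position across the large vertex: all \<open>k\<close> slots stem
     from the top entry, and their \<open>d\<close> and \<open>K\<close> are copied from it.\<close>
   define p where "p = (if q < k then 0 else Suc (q - k))"
   have p: "p < Suc L" using q(1) by (auto simp: p_def)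
   have "avg (dec pre) (%a. avg (dec (take t post)) (%v. g \<theta>' (run tf v (pst k (run tf a st0))))) \<le>
    avg (dec pre) (%a. avg (dec (take t post)) (%v. \<phi> \<theta>' (run tf v (pst k (run tf a st0)) ! 0)))"
    by (intro avg_mono) (auto simp: g_def \<phi>_def)
   also have "... <= avg (dec pre) (%a. \<phi> \<theta>' (pst k (run tf a st0) ! q))"
    by (intro avg_mono q(2) lp)
   also have "... = avg (dec pre) (%a. \<phi> \<theta>' (run tf a st0 ! p))"
   proof (intro avg_cong)
    fix a assume "a \<in> dec pre"
    from la[OF this] obtain d K J st where "run tf a st0 = (d, K, J) # st" "length st = L" by (cases "run tf a st0") auto
    then show "\<phi> \<theta>' (pst k (run tf a st0) ! q) = \<phi> \<theta>' (run tf a st0 ! p)"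
     using q(1) by (auto simp: pst_def p_def \<phi>_def nth_append split_def)
   qed
   also have "... <= 1" using ipre[OF th, of p pre] p L by simp
   finally show ?thesis .
  qed
  finally show ?thesis .
 qed
 have "avg (dec pre) (%a. avg (dec post) (%v.
   of_bool (\<exists>e\<in>set (outs tf a st0) \<union> set (outs tf v (pst k (run tf a st0))). x <= \<bar>real_of_int (fst e)\<bar>)))
  <= avg (dec pre) (%a. avg (dec post) (%v. (\<Sum>t<length pre. G (run tf (take t a) st0)) +
    (\<Sum>t<length post. G (run tf (take t v) (pst k (run tf a st0))))))" by (intro avg_mono point)
 also have "... = (\<Sum>t<length pre. avg (dec pre) (%a. G (run tf (take t a) st0))) +
    (\<Sum>t<length post. avg (dec pre) (%a. avg (dec post) (%v. G (run tf (take t v) (pst k (run tf a st0))))))"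
  unfolding avg_add avg_sum by (simp add: avg_const[OF card_dec_pos] avg_add avg_sum)
 also have "... <= (\<Sum>t<length pre. B * 2) + (\<Sum>t<length post. B * 2)"
 proof (intro add_mono sum_mono)
  have B0: "B >= 0" by (simp add: B_def)
  fix t
  have "avg (dec pre) (%a. G (run tf (take t a) st0)) <= B * (1 + 1)"
   unfolding G_def avg_cmult avg_sum using gpre[of \<theta> t] gpre[of "-\<theta>" t] B0
   by (intro mult_left_mono) (auto simp: T_def)
  then show "avg (dec pre) (%a. G (run tf (take t a) st0)) <= B * 2" by simp
  have "avg (dec pre) (%a. avg (dec post) (%v. G (run tf (take t v) (pst k (run tf a st0))))) <= B * (1 + 1)"
   unfolding G_def avg_cmult avg_sum using gpost[of \<theta> t] gpost[of "-\<theta>" t] B0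
   by (intro mult_left_mono) (auto simp: T_def)
  then show "avg (dec pre) (%a. avg (dec post) (%v. G (run tf (take t v) (pst k (run tf a st0))))) <= B * 2" by simp
 qed
 also have "... = 2 * real (length pre + length post) * B" by (simp add: algebra_simps)
 finally show ?thesis by (simp add: B_def)
qed


lemma avg_diff: "avg A (%x. f x - g x) = avg A f - avg A g" by (simp add: avg_def sum_subtractf diff_divide_distrib)

lemma avg_abs_le: "(\<And>x. \<bar>f x\<bar> <= g x) ==> \<bar>avg A f\<bar> <= avg A g"
 by (rule order_trans[OF avg_abs avg_mono])

lemma luk_take: "ks \<in> luk n ==> m <= n ==> m <= sum_list (take m ks)" by (auto simp: luk_def)

text \<open>Walking through the white vertices, the index \<open>J\<close> of the block of the vertex of large degree \<open>k\<close>
 that is being visited grows linearly.\<close>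

lemma label_code:
 fixes c \<theta> X x :: real
 assumes mg: "\<And>k j \<theta>'. j <= k ==> \<bar>\<theta>'\<bar> <= \<theta> ==> avg (bcomp k) (%ms. exp (\<theta>' * real_of_int (bsum ms j))) <= exp (c * \<theta>'^2 * real k)"
  and \<theta>: "0 <= \<theta>" and c: "0 <= c" and ks: "ks \<in> luk n" and good: "good \<kappa> p0 e X n ks"
  and \<kappa>: "0 <= \<kappa>" "\<kappa> < 1" and p0: "0 < p0" "p0 <= 2" and e: "0 <= e"
 obtains k N Js where "k >= 1" "length Js = N" "\<bar>real k - (1 - \<kappa>) * real n\<bar> <= e * real n" "\<bar>real N - p0 * real n\<bar> <= e * real n"
  "\<And>i. i < N ==> Js ! i <= k"
  "\<And>i. i < N ==> \<bar>real (Js ! i) * real N - real k * real i\<bar> <= (9 / (1 - \<kappa>)) * e * real n * (real n + real N + e * real n)"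
  "\<And>\<Phi> \<Psi> B \<eta> Bad. (\<And>l. \<bar>\<Phi> l\<bar> <= B) ==> (\<And>ms. \<bar>\<Psi> ms\<bar> <= B) ==> 0 <= \<eta> ==>
   (\<And>ms ds. ms \<in> bcomp k ==> \<not> Bad ms ==> length ds = N ==> (\<And>i. i < N ==> \<bar>real_of_int (ds ! i)\<bar> <= x) ==>
     \<bar>\<Phi> (map2 (%d J. d + bsum ms J) ds Js) - \<Psi> ms\<bar> <= \<eta>) ==>
   \<bar>avg (dec ks) (%mss. \<Phi> (outs chl mss [0])) - avg (bcomp k) \<Psi>\<bar>
    <= \<eta> + 2 * B * (avg (bcomp k) (%ms. of_bool (Bad ms)) + 2 * real n * exp (- \<theta> * x + c * \<theta>^2 * X))"
proof -
 from good obtain pre k post where kk: "ks = pre @ k # post" "k >= 1" and lln: "lln \<kappa> p0 e n (post @ pre)"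
  and kbd: "kbd X pre k post" by (auto simp: good_def)
 define P where "P = length pre"
 have n: "length pre + length post = n" "sum_list pre + k + sum_list post = n" using ks unfolding kk(1) luk_def by auto
 have take_pre: "m <= sum_list (take m pre)" if "m <= length pre" for m
  using luk_take[OF ks, of m] that n unfolding kk(1) by simp
 have take_post: "P + 1 + m <= sum_list pre + k + sum_list (take m post)" if "m < length post" for m
  using luk_take[OF ks, of "P + 1 + m"] that n unfolding kk(1) P_def by simp
 have lenj: "length (jst a x) = x" for a x by (simp add: jst_def)
 have rl: "length (run jst (take m pre) [0]) + m = 1 + sum_list (take m pre)" "length (outs jst (take m pre) [0]) = zeros (take m pre)"
  if "m <= length pre" for m
  using run_length[of "take m pre" jst "%x. x" "[0]"] that take_pre lenj by (auto simp: less_Suc_eq_le)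
 \<comment> \<open>The number of stack entries below the top when the large vertex is
   reached.\<close>
 define z where "z = sum_list pre - P"
 have rlz: "length (run jst pre [0]) = Suc z" using rl(1)[of P] take_pre[of P] by (simp add: P_def z_def)
 have zP: "z + P = sum_list pre" using take_pre[of P] by (simp add: P_def z_def)
 define S0 where "S0 = [0..<k] @ replicate z k"
 have lS0: "length S0 = k + z" by (simp add: S0_def)
 have ol: "length (outs jst (take m post) S0) = zeros (take m post)" if "m <= length post" for m
 proof -
  have "m' < length S0 + sum_list (take m' (map (%x. x) (take m post)))" if "m' < length (take m post)" for m'
   using take_post[of m'] that zP lS0 by (simp add: min_def split: if_splits)
  from run_length(2)[of "take m post" jst "%x. x" S0, OF lenj this] show ?thesis by simp
 qed
 \<comment> \<open>White vertices emitted before the large vertex receive index 0, where the bridge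
   vanishes.\<close>
 define Js where "Js = replicate (zeros pre) 0 @ outs jst post S0"
 define N where "N = zeros pre + zeros post"
 have lJs: "length Js = N" using ol[of "length post"] by (simp add: Js_def N_def)
 note l1 = lln[unfolded lln_def, rule_format]
 have s1: "\<bar>real (sum_list (take s post)) - \<kappa> * real s\<bar> <= e * real n" "\<bar>real (zeros (take s post)) - p0 * real s\<bar> <= e * real n"
  if "s <= length post" for s using l1[of s] that n by auto
 have s2: "\<bar>real (sum_list post + sum_list pre) - \<kappa> * real n\<bar> <= e * real n" "\<bar>real N - p0 * real n\<bar> <= e * real n"
  using l1[of n] n(1) by (auto simp: N_def add.commute)
 have k: "\<bar>real k - (1 - \<kappa>) * real n\<bar> <= e * real n"
 proof -
  have "real k = real n - real (sum_list post + sum_list pre)" using n(2) by linarith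
  then show ?thesis using s2(1) by (simp add: algebra_simps abs_minus_commute)
 qed
 define D where "D = 1 / (1 - \<kappa>)"
 have D: "1 <= D" "(1 - \<kappa>) * D = 1" using \<kappa> by (auto simp: D_def)
 \<comment> \<open>Before the large vertex the walk may not fall below its starting level although
   its drift is \<open>\<kappa> - 1 < 0\<close>; this forces the prefix to be short.\<close>
 have P: "real P <= 2 * D * e * real n"
 proof -
  have nn: "real n = real P + real (length post)" using n(1) by (simp add: P_def flip: of_nat_add)
  have "real P <= real (sum_list pre)" using zP by simp
  also have "... <= \<kappa> * real P + 2 * e * real n"
   using s2(1) s1(1)[of "length post"] nn by (simp add: algebra_simps abs_le_iff)
  finally have "(1 - \<kappa>) * real P <= 2 * e * real n" by (simp add: algebra_simps)
  from mult_left_mono[OF this, of D] D show ?thesis by (simp add: mult.assoc[symmetric] mult.commute[of D])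
 qed
 have en: "0 <= e * real n" using e by simp
 have eDn: "e * real n <= D * e * real n" using mult_right_mono[OF D(1) en] by (simp add: mult.assoc)
 \<comment> \<open>Both the block index and the number of emitted vertices are compared with the
   time \<open>t\<close> spent after the large vertex; eliminating \<open>t\<close> yields the
   linear relation between them.\<close>
 have Ji: "Js ! i <= k \<and> (\<exists>t\<le>n. \<bar>real (Js ! i) - (1 - \<kappa>) * real t\<bar> <= 2 * D * e * real n \<and> \<bar>real i - p0 * real t\<bar> <= 3 * D * e * real n)"
  if i: "i < N" for i
 proof (cases "i < zeros pre")
  case True
  have "zeros pre <= P" by (simp add: zeros_def P_def)
  then have "real i <= 2 * D * e * real n" using P True by linarith
  then show ?thesis using True P D en eDn by (intro conjI exI[of _ 0]) (auto simp: Js_def nth_append)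
 next
  case False
  define i' where "i' = i - zeros pre"
  have i': "i' < length (outs jst post S0)" using i False ol[of "length post"] by (auto simp: i'_def N_def)
  have Jo: "Js ! i = outs jst post S0 ! i'" using False by (simp add: Js_def nth_append i'_def)
  from outs_nth[OF i'] obtain t st where t: "t < length post" "run jst (take t post) S0 = Js ! i # st"
   "i' = length (outs jst (take t post) S0)" unfolding Jo by blast
  have it: "i' = zeros (take t post)" using t ol[of t] by simp
  have S0: "S0 = replicate (Suc 0) 0 @ [Suc 0..<k] @ replicate z k" using kk(2) by (simp add: S0_def upt_conv_Cons)
  note J = jst_index[OF t(2)[unfolded S0], simplified]
  have tn: "t <= n" using t(1) n(1) by simp
  have lo: "(1 - \<kappa>) * real t - e * real n <= real (Js ! i)"
  proof (cases "Js ! i = k")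
   case True
   have "(1 - \<kappa>) * real t <= (1 - \<kappa>) * real n" using tn \<kappa> by (intro mult_left_mono) auto
   then show ?thesis using k True by linarith
  next
   case False
   then have "int t <= int (sum_list (take t post)) + int (Js ! i)" using J t(1) by (simp add: min_def split: if_splits)
   then have "real t <= real (sum_list (take t post)) + real (Js ! i)" by linarith
   then show ?thesis using s1(1)[of t] t(1) by (simp add: algebra_simps abs_le_iff)
  qed
  have hi: "real (Js ! i) <= (1 - \<kappa>) * real t + e * real n"
  proof (cases "Js ! i = 0")
   case True
   then show ?thesis using \<kappa> en by simp
  next
   case False
   then obtain s where s: "s <= t" "int s = int (sum_list (take s (take t post))) + int (Js ! i)"
    using J t(1) by (auto simp: min_def split: if_splits)
   then have "real s = real (sum_list (take s post)) + real (Js ! i)" by (simp add: min_def)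
   then have "real (Js ! i) <= (1 - \<kappa>) * real s + e * real n"
    using s1(1)[of s] s(1) t(1) by (simp add: algebra_simps abs_le_iff)
   moreover have "(1 - \<kappa>) * real s <= (1 - \<kappa>) * real t" using s(1) \<kappa> by (intro mult_left_mono) auto
   ultimately show ?thesis by linarith
  qed
  have "\<bar>real i - p0 * real t\<bar> <= 3 * D * e * real n"
  proof -
   have "zeros pre <= P" by (simp add: zeros_def P_def)
   moreover have "real i = real (zeros pre) + real i'" using False by (simp add: i'_def)
   ultimately show ?thesis using s1(2)[of t] t(1) P eDn it by (simp add: abs_le_iff)
  qed
  then show ?thesis using J tn lo hi eDn en by (intro conjI exI[of _ t]) (auto simp: abs_le_iff)
 qed
 show thesis
 proof (rule that[of k Js N])
  show "k >= 1" "length Js = N" "\<bar>real k - (1 - \<kappa>) * real n\<bar> <= e * real n" "\<bar>real N - p0 * real n\<bar> <= e * real n"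
   using kk lJs k s2 by auto
  show "Js ! i <= k" if "i < N" for i using Ji[OF that] by simp
  show "\<bar>real (Js ! i) * real N - real k * real i\<bar> <= (9 / (1 - \<kappa>)) * e * real n * (real n + real N + e * real n)" if "i < N" for i
  proof -
   from Ji[OF that] obtain t where t: "t <= n" "\<bar>real (Js ! i) - (1 - \<kappa>) * real t\<bar> <= 2 * D * e * real n"
    "\<bar>real i - p0 * real t\<bar> <= 3 * D * e * real n" by blast
   have k1: "1 - \<kappa> <= 1" "0 <= 1 - \<kappa>" using \<kappa> by auto
   define u where "u = D * e * real n"
   have u: "0 <= u" "e * real n <= u" using eDn en by (auto simp: u_def)
   have kn: "real k <= real n" using n by simp
   have abs4: "\<bar>x + y - z - w\<bar> <= \<bar>x\<bar> + \<bar>y\<bar> + \<bar>z\<bar> + \<bar>w\<bar>" for x y z w :: real by linarith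
   \<comment> \<open>The cross product is expanded around the four linear approximations; their main
     terms cancel, and each remaining term contains one error.\<close>
   have "real (Js ! i) * real N - real k * real i =
    (real (Js ! i) - (1 - \<kappa>) * real t) * real N + ((1 - \<kappa>) * real t) * (real N - p0 * real n)
    - real k * (real i - p0 * real t) - (real k - (1 - \<kappa>) * real n) * (p0 * real t)" by (simp add: algebra_simps)
   also have "\<bar>...\<bar> <= \<bar>real (Js ! i) - (1 - \<kappa>) * real t\<bar> * real N + \<bar>(1 - \<kappa>) * real t\<bar> * \<bar>real N - p0 * real n\<bar>
    + real k * \<bar>real i - p0 * real t\<bar> + \<bar>real k - (1 - \<kappa>) * real n\<bar> * \<bar>p0 * real t\<bar>"
    by (rule order_trans[OF abs4]) (simp add: abs_mult)
   also have "... <= (2 * u) * real N + real n * u + real n * (3 * u) + u * (2 * real n)"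
   proof (intro add_mono mult_mono)
    show "\<bar>(1 - \<kappa>) * real t\<bar> <= real n" using k1 t(1) mult_mono[of "1 - \<kappa>" 1 "real t" "real n"] by (simp add: abs_mult)
    show "\<bar>p0 * real t\<bar> <= 2 * real n" using p0 t(1) mult_mono[of p0 2 "real t" "real n"] by (simp add: abs_mult)
    show "\<bar>real N - p0 * real n\<bar> <= u" "\<bar>real k - (1 - \<kappa>) * real n\<bar> <= u" using s2(2) k u(2) by linarith+
    show "\<bar>real (Js ! i) - (1 - \<kappa>) * real t\<bar> <= 2 * u" "\<bar>real i - p0 * real t\<bar> <= 3 * u"
     using t by (simp_all add: u_def mult.assoc)
   qed (use u kn in auto)
   also have "... <= 9 * u * (real n + real N + e * real n)"
    using u en mult_nonneg_nonneg[OF u(1), of "real n"] mult_nonneg_nonneg[OF u(1), of "real N"] mult_nonneg_nonneg[OF u(1) en]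
    by (simp add: algebra_simps)
   finally show ?thesis by (simp add: u_def D_def mult.assoc)
  qed
  fix \<Phi> \<Psi> B \<eta> Bad
  assume \<Phi>: "\<And>l. \<bar>\<Phi> l\<bar> <= (B::real)" and \<Psi>: "\<And>ms. \<bar>\<Psi> ms\<bar> <= B" and \<eta>: "0 <= \<eta>" and
   close: "\<And>ms ds. ms \<in> bcomp k ==> \<not> Bad ms ==> length ds = N ==> (\<And>i. i < N ==> \<bar>real_of_int (ds ! i)\<bar> <= x) ==>
     \<bar>\<Phi> (map2 (%d J. d + bsum ms J) ds Js) - \<Psi> ms\<bar> <= \<eta>"
  have B: "0 <= B" using \<Psi>[of "[]"] by linarith
  define dsp where "dsp = (%a v. \<exists>e\<in>set (outs tf a st0) \<union> set (outs tf v (pst k (run tf a st0))). x <= \<bar>real_of_int (fst e)\<bar>)"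
  have pt: "\<bar>\<Phi> (outs chl (a @ ms # v) [0]) - \<Psi> ms\<bar> <= \<eta> + 2 * B * (of_bool (Bad ms) + of_bool (dsp a v))"
   if a: "a \<in> dec pre" and ms: "ms \<in> bcomp k" and v: "v \<in> dec post" for a ms v
  proof (cases "Bad ms \<or> dsp a v")
   case True
   have "\<bar>\<Phi> (outs chl (a @ ms # v) [0]) - \<Psi> ms\<bar> <= 2 * B" using \<Phi>[of "outs chl (a @ ms # v) [0]"] \<Psi>[of ms] by linarith
   moreover have "2 * B * 1 <= 2 * B * (of_bool (Bad ms) + of_bool (dsp a v))" using True B by (intro mult_left_mono) auto
   ultimately show ?thesis using \<eta> by simp
  next
   case False
   define ds where "ds = map fst (outs tf a st0 @ outs tf v (pst k (run tf a st0)))"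
   have la: "map length a = pre" "map length v = post" using a v dec_length by auto
   have "length (run tf a st0) = Suc z" unfolding length_tf_run la using rlz by simp
   then obtain d K J st where r: "run tf a st0 = (d, K, J) # st" "length st = z" by (cases "run tf a st0") auto
   have o1: "length (outs tf a st0) = zeros pre"
   proof -
    have "length (outs tf a st0) = length (outs jst (map length a) [0])" using arg_cong[OF tf_J(2)[of a st0], of length] by simp
    then show ?thesis unfolding la using rl(2)[of P] by (simp add: P_def)
   qed
   have "map (snd \<circ> snd) (pst k (run tf a st0)) = S0" unfolding r(1) pst_def S0_def using r(2) by (auto simp: comp_def split_def map_replicate_const)
   then have o2: "map (snd \<circ> snd) (outs tf v (pst k (run tf a st0))) = outs jst post S0" unfolding tf_J la by simp
   have l2: "length (outs tf v (pst k (run tf a st0))) = zeros post"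
    using arg_cong[OF o2, of length] ol[of "length post"] by simp
   have lds: "length ds = N" by (simp add: ds_def o1 l2 N_def)
   have "outs chl (a @ ms # v) [0] = map2 (%d J. d + bsum ms J) ds Js"
   proof -
    have "map2 (%d J. d + bsum ms J) (map fst (outs tf a st0)) (replicate (zeros pre) 0) = map fst (outs tf a st0)"
     by (rule nth_equalityI) (auto simp: o1)
    moreover have "map (%(d, K, J). d + bsum ms J) E = map2 (%d J. d + bsum ms J) (map fst E) (map (snd \<circ> snd) E)"
     for E :: "(int \<times> nat \<times> nat) list" by (rule nth_equalityI) (auto simp: split_def)
    ultimately show ?thesis
     unfolding outs_decomp[OF ms kk(2), of a v, unfolded r(1), simplified] ds_def Js_def o2[symmetric] r(1)
     by (simp add: o1 zip_append)
   qed
   moreover have "\<bar>real_of_int (ds ! i)\<bar> <= x" if "i < N" for i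
   proof -
    have "ds ! i \<in> set ds" using that lds by simp
    then obtain e where "e \<in> set (outs tf a st0) \<union> set (outs tf v (pst k (run tf a st0)))" "ds ! i = fst e"
     unfolding ds_def by auto
    then show ?thesis using False unfolding dsp_def by (metis less_eq_real_def linorder_not_le)
   qed
   ultimately show ?thesis using close[OF ms _ lds] False by simp
  qed
  \<comment> \<open>The large bridge is averaged innermost, for fixed displacements and fixed block
    indices.\<close>
  have e1: "avg (dec ks) (%mss. \<Phi> (outs chl mss [0])) =
   avg (dec pre) (%a. avg (dec post) (%v. avg (bcomp k) (%ms. \<Phi> (outs chl (a @ ms # v) [0]))))"
   unfolding kk(1) avg_dec_append avg_dec_Cons by (subst avg_swap) (rule refl)
  have "avg (dec ks) (%mss. \<Phi> (outs chl mss [0])) - avg (bcomp k) \<Psi> =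
   avg (dec pre) (%a. avg (dec post) (%v. avg (bcomp k) (%ms. \<Phi> (outs chl (a @ ms # v) [0]) - \<Psi> ms)))"
   unfolding e1 avg_diff by (simp add: avg_const[OF card_dec_pos])
  then have "\<bar>avg (dec ks) (%mss. \<Phi> (outs chl mss [0])) - avg (bcomp k) \<Psi>\<bar> \<le>
   avg (dec pre) (%a. avg (dec post) (%v. avg (bcomp k) (%ms. \<bar>\<Phi> (outs chl (a @ ms # v) [0]) - \<Psi> ms\<bar>)))"
   by (simp only:) (intro avg_abs_le avg_abs)
  also have "... <= avg (dec pre) (%a. avg (dec post) (%v. avg (bcomp k) (%ms. \<eta> + 2 * B * (of_bool (Bad ms) + of_bool (dsp a v)))))"
   by (intro avg_mono pt)
  also have "... = \<eta> + 2 * B * (avg (bcomp k) (%ms. of_bool (Bad ms)) + avg (dec pre) (%a. avg (dec post) (%v. of_bool (dsp a v))))"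
   unfolding avg_add avg_cmult by (simp add: avg_const[OF card_dec_pos] avg_const[OF card_bcomp_pos] avg_add avg_cmult)
  also have "avg (dec pre) (%a. avg (dec post) (%v. of_bool (dsp a v))) <= 2 * real (length pre + length post) * exp (- \<theta> * x + c * \<theta>^2 * X)"
   unfolding dsp_def using rlz by (intro disp_bound[OF mg \<theta> c kbd]) auto
  finally show "\<bar>avg (dec ks) (%mss. \<Phi> (outs chl mss [0])) - avg (bcomp k) \<Psi>\<bar>
    <= \<eta> + 2 * B * (avg (bcomp k) (%ms. of_bool (Bad ms)) + 2 * real n * exp (- \<theta> * x + c * \<theta>^2 * X))"
   using B n(1) by (simp add: mult_left_mono)
 qed
qed

subsection \<open>Piecewise linear paths and the uniform distance\<close>

definition pl :: "nat => (nat => real) => real => real" where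
 "pl N v t = (let s = t * real N; k = nat \<lfloor>s\<rfloor> in v k + (s - real k) * (v (Suc k) - v k))"

text \<open>Both indices are clipped to \<open>N\<close>, so that values of \<open>v\<close> beyond
  \<open>N\<close> play no part even at \<open>t = 1\<close>. Uniform estimates for interpolated
  paths thereby reduce to estimates at neighbouring grid points.\<close>

lemma pl_conv:
 assumes "1 <= N" "0 <= t" "t <= 1"
 shows "\<exists>i i' \<nu>. i <= N \<and> i' <= N \<and> 0 <= \<nu> \<and> \<nu> <= 1 \<and> \<bar>real i / real N - t\<bar> <= 1 / real N \<and>
  \<bar>real i' / real N - t\<bar> <= 1 / real N \<and> (\<forall>v. pl N v t = (1 - \<nu>) * v i + \<nu> * v i')"
proof -
 define k where "k = nat \<lfloor>t * real N\<rfloor>"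
 have k: "real k <= t * real N" "t * real N < real k + 1" using assms by (auto simp: k_def)
 have "t * real N <= 1 * real N" using assms by (intro mult_right_mono) auto
 then have kN: "k <= N" "k = N ==> t * real N = real N" using k(1) by auto
 have e: "real k / real N - t = (real k - t * real N) / real N" for k using assms by (simp add: field_simps)
 show ?thesis
 proof (rule exI[of _ k], rule exI[of _ "min (Suc k) N"], rule exI[of _ "t * real N - real k"], intro conjI allI)
  show "\<bar>real k / real N - t\<bar> <= 1 / real N" unfolding e using k assms by (simp add: abs_divide divide_right_mono)
  show "\<bar>real (min (Suc k) N) / real N - t\<bar> <= 1 / real N" unfolding e
   using k kN assms by (cases "k = N") (auto simp: abs_divide intro!: divide_right_mono)
  show "pl N v t = (1 - (t * real N - real k)) * v k + (t * real N - real k) * v (min (Suc k) N)" for v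
   using kN by (cases "k = N") (auto simp: pl_def Let_def k_def[symmetric] algebra_simps min_def)
 qed (use k kN in auto)
qed

text \<open>The interpolation as a sum of ramps, from which its continuity can be read off.\<close>

lemma pl_sum:
 assumes "0 <= t" "t <= 1"
 shows "pl N v t = v 0 + (\<Sum>i<N. (v (Suc i) - v i) * max 0 (min 1 (t * real N - real i)))"
proof -
 define k where "k = nat \<lfloor>t * real N\<rfloor>"
 have k: "real k <= t * real N" "t * real N < real k + 1" using assms by (auto simp: k_def)
 have "t * real N <= 1 * real N" using assms by (intro mult_right_mono) auto
 then have kN: "k <= N" "k = N ==> t * real N = real N" using k(1) by auto
 have S: "(\<Sum>i<N'. (v (Suc i) - v i) * max 0 (min 1 (t * real N - real i))) =
   v (min N' k) - v 0 + (if k < N' then (v (Suc k) - v k) * (t * real N - real k) else 0)" for N'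
 proof (induction N')
  case (Suc N')
  consider "Suc N' <= k" | "N' = k" | "k < N'" by linarith
  then show ?case
  proof cases
   case 1
   then have "real N' + 1 <= real k" by linarith
   then have "max 0 (min 1 (t * real N - real N')) = 1" using k by auto
   then show ?thesis using Suc.IH 1 by (simp add: min_def)
  next
   case 2
   then have "max 0 (min 1 (t * real N - real N')) = t * real N - real k" using k by auto
   then show ?thesis using Suc.IH 2 by simp
  next
   case 3
   then have "real k + 1 <= real N'" by linarith
   then have "max 0 (min 1 (t * real N - real N')) = 0" using k by auto
   then show ?thesis using Suc.IH 3 by (simp add: min_def)
  qed
 qed simp
 show ?thesis unfolding S using kN by (cases "k = N") (auto simp: pl_def Let_def k_def[symmetric] min_def algebra_simps)
qed

lemma pl_C01: "(%t. pl N v t / c) \<in> C01"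
proof -
 have "continuous_on {0..1} (%t. (v 0 + (\<Sum>i<N. (v (Suc i) - v i) * max 0 (min 1 (t * real N - real i)))) / c)"
  unfolding divide_inverse by (intro continuous_intros)
 then show ?thesis unfolding C01_def mem_Collect_eq by (rule continuous_on_eq) (simp add: pl_sum)
qed

lemma pl_in_C01: "pl N v \<in> C01" using pl_C01[of N v 1] by simp

lemma convex_diff_le:
 fixes a a' b b' \<nu> \<mu> \<eta> :: real
 assumes "0 <= \<nu>" "\<nu> <= 1" "0 <= \<mu>" "\<mu> <= 1" "\<bar>a - b\<bar> <= \<eta>" "\<bar>a - b'\<bar> <= \<eta>" "\<bar>a' - b\<bar> <= \<eta>" "\<bar>a' - b'\<bar> <= \<eta>"
 shows "\<bar>((1 - \<nu>) * a + \<nu> * a') - ((1 - \<mu>) * b + \<mu> * b')\<bar> <= \<eta>"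
proof -
 have c: "\<bar>(1 - \<mu>) * x + \<mu> * y\<bar> <= \<eta>" if "\<bar>x\<bar> <= \<eta>" "\<bar>y\<bar> <= \<eta>" "0 <= \<mu>" "\<mu> <= 1" for x y \<mu> :: real
 proof -
  have "\<bar>(1 - \<mu>) * x + \<mu> * y\<bar> <= (1 - \<mu>) * \<bar>x\<bar> + \<mu> * \<bar>y\<bar>" using that by (intro order_trans[OF abs_triangle_ineq]) (simp add: abs_mult)
  also have "... <= (1 - \<mu>) * \<eta> + \<mu> * \<eta>" using that by (intro add_mono mult_left_mono) auto
  finally show ?thesis by (simp add: algebra_simps)
 qed
 have "\<bar>(1 - \<nu>) * ((1 - \<mu>) * (a - b) + \<mu> * (a - b')) + \<nu> * ((1 - \<mu>) * (a' - b) + \<mu> * (a' - b'))\<bar> <= \<eta>"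
  using assms by (intro c) auto
 then show ?thesis by (simp add: algebra_simps)
qed

lemma pl_close:
 assumes N: "1 <= N" "1 <= r" and t: "0 <= t" "t <= 1"
  and c: "\<And>i j. i <= N ==> j <= r ==> \<bar>real i / real N - real j / real r\<bar> <= 1 / real N + 1 / real r ==> \<bar>v i - y j\<bar> <= \<eta>"
 shows "\<bar>pl N v t - pl r y t\<bar> <= \<eta>"
proof -
 obtain i i' \<nu> where 1: "i <= N" "i' <= N" "0 <= \<nu>" "\<nu> <= 1" "\<bar>real i / real N - t\<bar> <= 1 / real N"
  "\<bar>real i' / real N - t\<bar> <= 1 / real N" "\<And>v. pl N v t = (1 - \<nu>) * v i + \<nu> * v i'"
  using pl_conv[OF N(1) t] by blast
 obtain j j' \<mu> where 2: "j <= r" "j' <= r" "0 <= \<mu>" "\<mu> <= 1" "\<bar>real j / real r - t\<bar> <= 1 / real r"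
  "\<bar>real j' / real r - t\<bar> <= 1 / real r" "\<And>v. pl r v t = (1 - \<mu>) * v j + \<mu> * v j'"
  using pl_conv[OF N(2) t] by blast
 show ?thesis unfolding 1(7) 2(7) using 1(1-6) 2(1-6) by (intro convex_diff_le c) linarith+
qed

lemma ud_le: "(\<And>t. 0 <= t ==> t <= 1 ==> \<bar>f t - g t\<bar> <= \<eta>) ==> unif_dist f g <= \<eta>"
 unfolding unif_dist_def by (intro cSUP_least) auto

lemma ud_ge:
 assumes "f \<in> C01" "g \<in> C01" "0 <= t" "t <= 1"
 shows "\<bar>f t - g t\<bar> <= unif_dist f g"
proof -
 have "continuous_on {0..1} (%t. \<bar>f t - g t\<bar>)" using assms by (intro continuous_intros) (auto simp: C01_def)
 then have "compact ((%t. \<bar>f t - g t\<bar>) ` {0..1})" by (rule compact_continuous_image) simp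
 then have "bdd_above ((%t. \<bar>f t - g t\<bar>) ` {0..1})" by (intro bounded_imp_bdd_above compact_imp_bounded)
 then show ?thesis unfolding unif_dist_def using assms by (intro cSUP_upper) auto
qed

lemma ud_props:
 assumes "f \<in> C01" "g \<in> C01"
 shows "0 <= unif_dist f g" "unif_dist f f = 0" "unif_dist g f = unif_dist f g"
  and "h \<in> C01 ==> unif_dist f h <= unif_dist f g + unif_dist g h"
proof -
 show "0 <= unif_dist f g" using ud_ge[OF assms, of 0] by linarith
 show "unif_dist f f = 0" by (simp add: unif_dist_def)
 show "unif_dist g f = unif_dist f g" by (simp add: unif_dist_def abs_minus_commute)
 assume h: "h \<in> C01"
 show "unif_dist f h <= unif_dist f g + unif_dist g h"
 proof (rule ud_le)
  fix t :: real assume "0 <= t" "t <= 1"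
  then show "\<bar>f t - h t\<bar> <= unif_dist f g + unif_dist g h"
   using ud_ge[OF assms, of t] ud_ge[OF assms(2) h, of t] by linarith
 qed
qed

subsection \<open>Trigonometric polynomials\<close>

text \<open>The free phase makes sines and constants available, and the product formula closes the
  set under multiplication. Expectations of its elements are linear combinations of values of
  characteristic functions.\<close>

inductive_set trig :: "nat => ((nat => real) => real) set" for r where
 base: "(%y. a * cos ((\<Sum>j\<le>r. c j * y j) + \<theta>)) \<in> trig r"
| add: "f \<in> trig r ==> g \<in> trig r ==> (%y. f y + g y) \<in> trig r"

lemma trig_mult:
 assumes "f \<in> trig r" "g \<in> trig r"
 shows "(%y. f y * g y) \<in> trig r" using assms(1)
proof induction
 case (base a c \<theta>)
 from assms(2) show ?case
 proof induction
  case (base a' c' \<theta>')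
  have "a * cos ((\<Sum>j\<le>r. c j * y j) + \<theta>) * (a' * cos ((\<Sum>j\<le>r. c' j * y j) + \<theta>')) =
   a * a' / 2 * cos ((\<Sum>j\<le>r. (c j - c' j) * y j) + (\<theta> - \<theta>')) + a * a' / 2 * cos ((\<Sum>j\<le>r. (c j + c' j) * y j) + (\<theta> + \<theta>'))" for y
  proof -
   have "(\<Sum>j\<le>r. (c j - c' j) * y j) + (\<theta> - \<theta>') = ((\<Sum>j\<le>r. c j * y j) + \<theta>) - ((\<Sum>j\<le>r. c' j * y j) + \<theta>')"
    "(\<Sum>j\<le>r. (c j + c' j) * y j) + (\<theta> + \<theta>') = ((\<Sum>j\<le>r. c j * y j) + \<theta>) + ((\<Sum>j\<le>r. c' j * y j) + \<theta>')"
    by (simp_all add: algebra_simps sum_subtractf sum.distrib)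
   then show ?thesis by (simp only: cos_add cos_diff) (simp add: field_simps)
  qed
  then show ?case by (simp only:) (intro trig.intros)
 next
  case (add g g')
  then show ?case by (simp only: distrib_left) (rule trig.add)
 qed
next
 case (add f f')
 then show ?case by (simp only: distrib_right) (rule trig.add)
qed

lemma trig_cont: "f \<in> trig r ==> continuous_on UNIV f"
 by (induction rule: trig.induct) (auto intro!: continuous_intros)

text \<open>The coordinates are replaced by their sines at a scale that is injective on the box of
  size \<open>L\<close>, and Stone-Weierstrass is applied on the resulting cube. As the sines lie in
  the cube for every argument, the approximation stays bounded outside the box too.\<close>

lemma trig_approx:
 fixes G :: "(nat => real) => real"
 assumes G: "continuous_on UNIV G" "\<And>y. \<bar>G y\<bar> <= B" and L: "0 < L" and \<eta>: "0 < \<eta>"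
 obtains \<tau> where "\<tau> \<in> trig r" "\<And>y. (\<And>j. j <= r ==> \<bar>y j\<bar> <= L) ==> (\<And>j. j > r ==> y j = 0) ==> \<bar>G y - \<tau> y\<bar> <= \<eta>"
  "\<And>y. \<bar>\<tau> y\<bar> <= B + \<eta>"
proof -
 define q where "q = pi / (2 * L)"
 have q: "q > 0" "q * L = pi / 2" using L by (auto simp: q_def)
 define S :: "(nat => real) set" where "S = (\<Pi>\<^sub>E j\<in>UNIV. if j <= r then {-1..1} else {0})"
 have S: "x \<in> S \<longleftrightarrow> (\<forall>j. (j <= r --> - 1 <= x j \<and> x j <= 1) \<and> (r < j --> x j = 0))" for x
  unfolding S_def PiE_UNIV_domain Pi_iff ball_UNIV by (intro arg_cong[where f = All] ext) auto
 define sn where "sn = (%y j. if j <= r then sin (y j * q) else (0::real))"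
 have sn: "sn y \<in> S" for y unfolding S by (auto simp: sn_def)
 define R where "R = {\<phi>. continuous_on UNIV \<phi> \<and> (\<exists>\<tau>\<in>trig r. \<forall>y. \<phi> (sn y) = \<tau> y)}"
 interpret function_ring_on R S
 proof
  have "compactin (product_topology (%_. euclidean) UNIV) S" unfolding S_def by (subst compactin_PiE) auto
  then show "compact S" by (simp add: euclidean_product_topology)
  show "f \<in> R ==> continuous_on S f" for f unfolding R_def by (auto intro: continuous_on_subset)
  show "f \<in> R ==> g \<in> R ==> (%x. f x + g x) \<in> R" for f g unfolding R_def
   by (auto intro!: continuous_on_add bexI[OF _ trig.add])
  show "f \<in> R ==> g \<in> R ==> (%x. f x * g x) \<in> R" for f g unfolding R_def
   by (auto intro!: continuous_on_mult bexI[OF _ trig_mult])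
  show "(%_. c) \<in> R" for c unfolding R_def using trig.base[of c "%_. 0" r 0] by auto
  fix x y assume xy: "x \<in> S" "y \<in> S" "x \<noteq> y"
  then obtain j where j: "x j \<noteq> y j" by auto
  then have jr: "j <= r" using xy S by (metis linorder_not_le)
  have "(\<Sum>i\<le>r. (if i = j then q else 0) * y i) = (\<Sum>i\<le>r. if i = j then q * y i else 0)" for y :: "nat => real"
   by (intro sum.cong) auto
  \<comment> \<open>The coordinates of the cube, which separate its points, are shifted
    cosines.\<close>
  then have c: "sn y j = 1 * cos ((\<Sum>i\<le>r. (if i = j then q else 0) * y i) + - (pi / 2))" for y
   using jr by (simp add: cos_diff mult.commute sn_def flip: diff_conv_add_uminus)
  note T = trig.base[of 1 "%i. if i = j then q else 0" r "- (pi / 2)"]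
  have "\<exists>\<tau>\<in>trig r. \<forall>y. sn y j = \<tau> y" by (rule bexI[OF _ T], rule allI, rule c)
  then have "(%x. x j) \<in> R" unfolding R_def by (intro CollectI conjI continuous_on_product_coordinates)
  with j show "\<exists>f\<in>R. f x \<noteq> f y" by (intro bexI[of _ "%x. x j"])
 qed
 define g where "g = (%x. G (%j. if j <= r then arcsin (x j) / q else 0))"
 have "continuous_on S g" unfolding g_def
 proof (rule continuous_on_compose2[OF G(1)], rule continuous_on_coordinatewise_then_product)
  fix j
  have xj: "continuous_on S (%x. x j)" by (rule continuous_on_subset[OF continuous_on_product_coordinates]) simp
  have "continuous_on S (%x. arcsin (x j) / q)" if "j <= r" using that S xj q by (intro continuous_intros) auto
  then show "continuous_on S (%x. if j <= r then arcsin (x j) / q else 0)" by (cases "j <= r") auto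
 qed auto
 from Stone_Weierstrass_basic[OF this \<eta>] obtain \<phi> where \<phi>: "\<phi> \<in> R" "\<And>x. x \<in> S ==> \<bar>g x - \<phi> x\<bar> < \<eta>" by blast
 then obtain \<tau> where \<tau>: "\<tau> \<in> trig r" "\<And>y. \<phi> (sn y) = \<tau> y" by (auto simp: R_def)
 show thesis
 proof (rule that[OF \<tau>(1)])
  have gB: "\<bar>g x\<bar> <= B" for x by (simp add: g_def G(2))
  show "\<bar>\<tau> y\<bar> <= B + \<eta>" for y using \<phi>(2)[OF sn[of y]] gB[of "sn y"] unfolding \<tau>(2) by linarith
  fix y :: "nat => real" assume y: "\<And>j. j <= r ==> \<bar>y j\<bar> <= L" "\<And>j. j > r ==> y j = 0"
  have "(%j. if j <= r then arcsin (sn y j) / q else 0) = y"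
  proof
   fix j
   show "(if j <= r then arcsin (sn y j) / q else 0) = y j"
   proof (cases "j <= r")
    case True
    have "\<bar>y j * q\<bar> <= pi / 2" using mult_right_mono[OF y(1)[OF True], of q] q by (simp add: abs_mult mult.commute[of L])
    then show ?thesis using True q by (simp add: sn_def arcsin_sin abs_le_iff)
   qed (use y in auto)
  qed
  then show "\<bar>G y - \<tau> y\<bar> <= \<eta>" using \<phi>(2)[OF sn[of y]] unfolding \<tau>(2) g_def by (simp add: less_imp_le)
 qed
qed

subsection \<open>Finite-dimensional distributions\<close>

text \<open>The bridge of length \<open>k\<close> sampled at \<open>r + 1\<close> points; the
  norming \<open>sqrt (2 * k)\<close> reflects the step variance 2.\<close>

definition grid :: "nat => nat => nat list => nat => real" where
 "grid r k ms j = (if j <= r then real_of_int (bsum ms (k * j div r)) / sqrt (2 * real k) else 0)"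

definition bgrid :: "(real => 'a => real) => nat => 'a => nat => real" where
 "bgrid b r \<omega> j = (if j <= r then b (real j / real r) \<omega> else 0)"

lemma sum_of_bool_less: fixes a k :: nat shows "a <= k ==> (\<Sum>i<k. of_bool (i < a) * f i) = (\<Sum>i<a. f i :: real)"
 by (rule sum.mono_neutral_cong_right) auto

lemma grid_index:
 assumes "1 <= r"
 shows "(%k. real (k * j div r) / real k) \<longlonglongrightarrow> real j / real r" "j <= r ==> k * j div r <= k"
  "\<bar>real (k * j div r) - real k * real j / real r\<bar> <= 1"
proof -
 show 1: "\<bar>real (k * j div r) - real k * real j / real r\<bar> <= 1" for k
 proof -
  have "real (k * j div r) = real (k * j) / real r - real (k * j mod r) / real r"
  proof -
   have "real (k * j) = real r * real (k * j div r) + real (k * j mod r)" by (metis mult_div_mod_eq of_nat_add of_nat_mult)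
   then show ?thesis using assms by (simp add: field_simps)
  qed
  moreover have "real (k * j mod r) / real r <= 1" using assms by (simp add: less_imp_le)
  ultimately show ?thesis using divide_nonneg_nonneg[of "real (k * j mod r)" "real r"] by simp
 qed
 have "\<bar>real (k * j div r) / real k - real j / real r\<bar> <= 1 / real k" if "k >= 1" for k
 proof -
  have "real (k * j div r) / real k - real j / real r = (real (k * j div r) - real k * real j / real r) / real k"
   using that by (simp add: diff_divide_distrib)
  then show ?thesis using 1[of k] that by (simp add: abs_divide divide_right_mono)
 qed
 then have "(%k. real (k * j div r) / real k - real j / real r) \<longlonglongrightarrow> 0"
  by (intro Lim_null_comparison[OF eventually_sequentiallyI[of 1] lim_const_over_n[of 1]]) simp
 then show "(%k. real (k * j div r) / real k) \<longlonglongrightarrow> real j / real r" by (simp add: LIM_zero_iff)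
 assume "j <= r"
 then have "k * j div r <= k * r div r" by (intro div_le_mono mult_left_mono) auto
 then show "k * j div r <= k" using assms by simp
qed

lemma bsum_sum: "j <= length ms ==> real_of_int (bsum ms j) = (\<Sum>i<j. real (ms ! i) - 1)"
 by (simp add: bsum_def sum_list_sum_nth sum_subtractf atLeast0LessThan)

text \<open>A linear combination of sampled values is a weighted sum of the steps, where step
  \<open>i\<close> has the weight of all grid points beyond it. \<open>bridge_char_limit\<close>
  then applies, and the two limits of the weights combine to half the covariance form of the
  Brownian bridge.\<close>

lemma grid_char:
 assumes r: "1 <= r"
 shows "(%k. avg (bcomp k) (%ms. cos ((\<Sum>j\<le>r. c j * grid r k ms j) + \<theta>))) \<longlonglongrightarrow>
  cos \<theta> * exp (- (\<Sum>i\<le>r. \<Sum>j\<le>r. c i * c j * bb_cov (real i / real r) (real j / real r)) / 2)"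
proof -
 define u where "u = (%k i j. of_bool (i < k * j div r) :: real)"
 define a where "a = (%k i. (\<Sum>j\<le>r. c j * u k i j) / sqrt 2)"
 define S where "S = (\<Sum>i\<le>r. \<Sum>j\<le>r. c i * c j * bb_cov (real i / real r) (real j / real r))"
 have bd: "\<bar>a k i\<bar> <= (\<Sum>j\<le>r. \<bar>c j\<bar>)" for k i
 proof -
  have "\<bar>\<Sum>j\<le>r. c j * u k i j\<bar> <= (\<Sum>j\<le>r. \<bar>c j\<bar>)"
   by (rule order_trans[OF sum_abs]) (auto simp: u_def intro!: sum_mono)
  moreover have "(1::real) <= sqrt 2" by simp
  ultimately show ?thesis unfolding a_def abs_divide
   by (subst pos_divide_le_eq) (auto intro: order_trans[OF _ mult_left_mono[of 1 "sqrt 2" "\<Sum>j\<le>r. \<bar>c j\<bar>"]] sum_nonneg)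
 qed
 have su: "(\<Sum>i<k. u k i j) = real (k * j div r)" "(\<Sum>i<k. u k i j * u k i l) = real (min (k * j div r) (k * l div r))"
  if "j <= r" "l <= r" for k j l
 proof -
  have "u k i j * u k i l = of_bool (i < min (k * j div r) (k * l div r)) * 1" "u k i j = of_bool (i < k * j div r) * 1" for i
   by (auto simp: u_def)
  then show "(\<Sum>i<k. u k i j) = real (k * j div r)" "(\<Sum>i<k. u k i j * u k i l) = real (min (k * j div r) (k * l div r))"
   using grid_index(2)[OF r that(1), of k] by (simp_all only: sum_of_bool_less min.coboundedI1) simp_all
 qed
 have s1: "(\<Sum>i<k. a k i) / real k = (\<Sum>j\<le>r. c j * (real (k * j div r) / real k)) / sqrt 2" for k
 proof -
  have "(\<Sum>i<k. a k i) = (\<Sum>j\<le>r. \<Sum>i<k. c j * u k i j) / sqrt 2"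
   unfolding a_def sum_divide_distrib[symmetric] by (subst sum.swap) (rule refl)
  also have "... = (\<Sum>j\<le>r. c j * real (k * j div r)) / sqrt 2" by (simp add: sum_distrib_left[symmetric] su)
  finally show ?thesis by (simp add: sum_divide_distrib mult.commute)
 qed
 have s2: "(\<Sum>i<k. (a k i)\<^sup>2) / real k = (\<Sum>j\<le>r. \<Sum>l\<le>r. c j * c l * min (real (k * j div r) / real k) (real (k * l div r) / real k)) / 2" for k
 proof -
  have "(\<Sum>i<k. (a k i)\<^sup>2) = (\<Sum>i<k. \<Sum>j\<le>r. \<Sum>l\<le>r. c j * c l * (u k i j * u k i l)) / 2"
   unfolding a_def power_divide sum_divide_distrib[symmetric] by (simp add: power2_eq_square sum_product mult_ac)
  also have "(\<Sum>i<k. \<Sum>j\<le>r. \<Sum>l\<le>r. c j * c l * (u k i j * u k i l)) = (\<Sum>j\<le>r. \<Sum>i<k. \<Sum>l\<le>r. c j * c l * (u k i j * u k i l))"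
   by (rule sum.swap)
  also have "... = (\<Sum>j\<le>r. \<Sum>l\<le>r. \<Sum>i<k. c j * c l * (u k i j * u k i l))" by (intro sum.cong refl sum.swap)
  also have "... = (\<Sum>j\<le>r. \<Sum>l\<le>r. c j * c l * real (min (k * j div r) (k * l div r)))"
   by (simp add: sum_distrib_left[symmetric] su)
  finally have "(\<Sum>i<k. (a k i)\<^sup>2) / real k = (\<Sum>j\<le>r. \<Sum>l\<le>r. c j * c l * (real (min (k * j div r) (k * l div r)) / real k)) / 2"
   by (simp add: sum_divide_distrib mult.commute)
  moreover have "real (min a b) / real k = min (real a / real k) (real b / real k)" for a b
   by (simp add: min_def divide_right_mono of_nat_le_iff) (auto simp: divide_le_cancel)
  ultimately show ?thesis by simp
 qed
 have l1: "(%k. (\<Sum>i<k. a k i) / real k) \<longlonglongrightarrow> (\<Sum>j\<le>r. c j * (real j / real r)) / sqrt 2"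
  unfolding s1 by (intro tendsto_intros grid_index(1) r) simp
 have l2: "(%k. (\<Sum>i<k. (a k i)\<^sup>2) / real k) \<longlonglongrightarrow> (\<Sum>j\<le>r. \<Sum>l\<le>r. c j * c l * min (real j / real r) (real l / real r)) / 2"
  unfolding s2 by (intro tendsto_intros grid_index(1) r) simp
 have ex: "(\<Sum>j\<le>r. \<Sum>l\<le>r. c j * c l * min (real j / real r) (real l / real r)) / 2 - ((\<Sum>j\<le>r. c j * (real j / real r)) / sqrt 2)\<^sup>2 = S / 2"
  unfolding S_def bb_cov_def power_divide
  by (simp add: power2_eq_square sum_product algebra_simps sum_subtractf diff_divide_distrib)
 have sum_eq: "(\<Sum>i<k. a k i / sqrt k * (real (ms ! i) - 1)) = (\<Sum>j\<le>r. c j * grid r k ms j)" if ms: "ms \<in> bcomp k" for k ms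
 proof -
  have len: "length ms = k" using ms by (simp add: comps_def)
  have "(\<Sum>i<k. a k i / sqrt k * (real (ms ! i) - 1)) = (\<Sum>i<k. \<Sum>j\<le>r. c j * (u k i j * (real (ms ! i) - 1)) / sqrt (2 * real k))"
   unfolding a_def by (simp add: real_sqrt_mult sum_divide_distrib sum_distrib_left sum_distrib_right mult_ac)
  also have "... = (\<Sum>j\<le>r. \<Sum>i<k. c j * (u k i j * (real (ms ! i) - 1)) / sqrt (2 * real k))" by (rule sum.swap)
  also have "... = (\<Sum>j\<le>r. c j * grid r k ms j)"
  proof (intro sum.cong refl)
   fix j assume "j \<in> {..r}"
   then have j: "j <= r" by simp
   note jk = grid_index(2)[OF r j, of k]
   have "(\<Sum>i<k. u k i j * (real (ms ! i) - 1)) = real_of_int (bsum ms (k * j div r))"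
    unfolding u_def sum_of_bool_less[OF jk] using bsum_sum jk len by simp
   then show "(\<Sum>i<k. c j * (u k i j * (real (ms ! i) - 1)) / sqrt (2 * real k)) = c j * grid r k ms j"
    using j by (simp add: grid_def sum_divide_distrib[symmetric] sum_distrib_left[symmetric])
  qed
  finally show ?thesis .
 qed
 have "(%k. (\<Sum>ms\<in>bcomp k. cis (\<Sum>i<k. a k i / sqrt k * (real (ms ! i) - 1))) / real (card (bcomp k))) \<longlonglongrightarrow> complex_of_real (exp (- (S / 2)))"
  using bridge_char_limit[OF bd l1 l2] unfolding ex .
 then have "(%k. Re (cis \<theta> * ((\<Sum>ms\<in>bcomp k. cis (\<Sum>i<k. a k i / sqrt k * (real (ms ! i) - 1))) / real (card (bcomp k))))) \<longlonglongrightarrow>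
   Re (cis \<theta> * complex_of_real (exp (- (S / 2))))" by (intro tendsto_intros)
 moreover have "Re (cis \<theta> * ((\<Sum>ms\<in>bcomp k. cis (\<Sum>i<k. a k i / sqrt k * (real (ms ! i) - 1))) / real (card (bcomp k)))) =
   avg (bcomp k) (%ms. cos ((\<Sum>j\<le>r. c j * grid r k ms j) + \<theta>))" for k
 proof -
  have "cis \<theta> * ((\<Sum>ms\<in>bcomp k. cis (\<Sum>i<k. a k i / sqrt k * (real (ms ! i) - 1))) / of_real (real (card (bcomp k)))) =
    (\<Sum>ms\<in>bcomp k. cis ((\<Sum>j\<le>r. c j * grid r k ms j) + \<theta>)) / of_real (real (card (bcomp k)))"
   unfolding times_divide_eq_right sum_distrib_left
   by (intro arg_cong2[where f = "(/)"] sum.cong refl) (simp only: sum_eq cis_mult add.commute)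
  then show ?thesis by (simp only: Re_divide_of_real Re_sum cis.sel avg_def)
 qed
 ultimately show ?thesis by (simp add: S_def)
qed

lemma char_normal:
 assumes "prob_space M" and v: "0 < v" and Y: "distributed M lborel Y (normal_density 0 (sqrt v))"
 shows "(\<integral>\<omega>. cos (Y \<omega> + \<theta>) \<partial>M) = cos \<theta> * exp (- v / 2)"
proof -
 interpret prob_space M by fact
 define X where "X = (%\<omega>. Y \<omega> / sqrt v)"
 have s: "0 < sqrt v" using v by simp
 have X: "distributed M lborel X std_normal_density" using Y normal_standard_normal_convert[OF s, of Y 0] by (simp add: X_def)
 have mX: "X \<in> borel_measurable M" using distributed_measurable[OF X] by simp
 have "distr M lborel X = density lborel std_normal_density" using X by (simp add: distributed_def)
 moreover have "distr M lborel X = distr M borel X" by (intro distr_cong) auto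
 ultimately have D: "distr M borel X = density lborel std_normal_density" by simp
 have "complex_of_real (exp (- (sqrt v)\<^sup>2 / 2)) = char (distr M borel X) (sqrt v)"
  unfolding D char_std_normal_distribution by simp
 also have "... = (CLINT \<omega>|M. iexp (sqrt v * X \<omega>))" unfolding char_def by (rule integral_distr[OF mX]) simp
 also have "... = (CLINT \<omega>|M. cis (Y \<omega>))" using v by (simp add: X_def cis_conv_exp)
 finally have c: "(CLINT \<omega>|M. cis (Y \<omega>)) = complex_of_real (exp (- v / 2))" using v by simp
 have mY: "Y \<in> borel_measurable M" using distributed_measurable[OF Y] by simp
 then have i: "integrable M (%\<omega>. cis (Y \<omega>))" unfolding cis_conv_exp
  by (intro integrable_const_bound[of _ 1]) auto
 have "(\<integral>\<omega>. cos (Y \<omega> + \<theta>) \<partial>M) = (\<integral>\<omega>. Re (cis \<theta> * cis (Y \<omega>)) \<partial>M)" by (simp add: cis_mult add.commute)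
 also have "... = Re (cis \<theta> * (CLINT \<omega>|M. cis (Y \<omega>)))" by (subst integral_Re) (auto simp: i)
 finally show ?thesis unfolding c by simp
qed

lemma bgrid_char:
 assumes bb: "brownian_bridge M b" and r: "1 <= r"
 shows "(\<integral>\<omega>. cos ((\<Sum>j\<le>r. c j * bgrid b r \<omega> j) + \<theta>) \<partial>M) =
  cos \<theta> * exp (- (\<Sum>i\<le>r. \<Sum>j\<le>r. c i * c j * bb_cov (real i / real r) (real j / real r)) / 2)"
proof -
 have ps: "prob_space M" using bb by (simp add: brownian_bridge_def)
 interpret prob_space M by (rule ps)
 define ts where "ts = map (%j. real j / real r) [0..<Suc r]"
 define cs where "cs = map c [0..<Suc r]"
 define v where "v = (\<Sum>i\<le>r. \<Sum>j\<le>r. c i * c j * bb_cov (real i / real r) (real j / real r))"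
 define Y where "Y = (%\<omega>. \<Sum>j\<le>r. c j * bgrid b r \<omega> j)"
 have nth: "ts ! i = real i / real r" "cs ! i = c i" if "i <= r" for i
  using that by (simp_all add: ts_def cs_def del: upt_Suc)
 have len: "length ts = Suc r" "length cs = Suc r" by (auto simp: ts_def cs_def)
 have sts: "set ts \<subseteq> {0..1}" using r by (auto simp: ts_def)
 have vs: "(\<Sum>i<length ts. \<Sum>j<length ts. cs!i * cs!j * bb_cov (ts!i) (ts!j)) = v"
  unfolding v_def len lessThan_Suc_atMost by (intro sum.cong refl) (simp add: nth)
 have ys: "(%\<omega>. \<Sum>i<length ts. cs!i * b (ts!i) \<omega>) = Y"
  unfolding Y_def len lessThan_Suc_atMost by (intro ext sum.cong refl) (simp add: nth bgrid_def)
 have d: "if v = 0 then AE \<omega> in M. Y \<omega> = 0 else distributed M lborel Y (normal_density 0 (sqrt v))"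
  using bb[unfolded brownian_bridge_def, THEN conjunct2, THEN conjunct2, THEN conjunct2, rule_format, OF sts, of cs] len
  unfolding Let_def vs ys by simp
 \<comment> \<open>Nonnegativity of the covariance form is obtained from the discrete bridges:
   averages of cosines are at most 1, hence so is their limit \<open>exp (- v / 2)\<close>.\<close>
 have "v >= 0"
 proof -
  have "avg (bcomp k) (%ms. cos ((\<Sum>j\<le>r. c j * grid r k ms j) + 0)) <= 1" for k
  proof -
   have "avg (bcomp k) (%ms. cos ((\<Sum>j\<le>r. c j * grid r k ms j) + 0)) <= avg (bcomp k) (%_. 1)" by (intro avg_mono) simp
   then show ?thesis using avg_const[OF card_bcomp_pos] by simp
  qed
  with grid_char[OF r, of c 0] have "cos 0 * exp (- v / 2) <= 1" unfolding v_def by (intro LIMSEQ_le_const2) auto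
  then show ?thesis by simp
 qed
 show ?thesis
 proof (cases "v = 0")
  case True
  then have "AE \<omega> in M. Y \<omega> = 0" using d by simp
  then have "(\<integral>\<omega>. cos (Y \<omega> + \<theta>) \<partial>M) = (\<integral>\<omega>. cos \<theta> \<partial>M)"
  proof (intro integral_cong_AE)
   have "(%\<omega>. b (real j / real r) \<omega>) \<in> borel_measurable M" if "j <= r" for j
    using bb that r unfolding brownian_bridge_def by (simp add: divide_le_eq_1)
   then have "Y \<in> borel_measurable M" unfolding Y_def bgrid_def by (intro borel_measurable_sum borel_measurable_times) auto
   then show "(%\<omega>. cos (Y \<omega> + \<theta>)) \<in> borel_measurable M" by measurable
  qed auto
  then show ?thesis using True by (simp add: Y_def v_def prob_space)
 next
  case False
  then have "0 < v" using \<open>v >= 0\<close> by simp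
  from char_normal[OF ps this, of Y \<theta>] d False show ?thesis by (simp add: Y_def v_def)
 qed
qed

lemma bb_measurable: "brownian_bridge M b ==> 0 <= t ==> t <= 1 ==> b t \<in> borel_measurable M"
 by (auto simp: brownian_bridge_def)

lemma bgrid_measurable:
 assumes "brownian_bridge M b" "1 <= r"
 shows "bgrid b r \<in> borel_measurable M"
proof (rule measurable_coordinatewise_then_product)
 fix j
 have "j <= r ==> b (real j / real r) \<in> borel_measurable M" using assms by (intro bb_measurable) (auto simp: divide_le_eq_1)
 then show "(%\<omega>. bgrid b r \<omega> j) \<in> borel_measurable M" unfolding bgrid_def by (cases "j <= r") auto
qed

lemma comp_bgrid_measurable:
 assumes "brownian_bridge M b" "1 <= r" "continuous_on UNIV G"
 shows "(%\<omega>. G (bgrid b r \<omega>) :: real) \<in> borel_measurable M"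
 using measurable_compose[OF bgrid_measurable[OF assms(1,2)] borel_measurable_continuous_onI[OF assms(3)]] .

lemma trig_limit:
 assumes bb: "brownian_bridge M b" and r: "1 <= r" and "\<tau> \<in> trig r"
 shows "integrable M (%\<omega>. \<tau> (bgrid b r \<omega>)) \<and>
  (%k. avg (bcomp k) (%ms. \<tau> (grid r k ms))) \<longlonglongrightarrow> (\<integral>\<omega>. \<tau> (bgrid b r \<omega>) \<partial>M)"
 using assms(3)
proof induction
 case (base a c \<theta>)
 interpret prob_space M using bb by (simp add: brownian_bridge_def)
 have "integrable M (%\<omega>. a * cos ((\<Sum>j\<le>r. c j * bgrid b r \<omega> j) + \<theta>))"
  using comp_bgrid_measurable[OF bb r trig_cont[OF trig.base]]
  by (intro integrable_const_bound[of _ "\<bar>a\<bar>"]) (auto simp: abs_mult intro!: mult_left_le)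
 then show ?case unfolding avg_cmult integral_mult_right_zero bgrid_char[OF bb r]
  using tendsto_mult[OF tendsto_const grid_char[OF r]] by blast
next
 case (add f g)
 then show ?case using tendsto_add by (auto simp: avg_add intro!: tendsto_eq_intros)
qed

text \<open>Tightness at finitely many points by the exponential Markov inequality with
  \<open>\<theta> = 1 / sqrt k\<close>; the bound \<open>k >= 64\<close> puts this
  \<open>\<theta>\<close> in the range of \<open>bridge_mgf\<close>.\<close>

lemma grid_tail:
 assumes r: "1 <= r" and \<epsilon>: "0 < \<epsilon>"
 shows "\<exists>L>0. \<forall>k\<ge>64. avg (bcomp k) (%ms. of_bool (\<exists>j\<le>r. L < \<bar>grid r k ms j\<bar>)) <= \<epsilon>"
proof -
 obtain C where C: "C >= 0" "\<And>k j \<theta>. j <= k ==> \<bar>\<theta>\<bar> <= 1/8 ==>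
   avg (bcomp k) (%ms. exp (\<theta> * real_of_int (bsum ms j))) <= exp (C * \<theta>\<^sup>2 * real k)"
  using bridge_mgf by blast
 define L where "L = max 1 (C - ln (\<epsilon> / (2 * real (Suc r))))"
 have "exp (C - L) <= exp (ln (\<epsilon> / (2 * real (Suc r))))" unfolding L_def by simp
 then have L: "exp (C - L) <= \<epsilon> / (2 * real (Suc r))" using \<epsilon> by simp
 show ?thesis
 proof (intro exI[of _ L] conjI allI impI)
  show "0 < L" by (simp add: L_def)
  fix k :: nat assume k: "64 <= k"
  have "8 = sqrt 64" by simp
  also have "... <= sqrt (real k)" using k by (simp only: real_sqrt_le_iff)
  finally have sk: "8 <= sqrt (real k)" .
  define \<theta> where "\<theta> = 1 / sqrt (real k)"
  have th: "0 <= \<theta>" "\<theta> <= 1/8" "\<theta>\<^sup>2 * real k = 1" using sk k by (auto simp: \<theta>_def power_divide field_simps)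
  define m where "m = (%j. k * j div r)"
  have "of_bool (\<exists>j\<le>r. L < \<bar>grid r k ms j\<bar>) \<le>
   (\<Sum>j\<le>r. exp (- L) * (exp (\<theta> * real_of_int (bsum ms (m j))) + exp (- \<theta> * real_of_int (bsum ms (m j)))))" (is "_ <= (\<Sum>j\<le>r. ?h j)") for ms
  proof (cases "\<exists>j\<le>r. L < \<bar>grid r k ms j\<bar>")
   case True
   then obtain j where j: "j <= r" "L < \<bar>real_of_int (bsum ms (m j))\<bar> / sqrt (2 * real k)" by (auto simp: grid_def m_def)
   have "\<bar>real_of_int (bsum ms (m j))\<bar> / sqrt (2 * real k) <= \<bar>real_of_int (bsum ms (m j))\<bar> / sqrt (real k)"
    using k by (intro divide_left_mono) auto
   then have "L <= \<theta> * \<bar>real_of_int (bsum ms (m j))\<bar>" using j(2) by (simp add: \<theta>_def)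
   also have "\<theta> * \<bar>real_of_int (bsum ms (m j))\<bar> = \<bar>\<theta> * real_of_int (bsum ms (m j))\<bar>" using th by (simp add: abs_mult)
   finally have "L <= \<theta> * real_of_int (bsum ms (m j)) \<or> L <= - \<theta> * real_of_int (bsum ms (m j))" by (simp add: abs_if split: if_splits)
   then have "1 <= ?h j"
   proof
    assume "L <= \<theta> * real_of_int (bsum ms (m j))"
    then have "1 <= exp (- L + \<theta> * real_of_int (bsum ms (m j)))" by simp
    then show ?thesis unfolding exp_add distrib_left by (simp add: add_increasing2)
   next
    assume "L <= - \<theta> * real_of_int (bsum ms (m j))"
    then have "1 <= exp (- L + - \<theta> * real_of_int (bsum ms (m j)))" by simp
    then show ?thesis unfolding exp_add distrib_left by (simp add: add_increasing)
   qed
   also have "... <= (\<Sum>j\<le>r. ?h j)" using j(1) by (intro member_le_sum) auto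
   finally show ?thesis using True by simp
  next
   case False
   have "0 <= (\<Sum>j\<le>r. ?h j)" by (intro sum_nonneg mult_nonneg_nonneg add_nonneg_nonneg) auto
   then show ?thesis by (simp only: False of_bool_eq)
  qed
  then have "avg (bcomp k) (%ms. of_bool (\<exists>j\<le>r. L < \<bar>grid r k ms j\<bar>)) \<le>
   avg (bcomp k) (%ms. \<Sum>j\<le>r. exp (- L) * (exp (\<theta> * real_of_int (bsum ms (m j))) + exp (- \<theta> * real_of_int (bsum ms (m j)))))"
   by (intro avg_mono)
  also have "... = (\<Sum>j\<le>r. exp (- L) * (avg (bcomp k) (%ms. exp (\<theta> * real_of_int (bsum ms (m j)))) + avg (bcomp k) (%ms. exp (- \<theta> * real_of_int (bsum ms (m j))))))"
   unfolding avg_sum avg_cmult avg_add by (rule refl)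
  also have "... <= (\<Sum>j\<le>r. exp (- L) * (exp C + exp C))"
  proof (intro sum_mono mult_left_mono add_mono)
   fix j assume "j \<in> {..r}"
   then have "m j <= k" unfolding m_def using grid_index(2)[OF r] by simp
   from C(2)[OF this, of \<theta>] C(2)[OF this, of "-\<theta>"] th
   show "avg (bcomp k) (%ms. exp (\<theta> * real_of_int (bsum ms (m j)))) <= exp C"
    "avg (bcomp k) (%ms. exp (- \<theta> * real_of_int (bsum ms (m j)))) <= exp C" by (auto simp: mult.assoc)
  qed auto
  also have "... = 2 * real (Suc r) * exp (C - L)" by (simp add: exp_diff exp_minus field_simps)
  also have "... <= 2 * real (Suc r) * (\<epsilon> / (2 * real (Suc r)))" using L by (intro mult_left_mono) auto
  finally show "avg (bcomp k) (%ms. of_bool (\<exists>j\<le>r. L < \<bar>grid r k ms j\<bar>)) <= \<epsilon>" by simp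
 qed
qed

lemma bgrid_tail:
 assumes bb: "brownian_bridge M b" and r: "1 <= r" and \<epsilon>: "0 < \<epsilon>"
 shows "\<exists>L0. \<forall>L\<ge>L0. measure M {\<omega> \<in> space M. \<exists>j\<le>r. L < \<bar>bgrid b r \<omega> j\<bar>} <= \<epsilon>"
proof -
 interpret prob_space M using bb by (simp add: brownian_bridge_def)
 define A where "A = (%L. {\<omega> \<in> space M. \<exists>j\<le>r. L < \<bar>bgrid b r \<omega> j\<bar>})"
 have [measurable]: "(%\<omega>. bgrid b r \<omega> j) \<in> borel_measurable M" for j
  using measurable_product_then_coordinatewise[OF bgrid_measurable[OF bb r]] .
 have m: "A L \<in> sets M" for L unfolding A_def by measurable
 have mono: "A L' \<subseteq> A L" if "L <= L'" for L L' using that by (fastforce simp: A_def)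
 have "(\<Inter>n. A (real n)) = {}"
 proof (rule ccontr)
  assume "(\<Inter>n. A (real n)) \<noteq> {}"
  then obtain \<omega> where \<omega>: "\<And>n. \<omega> \<in> A (real n)" by auto
  define Z where "Z = (\<Sum>j\<le>r. \<bar>bgrid b r \<omega> j\<bar>)"
  obtain n where n: "Z <= real n" using real_arch_simple by blast
  from \<omega>[of n] obtain j where "j <= r" "real n < \<bar>bgrid b r \<omega> j\<bar>" by (auto simp: A_def)
  moreover from this have "\<bar>bgrid b r \<omega> j\<bar> <= Z" unfolding Z_def by (intro member_le_sum) auto
  ultimately show False using n by linarith
 qed
 then have "(%n. measure M (A (real n))) \<longlonglongrightarrow> 0"
  using finite_Lim_measure_decseq[of "%n. A (real n)"] m mono by (auto simp: decseq_def)
 then have "\<forall>\<^sub>F n in sequentially. measure M (A (real n)) < \<epsilon>" using \<epsilon> by (rule order_tendstoD)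
 then obtain n where n: "measure M (A (real n)) < \<epsilon>" by (auto simp: eventually_sequentially)
 have "measure M (A L) <= \<epsilon>" if "real n <= L" for L using finite_measure_mono[OF mono[OF that] m] n by linarith
 then show ?thesis unfolding A_def by blast
qed

text \<open>\<open>G\<close> is replaced by a trigonometric polynomial, uniformly close on a box.
  Outside the box, which both laws leave with probability at most \<open>\<epsilon>\<close>, the
  global bound on the polynomial suffices.\<close>

lemma fdd_limit:
 assumes bb: "brownian_bridge M b" and r: "1 <= r" and G: "continuous_on UNIV G" "\<And>y. \<bar>G y\<bar> <= B"
 shows "(%k. avg (bcomp k) (%ms. G (grid r k ms))) \<longlonglongrightarrow> (\<integral>\<omega>. G (bgrid b r \<omega>) \<partial>M)"
proof -
 interpret prob_space M using bb by (simp add: brownian_bridge_def)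
 have B: "0 <= B" using G(2)[of undefined] by linarith
 have main: "\<forall>\<^sub>F k in sequentially. \<bar>avg (bcomp k) (%ms. G (grid r k ms)) - (\<integral>\<omega>. G (bgrid b r \<omega>) \<partial>M)\<bar> <= (5 + 4 * B) * \<epsilon>"
  if \<epsilon>: "0 < \<epsilon>" "\<epsilon> <= 1" for \<epsilon>
 proof -
  obtain L1 where L1: "L1 > 0" "\<And>k. k >= 64 ==> avg (bcomp k) (%ms. of_bool (\<exists>j\<le>r. L1 < \<bar>grid r k ms j\<bar>)) <= \<epsilon>"
   using grid_tail[OF r \<epsilon>(1)] by blast
  obtain L2 where L2: "\<And>L. L >= L2 ==> measure M {\<omega> \<in> space M. \<exists>j\<le>r. L < \<bar>bgrid b r \<omega> j\<bar>} <= \<epsilon>"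
   using bgrid_tail[OF bb r \<epsilon>(1)] by blast
  define L where "L = max L1 L2"
  have L: "L > 0" "L >= L1" "L >= L2" using L1(1) by (auto simp: L_def)
  obtain \<tau> where \<tau>: "\<tau> \<in> trig r" "\<And>y. (\<And>j. j <= r ==> \<bar>y j\<bar> <= L) ==> (\<And>j. j > r ==> y j = 0) ==> \<bar>G y - \<tau> y\<bar> <= \<epsilon>"
   "\<And>y. \<bar>\<tau> y\<bar> <= B + \<epsilon>" using trig_approx[OF G L(1) \<epsilon>(1)] by blast
  have pt: "\<bar>G y - \<tau> y\<bar> <= \<epsilon> + (2 * B + 1) * of_bool (\<exists>j\<le>r. L < \<bar>y j\<bar>)" if y: "\<And>j. j > r ==> y j = 0" for y
  proof (cases "\<exists>j\<le>r. L < \<bar>y j\<bar>")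
   case True
   have "\<bar>G y - \<tau> y\<bar> <= \<epsilon> + (2 * B + 1)" using G(2)[of y] \<tau>(3)[of y] \<epsilon> by linarith
   then show ?thesis using True by simp
  next
   case False
   then show ?thesis using \<tau>(2)[of y] y by (auto simp: not_less)
  qed
  have a1: "\<bar>avg (bcomp k) (%ms. G (grid r k ms)) - avg (bcomp k) (%ms. \<tau> (grid r k ms))\<bar> <= \<epsilon> + (2 * B + 1) * \<epsilon>"
   if k: "k >= 64" for k
  proof -
   have "\<bar>avg (bcomp k) (%ms. G (grid r k ms)) - avg (bcomp k) (%ms. \<tau> (grid r k ms))\<bar> =
    \<bar>avg (bcomp k) (%ms. G (grid r k ms) - \<tau> (grid r k ms))\<bar>"
    by (simp add: avg_def sum_subtractf diff_divide_distrib)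
   also have "... <= avg (bcomp k) (%ms. \<epsilon> + (2 * B + 1) * of_bool (\<exists>j\<le>r. L < \<bar>grid r k ms j\<bar>))"
    by (intro order_trans[OF avg_abs avg_mono] pt) (simp add: grid_def)
   also have "... = \<epsilon> + (2 * B + 1) * avg (bcomp k) (%ms. of_bool (\<exists>j\<le>r. L < \<bar>grid r k ms j\<bar>))"
    unfolding avg_add avg_cmult using avg_const[OF card_bcomp_pos] by simp
   also have "avg (bcomp k) (%ms. of_bool (\<exists>j\<le>r. L < \<bar>grid r k ms j\<bar>)) <= avg (bcomp k) (%ms. of_bool (\<exists>j\<le>r. L1 < \<bar>grid r k ms j\<bar>))"
    using L(2) by (intro avg_mono) fastforce
   also have "... <= \<epsilon>" by (rule L1(2)[OF k])
   finally show ?thesis using B by (simp add: mult_left_mono)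
  qed
  have a2: "\<bar>(\<integral>\<omega>. G (bgrid b r \<omega>) \<partial>M) - (\<integral>\<omega>. \<tau> (bgrid b r \<omega>) \<partial>M)\<bar> <= \<epsilon> + (2 * B + 1) * \<epsilon>"
  proof -
   define A where "A = {\<omega> \<in> space M. \<exists>j\<le>r. L < \<bar>bgrid b r \<omega> j\<bar>}"
   have [measurable]: "(%\<omega>. bgrid b r \<omega> j) \<in> borel_measurable M" for j
    using measurable_product_then_coordinatewise[OF bgrid_measurable[OF bb r]] .
   have mA: "A \<in> sets M" unfolding A_def by measurable
   have iG: "integrable M (%\<omega>. G (bgrid b r \<omega>))"
    using comp_bgrid_measurable[OF bb r G(1)] by (intro integrable_const_bound[of _ B]) (auto simp: G(2))
   have i\<tau>: "integrable M (%\<omega>. \<tau> (bgrid b r \<omega>))" using trig_limit[OF bb r \<tau>(1)] by blast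
   have iI: "integrable M (%\<omega>. \<epsilon> + (2 * B + 1) * indicator A \<omega>)" using mA by (auto simp: emeasure_eq_measure)
   have "\<bar>(\<integral>\<omega>. G (bgrid b r \<omega>) \<partial>M) - (\<integral>\<omega>. \<tau> (bgrid b r \<omega>) \<partial>M)\<bar> = \<bar>\<integral>\<omega>. G (bgrid b r \<omega>) - \<tau> (bgrid b r \<omega>) \<partial>M\<bar>"
    using iG i\<tau> by simp
   also have "... <= (\<integral>\<omega>. \<bar>G (bgrid b r \<omega>) - \<tau> (bgrid b r \<omega>)\<bar> \<partial>M)" by (rule integral_abs_bound)
   also have "... <= (\<integral>\<omega>. \<epsilon> + (2 * B + 1) * indicator A \<omega> \<partial>M)"
   proof (intro integral_mono iI integrable_abs Bochner_Integration.integrable_diff iG i\<tau>)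
    fix \<omega> assume "\<omega> \<in> space M"
    then have "indicator A \<omega> = (of_bool (\<exists>j\<le>r. L < \<bar>bgrid b r \<omega> j\<bar>) :: real)" by (auto simp: A_def indicator_def)
    then show "\<bar>G (bgrid b r \<omega>) - \<tau> (bgrid b r \<omega>)\<bar> <= \<epsilon> + (2 * B + 1) * indicator A \<omega>"
     using pt[of "bgrid b r \<omega>"] by (simp add: bgrid_def)
   qed
   also have "... = \<epsilon> + (2 * B + 1) * measure M A" using mA by (simp add: prob_space emeasure_eq_measure)
   also have "measure M A <= \<epsilon>" unfolding A_def by (rule L2[OF L(3)])
   finally show ?thesis using B by (simp add: mult_left_mono)
  qed
  have "\<forall>\<^sub>F k in sequentially. dist (avg (bcomp k) (%ms. \<tau> (grid r k ms))) (\<integral>\<omega>. \<tau> (bgrid b r \<omega>) \<partial>M) < \<epsilon>"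
   using trig_limit[OF bb r \<tau>(1)] \<epsilon>(1) by (intro tendstoD) auto
  then show ?thesis using eventually_ge_at_top[of 64]
  proof eventually_elim
   case (elim k)
   from a1[OF elim(2)] a2 elim(1) show ?case by (simp add: dist_real_def algebra_simps)
  qed
 qed
 show ?thesis
 proof (rule tendstoI)
  fix e :: real assume e: "0 < e"
  define \<epsilon> where "\<epsilon> = min 1 (e / (2 * (5 + 4 * B)))"
  have \<epsilon>: "0 < \<epsilon>" "\<epsilon> <= 1" using e B by (auto simp: \<epsilon>_def)
  have "(5 + 4 * B) * \<epsilon> <= (5 + 4 * B) * (e / (2 * (5 + 4 * B)))" using B by (intro mult_left_mono) (auto simp: \<epsilon>_def)
  also have "... = e / 2" using B by (simp add: field_simps)
  finally have "(5 + 4 * B) * \<epsilon> < e" using e by linarith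
  then show "\<forall>\<^sub>F k in sequentially. dist (avg (bcomp k) (%ms. G (grid r k ms))) (\<integral>\<omega>. G (bgrid b r \<omega>) \<partial>M) < e"
   using main[OF \<epsilon>] by (auto simp: dist_real_def elim!: eventually_mono)
 qed
qed

subsection \<open>From Lipschitz to continuous functionals\<close>

definition lipf :: "real => ((real => real) => real) => bool" where
 "lipf m F \<longleftrightarrow> 0 <= m \<and> (\<forall>f\<in>C01. \<forall>g\<in>C01. \<bar>F f - F g\<bar> <= m * unif_dist f g)"

lemma lipf_le:
 assumes "lipf m F" "f \<in> C01" "g \<in> C01" "\<And>t. 0 <= t ==> t <= 1 ==> \<bar>f t - g t\<bar> <= \<eta>"
 shows "\<bar>F f - F g\<bar> <= m * \<eta>"
proof -
 have "\<bar>F f - F g\<bar> <= m * unif_dist f g" using assms by (auto simp: lipf_def)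
 also have "... <= m * \<eta>" using assms(1) ud_le[of f g \<eta>, OF assms(4)] by (intro mult_left_mono) (auto simp: lipf_def)
 finally show ?thesis .
qed

lemma lipf_pl_cont:
 assumes F: "lipf m F" and r: "1 <= r"
 shows "continuous_on UNIV (%y. F (pl r y))" unfolding continuous_on_def
proof
 fix y0 :: "nat => real"
 have co: "((%y. y j) \<longlongrightarrow> y0 j) (at y0)" for j
  using continuous_on_product_coordinates[of j] unfolding continuous_on_def by auto
 have "((%y. m * (\<Sum>j\<le>r. \<bar>y j - y0 j\<bar>)) \<longlongrightarrow> m * (\<Sum>j\<le>r. \<bar>y0 j - y0 j\<bar>)) (at y0)"
  by (intro tendsto_intros co)
 then have l: "((%y. m * (\<Sum>j\<le>r. \<bar>y j - y0 j\<bar>)) \<longlongrightarrow> 0) (at y0)" by simp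
 have "\<bar>F (pl r y) - F (pl r y0)\<bar> <= m * (\<Sum>j\<le>r. \<bar>y j - y0 j\<bar>)" for y
 proof (rule lipf_le[OF F pl_in_C01 pl_in_C01])
  fix t :: real assume "0 <= t" "t <= 1"
  from pl_conv[OF r this] obtain i i' \<nu> where 1: "i <= r" "i' <= r" "0 <= \<nu>" "\<nu> <= 1" "\<And>v. pl r v t = (1 - \<nu>) * v i + \<nu> * v i'" by blast
  have s: "\<bar>y j - y0 j - 0\<bar> <= (\<Sum>j\<le>r. \<bar>y j - y0 j\<bar>)" if "j <= r" for j
   using member_le_sum[of j "{..r}" "%j. \<bar>y j - y0 j\<bar>"] that by simp
  have "pl r y t - pl r y0 t = ((1 - \<nu>) * (y i - y0 i) + \<nu> * (y i' - y0 i')) - ((1 - 0) * 0 + 0 * 0)"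
   unfolding 1(5) by (simp add: algebra_simps)
  then show "\<bar>pl r y t - pl r y0 t\<bar> <= (\<Sum>j\<le>r. \<bar>y j - y0 j\<bar>)"
   by (simp only:) (intro convex_diff_le s 1; simp)
 qed
 then have "((%y. F (pl r y) - F (pl r y0)) \<longlongrightarrow> 0) (at y0)"
  by (intro Lim_null_comparison[OF _ l] always_eventually) simp
 then show "((%y. F (pl r y)) \<longlongrightarrow> F (pl r y0)) (at y0 within UNIV)" by (simp add: LIM_zero_iff)
qed

abbreviation (input) "bexp M b F \<equiv> \<integral>\<omega>. F (%t. b t \<omega>) \<partial>M"

lemma bb_C01: "brownian_bridge M b ==> \<omega> \<in> space M ==> (%t. b t \<omega>) \<in> C01"
 by (simp add: brownian_bridge_def C01_def)

text \<open>The interpolations of a continuous path converge uniformly to it, so \<open>F\<close> of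
  the bridge is a pointwise limit of continuous functions of finitely many coordinates. This yields
  measurability and, by dominated convergence, the limit of the expectations.\<close>

lemma lipf_bridge:
 assumes bb: "brownian_bridge M b" and F: "lipf m F" and B: "\<forall>f\<in>C01. \<bar>F f\<bar> <= B"
 shows "(%\<omega>. F (%t. b t \<omega>)) \<in> borel_measurable M"
  and "(%r. \<integral>\<omega>. F (pl (Suc r) (bgrid b (Suc r) \<omega>)) \<partial>M) \<longlonglongrightarrow> bexp M b F"
proof -
 interpret prob_space M using bb by (simp add: brownian_bridge_def)
 have pw: "(%r. F (pl (Suc r) (bgrid b (Suc r) \<omega>))) \<longlonglongrightarrow> F (%t. b t \<omega>)" if \<omega>: "\<omega> \<in> space M" for \<omega>
 proof (rule tendstoI)
  fix e :: real assume e: "0 < e"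
  have m: "0 <= m" using F by (simp add: lipf_def)
  define \<eta> where "\<eta> = e / (2 * (m + 1))"
  have \<eta>: "0 < \<eta>" using e m by (simp add: \<eta>_def)
  have "m * \<eta> <= (m + 1) * \<eta>" using \<eta> by (intro mult_right_mono) auto
  also have "... < e" using e m by (simp add: \<eta>_def field_simps add_pos_nonneg)
  finally have me: "m * \<eta> < e" .
  have "uniformly_continuous_on {0..1} (%t. b t \<omega>)"
   using bb_C01[OF bb \<omega>] by (intro compact_uniformly_continuous) (auto simp: C01_def)
  then obtain d where d: "d > 0" "\<And>s t. s \<in> {0..1} ==> t \<in> {0..1} ==> \<bar>s - t\<bar> < d ==> \<bar>b s \<omega> - b t \<omega>\<bar> < \<eta>"
   unfolding uniformly_continuous_on_def dist_real_def using \<eta> by (metis abs_minus_commute)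
  have "\<forall>\<^sub>F r in sequentially. 1 / real (Suc r) < d"
   using LIMSEQ_inverse_real_of_nat d(1) by (auto simp: inverse_eq_divide dest: order_tendstoD)
  then show "\<forall>\<^sub>F r in sequentially. dist (F (pl (Suc r) (bgrid b (Suc r) \<omega>))) (F (%t. b t \<omega>)) < e"
  proof eventually_elim
   case (elim r)
   have "\<bar>F (pl (Suc r) (bgrid b (Suc r) \<omega>)) - F (%t. b t \<omega>)\<bar> <= m * \<eta>"
   proof (rule lipf_le[OF F pl_in_C01 bb_C01[OF bb \<omega>]])
    fix t :: real assume t: "0 <= t" "t <= 1"
    from pl_conv[of "Suc r", OF _ this] obtain i i' \<nu> where 1: "i <= Suc r" "i' <= Suc r" "0 <= \<nu>" "\<nu> <= 1"
     "\<bar>real i / real (Suc r) - t\<bar> <= 1 / real (Suc r)" "\<bar>real i' / real (Suc r) - t\<bar> <= 1 / real (Suc r)"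
     "\<And>v. pl (Suc r) v t = (1 - \<nu>) * v i + \<nu> * v i'" by auto
    have s: "\<bar>bgrid b (Suc r) \<omega> j - b t \<omega>\<bar> <= \<eta>" if "j <= Suc r" "\<bar>real j / real (Suc r) - t\<bar> <= 1 / real (Suc r)" for j
    proof -
     have "real j / real (Suc r) \<in> {0..1}" using that(1) by (simp add: divide_le_eq_1)
     moreover have "\<bar>real j / real (Suc r) - t\<bar> < d" using that(2) elim by linarith
     ultimately have "\<bar>b (real j / real (Suc r)) \<omega> - b t \<omega>\<bar> < \<eta>" using t by (intro d(2)) auto
     then show ?thesis using that(1) by (simp only: bgrid_def if_True less_imp_le)
    qed
    have "pl (Suc r) (bgrid b (Suc r) \<omega>) t - b t \<omega> =
     ((1 - \<nu>) * bgrid b (Suc r) \<omega> i + \<nu> * bgrid b (Suc r) \<omega> i') - ((1 - 0) * b t \<omega> + 0 * b t \<omega>)"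
     unfolding 1(7) by simp
    then show "\<bar>pl (Suc r) (bgrid b (Suc r) \<omega>) t - b t \<omega>\<bar> <= \<eta>"
     by (simp only:) (intro convex_diff_le s 1; simp)
   qed
   then show ?case using me by (simp add: dist_real_def)
  qed
 qed
 have ms: "(%\<omega>. F (pl (Suc r) (bgrid b (Suc r) \<omega>))) \<in> borel_measurable M" for r
  using comp_bgrid_measurable[OF bb _ lipf_pl_cont[OF F, of "Suc r"]] by simp
 show m: "(%\<omega>. F (%t. b t \<omega>)) \<in> borel_measurable M" by (rule borel_measurable_LIMSEQ_metric[OF ms pw])
 show "(%r. \<integral>\<omega>. F (pl (Suc r) (bgrid b (Suc r) \<omega>)) \<partial>M) \<longlonglongrightarrow> bexp M b F"
  using pw by (intro integral_dominated_convergence[where w = "%_. B"] m ms) (auto intro!: bspec[OF B] pl_in_C01)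
qed

text \<open>The Pasch-Hausdorff envelope, a minorant of \<open>F\<close> with Lipschitz constant
  \<open>m\<close>. Since \<open>F\<close> is bounded, paths at a fixed distance are irrelevant to
  the infimum for large \<open>m\<close>, and continuity of \<open>F\<close> gives pointwise
  convergence.\<close>

definition infconv :: "((real => real) => real) => nat => (real => real) => real" where
 "infconv F m f = (INF g\<in>C01. F g + real m * unif_dist f g)"

lemma infconv:
 assumes BB: "\<forall>f\<in>C01. \<bar>F f\<bar> <= B"
 shows "f \<in> C01 ==> infconv F m f <= F f" "\<forall>f\<in>C01. \<bar>infconv F m f\<bar> <= B" "lipf (real m) (infconv F m)"
  and "f \<in> C01 ==> (\<And>e. e > 0 ==> \<exists>d>0. \<forall>g\<in>C01. unif_dist f g < d --> \<bar>F g - F f\<bar> < e) ==>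
   (%m. infconv F m f) \<longlonglongrightarrow> F f"
proof -
 note B = bspec[OF BB]
 have ne: "C01 \<noteq> {}" using pl_in_C01 by blast
 have nn: "0 <= real m * unif_dist f g" if "f \<in> C01" "g \<in> C01" for m f g using ud_props(1)[OF that] by simp
 have bd: "bdd_below ((%g. F g + real m * unif_dist f g) ` C01)" if "f \<in> C01" for f m
 proof (rule bdd_belowI2)
  show "- B <= F g + real m * unif_dist f g" if "g \<in> C01" for g
   using B[OF that] nn[OF \<open>f \<in> C01\<close> that, of m] by linarith
 qed
 have low: "infconv F m f <= F g + real m * unif_dist f g" if "f \<in> C01" "g \<in> C01" for f g m
  unfolding infconv_def by (rule cINF_lower[OF bd[OF that(1)] that(2)])
 show 1: "infconv F m f <= F f" if f: "f \<in> C01" for f m using low[OF f f, of m] ud_props(2)[OF f f] by simp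
 show "\<forall>f\<in>C01. \<bar>infconv F m f\<bar> <= B" for m
 proof
  fix f assume f: "f \<in> C01"
  have "- B <= infconv F m f" unfolding infconv_def
  proof (rule cINF_greatest[OF ne])
   show "- B <= F g + real m * unif_dist f g" if "g \<in> C01" for g using B[OF that] nn[OF f that, of m] by linarith
  qed
  then show "\<bar>infconv F m f\<bar> <= B" using 1[OF f, of m] B[OF f] by linarith
 qed
 have l: "infconv F m f - real m * unif_dist f h <= infconv F m h" if "f \<in> C01" "h \<in> C01" for f h
  unfolding infconv_def[of F m h]
 proof (rule cINF_greatest[OF ne])
  fix g assume g: "g \<in> C01"
  have "real m * unif_dist f g <= real m * (unif_dist f h + unif_dist h g)"
   using ud_props(4)[OF that g] by (intro mult_left_mono) auto
  then show "infconv F m f - real m * unif_dist f h <= F g + real m * unif_dist h g"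
   using low[OF that(1) g, of m] by (simp add: algebra_simps)
 qed
 show "lipf (real m) (infconv F m)" unfolding lipf_def
 proof (intro conjI ballI)
  fix f g assume fg: "f \<in> C01" "g \<in> C01"
  show "\<bar>infconv F m f - infconv F m g\<bar> <= real m * unif_dist f g"
   using l[OF fg] l[OF fg(2,1)] ud_props(3)[OF fg] by (simp add: abs_le_iff)
 qed simp
 assume f: "f \<in> C01" and c: "\<And>e. e > 0 ==> \<exists>d>0. \<forall>g\<in>C01. unif_dist f g < d --> \<bar>F g - F f\<bar> < e"
 show "(%m. infconv F m f) \<longlonglongrightarrow> F f"
 proof (rule tendstoI)
  fix e :: real assume e: "0 < e"
  from c[of "e/2"] e obtain d where d: "d > 0" "\<And>g. g \<in> C01 ==> unif_dist f g < d ==> \<bar>F g - F f\<bar> < e/2" by auto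
  have "\<forall>\<^sub>F m in sequentially. 2 * B / d <= real m" using filterlim_real_sequentially by (simp add: filterlim_at_top)
  then show "\<forall>\<^sub>F m in sequentially. dist (infconv F m f) (F f) < e"
  proof eventually_elim
   case (elim m)
   have "F f - e/2 <= infconv F m f" unfolding infconv_def
   proof (rule cINF_greatest[OF ne])
    fix g assume g: "g \<in> C01"
    show "F f - e/2 <= F g + real m * unif_dist f g"
    proof (cases "unif_dist f g < d")
     case True
     then show ?thesis using d(2)[OF g True] nn[OF f g, of m] by linarith
    next
     case False
     have "2 * B <= real m * d" using elim d(1) by (simp add: field_simps)
     also have "... <= real m * unif_dist f g" using False by (intro mult_left_mono) auto
     finally show ?thesis using B[OF f] B[OF g] e by linarith
    qed
   qed
   then show ?case using 1[OF f, of m] e by (simp add: dist_real_def)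
  qed
 qed
qed

text \<open>Lipschitz minorants whose bridge expectations approach that of \<open>F\<close> give the
  lower bound by monotonicity; the upper bound is the same statement for \<open>- F\<close>.\<close>

lemma lip_suffices:
 fixes E :: "nat => ((real => real) => real) => real"
 assumes bb: "brownian_bridge M b"
  and mono: "\<And>n F G. (\<And>f. f \<in> C01 ==> F f <= G f) ==> E n F <= E n G"
  and neg: "\<And>n F. E n (%f. - F f) = - E n F"
  and lip: "\<And>F m B. lipf m F ==> \<forall>f\<in>C01. \<bar>F f\<bar> <= B ==> (%n. E n F) \<longlonglongrightarrow> bexp M b F"
  and F: "bdd_cont_functional F"
 shows "(%n. E n F) \<longlonglongrightarrow> bexp M b F"
proof -
 interpret prob_space M using bb by (simp add: brownian_bridge_def)
 have low: "\<forall>\<^sub>F n in sequentially. (bexp M b F) - e < E n F"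
  if F: "bdd_cont_functional F" and e: "0 < e" for F e
 proof -
  from F obtain B where B: "\<forall>f\<in>C01. \<bar>F f\<bar> <= B"
   and c: "\<And>f e. f \<in> C01 ==> e > 0 ==> \<exists>d>0. \<forall>g\<in>C01. unif_dist f g < d --> \<bar>F g - F f\<bar> < e"
   unfolding bdd_cont_functional_def by blast
  note I = infconv[of F B, OF B]
  have ms: "(%\<omega>. infconv F m (%t. b t \<omega>)) \<in> borel_measurable M" for m by (rule lipf_bridge(1)[OF bb I(3) I(2)])
  have pw: "(%m. infconv F m (%t. b t \<omega>)) \<longlonglongrightarrow> F (%t. b t \<omega>)" if "\<omega> \<in> space M" for \<omega>
   using I(4)[OF bb_C01[OF bb that] c[OF bb_C01[OF bb that]]] .
  have "(%m. \<integral>\<omega>. infconv F m (%t. b t \<omega>) \<partial>M) \<longlonglongrightarrow> bexp M b F"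
   using pw by (intro integral_dominated_convergence[where w = "%_. B"] ms borel_measurable_LIMSEQ_metric[OF ms])
    (auto intro!: bspec[OF I(2)] bb_C01[OF bb])
  then have "\<forall>\<^sub>F m in sequentially. (bexp M b F) - e < (\<integral>\<omega>. infconv F m (%t. b t \<omega>) \<partial>M)"
   using e by (intro order_tendstoD) auto
  then obtain m where m: "(bexp M b F) - e < (\<integral>\<omega>. infconv F m (%t. b t \<omega>) \<partial>M)"
   by (auto simp: eventually_sequentially)
  from order_tendstoD(1)[OF lip[OF I(3) I(2)] m] show ?thesis
  proof eventually_elim
   case (elim n)
   have "E n (infconv F m) <= E n F" by (rule mono[OF I(1)])
   then show ?case using elim by linarith
  qed
 qed
 have F': "bdd_cont_functional (%f. - F f)" using F unfolding bdd_cont_functional_def by (simp add: abs_minus_commute)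
 show ?thesis
 proof (rule tendstoI)
  fix e :: real assume e: "0 < e"
  from low[OF F e] low[OF F' e] show "\<forall>\<^sub>F n in sequentially. dist (E n F) (bexp M b F) < e"
  proof eventually_elim
   case (elim n)
   then show ?case unfolding neg by (simp add: dist_real_def abs_less_iff)
  qed
 qed
qed

subsection \<open>Convergence of the label process of good codes\<close>

text \<open>Windows of length \<open>2 * h\<close> around the grid points. The truncated subtraction
  and the minimum keep the window inside \<open>{0..k}\<close> at both ends.\<close>

definition osc_bad :: "nat => nat => real => nat list => bool" where
 "osc_bad r k x ms \<longleftrightarrow> (let h = 2 * k div r in \<exists>j\<le>r. let a = min (k * j div r - h) (k - 2 * h) in
   \<exists>i\<le>2 * h. x <= \<bar>real_of_int (bsum ms (a + i) - bsum ms a)\<bar>)"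

lemma osc_bad_prob:
 "\<exists>C\<ge>1. \<forall>k r \<alpha>. 1 <= k --> 8 <= r --> 0 < \<alpha> --> \<alpha> * real r <= 10 * sqrt (real k) -->
  avg (bcomp k) (%ms. of_bool (osc_bad r k (\<alpha> * sqrt (real k)) ms)) <= real (Suc r) * (C * exp (- (\<alpha>\<^sup>2 * real r / 80)))"
proof -
 obtain C where C: "C >= 1" "\<And>k a h x \<theta>. k >= 1 ==> a + h <= k ==> 2 * h <= k ==> 0 <= \<theta> ==> \<theta> <= 1/4 ==>
   avg (bcomp k) (%ms. of_bool (\<exists>i\<le>h. x <= \<bar>real_of_int (bsum ms (a + i) - bsum ms a)\<bar>)) <= C * exp (- \<theta> * x + 5 * \<theta>\<^sup>2 * real h)"
  using bridge_osc by meson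
 show ?thesis
 proof (intro exI[of _ C] conjI allI impI C(1))
  fix k r :: nat and \<alpha> :: real
  assume k: "1 <= k" and r: "8 <= r" and \<alpha>: "0 < \<alpha>" "\<alpha> * real r <= 10 * sqrt (real k)"
  define h where "h = 2 * k div r"
  define a where "a = (%j. min (k * j div r - h) (k - 2 * h))"
  have "4 * h <= (4 * (2 * k)) div r" unfolding h_def using r by (simp add: less_eq_div_iff_mult_less_eq mult.assoc)
  also have "... <= (k * r) div r" using r by (intro div_le_mono) simp
  finally have h: "4 * h <= k" using r by simp
  have "real h <= real (2 * k) / real r" unfolding h_def by (rule of_nat_div_le_of_nat)
  then have hr: "real h <= 2 * real k / real r" by simp
  \<comment> \<open>This minimizes
    \<open>- \<theta> * \<alpha> * sqrt k + 20 * \<theta>^2 * k / r\<close>, the exponent for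
    windows of length \<open>4 * k / r\<close>; the assumption on \<open>\<alpha> * r\<close> keeps
    it below \<open>1/4\<close>.\<close>
  define \<theta> where "\<theta> = \<alpha> * real r / (40 * sqrt (real k))"
  have sk: "0 < sqrt (real k)" using k by simp
  have \<theta>: "0 <= \<theta>" "\<theta> <= 1/4" using \<alpha> sk by (auto simp: \<theta>_def field_simps)
  have ex: "- \<theta> * (\<alpha> * sqrt (real k)) + 5 * \<theta>\<^sup>2 * real (2 * h) <= - (\<alpha>\<^sup>2 * real r / 80)"
  proof -
   have "- \<theta> * (\<alpha> * sqrt (real k)) = - (\<alpha>\<^sup>2 * real r / 40)" using sk by (simp add: \<theta>_def power2_eq_square)
   moreover have "5 * \<theta>\<^sup>2 * real (2 * h) <= 5 * \<theta>\<^sup>2 * (2 * (2 * real k / real r))" using hr by (intro mult_left_mono) auto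
   moreover have "5 * \<theta>\<^sup>2 * (2 * (2 * real k / real r)) = \<alpha>\<^sup>2 * real r / 80"
    using k r by (simp add: \<theta>_def power_divide power_mult_distrib field_simps) (simp add: power2_eq_square)
   ultimately show ?thesis by linarith
  qed
  have "of_bool (osc_bad r k (\<alpha> * sqrt (real k)) ms) \<le>
   (\<Sum>j\<le>r. of_bool (\<exists>i\<le>2 * h. \<alpha> * sqrt (real k) <= \<bar>real_of_int (bsum ms (a j + i) - bsum ms (a j))\<bar>) :: real)" (is "_ <= sum ?f _") for ms
  proof (cases "osc_bad r k (\<alpha> * sqrt (real k)) ms")
   case True
   then obtain j where j: "j <= r" "?f j = 1" unfolding osc_bad_def Let_def a_def h_def by auto
   then show ?thesis using member_le_sum[of j "{..r}" ?f] True by simp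
  qed (simp add: sum_nonneg)
  then have "avg (bcomp k) (%ms. of_bool (osc_bad r k (\<alpha> * sqrt (real k)) ms)) \<le>
   avg (bcomp k) (%ms. \<Sum>j\<le>r. of_bool (\<exists>i\<le>2 * h. \<alpha> * sqrt (real k) <= \<bar>real_of_int (bsum ms (a j + i) - bsum ms (a j))\<bar>))"
   by (intro avg_mono)
  also have "... <= (\<Sum>j\<le>r. C * exp (- (\<alpha>\<^sup>2 * real r / 80)))" unfolding avg_sum
  proof (intro sum_mono)
   fix j
   have "a j + 2 * h <= k" using h by (simp add: a_def)
   then have "avg (bcomp k) (%ms. of_bool (\<exists>i\<le>2 * h. \<alpha> * sqrt (real k) <= \<bar>real_of_int (bsum ms (a j + i) - bsum ms (a j))\<bar>))
     <= C * exp (- \<theta> * (\<alpha> * sqrt (real k)) + 5 * \<theta>\<^sup>2 * real (2 * h))" using h by (intro C(2) k \<theta>) auto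
   also have "... <= C * exp (- (\<alpha>\<^sup>2 * real r / 80))" using C(1) ex by (intro mult_left_mono) auto
   finally show "avg (bcomp k) (%ms. of_bool (\<exists>i\<le>2 * h. \<alpha> * sqrt (real k) <= \<bar>real_of_int (bsum ms (a j + i) - bsum ms (a j))\<bar>))
     <= C * exp (- (\<alpha>\<^sup>2 * real r / 80))" .
  qed
  finally show "avg (bcomp k) (%ms. of_bool (osc_bad r k (\<alpha> * sqrt (real k)) ms)) <= real (Suc r) * (C * exp (- (\<alpha>\<^sup>2 * real r / 80)))"
   by simp
 qed
qed

lemma osc_window:
 assumes nb: "\<not> osc_bad r k x ms" and j: "j <= r" and r: "8 <= r" and J: "J <= k"
  and d: "\<bar>real J - real (k * j div r)\<bar> <= 2 * real k / real r - 1"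
 shows "\<bar>real_of_int (bsum ms J - bsum ms (k * j div r))\<bar> <= 2 * x"
proof -
 define h where "h = 2 * k div r"
 define m where "m = k * j div r"
 define a where "a = min (m - h) (k - 2 * h)"
 have nb': "\<not> x <= \<bar>real_of_int (bsum ms (a + i) - bsum ms a)\<bar>" if "i <= 2 * h" for i
  using nb that j unfolding osc_bad_def Let_def a_def h_def m_def by blast
 have "4 * h <= (4 * (2 * k)) div r" unfolding h_def using r by (simp add: less_eq_div_iff_mult_less_eq mult.assoc)
 also have "... <= (k * r) div r" using r by (intro div_le_mono) simp
 finally have h: "4 * h <= k" using r by simp
 have mk: "m <= k" using grid_index(2)[of r j k] r j by (simp add: m_def)
 have "2 * real k / real r - 1 <= real h" using grid_index(3)[of r "2 * k" 1] r by (simp add: h_def)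
 then have "\<bar>real J - real m\<bar> <= real h" using d by (simp add: m_def)
 then have "J <= m + h" "m <= J + h" by linarith+
 then have b: "a <= J" "J - a <= 2 * h" "a <= m" "m - a <= 2 * h" using h mk J by (auto simp: a_def)
 from nb'[OF b(2)] nb'[OF b(4)] b have "\<bar>real_of_int (bsum ms J - bsum ms a)\<bar> <= x" "\<bar>real_of_int (bsum ms m - bsum ms a)\<bar> <= x" by auto
 then show ?thesis unfolding m_def[symmetric] by (simp add: abs_le_iff)
qed

text \<open>A crude bound on the whole bridge by adding up the windows. It is linear in
  \<open>r\<close>, which suffices because it will be multiplied by a relative norming error of
  order \<open>1 / r\<close>.\<close>

lemma osc_grid:
 assumes nb: "\<not> osc_bad r k x ms" and r: "8 <= r" and k: "3 * r <= k" and j: "j <= r"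
 shows "\<bar>real_of_int (bsum ms (k * j div r))\<bar> <= 2 * x * real j" using j
proof (induction j)
 case 0
 then show ?case by (simp add: bsum_def)
next
 case (Suc j)
 have kr: "3 <= real k / real r" using k r by (simp add: field_simps flip: of_nat_mult)
 have "\<bar>real (k * Suc j div r) - real (k * j div r)\<bar> <= real k / real r + 2"
 proof -
  have "real k * real (Suc j) / real r = real k * real j / real r + real k / real r" by (simp add: algebra_simps add_divide_distrib)
  moreover have "0 <= real k / real r" by simp
  moreover have "1 <= r" using r by simp
  note g = grid_index(3)[OF this, of k j] grid_index(3)[OF this, of k "Suc j"]
  moreover have "\<bar>x' - x\<bar> <= y + 2" if "\<bar>x - u\<bar> <= 1" "\<bar>x' - u'\<bar> <= 1" "u' = u + y" "0 <= y" for x x' u u' y :: real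
   using that by linarith
  ultimately show ?thesis using g by blast
 qed
 then have "\<bar>real (k * Suc j div r) - real (k * j div r)\<bar> <= 2 * real k / real r - 1" using kr by simp
 moreover have "k * Suc j div r <= k" using grid_index(2)[of r "Suc j" k] r Suc.prems by simp
 ultimately have "\<bar>real_of_int (bsum ms (k * Suc j div r) - bsum ms (k * j div r))\<bar> <= 2 * x"
  using Suc.prems by (intro osc_window[OF nb _ r]) auto
 then show ?case using Suc.IH Suc.prems by (simp add: algebra_simps abs_le_iff)
qed

lemma lpath_pl: "lpath c ls t = pl (length ls) (%i. (if i < length ls then real_of_int (ls ! i) else 0) / c) t"
 by (simp add: lpath_def pl_def Let_def diff_divide_distrib add_divide_distrib right_diff_distrib)

lemma lpath_C01: "lpath c ls \<in> C01" using pl_in_C01 unfolding lpath_pl[abs_def] .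

lemma abs_sqrt_diff_1: "0 <= q ==> \<bar>sqrt q - 1\<bar> <= \<bar>q - 1\<bar>"
proof -
 assume q: "0 <= q"
 have "\<bar>q - 1\<bar> = \<bar>sqrt q - 1\<bar> * \<bar>sqrt q + 1\<bar>"
  unfolding abs_mult[symmetric] using q by (simp add: algebra_simps)
 moreover have "\<bar>sqrt q - 1\<bar> * 1 <= \<bar>sqrt q - 1\<bar> * \<bar>sqrt q + 1\<bar>" using q by (intro mult_left_mono) auto
 ultimately show ?thesis by simp
qed

text \<open>The error consists of \<open>\<alpha>\<close> for the displacements of the small
  vertices, \<open>\<alpha>\<close> for using the norming \<open>c\<close> in place of
  \<open>sqrt (2 * k)\<close>, and \<open>2 * \<alpha>\<close> for the oscillation between the block
  index and the nearby grid point.\<close>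

lemma label_path_close:
 fixes ds :: "int list" and \<alpha> c :: real
 assumes nb: "\<not> osc_bad r k (\<alpha> * sqrt (real k)) ms" and ms: "ms \<in> bcomp k" and r: "8 <= r" and k: "3 * r <= k"
  and N: "1 <= N" "length ds = N" "length Js = N" and J: "\<And>i. i < N ==> Js ! i <= k"
  and JN: "\<And>i. i < N ==> \<bar>real (Js ! i) - real k * real i / real N\<bar> <= real k / (4 * real r)"
  and kN: "real k / real N + 2 <= 3 / 4 * (real k / real r)"
  and ds: "\<And>i. i < N ==> \<bar>real_of_int (ds ! i)\<bar> <= \<alpha> * c"
  and c: "0 < c" "\<bar>sqrt (2 * real k) / c - 1\<bar> <= 1 / (2 * real (Suc r))" and \<alpha>: "0 < \<alpha>" and t: "0 <= t" "t <= 1"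
 shows "\<bar>lpath c (map2 (%d J. d + bsum ms J) ds Js) t - pl r (grid r k ms) t\<bar> <= 4 * \<alpha>"
proof -
 \<comment> \<open>At \<open>i = N\<close> the path has returned to the root; the index
   \<open>k\<close> gives the bridge value 0 there.\<close>
 define J' where "J' = (%i. if i < N then Js ! i else k)"
 define d where "d = (%i. if i < N then ds ! i else 0)"
 define s where "s = sqrt (2 * real k)"
 have s: "0 < s" "sqrt (real k) <= s" using k r by (auto simp: s_def)
 have len: "length (map2 (%d J. d + bsum ms J) ds Js) = N" using N by simp
 show ?thesis unfolding lpath_pl len
 proof (rule pl_close[OF N(1) _ t])
  show "1 <= r" using r by simp
  fix i j assume i: "i <= N" and j: "j <= r" and ij: "\<bar>real i / real N - real j / real r\<bar> <= 1 / real N + 1 / real r"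
  define m where "m = k * j div r"
  have v: "(if i < N then real_of_int (map2 (%d J. d + bsum ms J) ds Js ! i) else 0) = real_of_int (d i) + real_of_int (bsum ms (J' i))"
   using N bsum_full[OF ms] by (auto simp: d_def J'_def)
  have J'k: "J' i <= k" using J by (simp add: J'_def)
  have Ji: "\<bar>real (J' i) - real k * real i / real N\<bar> <= real k / (4 * real r)"
   using JN[of i] i N(1) by (auto simp: J'_def)
  have "\<bar>real k * (real i / real N - real j / real r)\<bar> <= real k * (1 / real N + 1 / real r)"
   unfolding abs_mult using ij by (auto intro: mult_left_mono)
  then have "\<bar>real k * real i / real N - real k * real j / real r\<bar> <= real k / real N + real k / real r"
   by (simp add: right_diff_distrib distrib_left)
  moreover have "real k / (4 * real r) = (real k / real r) / 4" by simp
  ultimately have "\<bar>real (J' i) - real m\<bar> <= 2 * (real k / real r) - 1"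
   using Ji grid_index(3)[of r k j] kN r unfolding m_def abs_le_iff by linarith
  then have o1: "\<bar>real_of_int (bsum ms (J' i) - bsum ms m)\<bar> <= 2 * (\<alpha> * sqrt (real k))"
   unfolding m_def by (intro osc_window[OF nb j r J'k]) simp
  have o2: "\<bar>real_of_int (bsum ms m)\<bar> <= 2 * (\<alpha> * sqrt (real k)) * real r"
  proof -
   have "2 * (\<alpha> * sqrt (real k)) * real j <= 2 * (\<alpha> * sqrt (real k)) * real r" using j \<alpha> by (intro mult_left_mono) auto
   then show ?thesis using osc_grid[OF nb r k j] unfolding m_def by linarith
  qed
  have o3: "\<bar>real_of_int (bsum ms (J' i))\<bar> <= 2 * (\<alpha> * sqrt (real k)) * real (Suc r)"
   using o1 o2 by (simp add: algebra_simps abs_le_iff)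
  have sd: "y / s <= b" if "y <= b * sqrt (real k)" "0 <= b" for y b
   using that s by (simp add: pos_divide_le_eq) (meson mult_left_mono order_trans)
  have "(real_of_int (d i) + real_of_int (bsum ms (J' i))) / c - real_of_int (bsum ms m) / s =
   real_of_int (d i) / c + (real_of_int (bsum ms (J' i)) / s) * (s / c - 1) + real_of_int (bsum ms (J' i) - bsum ms m) / s"
   using s c by (simp add: field_simps)
  also have "\<bar>...\<bar> <= \<bar>real_of_int (d i)\<bar> / c + \<bar>real_of_int (bsum ms (J' i))\<bar> / s * \<bar>s / c - 1\<bar> + \<bar>real_of_int (bsum ms (J' i) - bsum ms m)\<bar> / s"
   using s c by (intro order_trans[OF abs_triangle_ineq] add_mono) (auto simp: abs_mult)
  also have "... <= \<alpha> + 2 * \<alpha> * real (Suc r) * (1 / (2 * real (Suc r))) + 2 * \<alpha>"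
  proof (intro add_mono mult_mono)
   show "\<bar>real_of_int (d i)\<bar> / c <= \<alpha>" using ds[of i] c \<alpha> by (simp add: d_def pos_divide_le_eq)
   show "\<bar>real_of_int (bsum ms (J' i))\<bar> / s <= 2 * \<alpha> * real (Suc r)" using o3 \<alpha> by (intro sd) (auto simp: mult_ac)
   show "\<bar>real_of_int (bsum ms (J' i) - bsum ms m)\<bar> / s <= 2 * \<alpha>" using o1 \<alpha> by (intro sd) (auto simp: mult_ac)
  qed (use c \<alpha> in \<open>auto simp: s_def\<close>)
  also have "... = 4 * \<alpha>" by (simp add: field_simps)
  finally show "\<bar>(if i < N then real_of_int (map2 (%d J. d + bsum ms J) ds Js ! i) else 0) / c - grid r k ms j\<bar> <= 4 * \<alpha>"
   unfolding v using j by (simp add: grid_def m_def s_def)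
 qed
qed

text \<open>The choice of parameters is nested: \<open>\<epsilon>\<close> fixes
  \<open>\<alpha>\<close>, then the mesh \<open>r\<close> is fixed so that the oscillation and the
  interpolation error of the bridge are small, and only then the tolerance \<open>e\<close> and a
  lower bound on \<open>n\<close>.\<close>

lemma labels_limit:
 assumes bb: "brownian_bridge M b" and F: "lipf m F" and B: "\<forall>f\<in>C01. \<bar>F f\<bar> <= B"
  and \<kappa>: "0 <= \<kappa>" "\<kappa> < 1" and p0: "0 < p0" and \<delta>: "0 < \<delta>" and \<epsilon>: "0 < \<epsilon>"
 shows "\<exists>e>0. \<forall>\<^sub>F n in sequentially. \<forall>ks\<in>luk n. good \<kappa> p0 e (real n powr (1 - \<delta>)) n ks -->
  \<bar>avg (dec ks) (%mss. F (lpath (sqrt (2 * (1 - \<kappa>) * real n)) (outs chl mss [0]))) - (bexp M b F)\<bar> <= \<epsilon>"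
proof -
 define I where "I = (bexp M b F)"
 have m: "0 <= m" using F by (simp add: lipf_def)
 have B0: "0 <= B" using bspec[OF B pl_in_C01[of 0 "%_. 0"]] by linarith
 obtain C1 where C1: "C1 >= 1" "\<And>k r \<alpha>. 1 <= k ==> 8 <= r ==> 0 < \<alpha> ==> \<alpha> * real r <= 10 * sqrt (real k) ==>
  avg (bcomp k) (%ms. of_bool (osc_bad r k (\<alpha> * sqrt (real k)) ms)) <= real (Suc r) * (C1 * exp (- (\<alpha>\<^sup>2 * real r / 80)))"
  using osc_bad_prob by blast
 obtain C where C: "C >= 0" "\<And>k j \<theta>. j <= k ==> \<bar>\<theta>\<bar> <= 1/8 ==>
   avg (bcomp k) (%ms. exp (\<theta> * real_of_int (bsum ms j))) <= exp (C * \<theta>\<^sup>2 * real k)"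
  using bridge_mgf by blast
 define \<alpha> where "\<alpha> = \<epsilon> / (16 * (m + 1))"
 have \<alpha>: "0 < \<alpha>" using \<epsilon> m by (simp add: \<alpha>_def)
 have m\<alpha>: "m * (4 * \<alpha>) <= \<epsilon> / 4"
 proof -
  have "m * (4 * \<alpha>) <= (m + 1) * (4 * \<alpha>)" using \<alpha> by (intro mult_right_mono) auto
  also have "... = \<epsilon> / 4" using m by (simp add: \<alpha>_def field_simps)
  finally show ?thesis .
 qed
 have "(%r. 2 * B * (real (Suc (Suc r)) * (C1 * exp (- (\<alpha>\<^sup>2 * real (Suc r) / 80))))) \<longlonglongrightarrow> 0"
  using \<alpha> by real_asymp
 then have "\<forall>\<^sub>F r in sequentially. 2 * B * (real (Suc (Suc r)) * (C1 * exp (- (\<alpha>\<^sup>2 * real (Suc r) / 80)))) < \<epsilon> / 4"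
  using \<epsilon> by (intro order_tendstoD(2)) auto
 moreover have "\<forall>\<^sub>F r in sequentially. dist (\<integral>\<omega>. F (pl (Suc r) (bgrid b (Suc r) \<omega>)) \<partial>M) I < \<epsilon> / 8"
  unfolding I_def using lipf_bridge(2)[OF bb F B] \<epsilon> by (intro tendstoD) auto
 ultimately have "\<forall>\<^sub>F r in sequentially. 8 <= r \<and> 2 * B * (real (Suc (Suc r)) * (C1 * exp (- (\<alpha>\<^sup>2 * real (Suc r) / 80)))) < \<epsilon> / 4 \<and>
  dist (\<integral>\<omega>. F (pl (Suc r) (bgrid b (Suc r) \<omega>)) \<partial>M) I < \<epsilon> / 8"
  using eventually_ge_at_top[of 8] by eventually_elim auto
 then obtain r' where r': "8 <= r' \<and> 2 * B * (real (Suc (Suc r')) * (C1 * exp (- (\<alpha>\<^sup>2 * real (Suc r') / 80)))) < \<epsilon> / 4 \<and>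
  dist (\<integral>\<omega>. F (pl (Suc r') (bgrid b (Suc r') \<omega>)) \<partial>M) I < \<epsilon> / 8" by (auto simp: eventually_sequentially)
 define r where "r = Suc r'"
 have r: "8 <= r" "2 * B * (real (Suc r) * (C1 * exp (- (\<alpha>\<^sup>2 * real r / 80)))) < \<epsilon> / 4"
  "\<bar>(\<integral>\<omega>. F (pl r (bgrid b r \<omega>)) \<partial>M) - I\<bar> < \<epsilon> / 8" using r' by (auto simp: r_def dist_real_def)
 have r1: "1 <= r" using r(1) by simp
 have "(%k. avg (bcomp k) (%ms. F (pl r (grid r k ms)))) \<longlonglongrightarrow> (\<integral>\<omega>. F (pl r (bgrid b r \<omega>)) \<partial>M)"
  by (rule fdd_limit[OF bb r1 lipf_pl_cont[OF F r1]]) (rule bspec[OF B pl_in_C01])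
 then have "\<forall>\<^sub>F k in sequentially. dist (avg (bcomp k) (%ms. F (pl r (grid r k ms)))) (\<integral>\<omega>. F (pl r (bgrid b r \<omega>)) \<partial>M) < \<epsilon> / 8"
  using \<epsilon> by (intro tendstoD) auto
 then obtain k1 where k1: "\<And>k. k >= k1 ==> \<bar>avg (bcomp k) (%ms. F (pl r (grid r k ms))) - (\<integral>\<omega>. F (pl r (bgrid b r \<omega>)) \<partial>M)\<bar> < \<epsilon> / 8"
  by (auto simp: eventually_sequentially dist_real_def)
 \<comment> \<open>A lower bound for the large degree: the summands provide, in order, the
   finite-dimensional limit, \<open>3 * r <= k\<close>, the condition on
   \<open>\<alpha> * r\<close>, and the comparison of the two mesh widths.\<close>
 define K where "K = real k1 + 3 * real r + (\<alpha> * real r / 10)\<^sup>2 + 4 * real r / 3 * (4 / p0 + 2)"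
 \<comment> \<open>The first three entries make \<open>N\<close> and \<open>k\<close> comparable to
   \<open>n\<close>, the fourth controls the norming error and the last the deviation of the block
   index from linear growth.\<close>
 define E where "E = {p0 / 2, (1 - \<kappa>) / 2, 1 / 2, (1 - \<kappa>) / (2 * real (Suc r)), (1 - \<kappa>)\<^sup>2 * p0 / (720 * real r)}"
 define e where "e = Min E"
 have el: "e <= x" if "x \<in> E" for x unfolding e_def by (rule Min_le[OF _ that]) (simp add: E_def)
 have e: "0 < e" "e <= p0 / 2" "e <= (1 - \<kappa>) / 2" "e <= 1 / 2" "e <= (1 - \<kappa>) / (2 * real (Suc r))" "e <= (1 - \<kappa>)\<^sup>2 * p0 / (720 * real r)"
  subgoal using \<kappa> p0 r1 by (auto simp: e_def E_def) by (rule el, simp add: E_def)+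
 define \<delta>' where "\<delta>' = min \<delta> (1/2)"
 have \<delta>': "0 < \<delta>'" "\<delta>' <= \<delta>" "\<delta>' < 1" using \<delta> by (auto simp: \<delta>'_def)
 \<comment> \<open>At this scale \<open>\<theta>^2 * n^(1 - \<delta>)\<close> stays bounded while
   \<open>\<theta> * sqrt n\<close> is a positive power of \<open>n\<close>, so the displacement
   bound beats the factor \<open>n\<close> from the union over times.\<close>
 define \<theta> where "\<theta> = (%n. real n powr ((\<delta>' - 1) / 2))"
 define c where "c = (%n. sqrt (2 * (1 - \<kappa>) * real n))"
 define a where "a = \<alpha> * sqrt (2 * (1 - \<kappa>))"
 have a: "0 < a" using \<alpha> \<kappa> by (simp add: a_def)
 have "(%n. real n powr ((\<delta>' - 1) / 2)) \<longlonglongrightarrow> 0" using \<delta>' by real_asymp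
 then have ev1: "\<forall>\<^sub>F n in sequentially. \<theta> n < 1/8" unfolding \<theta>_def by (intro order_tendstoD(2)) auto
 have "(%n. 2 * B * (2 * real n * exp (C - a * real n powr (\<delta>' / 2)))) \<longlonglongrightarrow> 0" using a \<delta>' by real_asymp
 then have ev2: "\<forall>\<^sub>F n in sequentially. 2 * B * (2 * real n * exp (C - a * real n powr (\<delta>' / 2))) < \<epsilon> / 4"
  by (rule order_tendstoD(2)) (use \<epsilon> in simp)
 have ev3: "\<forall>\<^sub>F n in sequentially. 2 * K / (1 - \<kappa>) <= real n" using filterlim_real_sequentially by (simp add: filterlim_at_top)
 have "\<forall>\<^sub>F n in sequentially. \<forall>ks\<in>luk n. good \<kappa> p0 e (real n powr (1 - \<delta>)) n ks -->
  \<bar>avg (dec ks) (%mss. F (lpath (c n) (outs chl mss [0]))) - I\<bar> <= \<epsilon>"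
  using ev1 ev2 ev3 eventually_ge_at_top[of 1]
 proof eventually_elim
  case (elim n)
  show ?case
  proof (intro ballI impI)
   fix ks assume ks: "ks \<in> luk n" and good: "good \<kappa> p0 e (real n powr (1 - \<delta>)) n ks"
   have n: "0 < real n" using elim(4) by simp
   have cn: "0 < c n" using n \<kappa> by (simp add: c_def)
   \<comment> \<open>A good code bounds \<open>p0\<close> by itself, since a word of length
     \<open>n\<close> contains at most \<open>n\<close> zeros.\<close>
   have p2: "p0 <= 2"
   proof -
    from good obtain rest where "lln \<kappa> p0 e n rest" by (auto simp: good_def)
    then have "\<bar>real (zeros (take n rest)) - p0 * real n\<bar> <= e * real n" by (auto simp: lln_def)
    moreover have "zeros (take n rest) <= n" unfolding zeros_def by (rule order_trans[OF length_filter_le]) simp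
    moreover have "e * real n <= 1/2 * real n" using e n by (intro mult_right_mono) auto
    ultimately have "p0 * real n <= 2 * real n" using n by linarith
    then show ?thesis using n by simp
   qed
   have mg: "avg (bcomp k) (%ms. exp (\<theta>' * real_of_int (bsum ms j))) <= exp (C * \<theta>'\<^sup>2 * real k)"
    if "j <= k" "\<bar>\<theta>'\<bar> <= \<theta> n" for k j \<theta>' using that elim(1) by (intro C(2)) auto
   have \<theta>0: "0 <= \<theta> n" by (simp add: \<theta>_def)
   show "\<bar>avg (dec ks) (%mss. F (lpath (c n) (outs chl mss [0]))) - I\<bar> <= \<epsilon>"
   proof (rule label_code[of "\<theta> n" C, OF mg \<theta>0 C(1) ks good \<kappa> p0 p2 less_imp_le[OF e(1)], where x = "\<alpha> * c n"])
    fix k N Js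
    assume kk: "1 <= k" and lJ: "length Js = N" and kn: "\<bar>real k - (1 - \<kappa>) * real n\<bar> <= e * real n" and Nn: "\<bar>real N - p0 * real n\<bar> <= e * real n"
     and Jk: "\<And>i. i < N ==> Js ! i <= k"
     and JN: "\<And>i. i < N ==> \<bar>real (Js ! i) * real N - real k * real i\<bar> <= 9 / (1 - \<kappa>) * e * real n * (real n + real N + e * real n)"
     and code: "\<And>\<Phi> \<Psi> B \<eta> Bad. (\<And>l. \<bar>\<Phi> l\<bar> <= B) ==> (\<And>ms. \<bar>\<Psi> ms\<bar> <= B) ==> 0 <= \<eta> ==>
      (\<And>ms ds. ms \<in> bcomp k ==> \<not> Bad ms ==> length ds = N ==> (\<And>i. i < N ==> \<bar>real_of_int (ds ! i)\<bar> <= \<alpha> * c n) ==>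
        \<bar>\<Phi> (map2 (%d J. d + bsum ms J) ds Js) - \<Psi> ms\<bar> <= \<eta>) ==>
      \<bar>avg (dec ks) (%mss. \<Phi> (outs chl mss [0])) - avg (bcomp k) \<Psi>\<bar>
       <= \<eta> + 2 * B * (avg (bcomp k) (%ms. of_bool (Bad ms)) + 2 * real n * exp (- \<theta> n * (\<alpha> * c n) + C * (\<theta> n)\<^sup>2 * (real n powr (1 - \<delta>))))"
    have k2: "(1 - \<kappa>) / 2 * real n <= real k"
     using kn mult_right_mono[OF e(3), of "real n"] n by (simp add: abs_le_iff field_simps)
    have N2: "p0 / 2 * real n <= real N" "real N <= 3 * real n"
     using Nn mult_right_mono[OF e(2), of "real n"] mult_right_mono[OF e(4), of "real n"] mult_right_mono[OF p2, of "real n"] n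
     by linarith+
    have kK: "K <= real k" using elim(3) k2 \<kappa> by (simp add: pos_divide_le_eq field_simps)
    have kn1: "real k <= 2 * real n"
    proof -
     have "e * real n <= 1/2 * real n" "(1 - \<kappa>) * real n <= 1 * real n" using e \<kappa> n by (auto intro: mult_right_mono)
     then show ?thesis using kn by (simp add: abs_le_iff)
    qed
    have pos: "0 <= (\<alpha> * real r / 10)\<^sup>2" "0 <= 4 * real r / 3 * (4 / p0 + 2)" using p0 by auto
    have K1: "k1 <= k" "3 * r <= k" using kK pos unfolding K_def by linarith+
    have K2: "(\<alpha> * real r / 10)\<^sup>2 <= real k" "4 * real r / 3 * (4 / p0 + 2) <= real k"
     using kK pos unfolding K_def by linarith+
    have K3: "\<alpha> * real r <= 10 * sqrt (real k)" using real_le_rsqrt[OF K2(1)] by simp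
    have N1: "1 <= N" using N2(1) mult_pos_pos[OF p0 n] by (cases N) auto
    have JN': "\<bar>real (Js ! i) - real k * real i / real N\<bar> <= real k / (4 * real r)" if "i < N" for i
    proof -
     have en: "e * real n <= 1/2 * real n" using e(4) n by (intro mult_right_mono) auto
     have "9 / (1 - \<kappa>) * e * real n * (real n + real N + e * real n) <= 9 / (1 - \<kappa>) * e * real n * (5 * real n)"
      using N2(2) en n \<kappa> e(1) by (intro mult_left_mono mult_nonneg_nonneg) (linarith | simp)+
     also have "... = 45 / (1 - \<kappa>) * real n * real n * e" by simp
     also have "... <= 45 / (1 - \<kappa>) * real n * real n * ((1 - \<kappa>)\<^sup>2 * p0 / (720 * real r))"
      using e(6) \<kappa> n by (intro mult_left_mono) auto
     also have "... = ((1 - \<kappa>) / 2 * real n) * (p0 / 2 * real n) * (1 / (4 * real r))"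
      using \<kappa> r1 by (simp add: field_simps power2_eq_square)
     also have "... <= real k * real N * (1 / (4 * real r))"
      using k2 N2(1) p0 n \<kappa> by (intro mult_right_mono mult_mono) auto
     finally have "\<bar>real (Js ! i) * real N - real k * real i\<bar> <= real k / (4 * real r) * real N"
      using JN[OF that] by simp
     moreover have "\<bar>real (Js ! i) - real k * real i / real N\<bar> = \<bar>real (Js ! i) * real N - real k * real i\<bar> / real N"
     proof -
      have "real (Js ! i) - real k * real i / real N = (real (Js ! i) * real N - real k * real i) / real N"
       using N1 by (simp add: field_simps)
      then show ?thesis by (simp only: abs_divide abs_of_nat)
     qed
     ultimately show ?thesis using N1 by (simp add: pos_divide_le_eq)
    qed
    have kN: "real k / real N + 2 <= 3 / 4 * (real k / real r)"
    proof -
     have "real k / real N <= 4 / p0"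
     proof -
      have "real k * p0 <= 2 * real n * p0" using kn1 p0 by (intro mult_right_mono) auto
      also have "... <= 4 * real N" using N2(1) by simp
      finally show ?thesis using p0 N1 by (simp add: field_simps)
     qed
     moreover have "4 / p0 + 2 <= 3 / 4 * (real k / real r)" using K2(2) r1 by (simp add: field_simps)
     ultimately show ?thesis by linarith
    qed
    have sc: "\<bar>sqrt (2 * real k) / c n - 1\<bar> <= 1 / (2 * real (Suc r))"
    proof -
     define q where "q = real k / ((1 - \<kappa>) * real n)"
     have "sqrt (2 * real k) / c n = sqrt q" using \<kappa> n unfolding c_def q_def real_sqrt_divide[symmetric] mult.assoc
      by (subst mult_divide_mult_cancel_left) auto
     moreover have "\<bar>q - 1\<bar> <= e / (1 - \<kappa>)"
     proof -
      have "q - 1 = (real k - (1 - \<kappa>) * real n) / ((1 - \<kappa>) * real n)" using \<kappa> n by (simp add: q_def diff_divide_distrib)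
      moreover have D: "0 < (1 - \<kappa>) * real n" using \<kappa> n by simp
      ultimately have "\<bar>q - 1\<bar> = \<bar>real k - (1 - \<kappa>) * real n\<bar> / ((1 - \<kappa>) * real n)"
       by (simp only: abs_divide abs_of_pos)
      also have "... <= e * real n / ((1 - \<kappa>) * real n)" using kn D by (intro divide_right_mono) auto
      finally have "\<bar>q - 1\<bar> <= e * real n / ((1 - \<kappa>) * real n)" .
      then show ?thesis using n by simp
     qed
     moreover have "e / (1 - \<kappa>) <= 1 / (2 * real (Suc r))" using e(5) \<kappa> by (simp add: field_simps)
     moreover have "0 <= q" using \<kappa> n by (simp add: q_def)
     ultimately show ?thesis using abs_sqrt_diff_1[of q] by linarith
    qed
    have "\<bar>avg (dec ks) (%mss. F (lpath (c n) (outs chl mss [0]))) - avg (bcomp k) (%ms. F (pl r (grid r k ms)))\<bar>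
     <= m * (4 * \<alpha>) + 2 * B * (avg (bcomp k) (%ms. of_bool (osc_bad r k (\<alpha> * sqrt (real k)) ms)) + 2 * real n * exp (- \<theta> n * (\<alpha> * c n) + C * (\<theta> n)\<^sup>2 * (real n powr (1 - \<delta>))))"
    proof (rule code)
     fix ms ds assume ms: "ms \<in> bcomp k" "\<not> osc_bad r k (\<alpha> * sqrt (real k)) ms" and ds: "length ds = N" "\<And>i. i < N ==> \<bar>real_of_int (ds ! i)\<bar> <= \<alpha> * c n"
     show "\<bar>F (lpath (c n) (map2 (%d J. d + bsum ms J) ds Js)) - F (pl r (grid r k ms))\<bar> <= m * (4 * \<alpha>)"
      by (rule lipf_le[OF F lpath_C01 pl_in_C01 label_path_close[OF ms(2,1) r(1) K1(2) N1 ds(1) lJ Jk JN' kN ds(2) cn sc \<alpha>]])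
    qed (use B lpath_C01 pl_in_C01 m \<alpha> in auto)
    also have "... <= \<epsilon> / 4 + (\<epsilon> / 4 + \<epsilon> / 4)"
    proof (intro add_mono m\<alpha>)
     have b1: "2 * B * avg (bcomp k) (%ms. of_bool (osc_bad r k (\<alpha> * sqrt (real k)) ms)) <= \<epsilon> / 4"
      using mult_left_mono[OF C1(2)[OF kk r(1) \<alpha> K3], of "2 * B"] B0 r(2) by simp
     have x1: "\<theta> n * (\<alpha> * c n) = a * real n powr (\<delta>' / 2)"
     proof -
      have "c n = sqrt (2 * (1 - \<kappa>)) * real n powr (1/2)" unfolding c_def using \<kappa> n by (simp add: real_sqrt_mult powr_half_sqrt)
      moreover have "\<theta> n * real n powr (1/2) = real n powr (\<delta>' / 2)" unfolding \<theta>_def powr_add[symmetric] by (simp add: field_simps)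
      ultimately show ?thesis by (simp add: a_def mult_ac)
     qed
     have x2: "C * (\<theta> n)\<^sup>2 * (real n powr (1 - \<delta>)) <= C"
     proof -
      have "(\<theta> n)\<^sup>2 * (real n powr (1 - \<delta>)) = real n powr (\<delta>' - \<delta>)"
       unfolding \<theta>_def power2_eq_square powr_add[symmetric] by (simp add: field_simps)
      also have "... <= real n powr 0" using \<delta>' elim(4) by (intro powr_mono) auto
      finally show ?thesis using C(1) n mult_left_mono[of "(\<theta> n)\<^sup>2 * (real n powr (1 - \<delta>))" 1 C] by (simp add: mult.assoc)
     qed
     have "exp (- \<theta> n * (\<alpha> * c n) + C * (\<theta> n)\<^sup>2 * (real n powr (1 - \<delta>))) <= exp (C - a * real n powr (\<delta>' / 2))"
      using x1 x2 by simp
     then have "2 * B * (2 * real n * exp (- \<theta> n * (\<alpha> * c n) + C * (\<theta> n)\<^sup>2 * (real n powr (1 - \<delta>)))) <= \<epsilon> / 4"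
      using elim(2) B0 by (intro order_trans[OF mult_left_mono less_imp_le[OF elim(2)]] mult_left_mono) auto
     with b1 show "2 * B * (avg (bcomp k) (%ms. of_bool (osc_bad r k (\<alpha> * sqrt (real k)) ms)) + 2 * real n * exp (- \<theta> n * (\<alpha> * c n) + C * (\<theta> n)\<^sup>2 * (real n powr (1 - \<delta>)))) <= \<epsilon> / 4 + \<epsilon> / 4"
      unfolding distrib_left by linarith
    qed
    finally show "\<bar>avg (dec ks) (%mss. F (lpath (c n) (outs chl mss [0]))) - I\<bar> <= \<epsilon>"
     using k1[OF K1(1)] r(3) by linarith
   qed auto
  qed
 qed
 then show ?thesis using e(1) unfolding I_def c_def by blast
qed

lemma avg_uminus: "avg A (%x. - f x) = - avg A f" by (simp add: avg_def sum_negf)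

theorem mainTheorem8:
  fixes w :: "nat \<Rightarrow> real"
    and M :: "'a measure" and b :: "real \<Rightarrow> 'a \<Rightarrow> real"
  assumes w0: "w 0 = 1"
    and wnn: "\<forall>i. w i \<ge> 0"
    and A: "condA1 w \<or> condA2 w"
    and bb: "brownian_bridge M b"
  shows "\<forall>F. bdd_cont_functional F \<longrightarrow>
     (\<lambda>n. mobile_expect w n (\<lambda>T l. F (scaled_proc w n T l)))
       \<longlonglongrightarrow> (\<integral>\<omega>. F (\<lambda>t. b t \<omega>) \<partial>M)"
proof (intro allI impI)
 fix F assume F: "bdd_cont_functional F"
 obtain p0 \<delta> where dg: "deg_good w p0 \<delta>" using A deg_A1[of w, OF w0 wnn[rule_format]] deg_A2[of w] by blast
 define Z where "Z = (%n. \<Sum>ks\<in>luk n. wt w ks)"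
 have p0: "0 < p0" and \<delta>: "0 < \<delta>" and \<kappa>: "0 <= kappa w" "kappa w < 1" and Z: "\<And>n. 0 < Z n"
  and bad: "\<And>e. e > 0 ==> (%n. badw w (kappa w) p0 e (real n powr (1 - \<delta>)) n / Z n) \<longlonglongrightarrow> 0"
  using dg unfolding deg_good_def Z_def by auto
 have wn: "0 <= wt w ks" for ks using wnn by (intro wt_nonneg) auto
 \<comment> \<open>The conditional expectation of the functional given the code;
   \<open>labels_limit\<close> controls it uniformly over good codes.\<close>
 define H where "H = (%n F ks. avg (dec ks) (%mss. F (lpath (sqrt (2 * (1 - kappa w) * real n)) (outs chl mss [0]))) :: real)"
 define E where "E = (%n F. (\<Sum>ks\<in>luk n. wt w ks * H n F ks) / Z n)"
 have "(%n. E n F) \<longlonglongrightarrow> bexp M b F"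
 proof (rule lip_suffices[OF bb _ _ _ F])
  fix n and F G :: "(real => real) => real" assume "\<And>f. f \<in> C01 ==> F f <= G f"
  then have "H n F ks <= H n G ks" for ks unfolding H_def by (intro avg_mono) (simp add: lpath_C01)
  then show "E n F <= E n G" unfolding E_def using Z[of n] wn by (intro divide_right_mono sum_mono mult_left_mono) auto
 next
  show "E n (%f. - F f) = - E n F" for n F by (simp add: E_def H_def avg_uminus sum_negf)
 next
  fix F m B assume F: "lipf m F" and B: "\<forall>f\<in>C01. \<bar>F f\<bar> <= B"
  define I where "I = (bexp M b F)"
  have HB: "\<bar>H n F ks\<bar> <= B" for n ks
  proof -
   have "\<bar>H n F ks\<bar> <= avg (dec ks) (%_. B)" unfolding H_def by (rule avg_abs_le) (use B lpath_C01 in auto)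
   then show ?thesis using avg_const[OF card_dec_pos] by simp
  qed
  have B0: "0 <= B" using HB[of 0 "[]"] by linarith
  define B' where "B' = B + \<bar>I\<bar> + 1"
  have B': "0 < B'" using B0 by (simp add: B'_def)
  show "(%n. E n F) \<longlonglongrightarrow> bexp M b F"
  proof (rule tendstoI)
   fix \<epsilon> :: real assume \<epsilon>: "0 < \<epsilon>"
   obtain e where e: "e > 0" and ev: "\<forall>\<^sub>F n in sequentially. \<forall>ks\<in>luk n. good (kappa w) p0 e (real n powr (1 - \<delta>)) n ks --> \<bar>H n F ks - I\<bar> <= \<epsilon> / 2"
    using labels_limit[OF bb F B \<kappa> p0 \<delta>, of "\<epsilon> / 2"] \<epsilon> unfolding H_def I_def by auto
   have "\<forall>\<^sub>F n in sequentially. badw w (kappa w) p0 e (real n powr (1 - \<delta>)) n / Z n < \<epsilon> / (2 * B')"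
    using bad[OF e] \<epsilon> B' by (intro order_tendstoD(2)) auto
   with ev show "\<forall>\<^sub>F n in sequentially. dist (E n F) (bexp M b F) < \<epsilon>"
   proof eventually_elim
    case (elim n)
    define Bad where "Bad = {ks \<in> luk n. \<not> good (kappa w) p0 e (real n powr (1 - \<delta>)) n ks}"
    have "E n F - I = (\<Sum>ks\<in>luk n. wt w ks * (H n F ks - I)) / Z n"
     using Z[of n] by (simp add: E_def Z_def diff_divide_distrib right_diff_distrib sum_subtractf flip: sum_distrib_right)
    \<comment> \<open>Good codes contribute at most \<open>\<epsilon> / 2\<close>; on bad codes the
      difference is only bounded, and their share of the weight tends to 0.\<close>
    also have "\<bar>...\<bar> <= (\<Sum>ks\<in>luk n. wt w ks * (\<epsilon> / 2) + (if ks \<in> Bad then wt w ks * B' else 0)) / Z n"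
     unfolding abs_divide abs_of_pos[OF Z]
    proof (intro divide_right_mono order_trans[OF sum_abs] sum_mono)
     fix ks assume ks: "ks \<in> luk n"
     have "\<bar>H n F ks - I\<bar> <= \<epsilon> / 2 + (if ks \<in> Bad then B' else 0)"
      using elim(1) ks HB[of n ks] \<epsilon> by (auto simp: Bad_def B'_def)
     then have "wt w ks * \<bar>H n F ks - I\<bar> <= wt w ks * (\<epsilon> / 2 + (if ks \<in> Bad then B' else 0))" using wn by (rule mult_left_mono)
     then show "\<bar>wt w ks * (H n F ks - I)\<bar> <= wt w ks * (\<epsilon> / 2) + (if ks \<in> Bad then wt w ks * B' else 0)"
      using wn[of ks] by (simp add: abs_mult distrib_left split: if_splits)
    qed (use Z[of n] in simp)
    also have "(\<Sum>ks\<in>luk n. wt w ks * (\<epsilon> / 2) + (if ks \<in> Bad then wt w ks * B' else 0)) = Z n * (\<epsilon> / 2) + (\<Sum>ks\<in>Bad. wt w ks) * B'"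
    proof -
     have "(\<Sum>ks\<in>luk n. if ks \<in> Bad then wt w ks * B' else 0) = (\<Sum>ks\<in>Bad. wt w ks * B')"
      by (rule sum.mono_neutral_cong_right) (auto simp: Bad_def finite_luk)
     then show ?thesis by (simp add: sum.distrib Z_def sum_distrib_right)
    qed
    also have "(Z n * (\<epsilon> / 2) + (\<Sum>ks\<in>Bad. wt w ks) * B') / Z n = \<epsilon> / 2 + (\<Sum>ks\<in>Bad. wt w ks) / Z n * B'"
     using Z[of n] by (simp add: field_simps)
    also have "... < \<epsilon> / 2 + \<epsilon> / (2 * B') * B'"
     using elim(2) B' unfolding Bad_def[symmetric] by (intro add_strict_left_mono mult_strict_right_mono)
    also have "... = \<epsilon>" using B' by simp
    finally show ?case by (simp add: dist_real_def I_def)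
   qed
  qed
 qed
 moreover have "mobile_expect w n (%T l. F (scaled_proc w n T l)) = E n F" for n
  unfolding mobile_expect_lpath[of w, OF w0] E_def H_def Z_def by (rule refl)
 ultimately show "(%n. mobile_expect w n (%T l. F (scaled_proc w n T l))) \<longlonglongrightarrow> bexp M b F" by simp
qed

end
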